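(* Let $\Omega\subset\mathbb R^d$, $d\ge2$, be a bounded connected polytope, $0<\nu\le1$, $f\in(H_0(\operatorname{div},\Omega))'$. Consider the mixed problem (M): $(\sigma,u,p)\in H^{-1}(\operatorname{curl}\operatorname{div},\Omega;\mathbb S\cap\mathbb T)\times H_0(\operatorname{div},\Omega)\times L_0^2(\Omega)$ satisfies $$\nu^{-1}(\sigma,\tau)+\langle\operatorname{div}\tau,u\rangle-(q,\operatorname{div}u)=0,\qquad \langle\operatorname{div}\sigma,v\rangle-(p,\operatorname{div}v)-(u,v)=-\langle f,v\rangle$$ for all $\tau\in H^{-1}(\operatorname{curl}\operatorname{div},\Omega;\mathbb S\cap\mathbb T)$, $q\in L_0^2(\Omega)$, $v\in H_0(\operatorname{div},\Omega)$; and the primal problem (P): $(u,p)\in H_0^1(\Omega;\mathbb R^d)\times L_0^2(\Omega)$ satisfies $$\nu(\varepsilon(u),\varepsilon(v))+(u,v)+(p,\operatorname{div}v)=\langle f,v\rangle\ \ \forall v\in H_0^1(\Omega;\mathbb R^d),\qquad(\operatorname{div}u,q)=0\ \ \forall q\in L_0^2(\Omega).$$ If $(\sigma,u,p)$ solves (M), then $\sigma=\nu\varepsilon(u)$, $u\in H_0^1(\Omega;\mathbb R^d)$, and $(u,p)$ solves (P). Conversely, if $(u,p)$ solves (P) and $\sigma:=\nu\varepsilon(u)$, then $(\sigma,u,p)$ solves (M).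
   Context: $\mathbb S$ and $\mathbb T$ are the symmetric and the traceless matrices in $\mathbb R^{d\times d}$. $\varepsilon(v)=\frac12(\nabla v+(\nabla v)^{\intercal})$; the divergence of a matrix field is row-wise. $(\cdot,\cdot)$ is the $L^2(\Omega)$ inner product. $H(\operatorname{div},\Omega)=\{v\in L^2(\Omega;\mathbb R^d):\operatorname{div}v\in L^2(\Omega)\}$ with the graph norm; $H_0(\operatorname{div},\Omega)$ is the subspace with vanishing normal trace on $\partial\Omega$; the prime denotes the dual, $\langle\cdot,\cdot\rangle$ the duality pairing. $L_0^2(\Omega)$: $L^2$ functions of zero mean. $H^{-1}(\operatorname{curl}\operatorname{div},\Omega;\mathbb S\cap\mathbb T):=\{\tau\in L^2(\Omega;\mathbb S\cap\mathbb T):\operatorname{div}\tau\in(H_0(\operatorname{div},\Omega))'\}$ (the distributional divergence extends to a bounded functional on $H_0(\operatorname{div},\Omega)$). *)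

theory Defs
  imports "HOL-Analysis.Analysis"
begin

text \<open>Elements of the function spaces below are represented by functions on all of
  \<open>real ^ 'n\<close>; only their values almost everywhere on \<open>\<Omega>\<close> matter.\<close>

text \<open>A not necessarily convex polytope, as an open set: the interior of a finite union of convex
  polytopes. In particular \<open>\<Omega>\<close> is the interior of its closure, so there are no slits.\<close>

definition polytopal_domain :: "(real ^ 'n) set \<Rightarrow> bool" where
  "polytopal_domain \<Omega> \<longleftrightarrow>
     \<Omega> \<noteq> {} \<and> (\<exists>\<P>. finite \<P> \<and> (\<forall>P\<in>\<P>. polytope P) \<and> \<Omega> = interior (\<Union>\<P>))"

definition L2 :: "(real ^ 'n) set \<Rightarrow> (real ^ 'n \<Rightarrow> 'b::euclidean_space) set" where
  "L2 \<Omega> = {f. f \<in> borel_measurable (lebesgue_on \<Omega>)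
            \<and> integrable (lebesgue_on \<Omega>) (\<lambda>x. (norm (f x))\<^sup>2)}"

text \<open>On matrix fields, \<open>\<bullet>\<close> is the Frobenius inner product.\<close>

definition ip :: "(real ^ 'n) set \<Rightarrow> (real ^ 'n \<Rightarrow> 'b::euclidean_space) \<Rightarrow> (real ^ 'n \<Rightarrow> 'b) \<Rightarrow> real" where
  "ip \<Omega> f g = (LINT x|lebesgue_on \<Omega>. f x \<bullet> g x)"

definition L2_0 :: "(real ^ 'n) set \<Rightarrow> (real ^ 'n \<Rightarrow> real) set" where
  "L2_0 \<Omega> = {q \<in> L2 \<Omega>. (LINT x|lebesgue_on \<Omega>. q x) = 0}"

primrec Ck :: "nat \<Rightarrow> (real ^ 'n \<Rightarrow> 'b::euclidean_space) \<Rightarrow> bool" where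
  "Ck 0 f \<longleftrightarrow> continuous_on UNIV f"
| "Ck (Suc k) f \<longleftrightarrow> (\<forall>x. f differentiable (at x)) \<and>
                   (\<forall>h. Ck k (\<lambda>x. frechet_derivative f (at x) h))"

text \<open>\<open>C\<^sub>c\<^sup>\<infinity>(\<Omega>)\<close>, extended by zero.\<close>

definition test :: "(real ^ 'n) set \<Rightarrow> (real ^ 'n \<Rightarrow> 'b::euclidean_space) set" where
  "test \<Omega> = {\<phi>. (\<forall>k. Ck k \<phi>) \<and> compact (closure {x. \<phi> x \<noteq> 0}) \<and> closure {x. \<phi> x \<noteq> 0} \<subseteq> \<Omega>}"

definition partial :: "'n \<Rightarrow> (real ^ 'n \<Rightarrow> 'b::euclidean_space) \<Rightarrow> real ^ 'n \<Rightarrow> 'b" where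
  "partial j \<phi> x = frechet_derivative \<phi> (at x) (axis j 1)"

definition has_weak_partial ::
    "(real ^ 'n) set \<Rightarrow> 'n \<Rightarrow> (real ^ 'n \<Rightarrow> 'b::euclidean_space) \<Rightarrow> (real ^ 'n \<Rightarrow> 'b) \<Rightarrow> bool" where
  "has_weak_partial \<Omega> j f g \<longleftrightarrow>
     (\<forall>\<phi>\<in>test \<Omega>. (LINT x|lebesgue_on \<Omega>. partial j \<phi> x *\<^sub>R f x)
                = - (LINT x|lebesgue_on \<Omega>. (\<phi> x :: real) *\<^sub>R g x))"

text \<open>The square integrable weak partial derivative, unique almost everywhere on \<open>\<Omega>\<close>; arbitrary
  if there is none.\<close>

definition wpartial ::
    "(real ^ 'n) set \<Rightarrow> 'n \<Rightarrow> (real ^ 'n \<Rightarrow> 'b::euclidean_space) \<Rightarrow> real ^ 'n \<Rightarrow> 'b" where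
  "wpartial \<Omega> j f = (SOME g. g \<in> L2 \<Omega> \<and> has_weak_partial \<Omega> j f g)"

definition H1 :: "(real ^ 'n) set \<Rightarrow> (real ^ 'n \<Rightarrow> 'b::euclidean_space) set" where
  "H1 \<Omega> = {f \<in> L2 \<Omega>. \<forall>j. \<exists>g\<in>L2 \<Omega>. has_weak_partial \<Omega> j f g}"

definition H1_norm :: "(real ^ 'n) set \<Rightarrow> (real ^ 'n \<Rightarrow> 'b::euclidean_space) \<Rightarrow> real" where
  "H1_norm \<Omega> f = sqrt (ip \<Omega> f f + (\<Sum>j\<in>UNIV. ip \<Omega> (wpartial \<Omega> j f) (wpartial \<Omega> j f)))"

definition H1_0 :: "(real ^ 'n) set \<Rightarrow> (real ^ 'n \<Rightarrow> 'b::euclidean_space) set" where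
  "H1_0 \<Omega> = {u \<in> H1 \<Omega>. \<forall>e>0. \<exists>\<phi>\<in>test \<Omega>. H1_norm \<Omega> (\<lambda>x. u x - \<phi> x) < e}"

definition wgrad :: "(real ^ 'n) set \<Rightarrow> (real ^ 'n \<Rightarrow> real) \<Rightarrow> real ^ 'n \<Rightarrow> real ^ 'n" where
  "wgrad \<Omega> \<phi> x = (\<chi> j. wpartial \<Omega> j \<phi> x)"

definition wgrad_vec :: "(real ^ 'n) set \<Rightarrow> (real ^ 'n \<Rightarrow> real ^ 'n) \<Rightarrow> real ^ 'n \<Rightarrow> real ^ 'n ^ 'n" where
  "wgrad_vec \<Omega> v x = (\<chi> i j. wpartial \<Omega> j v x $ i)"

definition eps :: "(real ^ 'n) set \<Rightarrow> (real ^ 'n \<Rightarrow> real ^ 'n) \<Rightarrow> real ^ 'n \<Rightarrow> real ^ 'n ^ 'n" where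
  "eps \<Omega> v x = (1/2) *\<^sub>R (wgrad_vec \<Omega> v x + transpose (wgrad_vec \<Omega> v x))"

definition has_weak_div ::
    "(real ^ 'n) set \<Rightarrow> (real ^ 'n \<Rightarrow> real ^ 'n) \<Rightarrow> (real ^ 'n \<Rightarrow> real) \<Rightarrow> bool" where
  "has_weak_div \<Omega> v g \<longleftrightarrow> (\<forall>\<phi>\<in>test \<Omega>. ip \<Omega> v (\<lambda>x. \<chi> j. partial j \<phi> x) = - ip \<Omega> g \<phi>)"

definition wdiv :: "(real ^ 'n) set \<Rightarrow> (real ^ 'n \<Rightarrow> real ^ 'n) \<Rightarrow> real ^ 'n \<Rightarrow> real" where
  "wdiv \<Omega> v = (SOME g. g \<in> L2 \<Omega> \<and> has_weak_div \<Omega> v g)"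

definition Hdiv :: "(real ^ 'n) set \<Rightarrow> (real ^ 'n \<Rightarrow> real ^ 'n) set" where
  "Hdiv \<Omega> = {v \<in> L2 \<Omega>. \<exists>g\<in>L2 \<Omega>. has_weak_div \<Omega> v g}"

definition Hdiv_norm :: "(real ^ 'n) set \<Rightarrow> (real ^ 'n \<Rightarrow> real ^ 'n) \<Rightarrow> real" where
  "Hdiv_norm \<Omega> v = sqrt (ip \<Omega> v v + ip \<Omega> (wdiv \<Omega> v) (wdiv \<Omega> v))"

text \<open>The normal trace \<open>v \<cdot> n\<close> is the functional on the boundary values of \<open>H\<^sup>1\<close> functions given by
  Green's formula, \<open>\<langle>v \<cdot> n, \<phi>\<rangle> = (v, \<nabla>\<phi>) + (div v, \<phi>)\<close>.\<close>

definition normal_trace ::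
    "(real ^ 'n) set \<Rightarrow> (real ^ 'n \<Rightarrow> real ^ 'n) \<Rightarrow> (real ^ 'n \<Rightarrow> real) \<Rightarrow> real" where
  "normal_trace \<Omega> v \<phi> = ip \<Omega> v (wgrad \<Omega> \<phi>) + ip \<Omega> (wdiv \<Omega> v) \<phi>"

definition H0div :: "(real ^ 'n) set \<Rightarrow> (real ^ 'n \<Rightarrow> real ^ 'n) set" where
  "H0div \<Omega> = {v \<in> Hdiv \<Omega>. \<forall>\<phi>\<in>H1 \<Omega>. normal_trace \<Omega> v \<phi> = 0}"

text \<open>Functionals are unconstrained outside \<open>H0div \<Omega>\<close>. Boundedness and linearity force them to
  respect equality almost everywhere.\<close>

definition H0div_dual :: "(real ^ 'n) set \<Rightarrow> ((real ^ 'n \<Rightarrow> real ^ 'n) \<Rightarrow> real) set" where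
  "H0div_dual \<Omega> = {F.
     (\<forall>v\<in>H0div \<Omega>. \<forall>w\<in>H0div \<Omega>. F (\<lambda>x. v x + w x) = F v + F w) \<and>
     (\<forall>c. \<forall>v\<in>H0div \<Omega>. F (\<lambda>x. c *\<^sub>R v x) = c * F v) \<and>
     (\<exists>C. \<forall>v\<in>H0div \<Omega>. \<bar>F v\<bar> \<le> C * Hdiv_norm \<Omega> v)}"

text \<open>\<open>F\<close> is a bounded functional on \<open>H0div \<Omega>\<close> extending the row-wise distributional divergence
  of \<open>\<tau>\<close>. The matrix \<open>jacobian \<phi> (at x)\<close> has the entries \<open>\<partial>\<^sub>j \<phi>\<^sub>i\<close>.\<close>

definition extends_div ::
    "(real ^ 'n) set \<Rightarrow> (real ^ 'n \<Rightarrow> real ^ 'n ^ 'n) \<Rightarrow> ((real ^ 'n \<Rightarrow> real ^ 'n) \<Rightarrow> real) \<Rightarrow> bool" where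
  "extends_div \<Omega> \<tau> F \<longleftrightarrow> F \<in> H0div_dual \<Omega> \<and>
     (\<forall>\<phi>\<in>test \<Omega>. F \<phi> = - ip \<Omega> \<tau> (\<lambda>x. jacobian \<phi> (at x)))"

text \<open>The values on \<open>H0div \<Omega>\<close> do not depend on the choice, since the test fields are dense in
  \<open>H0div \<Omega>\<close>.\<close>

definition div_dual ::
    "(real ^ 'n) set \<Rightarrow> (real ^ 'n \<Rightarrow> real ^ 'n ^ 'n) \<Rightarrow> (real ^ 'n \<Rightarrow> real ^ 'n) \<Rightarrow> real" where
  "div_dual \<Omega> \<tau> = (SOME F. extends_div \<Omega> \<tau> F)"

definition Hcurldiv_ST :: "(real ^ 'n) set \<Rightarrow> (real ^ 'n \<Rightarrow> real ^ 'n ^ 'n) set" where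
  "Hcurldiv_ST \<Omega> = {\<tau> \<in> L2 \<Omega>.
     (AE x in lebesgue_on \<Omega>. transpose (\<tau> x) = \<tau> x \<and> trace (\<tau> x) = 0) \<and>
     (\<exists>F. extends_div \<Omega> \<tau> F)}"

definition mixed_problem ::
    "(real ^ 'n) set \<Rightarrow> real \<Rightarrow> ((real ^ 'n \<Rightarrow> real ^ 'n) \<Rightarrow> real) \<Rightarrow>
     (real ^ 'n \<Rightarrow> real ^ 'n ^ 'n) \<Rightarrow> (real ^ 'n \<Rightarrow> real ^ 'n) \<Rightarrow> (real ^ 'n \<Rightarrow> real) \<Rightarrow> bool" where
  "mixed_problem \<Omega> \<nu> f \<sigma> u p \<longleftrightarrow>
     \<sigma> \<in> Hcurldiv_ST \<Omega> \<and> u \<in> H0div \<Omega> \<and> p \<in> L2_0 \<Omega> \<and>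
     (\<forall>\<tau>\<in>Hcurldiv_ST \<Omega>. \<forall>q\<in>L2_0 \<Omega>.
        inverse \<nu> * ip \<Omega> \<sigma> \<tau> + div_dual \<Omega> \<tau> u - ip \<Omega> q (wdiv \<Omega> u) = 0) \<and>
     (\<forall>v\<in>H0div \<Omega>.
        div_dual \<Omega> \<sigma> v - ip \<Omega> p (wdiv \<Omega> v) - ip \<Omega> u v = - f v)"

definition primal_problem ::
    "(real ^ 'n) set \<Rightarrow> real \<Rightarrow> ((real ^ 'n \<Rightarrow> real ^ 'n) \<Rightarrow> real) \<Rightarrow>
     (real ^ 'n \<Rightarrow> real ^ 'n) \<Rightarrow> (real ^ 'n \<Rightarrow> real) \<Rightarrow> bool" where
  "primal_problem \<Omega> \<nu> f u p \<longleftrightarrow>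
     u \<in> H1_0 \<Omega> \<and> p \<in> L2_0 \<Omega> \<and>
     (\<forall>v\<in>H1_0 \<Omega>.
        \<nu> * ip \<Omega> (eps \<Omega> u) (eps \<Omega> v) + ip \<Omega> u v + ip \<Omega> p (wdiv \<Omega> v) = f v) \<and>
     (\<forall>q\<in>L2_0 \<Omega>. ip \<Omega> (wdiv \<Omega> u) q = 0)"

end

theory Submission
  imports Defs
begin

text \<open>
  Both problems are compared through the test fields. They are dense in \<open>H0div \<Omega>\<close>: a pair
  orthogonal to all \<open>(\<phi>, div \<phi>)\<close> is of the form \<open>(\<nabla>r, r)\<close> with \<open>r \<in> H1 \<Omega>\<close>, hence orthogonal to
  \<open>(v, div v)\<close> by the vanishing normal trace of \<open>v\<close>. So \<open>div_dual \<Omega> \<tau>\<close> is determined by its values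
  on test fields, which gives the implication from (P) to (M).

  For the converse, testing (M) with the deviatoric part of an arbitrary smooth symmetric \<open>\<tau>\<close>, not
  vanishing on the boundary, shows that the zero extension of \<open>u\<close> has the weak symmetric gradient
  \<open>\<sigma> / \<nu>\<close> on the whole space. Mollification and Korn's inequality
  \<open>\<parallel>\<nabla>\<phi>\<parallel>\<^sup>2 \<le> 2 \<parallel>\<epsilon>(\<phi>)\<parallel>\<^sup>2\<close> put the zero extension into \<open>H\<^sup>1\<close> of the whole space. That its restriction
  lies in \<open>H1_0 \<Omega>\<close> is the only use of the polytopal shape, which need not be Lipschitz: the complement
  of \<open>\<Omega>\<close> is the closure of a finite union of convex open sets, so a point at distance less than \<open>d\<close>
  from it is carried out of \<open>\<Omega>\<close> by one of finitely many translations of length \<open>O(d)\<close>. Comparing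
  \<open>u\<close> with these translates bounds it by \<open>o(d)\<close> in \<open>L\<^sup>2\<close> of the boundary layer of width \<open>d\<close>, and
  cutoffs with gradient \<open>O(1/d)\<close> converge.
\<close>

subsection \<open>Square integrable functions on a measure space\<close>

text \<open>Deviatoric test tensors determine the full symmetric gradient of u. Testing (M) with
  \<open>\<tau> = 0\<close> makes div u orthogonal to all functions of mean zero; it has mean zero
  itself because the normal trace of u vanishes, so div u = 0. The spherical part of a test tensor
  is then invisible on both sides: \<sigma> is trace-free, and the divergence of the spherical part
  is a gradient, L2-orthogonal to divergence-free fields with vanishing normal trace even if the
  potential does not vanish on the boundary.

  A bound of order d on the boundary layer would not suffice, since the cutoffs cost 1/d. The gain
  to o(d) has two sources: a translation by d e differs from its linear expansion by o(d) in L2, and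
  the linear term is d times a derivative whose norm over the layer tends to zero, because the
  layers of an open set shrink to the empty set.

  Conversely, the second equation of (M) leaves no choice for div \<sigma>: it must be the
  functional \<open>(p, div v) + (u, v) - f v\<close>, and (P) on test fields says precisely that it
  extends the distributional divergence of \<nu> times the symmetric gradient.\<close>

definition l2 :: "'a measure \<Rightarrow> ('a \<Rightarrow> 'b::euclidean_space) set" where
  "l2 M = {f \<in> borel_measurable M. integrable M (\<lambda>x. (norm (f x))\<^sup>2)}"

definition l2_inner :: "'a measure \<Rightarrow> ('a \<Rightarrow> 'b::euclidean_space) \<Rightarrow> ('a \<Rightarrow> 'b) \<Rightarrow> real" where
  "l2_inner M f g = (LINT x|M. f x \<bullet> g x)"

definition l2_norm :: "'a measure \<Rightarrow> ('a \<Rightarrow> 'b::euclidean_space) \<Rightarrow> real" where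
  "l2_norm M f = sqrt (LINT x|M. (norm (f x))\<^sup>2)"

lemma l2_measurable [measurable_dest]: "f \<in> l2 M \<Longrightarrow> f \<in> borel_measurable M"
  by (simp add: l2_def)

lemma l2_integrable: "f \<in> l2 M \<Longrightarrow> integrable M (\<lambda>x. (norm (f x))\<^sup>2)"
  by (simp add: l2_def)

lemma l2_norm_sq: "(l2_norm M f)\<^sup>2 = (LINT x|M. (norm (f x))\<^sup>2)"
  by (simp add: l2_norm_def)

lemma l2_norm_sq_inner: "(l2_norm M f)\<^sup>2 = l2_inner M f f"
  by (simp add: l2_norm_def l2_inner_def power2_norm_eq_inner)

lemma l2_norm_nonneg [simp]: "0 \<le> l2_norm M f"
  by (simp add: l2_norm_def)

lemma l2_prod_integrable:
  assumes "f \<in> l2 M" "g \<in> l2 M"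
  shows "integrable M (\<lambda>x. norm (f x) * norm (g x))"
proof (rule Bochner_Integration.integrable_bound)
  show "integrable M (\<lambda>x. (norm (f x))\<^sup>2 + (norm (g x))\<^sup>2)"
    using assms by (simp add: l2_integrable)
  show "AE x in M. norm (norm (f x) * norm (g x)) \<le> norm ((norm (f x))\<^sup>2 + (norm (g x))\<^sup>2)"
  proof (intro AE_I2)
    fix x
    have "2 * (norm (f x) * norm (g x)) \<le> (norm (f x))\<^sup>2 + (norm (g x))\<^sup>2"
      using sum_squares_bound[of "norm (f x)" "norm (g x)"] by simp
    then show "norm (norm (f x) * norm (g x)) \<le> norm ((norm (f x))\<^sup>2 + (norm (g x))\<^sup>2)"
      by (simp add: abs_mult) (smt (verit) mult_nonneg_nonneg norm_ge_zero)
  qed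
qed (use assms in measurable)

lemma l2_inner_integrable:
  assumes "f \<in> l2 M" "g \<in> l2 M"
  shows "integrable M (\<lambda>x. f x \<bullet> g x)"
  by (rule Bochner_Integration.integrable_bound[OF l2_prod_integrable[OF assms]])
     (use assms in \<open>auto simp: Cauchy_Schwarz_ineq2 l2_measurable\<close>)

lemma l2_scaleR_integrable:
  assumes "f \<in> l2 M" "(g :: 'a \<Rightarrow> real) \<in> l2 M"
  shows "integrable M (\<lambda>x. g x *\<^sub>R f x)"
  by (rule Bochner_Integration.integrable_bound[OF l2_prod_integrable[OF assms(2,1)]])
     (use assms in \<open>auto simp: l2_measurable\<close>)

lemma l2_bounded:
  assumes "f \<in> l2 M" and [measurable]: "g \<in> borel_measurable M"
    and "AE x in M. norm (g x) \<le> C * norm (f x)"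
  shows "g \<in> l2 M"
proof -
  have "integrable M (\<lambda>x. (norm (g x))\<^sup>2)"
  proof (rule Bochner_Integration.integrable_bound)
    show "integrable M (\<lambda>x. C\<^sup>2 * (norm (f x))\<^sup>2)"
      using assms by (simp add: l2_integrable)
    show "AE x in M. norm ((norm (g x))\<^sup>2) \<le> norm (C\<^sup>2 * (norm (f x))\<^sup>2)"
      using assms(3)
      by eventually_elim (smt (verit) norm_ge_zero power_mono power_mult_distrib real_norm_def zero_le_power2)
  qed measurable
  then show ?thesis by (simp add: l2_def)
qed

lemma l2_zero [simp]: "(\<lambda>x. 0) \<in> l2 M"
  by (simp add: l2_def)

lemma l2_bounded_linear:
  assumes "bounded_linear L" "f \<in> l2 M"
  shows "(\<lambda>x. L (f x)) \<in> l2 M"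
proof -
  obtain K where "\<And>x. norm (L x) \<le> norm x * K"
    using bounded_linear.bounded[OF assms(1)] by blast
  moreover have "(\<lambda>x. L (f x)) \<in> borel_measurable M"
    using borel_measurable_continuous_on[OF linear_continuous_on[OF assms(1)] l2_measurable[OF assms(2)]] .
  ultimately show ?thesis
    by (intro l2_bounded[OF assms(2), where C = K]) (auto simp: mult.commute)
qed

lemma l2_scaleR: "f \<in> l2 M \<Longrightarrow> (\<lambda>x. c *\<^sub>R f x) \<in> l2 M"
  by (rule l2_bounded_linear[OF bounded_linear_scaleR_right])

lemma l2_minus: "f \<in> l2 M \<Longrightarrow> (\<lambda>x. - f x) \<in> l2 M"
  by (simp add: l2_def)

lemma l2_add:
  assumes "f \<in> l2 M" "g \<in> l2 M"
  shows "(\<lambda>x. f x + g x) \<in> l2 M"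
proof -
  have [measurable]: "f \<in> borel_measurable M" "g \<in> borel_measurable M"
    using assms by (auto simp: l2_def)
  have "integrable M (\<lambda>x. (norm (f x))\<^sup>2 + 2 * (f x \<bullet> g x) + (norm (g x))\<^sup>2)"
    using assms by (auto intro!: Bochner_Integration.integrable_add integrable_mult_right l2_inner_integrable l2_integrable)
  then have "integrable M (\<lambda>x. (norm (f x + g x))\<^sup>2)"
    by (simp add: power2_norm_eq_inner inner_simps inner_commute algebra_simps)
  then show ?thesis by (simp add: l2_def)
qed

lemma l2_diff: "f \<in> l2 M \<Longrightarrow> g \<in> l2 M \<Longrightarrow> (\<lambda>x. f x - g x) \<in> l2 M"
  using l2_add[of f M "\<lambda>x. - g x"] by (simp add: l2_minus)

lemma l2_sum: "(\<And>i. i \<in> I \<Longrightarrow> f i \<in> l2 M) \<Longrightarrow> (\<lambda>x. \<Sum>i\<in>I. f i x) \<in> l2 M"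
  by (induction I rule: infinite_finite_induct) (auto intro: l2_add)

lemma l2_cong_AE:
  assumes "f \<in> l2 M" "g \<in> borel_measurable M" "AE x in M. f x = g x"
  shows "g \<in> l2 M"
  by (rule l2_bounded[OF assms(1,2), of 1]) (use assms(3) in auto)

lemma l2_inner_cong_AE:
  assumes "AE x in M. f x = f' x" "AE x in M. g x = g' x"
    and "f \<in> borel_measurable M" "f' \<in> borel_measurable M"
    and "g \<in> borel_measurable M" "g' \<in> borel_measurable M"
  shows "l2_inner M f g = l2_inner M f' g'"
  unfolding l2_inner_def
  by (rule integral_cong_AE) (use assms in \<open>auto intro: borel_measurable_inner\<close>)

lemma l2_inner_commute: "l2_inner M f g = l2_inner M g f"
  by (simp add: l2_inner_def inner_commute)

lemma l2_inner_add_left: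
  "\<lbrakk>f \<in> l2 M; g \<in> l2 M; h \<in> l2 M\<rbrakk> \<Longrightarrow> l2_inner M (\<lambda>x. f x + g x) h = l2_inner M f h + l2_inner M g h"
  by (simp add: l2_inner_def inner_add_left l2_inner_integrable)

lemma l2_inner_diff_left:
  "\<lbrakk>f \<in> l2 M; g \<in> l2 M; h \<in> l2 M\<rbrakk> \<Longrightarrow> l2_inner M (\<lambda>x. f x - g x) h = l2_inner M f h - l2_inner M g h"
  by (simp add: l2_inner_def inner_diff_left l2_inner_integrable)

lemma l2_inner_scaleR_left: "l2_inner M (\<lambda>x. c *\<^sub>R f x) g = c * l2_inner M f g"
  by (simp add: l2_inner_def)

lemma l2_inner_add_right:
  "\<lbrakk>f \<in> l2 M; g \<in> l2 M; h \<in> l2 M\<rbrakk> \<Longrightarrow> l2_inner M h (\<lambda>x. f x + g x) = l2_inner M h f + l2_inner M h g"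
  by (simp add: l2_inner_def inner_add_right l2_inner_integrable)

lemma l2_inner_diff_right:
  "\<lbrakk>f \<in> l2 M; g \<in> l2 M; h \<in> l2 M\<rbrakk> \<Longrightarrow> l2_inner M h (\<lambda>x. f x - g x) = l2_inner M h f - l2_inner M h g"
  by (simp add: l2_inner_def inner_diff_right l2_inner_integrable)

lemma l2_inner_scaleR_right: "l2_inner M f (\<lambda>x. c *\<^sub>R g x) = c * l2_inner M f g"
  by (simp add: l2_inner_def)

lemma l2_norm_cong_AE:
  assumes "AE x in M. f x = g x" "f \<in> borel_measurable M" "g \<in> borel_measurable M"
  shows "l2_norm M f = l2_norm M g"
proof -
  have "(LINT x|M. (norm (f x))\<^sup>2) = (LINT x|M. (norm (g x))\<^sup>2)"
    by (rule integral_cong_AE) (use assms in auto)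
  then show ?thesis by (simp add: l2_norm_def)
qed

lemma l2_norm_eq_0:
  assumes "f \<in> l2 M" "l2_norm M f = 0"
  shows "AE x in M. f x = 0"
proof -
  have "(LINT x|M. (norm (f x))\<^sup>2) = 0"
    using assms(2) by (simp add: l2_norm_def)
  then show ?thesis
    using integral_nonneg_eq_0_iff_AE[OF l2_integrable[OF assms(1)]] by simp
qed

lemma l2_norm_scaleR: "l2_norm M (\<lambda>x. c *\<^sub>R f x) = \<bar>c\<bar> * l2_norm M f"
  by (simp add: l2_norm_def power_mult_distrib real_sqrt_mult)

lemma l2_norm_minus: "l2_norm M (\<lambda>x. - f x) = l2_norm M f"
  by (simp add: l2_norm_def)

lemma l2_norm_minus_commute: "l2_norm M (\<lambda>x. f x - g x) = l2_norm M (\<lambda>x. g x - f x)"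
  by (simp add: l2_norm_def norm_minus_commute)

lemma l2_norm_sq_add:
  assumes "f \<in> l2 M" "g \<in> l2 M"
  shows "(l2_norm M (\<lambda>x. f x + g x))\<^sup>2 = (l2_norm M f)\<^sup>2 + 2 * l2_inner M f g + (l2_norm M g)\<^sup>2"
  using assms
  by (simp add: l2_norm_sq_inner l2_inner_add_left l2_inner_add_right l2_add)
     (simp add: l2_inner_commute)

lemma l2_Cauchy_Schwarz:
  assumes f: "f \<in> l2 M" and g: "g \<in> l2 M"
  shows "\<bar>l2_inner M f g\<bar> \<le> l2_norm M f * l2_norm M g"
proof -
  have *: "2 * t * l2_inner M f g + t\<^sup>2 * (l2_norm M g)\<^sup>2 + (l2_norm M f)\<^sup>2 \<ge> 0" for t
    using l2_norm_sq_add[OF f l2_scaleR[OF g, of t]] zero_le_power2[of "l2_norm M (\<lambda>x. f x + t *\<^sub>R g x)"]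
    by (simp add: l2_inner_scaleR_right l2_norm_scaleR power_mult_distrib)
  have "(l2_inner M f g)\<^sup>2 \<le> (l2_norm M f * l2_norm M g)\<^sup>2"
  proof (cases "l2_norm M g = 0")
    case True
    then have "AE x in M. g x = 0" using l2_norm_eq_0 g by blast
    then have "l2_inner M f g = l2_inner M f (\<lambda>x. 0)"
      using f g by (intro l2_inner_cong_AE) (auto simp: l2_measurable)
    then show ?thesis by (simp add: l2_inner_def)
  next
    case False
    \<comment> \<open>The minimiser of the quadratic polynomial in \<open>*\<close>; it exists
      because \<open>l2_norm M g\<close> is nonzero in this case.\<close>
    define t where "t = - l2_inner M f g / (l2_norm M g)\<^sup>2"
    have "2 * t * l2_inner M f g + t\<^sup>2 * (l2_norm M g)\<^sup>2 = - (l2_inner M f g)\<^sup>2 / (l2_norm M g)\<^sup>2"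
      using False by (simp add: t_def field_simps power2_eq_square)
    with *[of t] have "(l2_inner M f g)\<^sup>2 / (l2_norm M g)\<^sup>2 \<le> (l2_norm M f)\<^sup>2" by simp
    then show ?thesis using False by (simp add: field_simps)
  qed
  then show ?thesis
    by (metis abs_le_square_iff abs_mult abs_of_nonneg l2_norm_nonneg)
qed

lemma l2_norm_triangle:
  assumes "f \<in> l2 M" "g \<in> l2 M"
  shows "l2_norm M (\<lambda>x. f x + g x) \<le> l2_norm M f + l2_norm M g"
proof (rule power2_le_imp_le)
  show "(l2_norm M (\<lambda>x. f x + g x))\<^sup>2 \<le> (l2_norm M f + l2_norm M g)\<^sup>2"
    using l2_norm_sq_add[OF assms] l2_Cauchy_Schwarz[OF assms] by (simp add: power2_sum)
qed simp

lemma l2_norm_triangle_diff: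
  assumes "f \<in> l2 M" "g \<in> l2 M" "h \<in> l2 M"
  shows "l2_norm M (\<lambda>x. f x - h x) \<le> l2_norm M (\<lambda>x. f x - g x) + l2_norm M (\<lambda>x. g x - h x)"
  using l2_norm_triangle[OF l2_diff[OF assms(1,2)] l2_diff[OF assms(2,3)]] by simp

lemma l2_norm_sum_le:
  assumes "finite I" "\<And>i. i \<in> I \<Longrightarrow> f i \<in> l2 M"
  shows "l2_norm M (\<lambda>x. \<Sum>i\<in>I. f i x) \<le> (\<Sum>i\<in>I. l2_norm M (f i))"
  using assms
proof (induction I rule: finite_induct)
  case (insert i I)
  have "l2_norm M (\<lambda>x. f i x + (\<Sum>j\<in>I. f j x)) \<le> l2_norm M (f i) + l2_norm M (\<lambda>x. \<Sum>j\<in>I. f j x)"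
    using insert by (intro l2_norm_triangle l2_sum) auto
  then show ?case using insert by simp
qed (simp add: l2_norm_def)

lemma l2_norm_fun: "f \<in> l2 M \<Longrightarrow> (\<lambda>x. norm (f x)) \<in> l2 M"
  by (auto simp: l2_def intro: borel_measurable_norm)

lemma l2_norm_mono:
  assumes "f \<in> l2 M" "g \<in> borel_measurable M" "AE x in M. norm (g x) \<le> norm (f x)"
  shows "l2_norm M g \<le> l2_norm M f"
proof -
  have "g \<in> l2 M" by (rule l2_bounded[OF assms(1,2), of 1]) (use assms(3) in simp)
  then have "(LINT x|M. (norm (g x))\<^sup>2) \<le> (LINT x|M. (norm (f x))\<^sup>2)"
    using assms by (intro integral_mono_AE) (auto simp: l2_integrable power_mono)
  then show ?thesis by (simp add: l2_norm_def)
qed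

lemma l2_norm_le_C:
  assumes "f \<in> l2 M" "g \<in> borel_measurable M" "AE x in M. norm (g x) \<le> C * norm (f x)" "C \<ge> 0"
  shows "l2_norm M g \<le> C * l2_norm M f"
  using l2_norm_mono[OF l2_scaleR[OF assms(1), of C] assms(2)] assms(3,4) by (simp add: l2_norm_scaleR)

section \<open>Convergence, completeness and orthogonal projection\<close>

lemma l2_inner_tendsto_left:
  assumes F: "\<And>n. F n \<in> l2 M" and f: "f \<in> l2 M" and g: "g \<in> l2 M"
    and lim: "(\<lambda>n. l2_norm M (\<lambda>x. F n x - f x)) \<longlonglongrightarrow> 0"
  shows "(\<lambda>n. l2_inner M (F n) g) \<longlonglongrightarrow> l2_inner M f g"
proof (rule LIM_zero_cancel, rule Lim_null_comparison)
  show "\<forall>\<^sub>F n in sequentially. norm (l2_inner M (F n) g - l2_inner M f g)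
      \<le> l2_norm M (\<lambda>x. F n x - f x) * l2_norm M g"
    using l2_Cauchy_Schwarz[OF l2_diff[OF F f] g]
    by (simp add: l2_inner_diff_left F f g)
  show "(\<lambda>n. l2_norm M (\<lambda>x. F n x - f x) * l2_norm M g) \<longlonglongrightarrow> 0"
    using tendsto_mult_left_zero[OF lim] .
qed

lemma l2_inner_tendsto:
  assumes F: "\<And>n. F n \<in> l2 M" "f \<in> l2 M" and G: "\<And>n. G n \<in> l2 M" "g \<in> l2 M"
    and lim: "(\<lambda>n. l2_norm M (\<lambda>x. F n x - f x)) \<longlonglongrightarrow> 0"
       "(\<lambda>n. l2_norm M (\<lambda>x. G n x - g x)) \<longlonglongrightarrow> 0"
  shows "(\<lambda>n. l2_inner M (F n) (G n)) \<longlonglongrightarrow> l2_inner M f g"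
proof -
  have "(\<lambda>n. l2_inner M (\<lambda>x. F n x - f x) (\<lambda>x. G n x - g x)) \<longlonglongrightarrow> 0"
  proof (rule Lim_null_comparison)
    show "\<forall>\<^sub>F n in sequentially. norm (l2_inner M (\<lambda>x. F n x - f x) (\<lambda>x. G n x - g x))
      \<le> l2_norm M (\<lambda>x. F n x - f x) * l2_norm M (\<lambda>x. G n x - g x)"
      using l2_Cauchy_Schwarz[OF l2_diff[OF F] l2_diff[OF G]] by simp
    show "(\<lambda>n. l2_norm M (\<lambda>x. F n x - f x) * l2_norm M (\<lambda>x. G n x - g x)) \<longlonglongrightarrow> 0"
      using tendsto_mult_zero[OF lim] .
  qed
  moreover have "l2_inner M (\<lambda>x. F n x - f x) (\<lambda>x. G n x - g x)
      = l2_inner M (F n) (G n) - l2_inner M f (G n) - (l2_inner M (F n) g - l2_inner M f g)" for n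
    using F G by (simp add: l2_inner_diff_left l2_inner_diff_right l2_diff)
  moreover have "(\<lambda>n. l2_inner M (F n) g) \<longlonglongrightarrow> l2_inner M f g"
    by (rule l2_inner_tendsto_left) (use F G lim in auto)
  moreover have "(\<lambda>n. l2_inner M f (G n)) \<longlonglongrightarrow> l2_inner M f g"
    using l2_inner_tendsto_left[of G M g f] F G lim by (simp add: l2_inner_commute)
  ultimately have "(\<lambda>n. l2_inner M (\<lambda>x. F n x - f x) (\<lambda>x. G n x - g x)
      + l2_inner M f (G n) + (l2_inner M (F n) g - l2_inner M f g)) \<longlonglongrightarrow> 0 + l2_inner M f g + (l2_inner M f g - l2_inner M f g)"
    by (intro tendsto_add tendsto_diff tendsto_const)
  then show ?thesis using F G by (simp add: l2_inner_diff_left l2_inner_diff_right l2_diff)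
qed

lemma l2_unique_limit:
  assumes F: "\<And>n. F n \<in> l2 M" and "f \<in> l2 M" "g \<in> l2 M"
    and "(\<lambda>n. l2_norm M (\<lambda>x. F n x - f x)) \<longlonglongrightarrow> 0"
    and "(\<lambda>n. l2_norm M (\<lambda>x. F n x - g x)) \<longlonglongrightarrow> 0"
  shows "AE x in M. f x = g x"
proof -
  have "l2_norm M (\<lambda>x. f x - g x) \<le> l2_norm M (\<lambda>x. F n x - f x) + l2_norm M (\<lambda>x. F n x - g x)" for n
    using l2_norm_triangle_diff[OF assms(2) F assms(3), of n] by (simp add: l2_norm_minus_commute)
  then have "l2_norm M (\<lambda>x. f x - g x) \<le> 0"
    using tendsto_add[OF assms(4,5)] by (intro LIMSEQ_le_const) (auto intro: exI[of _ 0])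
  then have "l2_norm M (\<lambda>x. f x - g x) = 0" by (simp add: order_antisym)
  then show ?thesis
    using l2_norm_eq_0[OF l2_diff[OF assms(2,3)]] by simp
qed

text \<open>Fatou's lemma for the squared distances to the single member \<open>F m\<close>: a bound
  along the sequence survives the pointwise limit, and square integrability of the limit comes with
  it. The bound is asked only from \<open>N\<close> on, so that \<open>m\<close> may be an index
  before \<open>N\<close>.\<close>

lemma l2_AE_limit:
  assumes F: "\<And>n. F n \<in> l2 M"
    and lim: "AE x in M. (\<lambda>n. F n x) \<longlonglongrightarrow> f x" and f [measurable]: "f \<in> borel_measurable M"
    and bd: "\<And>n. n \<ge> N \<Longrightarrow> l2_norm M (\<lambda>x. F n x - F m x) \<le> e"
  shows "f \<in> l2 M \<and> l2_norm M (\<lambda>x. f x - F m x) \<le> e"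
proof -
  have [measurable]: "F n \<in> borel_measurable M" for n using F by (rule l2_measurable)
  have e: "0 \<le> e" using order_trans[OF l2_norm_nonneg bd[OF order_refl]] .
  have 1: "(\<integral>\<^sup>+x. ennreal ((norm (F n x - F m x))\<^sup>2) \<partial>M) \<le> ennreal (e\<^sup>2)" if "n \<ge> N" for n
    using bd[OF that] l2_integrable[OF l2_diff[OF F[of n] F[of m]]]
    by (subst nn_integral_eq_integral)
       (auto simp: l2_norm_sq[symmetric] intro!: ennreal_leI power_mono)
  have "(\<integral>\<^sup>+x. ennreal ((norm (f x - F m x))\<^sup>2) \<partial>M)
      = (\<integral>\<^sup>+x. liminf (\<lambda>n. ennreal ((norm (F n x - F m x))\<^sup>2)) \<partial>M)"
  proof (rule nn_integral_cong_AE)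
    show "AE x in M. ennreal ((norm (f x - F m x))\<^sup>2) = liminf (\<lambda>n. ennreal ((norm (F n x - F m x))\<^sup>2))"
      using lim
    proof eventually_elim
      case (elim x)
      have "(\<lambda>n. ennreal ((norm (F n x - F m x))\<^sup>2)) \<longlonglongrightarrow> ennreal ((norm (f x - F m x))\<^sup>2)"
        using elim by (intro tendsto_ennrealI tendsto_intros)
      then show ?case by (intro lim_imp_Liminf[symmetric]) auto
    qed
  qed
  also have "\<dots> \<le> liminf (\<lambda>n. \<integral>\<^sup>+x. ennreal ((norm (F n x - F m x))\<^sup>2) \<partial>M)"
    by (rule nn_integral_liminf) measurable
  also have "\<dots> \<le> limsup (\<lambda>n. \<integral>\<^sup>+x. ennreal ((norm (F n x - F m x))\<^sup>2) \<partial>M)"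
    by (rule Liminf_le_Limsup) simp
  also have "\<dots> \<le> ennreal (e\<^sup>2)"
    by (rule Limsup_bounded) (use 1 in \<open>auto intro!: exI[of _ N] simp: eventually_sequentially\<close>)
  finally have le: "(\<integral>\<^sup>+x. ennreal ((norm (f x - F m x))\<^sup>2) \<partial>M) \<le> ennreal (e\<^sup>2)" .
  then have "integrable M (\<lambda>x. (norm (f x - F m x))\<^sup>2)"
    by (intro integrableI_bounded) (auto intro: order_le_less_trans)
  then have d: "(\<lambda>x. f x - F m x) \<in> l2 M" by (simp add: l2_def)
  have "ennreal ((l2_norm M (\<lambda>x. f x - F m x))\<^sup>2) \<le> ennreal (e\<^sup>2)"
    using le l2_integrable[OF d] by (simp add: l2_norm_sq nn_integral_eq_integral)
  then have "l2_norm M (\<lambda>x. f x - F m x) \<le> e"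
    using e by (simp add: ennreal_le_iff power_mono_iff)
  then show ?thesis using l2_add[OF d F[of m]] by simp
qed

text \<open>The weight \<open>4^n\<close> turns the bound \<open>(1/8)^n\<close> into the summable
  \<open>(1/2)^n\<close>. Hence the weighted squared increments have a finite sum almost everywhere,
  their terms are bounded by some \<open>K\<close>, and the increments are at most
  \<open>sqrt K * (1/2)^n\<close>. Working with squares throughout avoids L1 norms, which the L2
  norm does not control on a space of infinite measure.\<close>

lemma l2_fast_Cauchy_convergent:
  assumes F: "\<And>n. F n \<in> l2 M"
    and fast: "\<And>n. (l2_norm M (\<lambda>x. F (Suc n) x - F n x))\<^sup>2 \<le> (1/8)^n"
  shows "AE x in M. convergent (\<lambda>n. F n x)"
proof -
  have [measurable]: "F n \<in> borel_measurable M" for n using F by (rule l2_measurable)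
  define d where "d n x = 4^n * (norm (F (Suc n) x - F n x))\<^sup>2" for n x
  have "(\<integral>\<^sup>+x. (\<Sum>n. ennreal (d n x)) \<partial>M) = (\<Sum>n. \<integral>\<^sup>+x. ennreal (d n x) \<partial>M)"
    unfolding d_def by (rule nn_integral_suminf) measurable
  also have "\<dots> \<le> (\<Sum>n. ennreal ((1/2)^n))"
  proof (rule suminf_le)
    fix n
    have "(\<integral>\<^sup>+x. ennreal (d n x) \<partial>M) = ennreal (4^n * (l2_norm M (\<lambda>x. F (Suc n) x - F n x))\<^sup>2)"
      using l2_integrable[OF l2_diff[OF F[of "Suc n"] F[of n]]]
      by (subst nn_integral_eq_integral) (auto simp: d_def[abs_def] l2_norm_sq)
    also have "\<dots> \<le> ennreal (4^n * (1/8)^n)"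
      by (intro ennreal_leI mult_left_mono fast) auto
    also have "\<dots> = ennreal ((1/2)^n)"
      by (simp flip: power_mult_distrib)
    finally show "(\<integral>\<^sup>+x. ennreal (d n x) \<partial>M) \<le> ennreal ((1/2)^n)" .
  qed auto
  also have "\<dots> = ennreal (\<Sum>n. (1/2)^n)"
    by (rule suminf_ennreal2) (auto intro: summable_geometric)
  also have "\<dots> < \<infinity>" by simp
  finally have "(\<integral>\<^sup>+x. (\<Sum>n. ennreal (d n x)) \<partial>M) \<noteq> \<infinity>" by simp
  then have "AE x in M. (\<Sum>n. ennreal (d n x)) \<noteq> \<infinity>"
    by (intro nn_integral_PInf_AE) (auto simp: d_def)
  then show ?thesis
  proof eventually_elim
    case (elim x)
    have "summable (\<lambda>n. d n x)"
      by (rule summable_suminf_not_top) (use elim in \<open>auto simp: d_def\<close>)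
    then have "(\<lambda>n. d n x) \<longlonglongrightarrow> 0" by (rule summable_LIMSEQ_zero)
    then have "Bseq (\<lambda>n. d n x)" using convergent_imp_Bseq convergent_def by blast
    then obtain K where K: "K > 0" "\<And>n. norm (d n x) \<le> K" by (auto elim: BseqE)
    have "norm (F (Suc n) x - F n x) \<le> sqrt K * (1/2)^n" for n
    proof (rule power2_le_imp_le)
      have "4^n * (norm (F (Suc n) x - F n x))\<^sup>2 \<le> K" using K(2)[of n] by (simp add: d_def)
      then have "(norm (F (Suc n) x - F n x))\<^sup>2 \<le> K * (1/4)^n"
        by (simp add: power_divide field_simps)
      also have "\<dots> = (sqrt K * (1/2)^n)\<^sup>2"
        using K(1) by (simp add: power_mult_distrib power_divide)
          (simp add: power2_eq_square flip: power_mult_distrib)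
      finally show "(norm (F (Suc n) x - F n x))\<^sup>2 \<le> (sqrt K * (1/2)^n)\<^sup>2" .
    qed (use K in auto)
    moreover have "summable (\<lambda>n. sqrt K * (1/2::real)^n)"
      by (intro summable_mult summable_geometric) simp
    ultimately have "summable (\<lambda>n. F (Suc n) x - F n x)"
      by (intro summable_comparison_test'[of "\<lambda>n. sqrt K * (1/2)^n" 0 "\<lambda>n. F (Suc n) x - F n x"]) simp_all
    then have "convergent (\<lambda>n. \<Sum>i<n. F (Suc i) x - F i x)"
      by (simp add: summable_iff_convergent)
    then have "convergent (\<lambda>n. F n x - F 0 x)"
      by (simp only: sum_lessThan_telescope[of "\<lambda>n. F n x"])
    from convergent_add[OF this convergent_const[of "F 0 x"]]
    show ?case by simp
  qed
qed

lemma l2_complete: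
  assumes F: "\<And>n. F n \<in> l2 M"
    and Cauchy: "\<And>e. e > 0 \<Longrightarrow> \<exists>N. \<forall>m\<ge>N. \<forall>n\<ge>N. l2_norm M (\<lambda>x. F m x - F n x) < e"
  shows "\<exists>f \<in> l2 M. (\<lambda>n. l2_norm M (\<lambda>x. F n x - f x)) \<longlonglongrightarrow> 0"
proof -
  obtain N where N: "\<And>k m n. m \<ge> N k \<Longrightarrow> n \<ge> N k \<Longrightarrow> l2_norm M (\<lambda>x. F m x - F n x) < sqrt ((1/8)^k)"
    using Cauchy[of "sqrt ((1/8)^_)"] by (metis real_sqrt_gt_zero zero_less_divide_1_iff zero_less_numeral zero_less_power)
  \<comment> \<open>The sum puts both \<open>s k\<close> and \<open>s (Suc k)\<close> beyond
    \<open>N k\<close>; the summand \<open>k\<close> makes the subsequence tend to infinity.\<close>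
  define s where "s k = (\<Sum>i\<le>k. N i) + k" for k
  have s: "s k \<ge> N k" "s (Suc k) \<ge> N k" "s k \<ge> k" for k
  proof -
    have "N k \<le> (\<Sum>i\<le>k. N i)" by (rule member_le_sum) auto
    then show "s k \<ge> N k" "s (Suc k) \<ge> N k" "s k \<ge> k" by (auto simp: s_def)
  qed
  have "(l2_norm M (\<lambda>x. F (s (Suc k)) x - F (s k) x))\<^sup>2 \<le> (1/8)^k" for k
    using N[OF s(2,1), of k] by (simp add: real_less_rsqrt sqrt_ge_absD less_imp_le)
  then have conv: "AE x in M. convergent (\<lambda>k. F (s k) x)"
    by (intro l2_fast_Cauchy_convergent F)
  define f where "f x = lim (\<lambda>k. F (s k) x)" for x
  have [measurable]: "F n \<in> borel_measurable M" for n using F by (rule l2_measurable)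
  have f [measurable]: "f \<in> borel_measurable M"
    unfolding f_def by (rule borel_measurable_lim_metric) measurable
  have lim: "AE x in M. (\<lambda>k. F (s k) x) \<longlonglongrightarrow> f x"
    using conv by eventually_elim (simp add: f_def convergent_LIMSEQ_iff)
  have est: "\<exists>K. \<forall>m\<ge>K. f \<in> l2 M \<and> l2_norm M (\<lambda>x. f x - F m x) \<le> e" if "e > 0" for e
  proof -
    obtain K where K: "\<And>m n. m \<ge> K \<Longrightarrow> n \<ge> K \<Longrightarrow> l2_norm M (\<lambda>x. F m x - F n x) < e"
      using Cauchy[OF \<open>e > 0\<close>] by blast
    have "f \<in> l2 M \<and> l2_norm M (\<lambda>x. f x - F m x) \<le> e" if "m \<ge> K" for m
    proof -
      \<comment> \<open>An arbitrary member \<open>F m\<close> is placed at index 0 in front of the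
        convergent subsequence, so that \<open>l2_AE_limit\<close> measures the distance of the
        limit to \<open>F m\<close>. This is why the bound is claimed only from \<open>Suc K\<close>
        on.\<close>
      define G where "G n = (if n = 0 then F m else F (s n))" for n
      have "f \<in> l2 M \<and> l2_norm M (\<lambda>x. f x - G 0 x) \<le> e"
      proof (rule l2_AE_limit[where N = "Suc K"])
        show "AE x in M. (\<lambda>n. G n x) \<longlonglongrightarrow> f x"
          using lim
        proof eventually_elim
          case (elim x)
          then show ?case
            by (rule Lim_transform_eventually)
               (auto simp: G_def eventually_sequentially intro!: exI[of _ 1])
        qed
        show "l2_norm M (\<lambda>x. G n x - G 0 x) \<le> e" if "n \<ge> Suc K" for n
          using K[of "s n" m] s(3)[of n] that \<open>m \<ge> K\<close> by (simp add: G_def less_imp_le)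
      qed (auto simp: G_def F)
      then show ?thesis by (simp add: G_def)
    qed
    then show ?thesis by blast
  qed
  have "f \<in> l2 M" using est[of 1] by auto
  moreover have "(\<lambda>n. l2_norm M (\<lambda>x. F n x - f x)) \<longlonglongrightarrow> 0"
  proof (rule LIMSEQ_I)
    fix r :: real assume "r > 0"
    then obtain K where "\<forall>m\<ge>K. l2_norm M (\<lambda>x. f x - F m x) \<le> r/2" using est[of "r/2"] by auto
    then show "\<exists>no. \<forall>n\<ge>no. norm (l2_norm M (\<lambda>x. F n x - f x) - 0) < r"
      using \<open>r > 0\<close> by (intro exI[of _ K]) (auto simp: l2_norm_minus_commute[of M _ f] intro: le_less_trans)
  qed
  ultimately show ?thesis by blast
qed

lemma l2_parallelogram:
  assumes "f \<in> l2 M" "g \<in> l2 M"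
  shows "(l2_norm M (\<lambda>x. f x + g x))\<^sup>2 + (l2_norm M (\<lambda>x. f x - g x))\<^sup>2
       = 2 * (l2_norm M f)\<^sup>2 + 2 * (l2_norm M g)\<^sup>2"
  using l2_norm_sq_add[OF assms] l2_norm_sq_add[OF assms(1) l2_minus[OF assms(2)]]
    l2_inner_scaleR_right[of M f "-1" g]
  by (simp add: l2_norm_minus)

text \<open>\<open>S\<close> is a subspace that need not be closed, so a nearest point in
  \<open>S\<close> need not exist. A minimising sequence in \<open>S\<close> is returned together
  with the limit \<open>r\<close> of its residuals; the parallelogram law makes the residuals
  Cauchy, and minimality under the perturbations \<open>s k - c t\<close> makes \<open>r\<close>
  orthogonal to \<open>S\<close>.\<close>

lemma l2_projection_residual:
  assumes S: "S \<subseteq> l2 M" and ne: "S \<noteq> {}"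
    and add: "\<And>f g. f \<in> S \<Longrightarrow> g \<in> S \<Longrightarrow> (\<lambda>x. f x + g x) \<in> S"
    and scale: "\<And>c f. f \<in> S \<Longrightarrow> (\<lambda>x. c *\<^sub>R f x) \<in> S"
    and v: "v \<in> l2 M"
  shows "\<exists>s r. (\<forall>k::nat. s k \<in> S) \<and> r \<in> l2 M \<and> (\<forall>t\<in>S. l2_inner M r t = 0)
    \<and> (\<lambda>k. l2_norm M (\<lambda>x. v x - s k x - r x)) \<longlonglongrightarrow> 0"
proof -
  have Sl2: "s \<in> l2 M" if "s \<in> S" for s using S that by blast
  define D where "D = (INF s\<in>S. (l2_norm M (\<lambda>x. v x - s x))\<^sup>2)"
  have bdd: "bdd_below ((\<lambda>s. (l2_norm M (\<lambda>x. v x - s x))\<^sup>2) ` S)"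
    by (rule bdd_belowI2[of _ 0]) simp
  have D_le: "D \<le> (l2_norm M (\<lambda>x. v x - s x))\<^sup>2" if "s \<in> S" for s
    unfolding D_def by (rule cINF_lower[OF bdd that])
  have "\<exists>s\<in>S. (l2_norm M (\<lambda>x. v x - s x))\<^sup>2 < D + 1 / real (Suc k)" for k
    using cINF_less_iff[OF ne bdd, of "D + 1 / real (Suc k)"] by (simp add: D_def)
  then obtain s where s: "\<And>k. s k \<in> S" "\<And>k. (l2_norm M (\<lambda>x. v x - s k x))\<^sup>2 < D + 1 / real (Suc k)"
    by metis
  define R where "R k x = v x - s k x" for k x
  have R: "R k \<in> l2 M" for k unfolding R_def by (intro l2_diff v Sl2 s)
  have dist: "(l2_norm M (\<lambda>x. R m x - R n x))\<^sup>2 \<le> 2 / real (Suc m) + 2 / real (Suc n)" for m n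
  proof -
    \<comment> \<open>The midpoint of \<open>s m\<close> and \<open>s n\<close> lies in
      \<open>S\<close>, so the mean of the two residuals has squared norm at least \<open>D\<close>.
      In the parallelogram law this forces the difference of the residuals to be small.\<close>
    have "(\<lambda>x. (1/2) *\<^sub>R (s m x + s n x)) \<in> S" by (intro scale add s)
    moreover have "v x - (1/2) *\<^sub>R (s m x + s n x) = (1/2) *\<^sub>R (R m x + R n x)" for x
    proof -
      have "v x = (1/2) *\<^sub>R v x + (1/2) *\<^sub>R v x" by (simp flip: scaleR_add_left)
      then have "v x - (1/2) *\<^sub>R (s m x + s n x)
          = ((1/2) *\<^sub>R v x + (1/2) *\<^sub>R v x) - ((1/2) *\<^sub>R s m x + (1/2) *\<^sub>R s n x)"
        by (simp only: scaleR_add_right)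
      then show ?thesis
        by (simp only: add_diff_add R_def scaleR_add_right scaleR_diff_right)
    qed
    ultimately have "D \<le> (l2_norm M (\<lambda>x. (1/2) *\<^sub>R (R m x + R n x)))\<^sup>2"
      using D_le[of "\<lambda>x. (1/2) *\<^sub>R (s m x + s n x)"] by simp
    then have "D \<le> (\<bar>1/2\<bar> * l2_norm M (\<lambda>x. R m x + R n x))\<^sup>2"
      unfolding l2_norm_scaleR .
    then have "4 * D \<le> (l2_norm M (\<lambda>x. R m x + R n x))\<^sup>2"
      by (simp add: power_divide)
    moreover have "(l2_norm M (R k))\<^sup>2 < D + 1 / real (Suc k)" for k
      using s(2)[of k] by (simp add: R_def[abs_def])
    note this[of m] this[of n]
    ultimately show ?thesis using l2_parallelogram[OF R R, of m n] by linarith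
  qed
  have Cauchy: "\<exists>N. \<forall>m\<ge>N. \<forall>n\<ge>N. l2_norm M (\<lambda>x. R m x - R n x) < e" if "e > 0" for e
  proof -
    obtain N where N: "4 / real (Suc N) < e\<^sup>2"
      using \<open>e > 0\<close> reals_Archimedean[of "e\<^sup>2/4"] by (auto simp: field_simps)
    have "l2_norm M (\<lambda>x. R m x - R n x) < e" if "m \<ge> N" "n \<ge> N" for m n
    proof (rule power2_less_imp_less)
      have "2 / real (Suc m) \<le> 2 / real (Suc N)" "2 / real (Suc n) \<le> 2 / real (Suc N)"
        using that by (auto intro!: divide_left_mono)
      then show "(l2_norm M (\<lambda>x. R m x - R n x))\<^sup>2 < e\<^sup>2" using dist[of m n] N by simp
    qed (use \<open>e > 0\<close> in simp)
    then show ?thesis by blast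
  qed
  then obtain r where r: "r \<in> l2 M" "(\<lambda>k. l2_norm M (\<lambda>x. R k x - r x)) \<longlonglongrightarrow> 0"
    using l2_complete[of R, OF R Cauchy] by auto
  have "l2_inner M r t = 0" if t: "t \<in> S" for t
  proof -
    have key: "0 \<le> 2 * c * l2_inner M r t + c\<^sup>2 * (l2_norm M t)\<^sup>2" for c
    proof -
      have "D \<le> D + 1 / real (Suc k) + 2 * c * l2_inner M (R k) t + c\<^sup>2 * (l2_norm M t)\<^sup>2" for k
      proof -
        have "(\<lambda>x. s k x + (-c) *\<^sub>R t x) \<in> S" by (intro scale add s t)
        from D_le[OF this] have "D \<le> (l2_norm M (\<lambda>x. R k x + c *\<^sub>R t x))\<^sup>2"
          by (simp add: R_def algebra_simps)
        then show ?thesis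
          using l2_norm_sq_add[OF R l2_scaleR[OF Sl2[OF t]], of k c] s(2)[of k]
          by (simp add: R_def[abs_def] l2_inner_scaleR_right l2_norm_scaleR power_mult_distrib)
      qed
      moreover have "(\<lambda>k. D + 1 / real (Suc k) + 2 * c * l2_inner M (R k) t + c\<^sup>2 * (l2_norm M t)\<^sup>2)
          \<longlonglongrightarrow> D + 0 + 2 * c * l2_inner M r t + c\<^sup>2 * (l2_norm M t)\<^sup>2"
        by (intro tendsto_intros LIMSEQ_Suc[OF lim_1_over_n] l2_inner_tendsto_left R r Sl2 t)
      ultimately have "D \<le> D + 0 + 2 * c * l2_inner M r t + c\<^sup>2 * (l2_norm M t)\<^sup>2"
        by (intro LIMSEQ_le_const) auto
      then show ?thesis by simp
    qed
    \<comment> \<open>Adding one spares a separate case for \<open>t\<close> of norm zero;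
      \<open>- l2_inner M r t / N\<close> is then the minimiser of the enlarged quadratic.\<close>
    define N where "N = (l2_norm M t)\<^sup>2 + 1"
    have N: "N > 0" by (simp add: N_def add_nonneg_pos)
    have "0 \<le> 2 * c * l2_inner M r t + c\<^sup>2 * N" for c
      using key[of c] by (simp add: N_def algebra_simps)
    from this[of "- l2_inner M r t / N"] have "(l2_inner M r t)\<^sup>2 / N \<le> 0"
      using N by (simp add: power_divide power2_eq_square field_simps)
    then show ?thesis using N by (simp add: divide_le_0_iff)
  qed
  then show ?thesis using s(1) r by (auto simp: R_def intro!: exI[of _ s] exI[of _ r])
qed

subsection \<open>Calculus of smooth functions\<close>

definition smooth :: "(real ^ 'n \<Rightarrow> 'b::euclidean_space) \<Rightarrow> bool" where
  "smooth f \<longleftrightarrow> (\<forall>k. Ck k f)"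

lemma Ck_SucI:
  assumes "\<And>x. (f has_derivative D x) (at x)" "\<And>h. Ck k (\<lambda>x. D x h)"
  shows "Ck (Suc k) f"
proof -
  have "frechet_derivative f (at x) = D x" for x
    using frechet_derivative_at[OF assms(1)] by simp
  then show ?thesis using assms by (auto simp: differentiable_def)
qed

lemma Ck_Suc_has_derivative:
  "Ck (Suc k) f \<Longrightarrow> (f has_derivative frechet_derivative f (at x)) (at x)"
  by (simp add: frechet_derivative_works[symmetric])

lemma Ck_continuous: "Ck k f \<Longrightarrow> continuous_on UNIV f"
  by (cases k) (auto simp: continuous_on_eq_continuous_within differentiable_imp_continuous_within)

lemma Ck_SucD: "Ck (Suc k) f \<Longrightarrow> Ck k f"
proof (induction k arbitrary: f)
  case 0
  then show ?case using Ck_continuous by fastforce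
next
  case (Suc k)
  then show ?case by (metis Ck.simps(2))
qed

lemma Ck_const: "Ck k (\<lambda>x. c)"
proof (induction k arbitrary: c)
  case (Suc k)
  then show ?case by (intro Ck_SucI[where D = "\<lambda>_ _. 0"]) auto
qed auto

lemma Ck_add: "Ck k f \<Longrightarrow> Ck k g \<Longrightarrow> Ck k (\<lambda>x. f x + g x)"
proof (induction k arbitrary: f g)
  case (Suc k)
  show ?case
  proof (rule Ck_SucI)
    show "((\<lambda>x. f x + g x) has_derivative
        (\<lambda>h. frechet_derivative f (at x) h + frechet_derivative g (at x) h)) (at x)" for x
      using Suc.prems by (intro has_derivative_add Ck_Suc_has_derivative)
  qed (use Suc in auto)
qed (auto intro: continuous_on_add)

lemma Ck_bounded_linear:
  assumes "bounded_linear L"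
  shows "Ck k f \<Longrightarrow> Ck k (\<lambda>x. L (f x))"
proof (induction k arbitrary: f)
  case 0
  then show ?case by (auto intro: bounded_linear.continuous_on[OF assms])
next
  case (Suc k)
  show ?case
  proof (rule Ck_SucI)
    show "((\<lambda>x. L (f x)) has_derivative (\<lambda>h. L (frechet_derivative f (at x) h))) (at x)" for x
      using Suc.prems by (intro bounded_linear.has_derivative[OF assms] Ck_Suc_has_derivative)
  qed (use Suc in auto)
qed

lemma Ck_bilinear:
  assumes "bounded_bilinear prd"
  shows "Ck k f \<Longrightarrow> Ck k g \<Longrightarrow> Ck k (\<lambda>x. prd (f x) (g x))"
proof (induction k arbitrary: f g)
  case 0
  then show ?case by (auto intro: bounded_bilinear.continuous_on[OF assms])
next
  case (Suc k)
  show ?case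
  proof (rule Ck_SucI)
    show "((\<lambda>x. prd (f x) (g x)) has_derivative
        (\<lambda>h. prd (f x) (frechet_derivative g (at x) h) + prd (frechet_derivative f (at x) h) (g x))) (at x)" for x
      using Suc.prems by (intro bounded_bilinear.FDERIV[OF assms] Ck_Suc_has_derivative)
    show "Ck k (\<lambda>x. prd (f x) (frechet_derivative g (at x) h) + prd (frechet_derivative f (at x) h) (g x))" for h
      using Suc.prems Ck_SucD[OF Suc.prems(1)] Ck_SucD[OF Suc.prems(2)] by (intro Ck_add Suc.IH) auto
  qed
qed

lemma Ck_affine: "Ck k f \<Longrightarrow> Ck k (\<lambda>x. f (a + c *\<^sub>R x))"
proof (induction k arbitrary: f)
  case 0
  then show ?case
    by (auto intro!: continuous_on_compose2[of UNIV f] continuous_intros)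
next
  case (Suc k)
  show ?case
  proof (rule Ck_SucI)
    show "((\<lambda>x. f (a + c *\<^sub>R x)) has_derivative (\<lambda>h. frechet_derivative f (at (a + c *\<^sub>R x)) (c *\<^sub>R h))) (at x)" for x
      by (rule has_derivative_compose[OF _ Ck_Suc_has_derivative[OF Suc.prems]])
         (auto intro!: derivative_eq_intros)
  qed (use Suc in auto)
qed

lemma smooth_const: "smooth (\<lambda>x. c)"
  by (simp add: smooth_def Ck_const)

lemma smooth_add: "smooth f \<Longrightarrow> smooth g \<Longrightarrow> smooth (\<lambda>x. f x + g x)"
  by (simp add: smooth_def Ck_add)

lemma smooth_bounded_linear: "bounded_linear L \<Longrightarrow> smooth f \<Longrightarrow> smooth (\<lambda>x. L (f x))"
  by (simp add: smooth_def Ck_bounded_linear)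

lemma smooth_bilinear: "bounded_bilinear prd \<Longrightarrow> smooth f \<Longrightarrow> smooth g \<Longrightarrow> smooth (\<lambda>x. prd (f x) (g x))"
  by (simp add: smooth_def Ck_bilinear)

lemma smooth_affine: "smooth f \<Longrightarrow> smooth (\<lambda>x. f (a + c *\<^sub>R x))"
  by (simp add: smooth_def Ck_affine)

lemma smooth_sum: "(\<And>i. i \<in> I \<Longrightarrow> smooth (f i)) \<Longrightarrow> smooth (\<lambda>x. \<Sum>i\<in>I. f i x)"
  by (induction I rule: infinite_finite_induct) (auto intro: smooth_add smooth_const)

lemma smooth_has_derivative: "smooth f \<Longrightarrow> (f has_derivative frechet_derivative f (at x)) (at x)"
  unfolding smooth_def by (blast intro: Ck_Suc_has_derivative)

lemma smooth_deriv: "smooth f \<Longrightarrow> smooth (\<lambda>x. frechet_derivative f (at x) h)"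
  by (metis smooth_def Ck.simps(2))

lemma smooth_continuous: "smooth f \<Longrightarrow> continuous_on UNIV f"
  unfolding smooth_def using Ck_continuous by blast

lemma smooth_borel [measurable_dest]: "smooth f \<Longrightarrow> f \<in> borel_measurable borel"
  by (simp add: borel_measurable_continuous_onI smooth_continuous)

lemma smooth_partial: "smooth f \<Longrightarrow> smooth (partial j f)"
  unfolding partial_def[abs_def] by (rule smooth_deriv)

lemma smooth_vec_lambda:
  fixes f :: "'i::finite \<Rightarrow> real ^ 'n \<Rightarrow> 'b::euclidean_space"
  assumes "\<And>i. smooth (f i)"
  shows "smooth (\<lambda>x. \<chi> i. f i x)"
proof -
  have "(\<lambda>x. \<chi> i. f i x) = (\<lambda>x. \<Sum>i\<in>UNIV. axis i (f i x))"
  proof (intro ext iffD2[OF vec_eq_iff] allI)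
    fix x k
    have "(\<Sum>i\<in>UNIV. axis i (f i x)) $ k = (\<Sum>i\<in>UNIV. if i = k then f i x else 0)"
      unfolding sum_component by (rule sum.cong) (auto simp: axis_def)
    then show "(\<chi> i. f i x) $ k = (\<Sum>i\<in>UNIV. axis i (f i x)) $ k" by simp
  qed
  moreover have "smooth (\<lambda>x. \<Sum>i\<in>UNIV. axis i (f i x))"
  proof (intro smooth_sum smooth_bounded_linear[OF _ assms])
    show "bounded_linear (axis i :: 'b \<Rightarrow> 'b ^ 'i)" for i
    proof (rule bounded_linearI')
      fix x y :: 'b and c :: real
      show "axis i (x + y) = axis i x + (axis i y :: 'b ^ 'i)"
        by (auto simp: axis_def vec_eq_iff)
      show "axis i (c *\<^sub>R x) = c *\<^sub>R (axis i x :: 'b ^ 'i)"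
        by (auto simp: axis_def vec_eq_iff)
    qed
  qed
  ultimately show ?thesis by simp
qed

lemma frechet_derivative_eq_sum_partial:
  assumes "f differentiable (at x)"
  shows "frechet_derivative f (at x) h = (\<Sum>j\<in>UNIV. (h $ j) *\<^sub>R partial j f x)"
proof -
  have l: "linear (frechet_derivative f (at x))"
    using assms by (rule linear_frechet_derivative)
  have "frechet_derivative f (at x) (\<Sum>j\<in>UNIV. (h $ j) *\<^sub>R axis j 1)
      = (\<Sum>j\<in>UNIV. (h $ j) *\<^sub>R frechet_derivative f (at x) (axis j 1))"
    by (simp add: linear_sum[OF l] linear_scale[OF l])
  moreover have "(\<Sum>j\<in>UNIV. (h $ j) *\<^sub>R axis j 1) = h"
    using basis_expansion[of h] by (simp add: scalar_mult_eq_scaleR)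
  ultimately show ?thesis by (simp add: partial_def)
qed

lemma smooth_differentiable: "smooth f \<Longrightarrow> f differentiable (at x)"
  using smooth_has_derivative differentiable_def by blast

lemma partial_eqI: "(f has_derivative D) (at x) \<Longrightarrow> partial j f x = D (axis j 1)"
  unfolding partial_def using frechet_derivative_at by metis

lemma partial_add:
  "smooth f \<Longrightarrow> smooth g \<Longrightarrow> partial j (\<lambda>x. f x + g x) x = partial j f x + partial j g x"
  by (subst partial_eqI[OF has_derivative_add[OF smooth_has_derivative smooth_has_derivative]]) (auto simp: partial_def)

lemma partial_bounded_linear:
  "bounded_linear L \<Longrightarrow> smooth f \<Longrightarrow> partial j (\<lambda>x. L (f x)) x = L (partial j f x)"
  by (subst partial_eqI[OF bounded_linear.has_derivative[OF _ smooth_has_derivative]]) (auto simp: partial_def)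

lemma partial_bilinear:
  assumes "bounded_bilinear prd" "smooth f" "smooth g"
  shows "partial j (\<lambda>x. prd (f x) (g x)) x = prd (f x) (partial j g x) + prd (partial j f x) (g x)"
  by (subst partial_eqI[OF bounded_bilinear.FDERIV[OF assms(1) smooth_has_derivative smooth_has_derivative]])
     (use assms in \<open>auto simp: partial_def\<close>)

lemma partial_affine:
  assumes "smooth f"
  shows "partial j (\<lambda>x. f (a + c *\<^sub>R x)) x = c *\<^sub>R partial j f (a + c *\<^sub>R x)"
proof -
  have "((\<lambda>x. f (a + c *\<^sub>R x)) has_derivative (\<lambda>h. frechet_derivative f (at (a + c *\<^sub>R x)) (c *\<^sub>R h))) (at x)"
    by (rule has_derivative_compose[OF _ smooth_has_derivative[OF assms]])
       (auto intro!: derivative_eq_intros)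
  then have "partial j (\<lambda>x. f (a + c *\<^sub>R x)) x = frechet_derivative f (at (a + c *\<^sub>R x)) (c *\<^sub>R axis j 1)"
    by (rule partial_eqI)
  also have "\<dots> = c *\<^sub>R partial j f (a + c *\<^sub>R x)"
    unfolding partial_def
    using linear_scale[OF linear_frechet_derivative[OF smooth_differentiable[OF assms]]] .
  finally show ?thesis .
qed

lemma partial_const [simp]: "partial j (\<lambda>x. c) x = 0"
  by (simp add: partial_def)

subsection \<open>Test functions\<close>

text \<open>Any compact set outside which the function vanishes may replace the closed support,
  which is rarely known explicitly.\<close>

lemma testI:
  assumes "smooth \<phi>" "compact K" "K \<subseteq> \<Omega>" "\<And>x. x \<notin> K \<Longrightarrow> \<phi> x = 0"
  shows "\<phi> \<in> test \<Omega>"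
proof -
  have "{x. \<phi> x \<noteq> 0} \<subseteq> K" using assms(4) by blast
  then have "closure {x. \<phi> x \<noteq> 0} \<subseteq> K"
    using assms(2) by (simp add: closure_minimal compact_imp_closed)
  moreover from this have "compact (closure {x. \<phi> x \<noteq> 0})"
    using assms(2) compact_closure bounded_subset closure_subset compact_imp_bounded by metis
  ultimately show ?thesis using assms by (auto simp: test_def smooth_def)
qed

lemma testE:
  assumes "\<phi> \<in> test \<Omega>"
  obtains K where "compact K" "K \<subseteq> \<Omega>" "\<And>x. x \<notin> K \<Longrightarrow> \<phi> x = 0"
proof (rule that)
  show "compact (closure {x. \<phi> x \<noteq> 0})" "closure {x. \<phi> x \<noteq> 0} \<subseteq> \<Omega>"
    using assms by (simp_all add: test_def)
  show "\<phi> x = 0" if "x \<notin> closure {x. \<phi> x \<noteq> 0}" for x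
    using that closure_subset[of "{x. \<phi> x \<noteq> 0}"] by blast
qed

lemma test_smooth: "\<phi> \<in> test \<Omega> \<Longrightarrow> smooth \<phi>"
  by (simp add: test_def smooth_def)

lemma test_mono: "\<Omega> \<subseteq> \<Omega>' \<Longrightarrow> test \<Omega> \<subseteq> test \<Omega>'"
  by (auto simp: test_def)

lemma test_UNIV: "\<phi> \<in> test \<Omega> \<Longrightarrow> \<phi> \<in> test UNIV"
  using test_mono by blast

lemma test_zero: "(\<lambda>x. 0) \<in> test \<Omega>"
  by (rule testI[of _ "{}"]) (auto simp: smooth_const)

lemma test_add:
  assumes "\<phi> \<in> test \<Omega>" "\<psi> \<in> test \<Omega>"
  shows "(\<lambda>x. \<phi> x + \<psi> x) \<in> test \<Omega>"
proof -
  obtain K where K: "compact K" "K \<subseteq> \<Omega>" "\<And>x. x \<notin> K \<Longrightarrow> \<phi> x = 0" using testE[OF assms(1)] by metis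
  obtain L where L: "compact L" "L \<subseteq> \<Omega>" "\<And>x. x \<notin> L \<Longrightarrow> \<psi> x = 0" using testE[OF assms(2)] by metis
  show ?thesis
    by (rule testI[of _ "K \<union> L"]) (use K L assms in \<open>auto intro: smooth_add test_smooth\<close>)
qed

lemma test_bilinear_left:
  assumes "bounded_bilinear prd" "\<phi> \<in> test \<Omega>" "smooth f"
  shows "(\<lambda>x. prd (\<phi> x) (f x)) \<in> test \<Omega>"
proof -
  obtain K where K: "compact K" "K \<subseteq> \<Omega>" "\<And>x. x \<notin> K \<Longrightarrow> \<phi> x = 0" using testE[OF assms(2)] by metis
  show ?thesis
    by (rule testI[OF smooth_bilinear[OF assms(1)] K(1,2)])
       (use K assms in \<open>auto intro: test_smooth simp: bounded_bilinear.zero_left\<close>)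
qed

lemma test_bounded_linear:
  assumes "bounded_linear L" "\<phi> \<in> test \<Omega>"
  shows "(\<lambda>x. L (\<phi> x)) \<in> test \<Omega>"
proof -
  obtain K where K: "compact K" "K \<subseteq> \<Omega>" "\<And>x. x \<notin> K \<Longrightarrow> \<phi> x = 0" using testE[OF assms(2)] by metis
  show ?thesis
    by (rule testI[OF smooth_bounded_linear[OF assms(1)] K(1,2)])
       (use K assms in \<open>auto intro: test_smooth simp: linear_simps\<close>)
qed

lemma test_scaleR: "\<phi> \<in> test \<Omega> \<Longrightarrow> (\<lambda>x. c *\<^sub>R \<phi> x) \<in> test \<Omega>"
  by (rule test_bounded_linear[OF bounded_linear_scaleR_right])

lemma test_minus: "\<phi> \<in> test \<Omega> \<Longrightarrow> (\<lambda>x. - \<phi> x) \<in> test \<Omega>"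
  using test_scaleR[of \<phi> \<Omega> "-1"] by simp

lemma test_diff: "\<phi> \<in> test \<Omega> \<Longrightarrow> \<psi> \<in> test \<Omega> \<Longrightarrow> (\<lambda>x. \<phi> x - \<psi> x) \<in> test \<Omega>"
  using test_add[of \<phi> \<Omega> "\<lambda>x. - \<psi> x"] by (simp add: test_minus)

lemma test_sum: "(\<And>i. i \<in> I \<Longrightarrow> f i \<in> test \<Omega>) \<Longrightarrow> (\<lambda>x. \<Sum>i\<in>I. f i x) \<in> test \<Omega>"
  by (induction I rule: infinite_finite_induct) (auto intro: test_add test_zero)

lemma test_vec_lambda:
  fixes f :: "'i::finite \<Rightarrow> real ^ 'n \<Rightarrow> 'b::euclidean_space"
  assumes "\<And>i. f i \<in> test \<Omega>"
  shows "(\<lambda>x. \<chi> i. f i x) \<in> test \<Omega>"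
proof -
  have "\<exists>K. compact K \<and> K \<subseteq> \<Omega> \<and> (\<forall>x. x \<notin> K \<longrightarrow> f i x = 0)" for i
    using testE[OF assms[of i]] by metis
  then obtain K where K: "\<And>i. compact (K i)" "\<And>i. K i \<subseteq> \<Omega>" "\<And>i x. x \<notin> K i \<Longrightarrow> f i x = 0"
    by metis
  show ?thesis
    by (rule testI[of _ "\<Union>i. K i"])
       (use K assms in \<open>auto intro!: smooth_vec_lambda test_smooth[OF assms] compact_UN simp: vec_eq_iff\<close>)
qed

lemma test_deriv:
  assumes "\<phi> \<in> test \<Omega>"
  shows "(\<lambda>x. frechet_derivative \<phi> (at x) h) \<in> test \<Omega>"
proof -
  obtain K where K: "compact K" "K \<subseteq> \<Omega>" "\<And>x. x \<notin> K \<Longrightarrow> \<phi> x = 0" using testE[OF assms] by metis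
  have "frechet_derivative \<phi> (at x) h = 0" if "x \<notin> K" for x
  proof -
    have "(\<phi> has_derivative (\<lambda>h. 0)) (at x)"
      by (rule has_derivative_transform_within_open[of "\<lambda>x. 0" _ _ _ "- K"])
         (use K that in \<open>auto simp: compact_imp_closed\<close>)
    then show ?thesis using frechet_derivative_at by metis
  qed
  then show ?thesis
    by (intro testI[OF smooth_deriv K(1,2)]) (use assms in \<open>auto intro: test_smooth\<close>)
qed

lemma test_partial: "\<phi> \<in> test \<Omega> \<Longrightarrow> partial j \<phi> \<in> test \<Omega>"
  unfolding partial_def[abs_def] by (rule test_deriv)

lemma test_affine:
  assumes "\<phi> \<in> test UNIV" "c \<noteq> 0"
  shows "(\<lambda>x. \<phi> (a + c *\<^sub>R x)) \<in> test UNIV"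
proof -
  obtain K where K: "compact K" "\<And>x. x \<notin> K \<Longrightarrow> \<phi> x = 0" using testE[OF assms(1)] by metis
  show ?thesis
  proof (rule testI[of _ "(\<lambda>y. (1/c) *\<^sub>R (y - a)) ` K"])
    show "compact ((\<lambda>y. (1/c) *\<^sub>R (y - a)) ` K)"
      by (intro compact_continuous_image K continuous_intros)
    show "\<phi> (a + c *\<^sub>R x) = 0" if "x \<notin> (\<lambda>y. (1/c) *\<^sub>R (y - a)) ` K" for x
    proof (rule K(2), rule notI)
      assume "a + c *\<^sub>R x \<in> K"
      then have "(\<lambda>y. (1/c) *\<^sub>R (y - a)) (a + c *\<^sub>R x) \<in> (\<lambda>y. (1/c) *\<^sub>R (y - a)) ` K" by (rule imageI)
      then show False using that assms(2) by simp
    qed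
  qed (use assms in \<open>auto intro: smooth_affine test_smooth\<close>)
qed

lemma test_bounded:
  assumes "\<phi> \<in> test UNIV"
  obtains B where "B \<ge> 0" "\<And>x. norm (\<phi> x) \<le> B"
proof -
  obtain K where K: "compact K" "\<And>x. x \<notin> K \<Longrightarrow> \<phi> x = 0" using testE[OF assms] by metis
  have "compact (\<phi> ` K)"
    using K smooth_continuous[OF test_smooth[OF assms]]
    by (blast intro: compact_continuous_image continuous_on_subset)
  then obtain B where "B > 0" "\<forall>x\<in>K. norm (\<phi> x) \<le> B"
    using compact_imp_bounded bounded_pos by (metis image_eqI)
  then show ?thesis using that[of B] K(2) by (metis less_imp_le norm_zero)
qed

lemma test_deriv_bounded:
  assumes "\<phi> \<in> test UNIV"
  obtains L where "L \<ge> 0" "\<And>x h. norm (frechet_derivative \<phi> (at x) h) \<le> L * norm h"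
proof -
  have "\<exists>B. B \<ge> 0 \<and> (\<forall>x. norm (partial j \<phi> x) \<le> B)" for j
    using test_bounded[OF test_partial[OF assms, of j]] by metis
  then obtain B where B: "\<And>j. B j \<ge> 0" "\<And>j x. norm (partial j \<phi> x) \<le> B j"
    by metis
  have "norm (frechet_derivative \<phi> (at x) h) \<le> (\<Sum>j\<in>UNIV. B j) * norm h" for x h
  proof -
    have "norm (frechet_derivative \<phi> (at x) h) \<le> (\<Sum>j\<in>UNIV. norm ((h $ j) *\<^sub>R partial j \<phi> x))"
      unfolding frechet_derivative_eq_sum_partial[OF smooth_differentiable[OF test_smooth[OF assms]]]
      by (rule norm_sum)
    also have "\<dots> \<le> (\<Sum>j\<in>UNIV. B j * norm h)"
      using B by (intro sum_mono) (simp, metis component_le_norm_cart mult.commute mult_mono' abs_ge_zero norm_ge_zero)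
    finally show ?thesis by (simp add: sum_distrib_right)
  qed
  then show ?thesis using that[of "\<Sum>j\<in>UNIV. B j"] B by (simp add: sum_nonneg)
qed

lemma test_lipschitz:
  assumes "\<phi> \<in> test UNIV"
  obtains L where "L \<ge> 0" "\<And>x y. norm (\<phi> x - \<phi> y) \<le> L * norm (x - y)"
proof -
  obtain L where L: "L \<ge> 0" "\<And>x h. norm (frechet_derivative \<phi> (at x) h) \<le> L * norm h"
    using test_deriv_bounded[OF assms] by metis
  have "norm (\<phi> x - \<phi> y) \<le> L * norm (x - y)" for x y
  proof (rule differentiable_bound[of UNIV])
    show "onorm (frechet_derivative \<phi> (at x)) \<le> L" for x
      by (rule onorm_bound) (use L in auto)
  qed (use smooth_has_derivative[OF test_smooth[OF assms]] in auto)
  then show ?thesis using that L(1) by blast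
qed

lemma test_taylor:
  assumes "\<phi> \<in> test UNIV"
  obtains K where "K \<ge> 0" "\<And>x h. norm (\<phi> (x + h) - \<phi> x - frechet_derivative \<phi> (at x) h) \<le> K * (norm h)\<^sup>2"
proof -
  have "\<exists>L. L \<ge> 0 \<and> (\<forall>x y. norm (partial j \<phi> x - partial j \<phi> y) \<le> L * norm (x - y))" for j
    using test_lipschitz[OF test_partial[OF assms, of j]] by metis
  then obtain L where L: "\<And>j. L j \<ge> 0" "\<And>j x y. norm (partial j \<phi> x - partial j \<phi> y) \<le> L j * norm (x - y)"
    by metis
  define S where "S = (\<Sum>j\<in>UNIV. L j)"
  have S: "S \<ge> 0" using L by (simp add: S_def sum_nonneg)
  note diff = smooth_differentiable[OF test_smooth[OF assms]]
  have D: "norm (frechet_derivative \<phi> (at x) h - frechet_derivative \<phi> (at y) h) \<le> S * norm (x - y) * norm h" for x y h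
  proof -
    have "frechet_derivative \<phi> (at x) h - frechet_derivative \<phi> (at y) h
        = (\<Sum>j\<in>UNIV. (h $ j) *\<^sub>R (partial j \<phi> x - partial j \<phi> y))"
      by (simp add: frechet_derivative_eq_sum_partial[OF diff] sum_subtractf scaleR_diff_right)
    also have "norm \<dots> \<le> (\<Sum>j\<in>UNIV. norm ((h $ j) *\<^sub>R (partial j \<phi> x - partial j \<phi> y)))"
      by (rule norm_sum)
    also have "\<dots> \<le> (\<Sum>j\<in>UNIV. L j * norm (x - y) * norm h)"
      using L by (intro sum_mono) (simp, metis component_le_norm_cart mult.commute mult_mono' abs_ge_zero norm_ge_zero)
    finally show ?thesis by (simp add: S_def sum_distrib_right)
  qed
  have "norm (\<phi> (x + h) - \<phi> x - frechet_derivative \<phi> (at x) h) \<le> S * (norm h)\<^sup>2" for x h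
  proof -
    \<comment> \<open>Subtracting the derivative at \<open>x\<close> leaves a function whose
      derivative on the ball of radius \<open>norm h\<close> is of order \<open>norm h\<close>, so
      that the mean value inequality gives a quadratic remainder.\<close>
    define g where "g z = \<phi> z - frechet_derivative \<phi> (at x) z" for z
    have bl: "bounded_linear (frechet_derivative \<phi> (at x))" for x
      using smooth_has_derivative[OF test_smooth[OF assms]] has_derivative_bounded_linear by blast
    have "norm (g (x + h) - g x) \<le> S * norm h * norm (x + h - x)"
    proof (rule differentiable_bound[of "cball x (norm h)"])
      fix z assume z: "z \<in> cball x (norm h)"
      show "(g has_derivative (\<lambda>k. frechet_derivative \<phi> (at z) k - frechet_derivative \<phi> (at x) k)) (at z within cball x (norm h))"
        unfolding g_def
        by (intro has_derivative_diff has_derivative_at_withinI[OF smooth_has_derivative[OF test_smooth[OF assms]]]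
            bounded_linear_imp_has_derivative bl)
      have "norm (z - x) \<le> norm h" using z by (simp add: dist_norm norm_minus_commute)
      then have "norm (frechet_derivative \<phi> (at z) k - frechet_derivative \<phi> (at x) k) \<le> S * norm h * norm k" for k
        using D[of z k x] S by (meson mult_left_mono mult_right_mono norm_ge_zero order_trans)
      then show "onorm (\<lambda>k. frechet_derivative \<phi> (at z) k - frechet_derivative \<phi> (at x) k) \<le> S * norm h"
        by (intro onorm_bound) (use S in auto)
    qed (auto simp: dist_norm)
    moreover have "g (x + h) - g x = \<phi> (x + h) - \<phi> x - frechet_derivative \<phi> (at x) h"
      using linear_simps(1)[OF bl, of x x h] by (simp add: g_def)
    ultimately show ?thesis by (simp add: power2_eq_square)
  qed
  then show ?thesis using that S by blast
qed

subsection \<open>A bump function\<close>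

text \<open>The factor \<open>1 / t ^ m\<close> makes the family closed under differentiation.\<close>

definition flat :: "nat \<Rightarrow> real \<Rightarrow> real" where
  "flat m t = (if t > 0 then exp (- (1 / t)) / t ^ m else 0)"

lemma flat_tendsto_0: "((\<lambda>t. exp (- (1 / t)) / t ^ m) \<longlongrightarrow> (0::real)) (at_right 0)"
proof -
  have "((\<lambda>x. x ^ m / exp x) \<longlongrightarrow> (0::real)) at_top" by (rule tendsto_power_div_exp_0)
  then have "((\<lambda>t. exp (- (1 / inverse t)) / inverse t ^ m) \<longlongrightarrow> (0::real)) at_top"
    by (simp add: exp_minus field_simps)
  then show ?thesis by (simp add: filterlim_at_right_to_top)
qed

lemma flat_deriv: "(flat m has_real_derivative flat (m + 2) t - real m * flat (m + 1) t) (at t)"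
proof (rule linorder_cases[of t 0])
  assume "t < 0"
  then have "flat (m + 2) t - real m * flat (m + 1) t = 0" by (simp add: flat_def)
  moreover have "(flat m has_real_derivative 0) (at t)"
    by (rule has_field_derivative_transform_within_open[of "\<lambda>x. 0" _ _ "{..<0}"])
       (use \<open>t < 0\<close> in \<open>simp_all add: flat_def\<close>)
  ultimately show ?thesis by simp
next
  assume "t = 0"
  \<comment> \<open>Since \<open>flat m 0 = 0\<close>, this is the difference quotient at 0. From
    the right it is \<open>exp (- (1 / y))\<close> divided by the power \<open>Suc m\<close> of
    \<open>y\<close>, from the left it is zero.\<close>
  have "((\<lambda>y. flat m y / y) \<longlongrightarrow> 0) (at 0)"
  proof (rule filterlim_split_at)
    show "((\<lambda>y. flat m y / y) \<longlongrightarrow> 0) (at_left 0)"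
      by (rule tendsto_eventually) (auto simp: flat_def eventually_at_filter)
    show "((\<lambda>y. flat m y / y) \<longlongrightarrow> 0) (at_right 0)"
    proof (rule Lim_transform_eventually[OF flat_tendsto_0[of "Suc m"]])
      show "\<forall>\<^sub>F t in at_right 0. exp (- (1 / t)) / t ^ Suc m = flat m t / t"
        using eventually_at_right_less[of "0::real"]
        by eventually_elim (simp add: flat_def mult.commute)
    qed
  qed
  then show ?thesis using \<open>t = 0\<close> by (simp add: has_field_derivative_iff flat_def)
next
  assume t: "0 < t"
  have "((\<lambda>t. exp (- (1 / t)) / t ^ m) has_real_derivative flat (m + 2) t - real m * flat (m + 1) t) (at t)"
  proof (cases m)
    case 0
    then show ?thesis using t
      by (auto intro!: derivative_eq_intros simp: flat_def field_simps power2_eq_square)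
  next
    case (Suc n)
    have "((\<lambda>t. exp (- (1 / t))) has_real_derivative exp (- (1 / t)) / t\<^sup>2) (at t)"
      using t by (auto intro!: derivative_eq_intros simp: power2_eq_square)
    moreover have "((\<lambda>t. t ^ Suc n) has_real_derivative real (Suc n) * t ^ n) (at t)"
      using DERIV_pow[of "Suc n" t UNIV] by simp
    ultimately have "((\<lambda>t. exp (- (1 / t)) / t ^ Suc n) has_real_derivative
        (exp (- (1 / t)) / t\<^sup>2 * t ^ Suc n - exp (- (1 / t)) * (real (Suc n) * t ^ n)) / (t ^ Suc n * t ^ Suc n)) (at t)"
      using t by (intro DERIV_divide) auto
    moreover have "(exp (- (1 / t)) / t\<^sup>2 * t ^ Suc n - exp (- (1 / t)) * (real (Suc n) * t ^ n)) / (t ^ Suc n * t ^ Suc n)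
        = flat (m + 2) t - real m * flat (m + 1) t"
      using t by (simp add: Suc flat_def field_simps power2_eq_square)
    ultimately show ?thesis by (simp add: Suc)
  qed
  then show ?thesis
    by (rule has_field_derivative_transform_within_open[of _ _ _ "{0<..}"]) (use t in \<open>auto simp: flat_def\<close>)
qed

lemma smooth_inner_self: "smooth (\<lambda>x :: real ^ 'n. 1 - x \<bullet> x)"
proof -
  have "Ck k (\<lambda>x :: real ^ 'n. x)" for k
  proof (cases k)
    case (Suc k)
    show ?thesis
      unfolding Suc by (rule Ck_SucI[where D = "\<lambda>_ h. h"]) (simp_all add: Ck_const)
  qed auto
  then have "smooth (\<lambda>x :: real ^ 'n. x)" by (simp add: smooth_def)
  from smooth_bilinear[OF bounded_bilinear_inner this this]
  have "smooth (\<lambda>x :: real ^ 'n. x \<bullet> x)" .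
  from smooth_add[OF smooth_const[of 1] smooth_bounded_linear[OF bounded_linear_mult_right[of "-1"] this]]
  show ?thesis by simp
qed

text \<open>The exponent has to vary in the induction: one differentiation leads from
  \<open>m\<close> to \<open>m + 1\<close> and \<open>m + 2\<close>, multiplied by a derivative of
  the smooth function \<open>1 - x \<bullet> x\<close>.\<close>

lemma Ck_flat_inner: "Ck k (\<lambda>x :: real ^ 'n. flat m (1 - x \<bullet> x))"
proof (induction k arbitrary: m)
  case 0
  have "continuous_on UNIV (flat m)"
    by (rule DERIV_continuous_on) (use flat_deriv in blast)
  then show ?case
    by (auto intro!: continuous_on_compose2[of UNIV "flat m"] continuous_intros)
next
  case (Suc k)
  let ?q = "\<lambda>x :: real ^ 'n. 1 - x \<bullet> x"
  show ?case
  proof (rule Ck_SucI)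
    show "((\<lambda>x. flat m (?q x)) has_derivative
        (\<lambda>h. frechet_derivative ?q (at x) h * (flat (m + 2) (?q x) - real m * flat (m + 1) (?q x)))) (at x)" for x
      using has_derivative_compose[OF smooth_has_derivative[OF smooth_inner_self]
          flat_deriv[unfolded has_field_derivative_def]]
      by (simp add: mult.commute)
    fix h
    have "Ck k (\<lambda>x. frechet_derivative ?q (at x) h)"
      using smooth_deriv[OF smooth_inner_self, of h] unfolding smooth_def by blast
    moreover have "Ck k (\<lambda>x. flat (m + 2) (?q x) + (- real m) * flat (m + 1) (?q x))"
      using Suc.IH by (intro Ck_add Ck_bounded_linear[OF bounded_linear_mult_right])
    then have "Ck k (\<lambda>x. flat (m + 2) (?q x) - real m * flat (m + 1) (?q x))" by simp
    ultimately show "Ck k (\<lambda>x. frechet_derivative ?q (at x) h * (flat (m + 2) (?q x) - real m * flat (m + 1) (?q x)))"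
      by (rule Ck_bilinear[OF bounded_bilinear_mult])
  qed
qed

text \<open>The square \<open>x \<bullet> x\<close> is smooth at the origin, where
  \<open>norm x\<close> is not, and \<open>1 - x \<bullet> x\<close> is positive exactly on the open
  unit ball.\<close>

definition bump :: "real ^ 'n \<Rightarrow> real" where
  "bump x = flat 0 (1 - x \<bullet> x)"

lemma bump_nonneg [simp]: "0 \<le> bump x"
  by (simp add: bump_def flat_def)

lemma bump_pos: "norm x < 1 \<Longrightarrow> 0 < bump x"
  using power_strict_mono[of "norm x" 1 2] by (simp add: bump_def flat_def power2_norm_eq_inner)

lemma bump_eq_0: "1 \<le> norm x \<Longrightarrow> bump x = 0"
  using power_mono[of 1 "norm x" 2] by (simp add: bump_def flat_def power2_norm_eq_inner)

lemma bump_test: "bump \<in> test UNIV"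
  by (rule testI[of _ "cball 0 1"])
     (auto simp: smooth_def bump_def[abs_def] Ck_flat_inner bump_eq_0[unfolded bump_def])

subsection \<open>Affine substitutions in Lebesgue integrals\<close>

lemma integral_lborel_affine:
  fixes g :: "'a::euclidean_space \<Rightarrow> 'b::{banach, second_countable_topology}"
  assumes c: "c \<noteq> 0" and [measurable]: "g \<in> borel_measurable borel"
  shows "integral\<^sup>L lborel g = \<bar>c\<bar>^DIM('a) *\<^sub>R (LINT x|lborel. g (t + c *\<^sub>R x))"
proof -
  have "integral\<^sup>L lborel g = integral\<^sup>L (density (distr lborel borel (\<lambda>x. t + c *\<^sub>R x)) (\<lambda>_. ennreal (\<bar>c\<bar>^DIM('a)))) g"
    by (subst lborel_affine[OF c, of t]) simp
  also have "\<dots> = (LINT x|distr lborel borel (\<lambda>x. t + c *\<^sub>R x). \<bar>c\<bar>^DIM('a) *\<^sub>R g x)"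
    by (rule integral_density) auto
  also have "\<dots> = \<bar>c\<bar>^DIM('a) *\<^sub>R (LINT x|lborel. g (t + c *\<^sub>R x))"
    by (simp add: integral_distr)
  finally show ?thesis .
qed

lemma integral_lborel_translate:
  fixes g :: "'a::euclidean_space \<Rightarrow> 'b::{banach, second_countable_topology}"
  assumes "g \<in> borel_measurable borel"
  shows "(LINT x|lborel. g (x + t)) = integral\<^sup>L lborel g"
  using integral_lborel_affine[of 1 g t] assms by (simp add: add.commute)

lemma integral_lborel_reflect:
  fixes g :: "'a::euclidean_space \<Rightarrow> 'b::{banach, second_countable_topology}"
  assumes "g \<in> borel_measurable borel"
  shows "(LINT x|lborel. g (t - x)) = integral\<^sup>L lborel g"
  using integral_lborel_affine[of "-1" g t] assms by simp

lemma integrable_lborel_affine: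
  fixes g :: "'a::euclidean_space \<Rightarrow> 'b::{banach, second_countable_topology}"
  assumes c: "c \<noteq> 0" and [measurable]: "g \<in> borel_measurable borel"
  shows "integrable lborel (\<lambda>x. g (t + c *\<^sub>R x)) \<longleftrightarrow> integrable lborel g"
proof -
  have "integrable lborel g \<longleftrightarrow> integrable (density (distr lborel borel (\<lambda>x. t + c *\<^sub>R x)) (\<lambda>_. ennreal (\<bar>c\<bar>^DIM('a)))) g"
    by (subst lborel_affine[OF c, of t]) simp
  also have "\<dots> \<longleftrightarrow> integrable (distr lborel borel (\<lambda>x. t + c *\<^sub>R x)) (\<lambda>x. \<bar>c\<bar>^DIM('a) *\<^sub>R g x)"
    by (rule integrable_density) auto
  also have "\<dots> \<longleftrightarrow> integrable lborel (\<lambda>x. g (t + c *\<^sub>R x))"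
  proof
    assume "integrable (distr lborel borel (\<lambda>x. t + c *\<^sub>R x)) (\<lambda>x. \<bar>c\<bar>^DIM('a) *\<^sub>R g x)"
    then have "integrable lborel (\<lambda>x. \<bar>c\<bar>^DIM('a) *\<^sub>R g (t + c *\<^sub>R x))"
      by (simp add: integrable_distr_eq)
    from integrable_scaleR_right[OF this, of "inverse (\<bar>c\<bar>^DIM('a))"]
    show "integrable lborel (\<lambda>x. g (t + c *\<^sub>R x))" using c by simp
  qed (simp add: integrable_distr_eq)
  finally show ?thesis by simp
qed

lemma integrable_lborel_translate:
  fixes g :: "'a::euclidean_space \<Rightarrow> 'b::{banach, second_countable_topology}"
  assumes "g \<in> borel_measurable borel"
  shows "integrable lborel (\<lambda>x. g (x + t)) \<longleftrightarrow> integrable lborel g"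
  using integrable_lborel_affine[of 1 g t] assms by (simp add: add.commute)

lemma l2_translate:
  assumes "f \<in> l2 lborel"
  shows "(\<lambda>x. f (x + t)) \<in> l2 lborel" "l2_norm lborel (\<lambda>x. f (x + t)) = l2_norm lborel f"
proof -
  have [measurable]: "f \<in> borel_measurable borel" using l2_measurable[OF assms] by simp
  show "(\<lambda>x. f (x + t)) \<in> l2 lborel"
    using assms integrable_lborel_translate[of "\<lambda>x. (norm (f x))\<^sup>2" t] by (simp add: l2_def)
  show "l2_norm lborel (\<lambda>x. f (x + t)) = l2_norm lborel f"
    using integral_lborel_translate[of "\<lambda>x. (norm (f x))\<^sup>2" t] by (simp add: l2_norm_def)
qed

lemma integrable_lborel_indicator_ball: "integrable lborel (\<lambda>x::'a::euclidean_space. c * indicator (cball a R) x :: real)"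
  using emeasure_bounded_finite[of "cball a R"]
  by (intro integrable_mult_right integrable_real_indicator) auto

lemma l2_bounded_support:
  fixes f :: "'a::euclidean_space \<Rightarrow> 'b::euclidean_space"
  assumes [measurable]: "f \<in> borel_measurable borel"
    and "\<And>x. norm (f x) \<le> B" "\<And>x. norm x > R \<Longrightarrow> f x = 0"
  shows "f \<in> l2 lborel"
proof -
  have "integrable lborel (\<lambda>x. (norm (f x))\<^sup>2)"
  proof (rule Bochner_Integration.integrable_bound)
    show "integrable lborel (\<lambda>x. B\<^sup>2 * indicator (cball 0 R) x :: real)"
      by (rule integrable_lborel_indicator_ball)
    show "AE x in lborel. norm ((norm (f x))\<^sup>2) \<le> norm (B\<^sup>2 * indicator (cball 0 R) x :: real)"
      using assms by (intro AE_I2) (auto simp: indicator_def not_le intro: power_mono)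
  qed measurable
  then show ?thesis by (simp add: l2_def)
qed

lemma l2_continuous_bounded_support:
  fixes g :: "'a::euclidean_space \<Rightarrow> 'b::euclidean_space"
  assumes "continuous_on UNIV g" "\<And>x. norm x > R \<Longrightarrow> g x = 0"
  shows "g \<in> l2 lborel"
proof -
  have "compact (g ` cball 0 R)"
    using assms(1) by (intro compact_continuous_image) (auto intro: continuous_on_subset)
  then obtain B where "B > 0" "\<forall>x\<in>cball 0 R. norm (g x) \<le> B"
    by (auto dest!: compact_imp_bounded simp: bounded_pos)
  then have "norm (g x) \<le> B" for x using assms(2)[of x] by (cases "norm x > R") auto
  then show ?thesis
    using assms by (intro l2_bounded_support[of g B R]) (auto intro: borel_measurable_continuous_onI)
qed

lemma l2_norm_bounded_support:
  fixes f :: "'a::euclidean_space \<Rightarrow> 'b::euclidean_space"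
  assumes [measurable]: "f \<in> borel_measurable borel"
    and B: "\<And>x. norm (f x) \<le> B" "\<And>x. norm x > R \<Longrightarrow> f x = 0"
  shows "l2_norm lborel f \<le> B * sqrt (measure lborel (cball (0::'a) R))"
proof -
  have f: "f \<in> l2 lborel" by (rule l2_bounded_support[OF assms])
  have "B \<ge> 0" using B(1)[of 0] by (meson norm_ge_zero order_trans)
  have "(LINT x|lborel. (norm (f x))\<^sup>2) \<le> (LINT x|lborel. B\<^sup>2 * indicator (cball (0::'a) R) x)"
  proof (rule integral_mono)
    show "(norm (f x))\<^sup>2 \<le> B\<^sup>2 * indicator (cball 0 R) x" for x
      using assms by (auto simp: indicator_def not_le intro: power_mono)
  qed (use f l2_integrable integrable_lborel_indicator_ball in blast)+
  also have "\<dots> = B\<^sup>2 * measure lborel (cball (0::'a) R)" by simp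
  finally have "l2_norm lborel f \<le> sqrt (B\<^sup>2 * measure lborel (cball (0::'a) R))"
    by (simp add: l2_norm_def)
  then show ?thesis using \<open>B \<ge> 0\<close> by (simp add: real_sqrt_mult)
qed

lemma integrable_bounded_support:
  fixes f :: "'a::euclidean_space \<Rightarrow> 'b::euclidean_space"
  assumes f: "f \<in> l2 lborel" and "\<And>x. norm x > R \<Longrightarrow> f x = 0"
  shows "integrable lborel f"
proof (rule Bochner_Integration.integrable_bound)
  have "(indicator (cball 0 R) :: 'a \<Rightarrow> real) \<in> l2 lborel"
    by (rule l2_bounded_support[where B = 1 and R = R]) (auto simp: indicator_def intro!: borel_measurable_indicator)
  from l2_prod_integrable[OF this f]
  show "integrable lborel (\<lambda>x. norm (indicator (cball 0 R) x :: real) * norm (f x))" .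
  show "AE x in lborel. norm (f x) \<le> norm (norm (indicator (cball 0 R) x :: real) * norm (f x))"
    using assms by (intro AE_I2) (auto simp: indicator_def not_le)
qed (use l2_measurable[OF f] in simp)

lemma test_support_ball:
  assumes "\<phi> \<in> test UNIV"
  obtains R where "R > 0" "\<And>x. norm x > R \<Longrightarrow> \<phi> x = 0"
proof -
  obtain K where K: "compact K" "\<And>x. x \<notin> K \<Longrightarrow> \<phi> x = 0" using testE[OF assms] by metis
  then obtain R where "R > 0" "\<forall>x\<in>K. norm x \<le> R"
    using compact_imp_bounded bounded_pos by metis
  then show ?thesis using that[of R] K(2) by (meson not_le)
qed

lemma test_borel: "\<phi> \<in> test UNIV \<Longrightarrow> \<phi> \<in> borel_measurable borel"
  by (rule smooth_borel[OF test_smooth])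

lemma test_l2: "\<phi> \<in> test UNIV \<Longrightarrow> \<phi> \<in> l2 lborel"
  by (metis test_support_ball test_bounded l2_bounded_support test_borel)

lemma test_integrable: "\<phi> \<in> test UNIV \<Longrightarrow> integrable lborel \<phi>"
  by (metis test_support_ball test_l2 integrable_bounded_support)

subsection \<open>Difference quotients and integration by parts\<close>

text \<open>Uniformity in \<open>t\<close> is the point: the remainder is quadratic in
  \<open>t\<close> and supported in one ball for all small \<open>t\<close>, so its integral and its
  L2 norm are quadratic in \<open>t\<close> as well.\<close>

lemma test_difference_quotient:
  fixes \<phi> :: "real ^ 'n \<Rightarrow> 'b::euclidean_space"
  assumes "\<phi> \<in> test UNIV"
  obtains K R where "K \<ge> 0" "R \<ge> 0"
    "\<And>t x. \<bar>t\<bar> \<le> 1 \<Longrightarrow> norm (\<phi> (x + t *\<^sub>R e) - \<phi> x - t *\<^sub>R frechet_derivative \<phi> (at x) e) \<le> K * t\<^sup>2"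
    "\<And>t x. \<bar>t\<bar> \<le> 1 \<Longrightarrow> norm x > R \<Longrightarrow> \<phi> (x + t *\<^sub>R e) - \<phi> x - t *\<^sub>R frechet_derivative \<phi> (at x) e = 0"
proof -
  obtain K where K: "K \<ge> 0" "\<And>x h. norm (\<phi> (x + h) - \<phi> x - frechet_derivative \<phi> (at x) h) \<le> K * (norm h)\<^sup>2"
    using test_taylor[OF assms] by metis
  obtain R where R: "R > 0" "\<And>x. norm x > R \<Longrightarrow> \<phi> x = 0" using test_support_ball[OF assms] by metis
  obtain S where S: "S > 0" "\<And>x. norm x > S \<Longrightarrow> frechet_derivative \<phi> (at x) e = 0"
    using test_support_ball[OF test_deriv[OF assms]] by metis
  have lin: "frechet_derivative \<phi> (at x) (t *\<^sub>R e) = t *\<^sub>R frechet_derivative \<phi> (at x) e" for t x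
    using linear_scale[OF linear_frechet_derivative[OF smooth_differentiable[OF test_smooth[OF assms]]]] .
  show ?thesis
  \<comment> \<open>Beyond this radius the function, its derivative and the function shifted by at
    most \<open>norm e\<close> all vanish.\<close>
  proof (rule that[of "K * (norm e)\<^sup>2" "R + S + norm e"])
    show "norm (\<phi> (x + t *\<^sub>R e) - \<phi> x - t *\<^sub>R frechet_derivative \<phi> (at x) e) \<le> K * (norm e)\<^sup>2 * t\<^sup>2" for t x
      using K(2)[of x "t *\<^sub>R e"] by (simp add: lin power_mult_distrib mult_ac)
    fix t :: real and x :: "real ^ 'n"
    assume t: "\<bar>t\<bar> \<le> 1" and x: "R + S + norm e < norm x"
    have "norm (t *\<^sub>R e) \<le> norm e" using t by (simp add: mult_left_le_one_le)
    then have "norm (x + t *\<^sub>R e) > R"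
      using x S(1) norm_diff_ineq[of x "t *\<^sub>R e"] by linarith
    then show "\<phi> (x + t *\<^sub>R e) - \<phi> x - t *\<^sub>R frechet_derivative \<phi> (at x) e = 0"
      using R(2)[of "x + t *\<^sub>R e"] R(2)[of x] S(2)[of x] x R(1) S(1) norm_ge_zero[of e] by simp
  qed (use K R S in auto)
qed

text \<open>By translation invariance the increment
  \<open>\<phi> (x + t *\<^sub>R e) - \<phi> x\<close> integrates to zero, so \<open>t\<close> times
  the integral of the derivative is bounded by a multiple of the square of \<open>t\<close>.
  Dividing by \<open>t\<close> and letting it tend to zero gives the claim without iterated
  integration.\<close>

lemma integral_deriv_test:
  fixes \<phi> :: "real ^ 'n \<Rightarrow> 'b::euclidean_space"
  assumes "\<phi> \<in> test UNIV"
  shows "(LINT x|lborel. frechet_derivative \<phi> (at x) e) = 0"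
proof -
  obtain K R where K: "K \<ge> 0" "R \<ge> 0"
    and bd: "\<And>t x. \<bar>t\<bar> \<le> 1 \<Longrightarrow> norm (\<phi> (x + t *\<^sub>R e) - \<phi> x - t *\<^sub>R frechet_derivative \<phi> (at x) e) \<le> K * t\<^sup>2"
    and supp: "\<And>t x. \<bar>t\<bar> \<le> 1 \<Longrightarrow> norm x > R \<Longrightarrow> \<phi> (x + t *\<^sub>R e) - \<phi> x - t *\<^sub>R frechet_derivative \<phi> (at x) e = 0"
    using test_difference_quotient[OF assms] by metis
  let ?I = "LINT x|lborel. frechet_derivative \<phi> (at x) e"
  let ?V = "measure lborel (cball (0 :: real ^ 'n) R)"
  note [measurable] = test_borel[OF assms] test_borel[OF test_deriv[OF assms]]
  have est: "norm ?I \<le> K * ?V * t" if t: "0 < t" "t \<le> 1" for t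
  proof -
    let ?g = "\<lambda>x. \<phi> (x + t *\<^sub>R e) - \<phi> x - t *\<^sub>R frechet_derivative \<phi> (at x) e"
    have i: "integrable lborel (\<lambda>x. \<phi> (x + t *\<^sub>R e))" "integrable lborel \<phi>"
       "integrable lborel (\<lambda>x. frechet_derivative \<phi> (at x) e)"
      using integrable_lborel_translate[OF test_borel[OF assms], of "t *\<^sub>R e"]
        test_integrable[OF assms] test_integrable[OF test_deriv[OF assms]] by auto
    then have g: "integrable lborel ?g" by auto
    have "integral\<^sup>L lborel ?g = - (t *\<^sub>R ?I)"
      using i integral_lborel_translate[OF test_borel[OF assms], of "t *\<^sub>R e"] by simp
    then have "t * norm ?I = norm (integral\<^sup>L lborel ?g)" using t by simp
    also have "\<dots> \<le> (LINT x|lborel. norm (?g x))" by (rule integral_norm_bound)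
    also have "\<dots> \<le> (LINT x|lborel. K * t\<^sup>2 * indicator (cball (0 :: real ^ 'n) R) x)"
    proof (rule integral_mono)
      show "norm (?g x) \<le> K * t\<^sup>2 * indicator (cball 0 R) x" for x
        using bd[of t x] supp[of t x] t by (cases "norm x \<le> R") (auto simp: indicator_def)
    qed (use g integrable_lborel_indicator_ball in auto)
    also have "\<dots> = t * (K * ?V * t)" by (simp add: power2_eq_square)
    finally show ?thesis using t by simp
  qed
  have "((\<lambda>t. K * ?V * t) \<longlongrightarrow> K * ?V * 0) (at_right 0)"
    by (intro tendsto_intros)
  moreover have "\<forall>\<^sub>F t in at_right 0. norm ?I \<le> K * ?V * t"
    using eventually_at_right_less[of 0] eventually_at_right[of 0 1]
    by (auto simp: eventually_at_right[of 0 1] intro!: est exI[of _ 1])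
  ultimately have "norm ?I \<le> K * ?V * 0"
    by (intro tendsto_lowerbound) auto
  then show ?thesis by simp
qed

lemma integral_partial_test: "\<phi> \<in> test UNIV \<Longrightarrow> (LINT x|lborel. partial j \<phi> x) = 0"
  unfolding partial_def by (rule integral_deriv_test)

lemma integration_by_parts:
  fixes prd :: "'b::euclidean_space \<Rightarrow> 'c::euclidean_space \<Rightarrow> 'd::euclidean_space"
  assumes "bounded_bilinear prd" "f \<in> test UNIV" "smooth g"
  shows "(LINT x|lborel. prd (partial j f x) (g x)) = - (LINT x|lborel. prd (f x) (partial j g x))"
proof -
  have "(LINT x|lborel. prd (f x) (partial j g x) + prd (partial j f x) (g x)) = 0"
    using integral_partial_test[OF test_bilinear_left[OF assms], of j]
    by (simp add: partial_bilinear[OF assms(1) test_smooth[OF assms(2)] assms(3)])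
  moreover have "integrable lborel (\<lambda>x. prd (f x) (partial j g x))"
    by (rule test_integrable[OF test_bilinear_left[OF assms(1,2) smooth_partial[OF assms(3)]]])
  moreover have "integrable lborel (\<lambda>x. prd (partial j f x) (g x))"
    by (rule test_integrable[OF test_bilinear_left[OF assms(1) test_partial[OF assms(2)] assms(3)]])
  ultimately show ?thesis by (simp add: eq_neg_iff_add_eq_0 add.commute)
qed

lemma l2_difference_quotient:
  fixes \<phi> :: "real ^ 'n \<Rightarrow> 'b::euclidean_space"
  assumes "\<phi> \<in> test UNIV"
  shows "\<exists>C\<ge>0. \<forall>t. \<bar>t\<bar> \<le> 1 \<longrightarrow> l2_norm lborel (\<lambda>x. \<phi> (x + t *\<^sub>R e) - \<phi> x - t *\<^sub>R frechet_derivative \<phi> (at x) e) \<le> C * t\<^sup>2"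
proof -
  obtain K R where K: "K \<ge> 0" "R \<ge> 0"
    and bd: "\<And>t x. \<bar>t\<bar> \<le> 1 \<Longrightarrow> norm (\<phi> (x + t *\<^sub>R e) - \<phi> x - t *\<^sub>R frechet_derivative \<phi> (at x) e) \<le> K * t\<^sup>2"
    and supp: "\<And>t x. \<bar>t\<bar> \<le> 1 \<Longrightarrow> norm x > R \<Longrightarrow> \<phi> (x + t *\<^sub>R e) - \<phi> x - t *\<^sub>R frechet_derivative \<phi> (at x) e = 0"
    using test_difference_quotient[OF assms] by metis
  note [measurable] = test_borel[OF assms] test_borel[OF test_deriv[OF assms]]
  show ?thesis
  proof (intro exI[of _ "K * sqrt (measure lborel (cball (0 :: real ^ 'n) R))"] conjI allI impI)
    fix t :: real assume t: "\<bar>t\<bar> \<le> 1"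
    have "l2_norm lborel (\<lambda>x. \<phi> (x + t *\<^sub>R e) - \<phi> x - t *\<^sub>R frechet_derivative \<phi> (at x) e)
        \<le> K * t\<^sup>2 * sqrt (measure lborel (cball (0 :: real ^ 'n) R))"
      by (rule l2_norm_bounded_support) (use bd[OF t] supp[OF t] in auto)
    then show "l2_norm lborel (\<lambda>x. \<phi> (x + t *\<^sub>R e) - \<phi> x - t *\<^sub>R frechet_derivative \<phi> (at x) e)
        \<le> K * sqrt (measure lborel (cball (0 :: real ^ 'n) R)) * t\<^sup>2" by (simp add: mult_ac)
  qed (use K in auto)
qed

text \<open>The translation distance is subadditive along multiples of \<open>e\<close>, so it is at most its slope at \<open>0\<close>.\<close>

lemma l2_translation_bound:
  fixes \<phi> :: "real ^ 'n \<Rightarrow> 'b::euclidean_space"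
  assumes t: "\<phi> \<in> test UNIV"
  shows "l2_norm lborel (\<lambda>x. \<phi> (x + e) - \<phi> x) \<le> l2_norm lborel (\<lambda>x. frechet_derivative \<phi> (at x) e)"
proof -
  obtain C where C: "C \<ge> 0"
    "\<And>t. \<bar>t\<bar> \<le> 1 \<Longrightarrow> l2_norm lborel (\<lambda>x. \<phi> (x + t *\<^sub>R e) - \<phi> x - t *\<^sub>R frechet_derivative \<phi> (at x) e) \<le> C * t\<^sup>2"
    using l2_difference_quotient[OF t, of e] by auto
  let ?h = "\<lambda>t. l2_norm lborel (\<lambda>x. \<phi> (x + t *\<^sub>R e) - \<phi> x)"
  let ?d = "l2_norm lborel (\<lambda>x. frechet_derivative \<phi> (at x) e)"
  note tr = l2_translate(1)[OF test_l2[OF t]]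
  have sub: "?h (s + t) \<le> ?h s + ?h t" for s t
  proof -
    have "?h (s + t) \<le> l2_norm lborel (\<lambda>x. \<phi> (x + (s + t) *\<^sub>R e) - \<phi> (x + t *\<^sub>R e)) + ?h t"
      by (rule l2_norm_triangle_diff) (intro tr test_l2 t)+
    also have "l2_norm lborel (\<lambda>x. \<phi> (x + (s + t) *\<^sub>R e) - \<phi> (x + t *\<^sub>R e)) = ?h s"
      using l2_translate(2)[OF l2_diff[OF tr[of "s *\<^sub>R e"] test_l2[OF t]], of "t *\<^sub>R e"]
      by (simp add: algebra_simps)
    finally show ?thesis .
  qed
  have mult: "?h (real m * s) \<le> real m * ?h s" for m s
  proof (induction m)
    case 0
    then show ?case by (simp add: l2_norm_def)
  next
    case (Suc m)
    then show ?case using sub[of "real m * s" s] by (simp add: algebra_simps)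
  qed
  have "?h 1 \<le> ?d + C / real (Suc n)" for n
  proof -
    let ?s = "1 / real (Suc n)"
    have "?h 1 \<le> real (Suc n) * ?h ?s" using mult[of "Suc n" ?s] by simp
    also have "?h ?s \<le> C * ?s\<^sup>2 + ?s * ?d"
    proof -
      have "l2_norm lborel (\<lambda>x. (\<phi> (x + ?s *\<^sub>R e) - \<phi> x - ?s *\<^sub>R frechet_derivative \<phi> (at x) e)
            + ?s *\<^sub>R frechet_derivative \<phi> (at x) e)
          \<le> l2_norm lborel (\<lambda>x. \<phi> (x + ?s *\<^sub>R e) - \<phi> x - ?s *\<^sub>R frechet_derivative \<phi> (at x) e)
            + l2_norm lborel (\<lambda>x. ?s *\<^sub>R frechet_derivative \<phi> (at x) e)"
        by (intro l2_norm_triangle l2_diff l2_scaleR tr test_l2 test_deriv t)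
      moreover have "\<bar>?s\<bar> \<le> 1" by simp
      ultimately show ?thesis using C(2)[of ?s] by (simp add: l2_norm_scaleR[of _ ?s, simplified])
    qed
    then have "real (Suc n) * ?h ?s \<le> real (Suc n) * (C * ?s\<^sup>2 + ?s * ?d)"
      by (intro mult_left_mono) auto
    also have "\<dots> = ?d + C / real (Suc n)" by (simp add: distrib_left power2_eq_square del: of_nat_Suc)
    finally show ?thesis .
  qed
  moreover have "(\<lambda>n. ?d + C / real (Suc n)) \<longlonglongrightarrow> ?d + 0"
    by (intro tendsto_intros LIMSEQ_Suc[OF lim_const_over_n])
  ultimately have "?h 1 \<le> ?d + 0" by (intro LIMSEQ_le_const) auto
  then show ?thesis by simp
qed

lemma l2_inner_translate:
  assumes "f \<in> l2 lborel" "g \<in> l2 lborel"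
  shows "l2_inner lborel (\<lambda>x. f (x + a)) (\<lambda>x. g (x + b)) = l2_inner lborel f (\<lambda>x. g (x + (b - a)))"
proof -
  have [measurable]: "f \<in> borel_measurable borel" "g \<in> borel_measurable borel"
    using l2_measurable[OF assms(1)] l2_measurable[OF assms(2)] by simp_all
  show ?thesis
    using integral_lborel_translate[of "\<lambda>x. f x \<bullet> g (x + (b - a))" a] by (simp add: l2_inner_def)
qed

lemma l2_difference_quotient_tendsto:
  fixes \<phi> :: "real ^ 'n \<Rightarrow> 'b::euclidean_space"
  assumes t: "\<phi> \<in> test UNIV"
  shows "(\<lambda>n. l2_norm lborel (\<lambda>x. real (Suc n) *\<^sub>R (\<phi> (x + (1 / real (Suc n)) *\<^sub>R e) - \<phi> x)
            - frechet_derivative \<phi> (at x) e)) \<longlonglongrightarrow> 0"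
proof -
  obtain C where C: "C \<ge> 0"
    "\<And>t. \<bar>t\<bar> \<le> 1 \<Longrightarrow> l2_norm lborel (\<lambda>x. \<phi> (x + t *\<^sub>R e) - \<phi> x - t *\<^sub>R frechet_derivative \<phi> (at x) e) \<le> C * t\<^sup>2"
    using l2_difference_quotient[OF t, of e] by auto
  show ?thesis
  proof (rule Lim_null_comparison)
    show "(\<lambda>n. C / real (Suc n)) \<longlonglongrightarrow> 0" by (rule LIMSEQ_Suc[OF lim_const_over_n])
    have "l2_norm lborel (\<lambda>x. real (Suc n) *\<^sub>R (\<phi> (x + (1 / real (Suc n)) *\<^sub>R e) - \<phi> x)
            - frechet_derivative \<phi> (at x) e) \<le> C / real (Suc n)" for n
    proof -
      let ?s = "1 / real (Suc n)"
      have "l2_norm lborel (\<lambda>x. real (Suc n) *\<^sub>R (\<phi> (x + ?s *\<^sub>R e) - \<phi> x) - frechet_derivative \<phi> (at x) e)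
          = l2_norm lborel (\<lambda>x. real (Suc n) *\<^sub>R (\<phi> (x + ?s *\<^sub>R e) - \<phi> x - ?s *\<^sub>R frechet_derivative \<phi> (at x) e))"
        by (simp add: scaleR_diff_right del: of_nat_Suc)
      also have "\<dots> = real (Suc n) * l2_norm lborel (\<lambda>x. \<phi> (x + ?s *\<^sub>R e) - \<phi> x - ?s *\<^sub>R frechet_derivative \<phi> (at x) e)"
        by (simp add: l2_norm_scaleR)
      also have "\<dots> \<le> real (Suc n) * (C * ?s\<^sup>2)" by (intro mult_left_mono C(2)) auto
      also have "\<dots> = C / real (Suc n)" by (simp add: power2_eq_square del: of_nat_Suc)
      finally show ?thesis .
    qed
    then show "\<forall>\<^sub>F n in sequentially. norm (l2_norm lborel (\<lambda>x. real (Suc n) *\<^sub>R (\<phi> (x + (1 / real (Suc n)) *\<^sub>R e) - \<phi> x)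
            - frechet_derivative \<phi> (at x) e)) \<le> C / real (Suc n)" by simp
  qed
qed

text \<open>Two integrations by parts carried out on difference quotients, where a shift of
  \<open>f\<close> can be traded for the opposite shift of \<open>g\<close> by translation
  invariance. No second derivatives appear, and the two sign changes cancel in the limit.\<close>

lemma test_swap_partial:
  fixes f g :: "real ^ 'n \<Rightarrow> real"
  assumes f: "f \<in> test UNIV" and g: "g \<in> test UNIV"
  shows "l2_inner lborel (partial i f) (partial j g) = l2_inner lborel (partial j f) (partial i g)"
proof -
  define Q where "Q s e h x = s *\<^sub>R (h (x + (1/s) *\<^sub>R e) - h x)" for s :: real and e :: "real ^ 'n" and h :: "real ^ 'n \<Rightarrow> real" and x
  note tr = l2_translate(1)[OF test_l2]
  have Ql2: "Q s e h \<in> l2 lborel" if "h \<in> test UNIV" for s e h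
    unfolding Q_def[abs_def] by (intro l2_scaleR l2_diff tr test_l2 that)
  have lim: "(\<lambda>n. l2_norm lborel (\<lambda>x. Q (real (Suc n)) (axis i 1) h x - partial i h x)) \<longlonglongrightarrow> 0"
    if "h \<in> test UNIV" for i h
    using l2_difference_quotient_tendsto[OF that, of "axis i 1"] by (simp add: Q_def partial_def)
  have lim': "(\<lambda>n. l2_norm lborel (\<lambda>x. Q (real (Suc n)) (- axis i 1) h x - (- partial i h x))) \<longlonglongrightarrow> 0"
    if "h \<in> test UNIV" for i h
    using l2_difference_quotient_tendsto[OF that, of "- axis i 1"]
      linear_neg[OF linear_frechet_derivative[OF smooth_differentiable[OF test_smooth[OF that]]]]
    by (simp add: Q_def partial_def)
  have eq: "l2_inner lborel (Q s a f) (Q s b g) = l2_inner lborel (Q s (- b) f) (Q s (- a) g)" for s a b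
  proof -
    note l2s = tr[OF f] tr[OF g] test_l2[OF f] test_l2[OF g] l2_diff
    let ?T = "\<lambda>c. l2_inner lborel f (\<lambda>x. g (x + c))"
    have T: "l2_inner lborel (\<lambda>x. f (x + a)) (\<lambda>x. g (x + b)) = ?T (b - a)"
      "l2_inner lborel (\<lambda>x. f (x + a)) g = ?T (- a)" "l2_inner lborel f g = ?T 0" for a b
      using l2_inner_translate[OF test_l2[OF f] test_l2[OF g], of a b]
        l2_inner_translate[OF test_l2[OF f] test_l2[OF g], of a 0] by auto
    \<comment> \<open>The right-hand side is unchanged when \<open>(a, b)\<close> is replaced by
      \<open>(- b, - a)\<close>: its four arguments \<open>b - a\<close>, \<open>- a\<close>,
      \<open>b\<close>, \<open>0\<close> are only permuted, and the two that change places carry the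
      same sign.\<close>
    have "l2_inner lborel (\<lambda>x. f (x + a) - f x) (\<lambda>x. g (x + b) - g x)
        = ?T (b - a) - ?T (- a) - (?T b - ?T 0)" for a b
      using T by (simp add: l2_inner_diff_left l2_inner_diff_right l2s)
    note this[of "(1/s) *\<^sub>R a" "(1/s) *\<^sub>R b"] this[of "- (1/s) *\<^sub>R b" "- (1/s) *\<^sub>R a"]
    moreover have "l2_inner lborel (Q s a f) (Q s b g) = s * (s * l2_inner lborel
        (\<lambda>x. f (x + (1/s) *\<^sub>R a) - f x) (\<lambda>x. g (x + (1/s) *\<^sub>R b) - g x))" for a b
      unfolding Q_def[abs_def] by (subst l2_inner_scaleR_left, subst l2_inner_scaleR_right, rule refl)
    ultimately show ?thesis by simp
  qed
  have "(\<lambda>n. l2_inner lborel (Q (real (Suc n)) (axis i 1) f) (Q (real (Suc n)) (axis j 1) g))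
      \<longlonglongrightarrow> l2_inner lborel (partial i f) (partial j g)"
    by (intro l2_inner_tendsto Ql2 lim f g test_l2 test_partial)
  moreover have "(\<lambda>n. l2_inner lborel (Q (real (Suc n)) (axis i 1) f) (Q (real (Suc n)) (axis j 1) g))
      \<longlonglongrightarrow> l2_inner lborel (\<lambda>x. - partial j f x) (\<lambda>x. - partial i g x)"
    unfolding eq[of _ "axis i 1" "axis j 1"] by (intro l2_inner_tendsto Ql2 lim' f g test_l2 test_partial test_minus)
  ultimately have "l2_inner lborel (partial i f) (partial j g) = l2_inner lborel (\<lambda>x. - partial j f x) (\<lambda>x. - partial i g x)"
    by (rule LIMSEQ_unique)
  then show ?thesis by (simp add: l2_inner_def)
qed

subsection \<open>Mollification\<close>

text \<open>A bump of radius \<open>1 / Suc k\<close>, positive for every \<open>k\<close>. Dividing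
  by its own integral gives mass one in every dimension; the power of \<open>Suc k\<close> behind
  this becomes explicit in \<open>moll_eq\<close>.\<close>

definition moll :: "nat \<Rightarrow> real ^ 'n \<Rightarrow> real" where
  "moll k x = bump (real (Suc k) *\<^sub>R x) / (LINT y|lborel. bump (real (Suc k) *\<^sub>R y :: real ^ 'n))"

lemma bump_scaled_test: "(\<lambda>x. bump (real (Suc k) *\<^sub>R x)) \<in> test UNIV"
  using test_affine[OF bump_test, of "real (Suc k)" 0] by simp

lemma integral_bump_pos: "0 < (LINT y|lborel. bump (y :: real ^ 'n))"
proof -
  have nn: "0 \<le> (LINT y|lborel. bump (y :: real ^ 'n))" by (simp add: integral_nonneg_AE)
  have "(LINT y|lborel. bump (y :: real ^ 'n)) \<noteq> 0"
  proof
    assume "(LINT y|lborel. bump (y :: real ^ 'n)) = 0"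
    then have "AE y in lborel. bump (y :: real ^ 'n) = 0"
      using integral_nonneg_eq_0_iff_AE[OF test_integrable[OF bump_test, where 'a = 'n]] by simp
    then have "AE y in lborel. (y :: real ^ 'n) \<notin> ball 0 1"
      by eventually_elim (use bump_pos in fastforce)
    then have "emeasure lborel (ball (0 :: real ^ 'n) 1) = 0"
      by (subst (asm) AE_iff_measurable[OF _ refl]) (auto simp: ball_def)
    then have "measure lborel (ball (0 :: real ^ 'n) 1) = 0" by (simp add: measure_def)
    then show False using content_ball_pos[of 1 "0 :: real ^ 'n"] by simp
  qed
  with nn show ?thesis by (metis less_le)
qed

lemma integral_scaled:
  fixes g :: "real ^ 'n \<Rightarrow> real"
  assumes "g \<in> borel_measurable borel"
  shows "(LINT x|lborel. g (real (Suc k) *\<^sub>R x)) = integral\<^sup>L lborel g / real (Suc k) ^ CARD('n)"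
  using integral_lborel_affine[of "real (Suc k)" g 0] assms by (simp add: field_simps del: of_nat_Suc)

lemma moll_eq:
  "moll k (x :: real ^ 'n) = (real (Suc k) ^ CARD('n) / (LINT y|lborel. bump (y :: real ^ 'n))) * bump (real (Suc k) *\<^sub>R x)"
  unfolding moll_def by (subst integral_scaled) (auto intro: test_borel bump_test simp del: of_nat_Suc)

lemma moll_test: "moll k \<in> test UNIV"
  unfolding moll_eq[abs_def] by (rule test_bounded_linear[OF bounded_linear_mult_right bump_scaled_test])

lemma moll_nonneg [simp]: "0 \<le> moll k x"
  by (simp add: moll_def integral_nonneg_AE)

lemma moll_eq_0: "1 / real (Suc k) \<le> norm x \<Longrightarrow> moll k x = 0"
  by (simp add: moll_def bump_eq_0 field_simps del: of_nat_Suc)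

lemma integral_moll: "(LINT x|lborel. moll k (x :: real ^ 'n)) = 1"
  unfolding moll_eq
  by (subst integral_mult_right_zero, subst integral_scaled)
     (use integral_bump_pos[where 'n = 'n] in \<open>auto intro: test_borel bump_test simp del: of_nat_Suc\<close>)

text \<open>Scaling: the normalised dilation preserves L1 norms and each derivative brings out one
  factor \<open>Suc k\<close>. This linear growth is the inverse-distance bound on the gradients of
  the cutoff functions.\<close>

lemma moll_partial_bound:
  obtains C where "C \<ge> 0" "\<And>k j. (LINT x|lborel. \<bar>partial j (moll k) (x :: real ^ 'n)\<bar>) \<le> C * real (Suc k)"
proof -
  let ?J = "LINT y|lborel. bump (y :: real ^ 'n)"
  define D where "D j = (LINT x|lborel. \<bar>partial j bump (x :: real ^ 'n)\<bar>)" for j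
  have D: "D j \<ge> 0" for j by (simp add: D_def integral_nonneg_AE)
  have eq: "(LINT x|lborel. \<bar>partial j (moll k) (x :: real ^ 'n)\<bar>) = D j / ?J * real (Suc k)" for j k
  proof -
    have "partial j (moll k) x = (real (Suc k) ^ CARD('n) / ?J) * (real (Suc k) * partial j bump (real (Suc k) *\<^sub>R x))" for x :: "real ^ 'n"
    proof -
      have "partial j (\<lambda>x. bump (real (Suc k) *\<^sub>R x)) x = real (Suc k) * partial j bump (real (Suc k) *\<^sub>R x)"
        using partial_affine[OF test_smooth[OF bump_test], of j 0 "real (Suc k)"] by (simp del: of_nat_Suc)
      then show ?thesis
        unfolding moll_eq[abs_def]
        by (subst partial_bounded_linear[OF bounded_linear_mult_right test_smooth[OF bump_scaled_test]])
           (simp del: of_nat_Suc)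
    qed
    then have "(LINT x|lborel. \<bar>partial j (moll k) (x :: real ^ 'n)\<bar>)
        = (LINT x|lborel. (real (Suc k) ^ CARD('n) / ?J * real (Suc k)) * \<bar>partial j bump (real (Suc k) *\<^sub>R x :: real ^ 'n)\<bar>)"
      using integral_bump_pos[where 'n = 'n] by (simp add: abs_mult mult.assoc del: of_nat_Suc)
    also have "\<dots> = (real (Suc k) ^ CARD('n) / ?J * real (Suc k)) * (D j / real (Suc k) ^ CARD('n))"
      unfolding D_def
      using integral_scaled[OF borel_measurable_abs[OF test_borel[OF test_partial[OF bump_test, of j]]], of k]
      by (simp del: of_nat_Suc)
    finally show ?thesis by (simp del: of_nat_Suc)
  qed
  have le: "D j \<le> (\<Sum>j\<in>UNIV. D j)" for j by (rule member_le_sum) (auto simp: D)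
  show ?thesis
  proof (rule that[of "(\<Sum>j\<in>UNIV. D j) / ?J"])
    show "(LINT x|lborel. \<bar>partial j (moll k) (x :: real ^ 'n)\<bar>) \<le> (\<Sum>j\<in>UNIV. D j) / ?J * real (Suc k)" for k j
      unfolding eq using le integral_bump_pos[where 'n = 'n] by (intro mult_right_mono divide_right_mono) auto
  qed (use D integral_bump_pos[where 'n = 'n] in \<open>auto intro!: sum_nonneg divide_nonneg_pos\<close>)
qed

section \<open>Convolution with smooth kernels\<close>

definition conv :: "(real ^ 'n \<Rightarrow> real) \<Rightarrow> (real ^ 'n \<Rightarrow> 'b::euclidean_space) \<Rightarrow> real ^ 'n \<Rightarrow> 'b" where
  "conv \<eta> f x = (LINT y|lborel. \<eta> (x - y) *\<^sub>R f y)"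

lemma test_reflect: "\<eta> \<in> test UNIV \<Longrightarrow> (\<lambda>y. \<eta> (x - y)) \<in> test UNIV"
  using test_affine[of \<eta> "-1" x] by simp

lemma conv_integrable:
  fixes f :: "real ^ 'n \<Rightarrow> 'b::euclidean_space"
  assumes \<eta>: "\<eta> \<in> test UNIV" and f: "integrable lborel f"
  shows "integrable lborel (\<lambda>y. \<eta> (x - y) *\<^sub>R f y)"
proof -
  obtain B where B: "B \<ge> 0" "\<And>x. norm (\<eta> x) \<le> B" using test_bounded[OF \<eta>] by metis
  have [measurable]: "f \<in> borel_measurable borel" using borel_measurable_integrable[OF f] by simp
  note [measurable] = test_borel[OF \<eta>]
  show ?thesis
  proof (rule Bochner_Integration.integrable_bound)
    show "integrable lborel (\<lambda>y. B *\<^sub>R f y)" using f by simp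
    show "AE y in lborel. norm (\<eta> (x - y) *\<^sub>R f y) \<le> norm (B *\<^sub>R f y)"
      using B by (intro AE_I2) (auto intro!: mult_right_mono)
  qed measurable
qed

text \<open>The quadratic Taylor remainder of \<open>\<eta>\<close> is uniform in the base point and
  therefore integrates against \<open>norm (f y)\<close>. All differentiation falls on the kernel,
  so mere integrability of \<open>f\<close> is enough.\<close>

lemma conv_has_derivative:
  assumes \<eta>: "\<eta> \<in> test UNIV" and f: "integrable lborel f"
  shows "(conv \<eta> f has_derivative (\<lambda>h. conv (\<lambda>z. frechet_derivative \<eta> (at z) h) f x)) (at x)"
proof -
  let ?D = "\<lambda>h. conv (\<lambda>z. frechet_derivative \<eta> (at z) h) f x"
  obtain K where K: "K \<ge> 0" "\<And>x h. norm (\<eta> (x + h) - \<eta> x - frechet_derivative \<eta> (at x) h) \<le> K * (norm h)\<^sup>2"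
    using test_taylor[OF \<eta>] by metis
  have lin: "linear (frechet_derivative \<eta> (at z))" for z
    by (rule linear_frechet_derivative[OF smooth_differentiable[OF test_smooth[OF \<eta>]]])
  note int = conv_integrable[OF \<eta> f] conv_integrable[OF test_deriv[OF \<eta>] f]
  have "linear ?D"
    by (rule linearI)
       (simp_all add: conv_def linear_add[OF lin] linear_scale[OF lin] scaleR_add_left int flip: scaleR_scaleR)
  then have bl: "bounded_linear ?D" by (simp add: linear_conv_bounded_linear)
  define C where "C = K * (LINT y|lborel. norm (f y))"
  have est: "norm (conv \<eta> f (x + h) - conv \<eta> f x - ?D h) \<le> C * (norm h)\<^sup>2" for h
  proof -
    let ?g = "\<lambda>y. \<eta> (x + h - y) *\<^sub>R f y - \<eta> (x - y) *\<^sub>R f y - frechet_derivative \<eta> (at (x - y)) h *\<^sub>R f y"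
    have eq: "conv \<eta> f (x + h) - conv \<eta> f x - ?D h = integral\<^sup>L lborel ?g"
      by (simp add: conv_def int)
    have "norm (conv \<eta> f (x + h) - conv \<eta> f x - ?D h) \<le> (LINT y|lborel. norm (?g y))"
      unfolding eq by (rule integral_norm_bound)
    also have "\<dots> \<le> (LINT y|lborel. K * (norm h)\<^sup>2 * norm (f y))"
    proof (rule integral_mono)
      show "norm (?g y) \<le> K * (norm h)\<^sup>2 * norm (f y)" for y
      proof -
        have "?g y = (\<eta> (x - y + h) - \<eta> (x - y) - frechet_derivative \<eta> (at (x - y)) h) *\<^sub>R f y"
          by (simp add: scaleR_diff_left algebra_simps)
        then show ?thesis using K(2)[of "x - y" h] by (simp add: mult_right_mono)
      qed
    qed (use f int in auto)
    finally show ?thesis by (simp add: C_def mult_ac)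
  qed
  have "(\<lambda>h. norm (conv \<eta> f (x + h) - conv \<eta> f x - ?D h) / norm h) \<midarrow>0\<rightarrow> 0"
  proof (rule Lim_null_comparison)
    show "\<forall>\<^sub>F h in at 0. norm (norm (conv \<eta> f (x + h) - conv \<eta> f x - ?D h) / norm h) \<le> C * norm h"
      using est by (auto simp: eventually_at_filter field_simps power2_eq_square)
    have "(\<lambda>h::real ^ 'a. C * norm h) \<midarrow>0\<rightarrow> C * norm (0::real ^ 'a)" by (intro tendsto_intros)
    then show "(\<lambda>h::real ^ 'a. C * norm h) \<midarrow>0\<rightarrow> 0" by simp
  qed
  then show ?thesis using bl by (simp add: has_derivative_at)
qed

lemma conv_Ck:
  assumes "integrable lborel f"
  shows "\<eta> \<in> test UNIV \<Longrightarrow> Ck k (conv \<eta> f)"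
proof (induction k arbitrary: \<eta>)
  case 0
  have "conv \<eta> f differentiable (at x)" for x
    using conv_has_derivative[OF 0 assms] by (auto simp: differentiable_def)
  then show ?case
    by (auto simp: continuous_on_eq_continuous_within differentiable_imp_continuous_within)
next
  case (Suc k)
  show ?case
    by (rule Ck_SucI[OF conv_has_derivative[OF Suc.prems assms] Suc.IH[OF test_deriv[OF Suc.prems]]])
qed

lemma conv_smooth: "\<eta> \<in> test UNIV \<Longrightarrow> integrable lborel f \<Longrightarrow> smooth (conv \<eta> f)"
  by (simp add: smooth_def conv_Ck)

lemma partial_conv: "\<eta> \<in> test UNIV \<Longrightarrow> integrable lborel f \<Longrightarrow> partial j (conv \<eta> f) x = conv (partial j \<eta>) f x"
  using partial_eqI[OF conv_has_derivative] by (simp add: partial_def[abs_def])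

lemma conv_moll_eq_0:
  assumes "\<And>y. norm (x - y) < 1 / real (Suc k) \<Longrightarrow> f y = 0"
  shows "conv (moll k) f x = 0"
proof -
  have "moll k (x - y) *\<^sub>R f y = 0" for y
    using assms moll_eq_0[of k "x - y"] by (cases "norm (x - y) < 1 / real (Suc k)") auto
  then show ?thesis unfolding conv_def by (simp only: Bochner_Integration.integral_zero)
qed

lemma conv_moll_test:
  fixes f :: "real ^ 'n \<Rightarrow> 'b::euclidean_space"
  assumes "integrable lborel f" "\<And>x. norm x > R \<Longrightarrow> f x = 0"
  shows "conv (moll k) f \<in> test UNIV"
proof (rule testI[of _ "cball 0 (R + 1)"])
  show "conv (moll k) f x = 0" if "x \<notin> cball 0 (R + 1)" for x
  proof (rule conv_moll_eq_0)
    fix y assume "norm (x - y) < 1 / real (Suc k)"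
    then have "norm (x - y) < 1" by (rule less_le_trans) simp
    then show "f y = 0" using that norm_triangle_ineq2[of x y] by (intro assms(2)) (simp add: dist_norm)
  qed
qed (auto intro: conv_smooth moll_test assms)

lemma integral_moll_reflect: "(LINT y|lborel. moll k (x - y)) = 1"
  using integral_lborel_reflect[OF test_borel[OF moll_test], of k x] integral_moll[of k] by simp

text \<open>Jensen's inequality for the probability density \<open>moll k (x - y)\<close>, obtained
  from the Cauchy-Schwarz inequality by writing the kernel as the product of two square
  roots.\<close>

lemma conv_moll_norm_sq:
  fixes f :: "real ^ 'n \<Rightarrow> 'b::euclidean_space"
  assumes f: "f \<in> l2 lborel"
  shows "integrable lborel (\<lambda>y. moll k (x - y) * (norm (f y))\<^sup>2)"
    "(norm (conv (moll k) f x))\<^sup>2 \<le> (LINT y|lborel. moll k (x - y) * (norm (f y))\<^sup>2)"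
proof -
  obtain B where B: "B \<ge> 0" "\<And>x :: real ^ 'n. norm (moll k x) \<le> B" using test_bounded[OF moll_test] by metis
  note [measurable] = test_borel[OF test_reflect[OF moll_test, of k x]]
  have [measurable]: "f \<in> borel_measurable borel" using l2_measurable[OF f] by simp
  let ?a = "\<lambda>y. sqrt (moll k (x - y))"
  let ?b = "\<lambda>y. sqrt (moll k (x - y)) * norm (f y)"
  have a: "?a \<in> l2 lborel"
    using test_integrable[OF test_reflect[OF moll_test, of k x]] by (simp add: l2_def)
  have b: "?b \<in> l2 lborel"
  proof (rule l2_bounded[OF f])
    show "AE y in lborel. norm (?b y) \<le> sqrt B * norm (f y)"
      using B by (intro AE_I2) (auto simp: abs_mult intro!: mult_right_mono)
  qed simp
  show "integrable lborel (\<lambda>y. moll k (x - y) * (norm (f y))\<^sup>2)"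
    using l2_integrable[OF b] by (simp add: power_mult_distrib)
  have "norm (conv (moll k) f x) \<le> (LINT y|lborel. norm (moll k (x - y) *\<^sub>R f y))"
    unfolding conv_def by (rule integral_norm_bound)
  also have "\<dots> = l2_inner lborel ?a ?b" by (simp add: l2_inner_def flip: mult.assoc)
  finally have "norm (conv (moll k) f x) \<le> \<bar>l2_inner lborel ?a ?b\<bar>" by simp
  also have "\<dots> \<le> l2_norm lborel ?a * l2_norm lborel ?b" by (rule l2_Cauchy_Schwarz[OF a b])
  also have "l2_norm lborel ?a = 1" by (simp add: l2_norm_def integral_moll_reflect)
  finally have "(norm (conv (moll k) f x))\<^sup>2 \<le> (l2_norm lborel ?b)\<^sup>2" by (intro power_mono) auto
  then show "(norm (conv (moll k) f x))\<^sup>2 \<le> (LINT y|lborel. moll k (x - y) * (norm (f y))\<^sup>2)"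
    by (simp add: l2_norm_sq power_mult_distrib)
qed

text \<open>The pointwise Jensen bound is integrated over \<open>x\<close> and the order of
  integration exchanged; as a function of \<open>x\<close> the kernel again has mass one.\<close>

lemma conv_moll_l2:
  fixes f :: "real ^ 'n \<Rightarrow> 'b::euclidean_space"
  assumes f: "f \<in> l2 lborel" and int: "integrable lborel f"
  shows "conv (moll k) f \<in> l2 lborel" "l2_norm lborel (conv (moll k) f) \<le> l2_norm lborel f"
proof -
  note [measurable] = smooth_borel[OF conv_smooth[OF moll_test int, of k]] test_borel[OF moll_test, of k]
  have [measurable]: "f \<in> borel_measurable borel" using l2_measurable[OF f] by simp
  have moll1: "(\<integral>\<^sup>+x. ennreal (moll k (x - y)) \<partial>lborel) = 1" for y :: "real ^ 'n"
  proof -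
    have "(LINT x|lborel. moll k (x - y)) = 1"
      using integral_lborel_translate[OF test_borel[OF moll_test], of k "- y"] integral_moll[of k] by simp
    moreover have "integrable lborel (\<lambda>x. moll k (x - y))"
      using integrable_lborel_translate[OF test_borel[OF moll_test], of k "- y"] test_integrable[OF moll_test, of k] by simp
    ultimately show ?thesis by (subst nn_integral_eq_integral) auto
  qed
  have "(\<integral>\<^sup>+x. ennreal ((norm (conv (moll k) f x))\<^sup>2) \<partial>lborel)
      \<le> (\<integral>\<^sup>+x. (\<integral>\<^sup>+y. ennreal (moll k (x - y) * (norm (f y))\<^sup>2) \<partial>lborel) \<partial>lborel)"
  proof (rule nn_integral_mono)
    fix x :: "real ^ 'n"
    show "ennreal ((norm (conv (moll k) f x))\<^sup>2) \<le> (\<integral>\<^sup>+y. ennreal (moll k (x - y) * (norm (f y))\<^sup>2) \<partial>lborel)"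
      using conv_moll_norm_sq[OF f, of k x]
      by (subst nn_integral_eq_integral) (auto intro!: ennreal_leI)
  qed
  also have "\<dots> = (\<integral>\<^sup>+y. (\<integral>\<^sup>+x. ennreal (moll k (x - y) * (norm (f y))\<^sup>2) \<partial>lborel) \<partial>lborel)"
    by (rule lborel_pair.Fubini'[symmetric]) measurable
  also have "\<dots> = (\<integral>\<^sup>+y. ennreal ((norm (f y))\<^sup>2) \<partial>lborel)"
  proof (rule nn_integral_cong)
    fix y :: "real ^ 'n"
    have "(\<integral>\<^sup>+x. ennreal (moll k (x - y) * (norm (f y))\<^sup>2) \<partial>lborel)
        = (\<integral>\<^sup>+x. ennreal (moll k (x - y)) * ennreal ((norm (f y))\<^sup>2) \<partial>lborel)"
      by (simp add: ennreal_mult)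
    also have "\<dots> = (\<integral>\<^sup>+x. ennreal (moll k (x - y)) \<partial>lborel) * ennreal ((norm (f y))\<^sup>2)"
      by (rule nn_integral_multc) measurable
    finally show "(\<integral>\<^sup>+x. ennreal (moll k (x - y) * (norm (f y))\<^sup>2) \<partial>lborel) = ennreal ((norm (f y))\<^sup>2)"
      by (simp add: moll1)
  qed
  also have "\<dots> = ennreal ((l2_norm lborel f)\<^sup>2)"
    unfolding l2_norm_sq using l2_integrable[OF f] by (intro nn_integral_eq_integral) auto
  finally have le: "(\<integral>\<^sup>+x. ennreal ((norm (conv (moll k) f x))\<^sup>2) \<partial>lborel) \<le> ennreal ((l2_norm lborel f)\<^sup>2)" .
  then have "integrable lborel (\<lambda>x. (norm (conv (moll k) f x))\<^sup>2)"
    by (intro integrableI_bounded) (auto intro: order_le_less_trans)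
  then show l2: "conv (moll k) f \<in> l2 lborel" by (simp add: l2_def)
  have "ennreal ((l2_norm lborel (conv (moll k) f))\<^sup>2) \<le> ennreal ((l2_norm lborel f)\<^sup>2)"
    using le l2_integrable[OF l2] by (simp add: l2_norm_sq nn_integral_eq_integral)
  then show "l2_norm lborel (conv (moll k) f) \<le> l2_norm lborel f"
    by (simp add: ennreal_le_iff power_mono_iff)
qed

section \<open>Approximation by continuous functions and by mollification\<close>

lemma l2_dominated_convergence:
  assumes F: "\<And>n. F n \<in> borel_measurable M" and f: "f \<in> borel_measurable M" and w: "(w :: 'a \<Rightarrow> real) \<in> l2 M"
    and lim: "AE x in M. (\<lambda>n. F n x) \<longlonglongrightarrow> f x"
    and bd: "\<And>n. AE x in M. norm (F n x - f x) \<le> w x"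
  shows "(\<lambda>n. l2_norm M (\<lambda>x. F n x - f x)) \<longlonglongrightarrow> 0"
proof -
  note [measurable] = F f
  have "(\<lambda>n. LINT x|M. (norm (F n x - f x))\<^sup>2) \<longlonglongrightarrow> (LINT x|M. 0)"
  proof (rule integral_dominated_convergence)
    show "integrable M (\<lambda>x. (w x)\<^sup>2)" using l2_integrable[OF w] by simp
    show "AE x in M. (\<lambda>n. (norm (F n x - f x))\<^sup>2) \<longlonglongrightarrow> 0"
      using lim
    proof eventually_elim
      case (elim x)
      then have "(\<lambda>n. (norm (F n x - f x))\<^sup>2) \<longlonglongrightarrow> (norm (f x - f x))\<^sup>2"
        by (intro tendsto_intros)
      then show ?case by simp
    qed
    show "AE x in M. norm ((norm (F n x - f x))\<^sup>2) \<le> (w x)\<^sup>2" for n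
      using bd[of n] by eventually_elim (simp add: power_mono)
  qed auto
  then have "(\<lambda>n. sqrt (LINT x|M. (norm (F n x - f x))\<^sup>2)) \<longlonglongrightarrow> sqrt (LINT x|M. 0)"
    by (rule tendsto_real_sqrt)
  then show ?thesis by (simp add: l2_norm_def)
qed

text \<open>A measurable function is the limit, off a negligible set, of continuous functions. These
  converge without any domination, so they are truncated in size and in space by continuous maps
  that do not affect \<open>f\<close>; dominated convergence then applies.\<close>

lemma l2_approx_bounded_measurable:
  fixes f :: "real ^ 'n \<Rightarrow> 'b::euclidean_space"
  assumes [measurable]: "f \<in> borel_measurable borel"
    and B: "\<And>x. norm (f x) \<le> B" and R: "\<And>x. norm x > R \<Longrightarrow> f x = 0" and "e > 0"
  shows "\<exists>g. continuous_on UNIV g \<and> (\<forall>x. norm x > R + 1 \<longrightarrow> g x = 0) \<and> l2_norm lborel (\<lambda>x. g x - f x) < e"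
proof -
  \<comment> \<open>Positive, which makes the quotient in \<open>c\<close> meaningful and
    continuous.\<close>
  define B' where "B' = max B 1"
  have B': "B' > 0" "\<And>x. norm (f x) \<le> B'" using B by (auto simp: B'_def intro: order_trans max.cobounded1)
  have "f \<in> borel_measurable (lebesgue_on UNIV)"
    unfolding lebesgue_on_UNIV_eq by (rule measurable_completion) simp
  then have "f measurable_on UNIV" by (intro lebesgue_measurable_imp_measurable_on) auto
  then obtain N g where N: "negligible N" and g: "\<And>n. continuous_on UNIV (g n)"
    and lim: "\<And>x. x \<notin> N \<Longrightarrow> (\<lambda>n. g n x) \<longlonglongrightarrow> f x"
    by (auto simp: measurable_on_def)
  \<comment> \<open>\<open>\<kappa>\<close> is 1 where \<open>norm x \<le> R\<close> and 0 beyond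
    \<open>R + 1\<close>; \<open>c\<close> is the radial retraction onto the ball of radius
    \<open>B'\<close>. Both leave \<open>f\<close> unchanged.\<close>
  define \<kappa> where "\<kappa> x = max 0 (min 1 (R + 1 - norm x))" for x :: "real ^ 'n"
  define c where "c y = (B' / max B' (norm y)) *\<^sub>R y" for y :: 'b
  define h where "h n x = \<kappa> x *\<^sub>R c (g n x)" for n x
  have c_bd: "norm (c y) \<le> B'" for y
    using B'(1) by (auto simp: c_def max_def field_simps)
  have c_id: "c (f x) = f x" for x
    using B' by (simp add: c_def max_absorb1)
  have c_cont: "continuous_on UNIV c"
    unfolding c_def using B'(1) by (intro continuous_intros) (auto simp: max_def)
  have h_cont: "continuous_on UNIV (h n)" for n
    unfolding h_def \<kappa>_def by (intro continuous_intros continuous_on_compose2[OF c_cont g]) auto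
  have [measurable]: "h n \<in> borel_measurable borel" for n
    by (rule borel_measurable_continuous_onI[OF h_cont])
  have \<kappa>01: "0 \<le> \<kappa> x" "\<kappa> x \<le> 1" for x by (auto simp: \<kappa>_def)
  have AE: "AE x in lborel. (\<lambda>n. h n x) \<longlonglongrightarrow> f x"
  proof -
    have "AE x in lebesgue. x \<notin> N" using N by (simp add: AE_not_in negligible_iff_null_sets)
    then have "AE x in lborel. x \<notin> N" by (simp add: AE_completion_iff)
    then show ?thesis
    proof eventually_elim
      case (elim x)
      have "isCont c (f x)" using c_cont by (simp add: continuous_on_eq_continuous_at)
      then have "(\<lambda>n. c (g n x)) \<longlonglongrightarrow> c (f x)" using lim[OF elim] isCont_tendsto_compose by blast
      then have "(\<lambda>n. h n x) \<longlonglongrightarrow> \<kappa> x *\<^sub>R f x" unfolding h_def c_id by (intro tendsto_intros)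
      moreover have "\<kappa> x *\<^sub>R f x = f x" using R[of x] by (cases "norm x > R") (auto simp: \<kappa>_def)
      ultimately show ?case by simp
    qed
  qed
  have hR: "h n x = 0" if "norm x > R + 1" for n x using that by (simp add: h_def \<kappa>_def)
  have "(\<lambda>n. l2_norm lborel (\<lambda>x. h n x - f x)) \<longlonglongrightarrow> 0"
  proof (rule l2_dominated_convergence)
    show "(\<lambda>x. 2 * B' * indicator (cball 0 (R + 1)) x) \<in> l2 lborel"
      by (rule l2_bounded_support[where B = "2 * B'" and R = "R + 1"]) (use B'(1) in \<open>auto simp: indicator_def\<close>)
    show "AE x in lborel. norm (h n x - f x) \<le> 2 * B' * indicator (cball 0 (R + 1)) x" for n
    proof (intro AE_I2)
      fix x
      have "norm (h n x) \<le> 1 * B'" unfolding h_def norm_scaleR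
        using \<kappa>01[of x] c_bd B' by (intro mult_mono) auto
      then have "norm (h n x - f x) \<le> 2 * B'" using B'(2)[of x] norm_triangle_ineq4[of "h n x" "f x"] by linarith
      then show "norm (h n x - f x) \<le> 2 * B' * indicator (cball 0 (R + 1)) x"
        using hR[of x n] R[of x] by (cases "norm x > R + 1") (auto simp: indicator_def)
    qed
  qed (use AE in auto)
  then obtain n where "l2_norm lborel (\<lambda>x. h n x - f x) < e"
    using order_tendstoD(2)[OF _ \<open>e > 0\<close>] eventually_happens'[OF sequentially_bot] by blast
  then show ?thesis using h_cont hR by blast
qed

lemma l2_approx_continuous:
  fixes f :: "real ^ 'n \<Rightarrow> 'b::euclidean_space"
  assumes f: "f \<in> l2 lborel" and R: "\<And>x. norm x > R \<Longrightarrow> f x = 0" and "e > 0"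
  shows "\<exists>g. continuous_on UNIV g \<and> (\<forall>x. norm x > R + 1 \<longrightarrow> g x = 0) \<and> l2_norm lborel (\<lambda>x. g x - f x) < e"
proof -
  have [measurable]: "f \<in> borel_measurable borel" using l2_measurable[OF f] by simp
  \<comment> \<open>Large values are replaced by zero, so \<open>F n\<close> is dominated by
    \<open>f\<close> and agrees with it at each point from some \<open>n\<close> on.\<close>
  define F where "F n x = (if norm (f x) \<le> real n then f x else 0)" for n :: nat and x
  have [measurable]: "F n \<in> borel_measurable borel" for n unfolding F_def by measurable
  have "(\<lambda>n. l2_norm lborel (\<lambda>x. F n x - f x)) \<longlonglongrightarrow> 0"
  proof (rule l2_dominated_convergence)
    show "(\<lambda>x. norm (f x)) \<in> l2 lborel" using f by (simp add: l2_def)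
    show "AE x in lborel. (\<lambda>n. F n x) \<longlonglongrightarrow> f x"
    proof (intro AE_I2 tendsto_eventually)
      fix x
      obtain m :: nat where "norm (f x) \<le> real m" using real_arch_simple by blast
      then show "\<forall>\<^sub>F n in sequentially. F n x = f x"
        by (auto simp: F_def eventually_sequentially intro!: exI[of _ m])
    qed
  qed (auto simp: F_def)
  then obtain n where n: "l2_norm lborel (\<lambda>x. F n x - f x) < e/2"
    using order_tendstoD(2)[of _ 0 sequentially "e/2"] \<open>e > 0\<close> eventually_happens'[OF sequentially_bot] by fastforce
  have "\<exists>g. continuous_on UNIV g \<and> (\<forall>x. norm x > R + 1 \<longrightarrow> g x = 0) \<and> l2_norm lborel (\<lambda>x. g x - F n x) < e/2"
    by (rule l2_approx_bounded_measurable[where B = "real n"]) (use R \<open>e > 0\<close> in \<open>auto simp: F_def\<close>)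
  then obtain g where g: "continuous_on UNIV g" "\<And>x. norm x > R + 1 \<Longrightarrow> g x = 0" "l2_norm lborel (\<lambda>x. g x - F n x) < e/2"
    by blast
  have F: "F n \<in> l2 lborel" by (rule l2_bounded[OF f, of _ 1]) (auto simp: F_def)
  have gl: "g \<in> l2 lborel" by (rule l2_continuous_bounded_support[OF g(1,2)])
  have "l2_norm lborel (\<lambda>x. g x - f x) < e"
    using l2_norm_triangle_diff[OF gl F f] g(3) n by simp
  then show ?thesis using g by blast
qed

lemma conv_diff:
  assumes "\<eta> \<in> test UNIV" "integrable lborel f" "integrable lborel g"
  shows "conv \<eta> (\<lambda>y. f y - g y) x = conv \<eta> f x - conv \<eta> g x"
  using conv_integrable[OF assms(1,2)] conv_integrable[OF assms(1,3)] by (simp add: conv_def scaleR_diff_right)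

lemma conv_moll_continuous_tendsto:
  fixes g :: "real ^ 'n \<Rightarrow> 'b::euclidean_space"
  assumes cont: "continuous_on UNIV g" and R: "\<And>x. norm x > R \<Longrightarrow> g x = 0" and "R > 0"
    and gl: "g \<in> l2 lborel" and "e > 0"
  shows "\<exists>N. \<forall>k\<ge>N. l2_norm lborel (\<lambda>x. conv (moll k) g x - g x) \<le> e"
proof -
  let ?V = "sqrt (measure lborel (cball (0 :: real ^ 'n) (R + 1)))"
  have int: "integrable lborel g" using gl R by (rule integrable_bounded_support)
  have V: "0 \<le> ?V" by simp
  \<comment> \<open>The uniform error allowed at each point; the summand 1 keeps the denominator
    positive without computing the volume.\<close>
  define e' where "e' = e / (?V + 1)"
  have "0 < ?V + 1" using V by linarith
  then have e': "e' > 0" "e' * (?V + 1) = e"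
    unfolding e'_def using \<open>e > 0\<close> by (simp_all only: divide_pos_pos) simp
  then have e': "e' > 0" "e' * ?V \<le> e" by (simp_all add: distrib_left)
  \<comment> \<open>Mollification moves points by at most 1. From inside radius \<open>R + 1\<close>
    it stays within \<open>R + 2\<close>; from outside radius \<open>R + 1\<close> it stays outside
    \<open>R\<close>, where \<open>g\<close> vanishes.\<close>
  have "uniformly_continuous_on (cball 0 (R + 2)) g"
    using cont by (intro compact_uniformly_continuous) (auto intro: continuous_on_subset)
  then obtain d where d: "d > 0" "\<And>x y. x \<in> cball 0 (R + 2) \<Longrightarrow> y \<in> cball 0 (R + 2) \<Longrightarrow> dist y x < d \<Longrightarrow> dist (g y) (g x) < e'"
    using \<open>e' > 0\<close> unfolding uniformly_continuous_on_def by metis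
  obtain N where N: "1 / real (Suc N) < d" using \<open>d > 0\<close> nat_approx_posE by metis
  have "l2_norm lborel (\<lambda>x. conv (moll k) g x - g x) \<le> e" if "k \<ge> N" for k
  proof -
    have "1 / real (Suc k) \<le> 1 / real (Suc N)" using that by (intro divide_left_mono) auto
    then have k: "1 / real (Suc k) < d" "1 / real (Suc k) \<le> 1" using N by auto
    have small: "norm (g y - g x) \<le> e'" if "norm (x - y) < 1 / real (Suc k)" for x y
    proof (cases "norm x > R + 1")
      case True
      then have "norm y > R" using that k(2) norm_triangle_ineq2[of x y] by linarith
      then show ?thesis using R[of x] R[of y] True e' by simp
    next
      case False
      then have "norm y \<le> R + 2" using that k(2) norm_triangle_ineq2[of y x] unfolding norm_minus_commute[of x y] by linarith
      then show ?thesis using d(2)[of x y] that k(1) False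
        by (simp add: dist_norm norm_minus_commute less_imp_le)
    qed
    have bd: "norm (conv (moll k) g x - g x) \<le> e'" for x
    proof -
      have mi: "integrable lborel (\<lambda>y. moll k (x - y))" by (rule test_integrable[OF test_reflect[OF moll_test]])
      have "conv (moll k) g x - g x = (LINT y|lborel. moll k (x - y) *\<^sub>R g y) - (LINT y|lborel. moll k (x - y) *\<^sub>R g x)"
        using integral_moll_reflect[of k x] mi by (simp add: conv_def)
      also have "\<dots> = (LINT y|lborel. moll k (x - y) *\<^sub>R (g y - g x))"
        using conv_integrable[OF moll_test int, of k x] mi by (simp add: scaleR_diff_right)
      also have "norm \<dots> \<le> (LINT y|lborel. norm (moll k (x - y) *\<^sub>R (g y - g x)))"
        by (rule integral_norm_bound)
      also have "\<dots> \<le> (LINT y|lborel. e' * moll k (x - y))"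
      proof (rule integral_mono)
        show "norm (moll k (x - y) *\<^sub>R (g y - g x)) \<le> e' * moll k (x - y)" for y
        proof (cases "norm (x - y) < 1 / real (Suc k)")
          case True
          then show ?thesis
            using mult_right_mono[OF small[OF True] moll_nonneg[of k "x - y"]] by (simp add: mult.commute)
        qed (use moll_eq_0[of k "x - y"] in auto)
        show "integrable lborel (\<lambda>y. norm (moll k (x - y) *\<^sub>R (g y - g x)))"
          using conv_integrable[OF moll_test int, of k x] mi by (auto simp: scaleR_diff_right simp del: norm_scaleR)
      qed (use mi in auto)
      also have "\<dots> = e'" by (simp add: integral_moll_reflect)
      finally show ?thesis .
    qed
    have supp: "conv (moll k) g x - g x = 0" if "norm x > R + 1" for x
    proof -
      have "conv (moll k) g x = 0"
      proof (rule conv_moll_eq_0)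
        fix y assume "norm (x - y) < 1 / real (Suc k)"
        then show "g y = 0" using that k(2) norm_triangle_ineq2[of x y] by (intro R) linarith
      qed
      then show ?thesis using R[of x] that by simp
    qed
    have [measurable]: "conv (moll k) g \<in> borel_measurable borel" "g \<in> borel_measurable borel"
      using smooth_borel[OF conv_smooth[OF moll_test int]] borel_measurable_continuous_onI[OF cont] by auto
    have "l2_norm lborel (\<lambda>x. conv (moll k) g x - g x) \<le> e' * ?V"
      by (rule l2_norm_bounded_support) (use bd supp in auto)
    then show ?thesis using e' by simp
  qed
  then show ?thesis by blast
qed

text \<open>Mollification does not increase the L2 norm, so convergence carries over from a nearby
  continuous function; the error of the approximation is paid twice.\<close>

lemma conv_moll_tendsto:
  fixes f :: "real ^ 'n \<Rightarrow> 'b::euclidean_space"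
  assumes f: "f \<in> l2 lborel" and R: "\<And>x. norm x > R \<Longrightarrow> f x = 0"
  shows "(\<lambda>k. l2_norm lborel (\<lambda>x. conv (moll k) f x - f x)) \<longlonglongrightarrow> 0"
proof (rule LIMSEQ_I)
  fix e :: real assume "e > 0"
  define S where "S = max R 1"
  have S: "S > 0" "\<And>x. norm x > S \<Longrightarrow> f x = 0" using R by (auto simp: S_def)
  have "\<exists>g. continuous_on UNIV g \<and> (\<forall>x. norm x > S + 1 \<longrightarrow> g x = 0) \<and> l2_norm lborel (\<lambda>x. g x - f x) < e/4"
    by (rule l2_approx_continuous[OF f S(2)]) (use \<open>e > 0\<close> in auto)
  then obtain g where g: "continuous_on UNIV g" "\<And>x. norm x > S + 1 \<Longrightarrow> g x = 0" "l2_norm lborel (\<lambda>x. g x - f x) < e/4"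
    by blast
  have gl: "g \<in> l2 lborel" by (rule l2_continuous_bounded_support[OF g(1,2)])
  have fi: "integrable lborel f" using f R by (rule integrable_bounded_support)
  have gi: "integrable lborel g" using gl g(2) by (rule integrable_bounded_support)
  obtain N where N: "\<And>k. k \<ge> N \<Longrightarrow> l2_norm lborel (\<lambda>x. conv (moll k) g x - g x) \<le> e/4"
    using conv_moll_continuous_tendsto[of g "S + 1" "e/4"] g(1,2) gl S(1) \<open>e > 0\<close> by auto
  have "l2_norm lborel (\<lambda>x. conv (moll k) f x - f x) < e" if "k \<ge> N" for k
  proof -
    have "l2_norm lborel (\<lambda>x. conv (moll k) f x - conv (moll k) g x) \<le> l2_norm lborel (\<lambda>x. f x - g x)"
      using conv_moll_l2(2)[OF l2_diff[OF f gl] Bochner_Integration.integrable_diff[OF fi gi], of k]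
      unfolding conv_diff[OF moll_test fi gi, abs_def] .
    then have 1: "l2_norm lborel (\<lambda>x. conv (moll k) f x - conv (moll k) g x) < e/4"
      using g(3) unfolding l2_norm_minus_commute[of lborel f g] by linarith
    have "l2_norm lborel (\<lambda>x. conv (moll k) f x - f x) \<le>
      l2_norm lborel (\<lambda>x. conv (moll k) f x - conv (moll k) g x) + l2_norm lborel (\<lambda>x. conv (moll k) g x - f x)"
      by (rule l2_norm_triangle_diff) (intro conv_moll_l2 f gl fi gi)+
    also have "l2_norm lborel (\<lambda>x. conv (moll k) g x - f x) \<le>
      l2_norm lborel (\<lambda>x. conv (moll k) g x - g x) + l2_norm lborel (\<lambda>x. g x - f x)"
      by (rule l2_norm_triangle_diff) (intro conv_moll_l2 f gl fi gi)+
    finally show ?thesis using 1 N[OF that] g(3) \<open>e > 0\<close> by simp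
  qed
  then show "\<exists>N. \<forall>k\<ge>N. norm (l2_norm lborel (\<lambda>x. conv (moll k) f x - f x) - 0) < e" by auto
qed

subsection \<open>Korn's inequality\<close>

text \<open>The classical counterpart of \<open>eps\<close>. The latter is built from chosen weak
  derivatives and is fixed only almost everywhere, whereas mollifications have to be compared at
  every point.\<close>

definition sgrad :: "(real ^ 'n \<Rightarrow> real ^ 'n) \<Rightarrow> real ^ 'n \<Rightarrow> real ^ 'n ^ 'n" where
  "sgrad \<phi> x = (\<chi> i j. (partial j \<phi> x $ i + partial i \<phi> x $ j) / 2)"

lemma norm_matrix_sq: "(norm (A :: real ^ 'n ^ 'm))\<^sup>2 = (\<Sum>i\<in>UNIV. \<Sum>j\<in>UNIV. (A $ i $ j)\<^sup>2)"
  by (simp add: power2_norm_eq_inner inner_vec_def) (simp add: power2_eq_square)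

lemma sgrad_test: "\<phi> \<in> test \<Omega> \<Longrightarrow> sgrad \<phi> \<in> test \<Omega>"
  unfolding sgrad_def[abs_def]
proof (intro test_vec_lambda)
  fix i j
  assume "\<phi> \<in> test \<Omega>"
  then have "(\<lambda>x. (1/2) *\<^sub>R (partial j \<phi> x $ i + partial i \<phi> x $ j)) \<in> test \<Omega>"
    by (intro test_scaleR test_add test_bounded_linear[OF bounded_linear_vec_nth] test_partial)
  then show "(\<lambda>x. (partial j \<phi> x $ i + partial i \<phi> x $ j) / 2) \<in> test \<Omega>" by simp
qed

text \<open>Pointwise, twice the square of the symmetric gradient is the square of the gradient plus
  the sum of the products \<open>\<partial>\<close>-wise transposed, \<open>partial j\<close> of
  component \<open>i\<close> times \<open>partial i\<close> of component \<open>j\<close>.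
  Exchanging the two derivatives under the integral turns this sum into the integral of the squared
  divergence, which is nonnegative. Hence the constant 2.\<close>

lemma korn:
  fixes \<phi> :: "real ^ 'n \<Rightarrow> real ^ 'n"
  assumes t: "\<phi> \<in> test UNIV"
  shows "(\<Sum>j\<in>UNIV. (l2_norm lborel (partial j \<phi>))\<^sup>2) \<le> 2 * (l2_norm lborel (sgrad \<phi>))\<^sup>2"
proof -
  let ?c = "\<lambda>i x. \<phi> x $ i"
  have c: "?c i \<in> test UNIV" for i by (rule test_bounded_linear[OF bounded_linear_vec_nth t])
  have pc: "partial j (?c i) x = partial j \<phi> x $ i" for i j x
    by (rule partial_bounded_linear[OF bounded_linear_vec_nth test_smooth[OF t]])
  note pl = test_l2[OF test_partial[OF c]]
  have int: "integrable lborel (\<lambda>x. partial j (?c i) x * partial l (?c k) x)" for i j k l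
    using l2_inner_integrable[OF pl[of j i] pl[of l k]] by simp
  have pw: "2 * (norm (sgrad \<phi> x))\<^sup>2
      = (\<Sum>j\<in>UNIV. (norm (partial j \<phi> x))\<^sup>2) + (\<Sum>i\<in>UNIV. \<Sum>j\<in>UNIV. partial j (?c i) x * partial i (?c j) x)" for x
  proof -
    let ?a = "\<lambda>i j. partial j \<phi> x $ i"
    have "2 * (norm (sgrad \<phi> x))\<^sup>2 = (\<Sum>i\<in>UNIV. \<Sum>j\<in>UNIV. (?a i j)\<^sup>2 / 2 + (?a j i)\<^sup>2 / 2 + ?a i j * ?a j i)"
      unfolding norm_matrix_sq sgrad_def sum_distrib_left
      by (intro sum.cong refl) (simp add: power2_eq_square field_simps)
    also have "\<dots> = (\<Sum>i\<in>UNIV. \<Sum>j\<in>UNIV. (?a i j)\<^sup>2 / 2) + (\<Sum>i\<in>UNIV. \<Sum>j\<in>UNIV. (?a j i)\<^sup>2 / 2)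
        + (\<Sum>i\<in>UNIV. \<Sum>j\<in>UNIV. ?a i j * ?a j i)"
      by (simp add: sum.distrib)
    also have "(\<Sum>i\<in>UNIV. \<Sum>j\<in>UNIV. (?a i j)\<^sup>2 / 2) = (\<Sum>i\<in>UNIV. \<Sum>j\<in>UNIV. (?a j i)\<^sup>2 / 2)"
      by (rule sum.swap)
    also have "(\<Sum>i\<in>UNIV. \<Sum>j\<in>UNIV. (?a j i)\<^sup>2 / 2) + (\<Sum>i\<in>UNIV. \<Sum>j\<in>UNIV. (?a j i)\<^sup>2 / 2)
        = (\<Sum>j\<in>UNIV. (norm (partial j \<phi> x))\<^sup>2)"
      unfolding power2_norm_eq_inner inner_vec_def by (simp add: power2_eq_square flip: sum.distrib)
    finally show ?thesis by (simp add: pc)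
  qed
  have "2 * (l2_norm lborel (sgrad \<phi>))\<^sup>2 = (LINT x|lborel. 2 * (norm (sgrad \<phi> x))\<^sup>2)"
    by (simp add: l2_norm_sq)
  also have "\<dots> = (\<Sum>j\<in>UNIV. (l2_norm lborel (partial j \<phi>))\<^sup>2)
      + (\<Sum>i\<in>UNIV. \<Sum>j\<in>UNIV. l2_inner lborel (partial j (?c i)) (partial i (?c j)))"
    unfolding pw l2_norm_sq l2_inner_def
    using int l2_integrable[OF test_l2[OF test_partial[OF t]]] by (simp add: inner_real_def)
  also have "(\<Sum>i\<in>UNIV. \<Sum>j\<in>UNIV. l2_inner lborel (partial j (?c i)) (partial i (?c j)))
      = (\<Sum>i\<in>UNIV. \<Sum>j\<in>UNIV. l2_inner lborel (partial i (?c i)) (partial j (?c j)))"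
    by (intro sum.cong refl test_swap_partial c)
  also have "\<dots> = (LINT x|lborel. (\<Sum>i\<in>UNIV. partial i (?c i) x)\<^sup>2)"
    using int by (simp add: l2_inner_def power2_eq_square sum_product)
  finally show ?thesis by (simp add: integral_nonneg_AE)
qed

subsection \<open>Functions on an open set and their extensions by zero\<close>

lemma borel_measurable_lebesgue_on: "f \<in> borel_measurable borel \<Longrightarrow> f \<in> borel_measurable (lebesgue_on \<Omega>)"
  by (intro measurable_restrict_space1 measurable_completion) simp

text \<open>The link between the two measures in play: the problems are posed on
  \<open>lebesgue_on \<Omega>\<close>, while translations and convolutions act on Borel functions
  under \<open>lborel\<close>.\<close>

lemma integral_lebesgue_on_zero_outside:
  fixes f :: "'a::euclidean_space \<Rightarrow> 'b::euclidean_space"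
  assumes f: "f \<in> borel_measurable borel" and \<Omega>: "\<Omega> \<in> sets borel" and zero: "\<And>x. x \<notin> \<Omega> \<Longrightarrow> f x = 0"
  shows "integral\<^sup>L (lebesgue_on \<Omega>) f = integral\<^sup>L lborel f"
    "integrable (lebesgue_on \<Omega>) f \<longleftrightarrow> integrable lborel f"
proof -
  have eq: "(\<lambda>x. indicator \<Omega> x *\<^sub>R f x) = f" using zero by (auto simp: indicator_def)
  have \<Omega>': "\<Omega> \<inter> space lebesgue \<in> sets lebesgue" using \<Omega> by (simp add: sets_completionI_sets)
  show "integral\<^sup>L (lebesgue_on \<Omega>) f = integral\<^sup>L lborel f"
    unfolding integral_restrict_space[OF \<Omega>'] eq using f by (intro integral_completion) simp
  show "integrable (lebesgue_on \<Omega>) f \<longleftrightarrow> integrable lborel f"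
    unfolding integrable_restrict_space[OF \<Omega>'] eq using f by (intro integrable_completion) simp
qed

lemma l2_zero_outside:
  assumes "f \<in> borel_measurable borel" and "\<Omega> \<in> sets borel" and "\<And>x. x \<notin> \<Omega> \<Longrightarrow> f x = 0"
  shows "f \<in> l2 (lebesgue_on \<Omega>) \<longleftrightarrow> f \<in> l2 lborel"
    "l2_norm (lebesgue_on \<Omega>) f = l2_norm lborel f"
  using integral_lebesgue_on_zero_outside[of "\<lambda>x. (norm (f x))\<^sup>2" \<Omega>] assms
  by (simp_all add: l2_def l2_norm_def borel_measurable_lebesgue_on)

lemma l2_restrict:
  assumes f: "f \<in> l2 lborel" and \<Omega>: "\<Omega> \<in> sets borel"
  shows "f \<in> l2 (lebesgue_on \<Omega>)" "l2_norm (lebesgue_on \<Omega>) f \<le> l2_norm lborel f"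
proof -
  have [measurable]: "f \<in> borel_measurable borel" using l2_measurable[OF f] by simp
  note [measurable] = \<Omega>
  let ?F = "\<lambda>x. indicator \<Omega> x *\<^sub>R f x"
  have F: "?F \<in> borel_measurable borel" by measurable
  have bd: "norm (?F x) \<le> 1 * norm (f x)" for x by (simp add: indicator_def)
  have Fl: "?F \<in> l2 lborel" by (rule l2_bounded[OF f, of _ 1]) (use F bd in auto)
  then have F\<Omega>: "?F \<in> l2 (lebesgue_on \<Omega>)" using l2_zero_outside(1)[OF F \<Omega>] by simp
  have ae: "AE x in lebesgue_on \<Omega>. ?F x = f x" by (rule AE_I2) simp
  have fm: "f \<in> borel_measurable (lebesgue_on \<Omega>)" by (rule borel_measurable_lebesgue_on) simp
  show "f \<in> l2 (lebesgue_on \<Omega>)" by (rule l2_cong_AE[OF F\<Omega> fm ae])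
  have "l2_norm (lebesgue_on \<Omega>) f = l2_norm (lebesgue_on \<Omega>) ?F"
    by (rule l2_norm_cong_AE[symmetric, OF ae l2_measurable[OF F\<Omega>] fm])
  also have "\<dots> = l2_norm lborel ?F" using l2_zero_outside(2)[OF F \<Omega>] by simp
  also have "\<dots> \<le> l2_norm lborel f" by (rule l2_norm_mono[OF f]) (use F bd in auto)
  finally show "l2_norm (lebesgue_on \<Omega>) f \<le> l2_norm lborel f" .
qed

text \<open>Elements of the function spaces are Lebesgue measurable on \<Omega> and arbitrary
  elsewhere. The zero extension is measurable for the completed measure, and each of its coordinates
  has a Borel version, which makes mollification on the whole space possible.\<close>

lemma borel_representative:
  fixes g :: "'a::euclidean_space \<Rightarrow> 'b::euclidean_space"
  assumes g: "g \<in> borel_measurable (lebesgue_on \<Omega>)" and \<Omega>: "\<Omega> \<in> sets borel"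
  obtains G where "G \<in> borel_measurable borel" "\<And>x. x \<notin> \<Omega> \<Longrightarrow> G x = 0" "AE x in lebesgue_on \<Omega>. G x = g x"
proof -
  have \<Omega>l: "\<Omega> \<in> sets lebesgue" using \<Omega> by (simp add: sets_completionI_sets)
  define g0 where "g0 x = (if x \<in> \<Omega> then g x else 0)" for x
  have g0: "g0 \<in> borel_measurable lebesgue"
    unfolding g0_def by (rule iffD2[OF borel_measurable_if[OF \<Omega>l] g])
  have "\<exists>h\<in>borel_measurable lborel. AE x in lborel. g0 x \<bullet> b = (h x :: real)" for b
    using g0 by (intro completion_ex_borel_measurable_real) simp
  then obtain h where h: "\<And>b. h b \<in> borel_measurable borel" "\<And>b. AE x in lborel. g0 x \<bullet> b = h b x"
    using bchoice[of UNIV "\<lambda>b h. h \<in> borel_measurable lborel \<and> (AE x in lborel. g0 x \<bullet> b = h x)"]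
    by (auto simp: measurable_lborel1)
  define G where "G x = (if x \<in> \<Omega> then (\<Sum>b\<in>Basis. h b x *\<^sub>R b) else 0)" for x
  note [measurable] = h(1) \<Omega>
  have "AE x in lborel. \<forall>b\<in>Basis. g0 x \<bullet> b = h b x"
    by (intro AE_finite_allI h) auto
  then have "AE x in lborel. x \<in> \<Omega> \<longrightarrow> G x = g x"
  proof eventually_elim
    case (elim x)
    then have "(\<Sum>b\<in>Basis. h b x *\<^sub>R b) = (\<Sum>b\<in>Basis. (g0 x \<bullet> b) *\<^sub>R b)" by simp
    then show ?case by (simp add: G_def g0_def euclidean_representation)
  qed
  then have "AE x in lebesgue. x \<in> \<Omega> \<longrightarrow> G x = g x" by (rule AE_completion)
  then have "AE x in lebesgue_on \<Omega>. G x = g x"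
    using \<Omega>l by (simp add: AE_restrict_space_iff)
  moreover have "G \<in> borel_measurable borel" unfolding G_def by measurable
  ultimately show ?thesis using that[of G] by (auto simp: G_def)
qed

text \<open>The explicit gap to the complement leaves room for mollifying a function supported in
  \<open>K m\<close> without leaving \<Omega>.\<close>

lemma compact_exhaustion:
  fixes \<Omega> :: "'a::euclidean_space set"
  assumes "open \<Omega>"
  obtains K where "\<And>m. compact (K m)" "\<And>m x y. x \<in> K m \<Longrightarrow> dist x y < 1 / real (Suc m) \<Longrightarrow> y \<in> \<Omega>" "\<Omega> = (\<Union>m. K m)"
proof -
  define K where "K m = cball 0 (real m) \<inter> {x. \<forall>y\<in>-\<Omega>. 1 / real (Suc m) \<le> dist x y}" for m
  have "compact (K m)" for m
  proof -
    have "{x. \<forall>y\<in>-\<Omega>. 1 / real (Suc m) \<le> dist x y} = (\<Inter>y\<in>-\<Omega>. {x. 1 / real (Suc m) \<le> dist x y})"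
      by blast
    moreover have "closed \<dots>" by (intro closed_INT ballI closed_Collect_le continuous_intros)
    ultimately show ?thesis unfolding K_def by (intro compact_Int_closed compact_cball) simp
  qed
  moreover have "y \<in> \<Omega>" if "x \<in> K m" "dist x y < 1 / real (Suc m)" for m x y
    using that by (force simp: K_def)
  moreover have "\<Omega> = (\<Union>m. K m)"
  proof (intro equalityI subsetI)
    fix x assume "x \<in> \<Omega>"
    then obtain e where e: "e > 0" "\<And>y. dist y x < e \<Longrightarrow> y \<in> \<Omega>" using assms by (auto simp: open_dist)
    obtain m where m: "1 / real (Suc m) < e" using nat_approx_posE[OF e(1)] by metis
    obtain l :: nat where l: "norm x \<le> real l" using real_arch_simple by blast
    have "1 / real (Suc (max l m)) \<le> 1 / real (Suc m)" by (intro divide_left_mono) auto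
    with m have lt: "1 / real (Suc (max l m)) < e" by linarith
    have "1 / real (Suc (max l m)) \<le> dist x y" if "y \<notin> \<Omega>" for y
      using e(2)[of y] that lt unfolding dist_commute[of x y] by linarith
    moreover have "norm x \<le> real (max l m)" using l by linarith
    ultimately have "x \<in> K (max l m)" by (simp add: K_def)
    then show "x \<in> (\<Union>m. K m)" by blast
  next
    fix x assume "x \<in> (\<Union>m. K m)"
    then obtain m where "x \<in> K m" by blast
    then show "x \<in> \<Omega>" by (force simp: K_def)
  qed
  ultimately show ?thesis using that by blast
qed

lemma test_l2_on: "\<phi> \<in> test \<Omega> \<Longrightarrow> \<Omega>' \<in> sets borel \<Longrightarrow> \<phi> \<in> l2 (lebesgue_on \<Omega>')"
  by (intro l2_restrict test_l2 test_UNIV)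

text \<open>The test functions are mollifications of \<open>g\<close> itself, cut off to a compact
  \<open>K m\<close>. Their pairing with \<open>g\<close> vanishes once the radius fits into the gap
  around \<open>K m\<close>, and it tends to the squared norm of the cut-off function.\<close>

lemma du_bois_reymond:
  fixes g :: "real ^ 'n \<Rightarrow> 'b::euclidean_space"
  assumes \<Omega>: "open \<Omega>" and g: "g \<in> l2 (lebesgue_on \<Omega>)"
    and zero: "\<And>\<phi> :: real ^ 'n \<Rightarrow> 'b. \<phi> \<in> test \<Omega> \<Longrightarrow> l2_inner (lebesgue_on \<Omega>) g \<phi> = 0"
  shows "AE x in lebesgue_on \<Omega>. g x = 0"
proof -
  have \<Omega>b: "\<Omega> \<in> sets borel" using \<Omega> by simp
  have \<Omega>l: "\<Omega> \<in> sets lebesgue" using \<Omega>b by (simp add: sets_completionI_sets)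
  obtain G where G: "G \<in> borel_measurable borel" "\<And>x. x \<notin> \<Omega> \<Longrightarrow> G x = 0" "AE x in lebesgue_on \<Omega>. G x = g x"
    using borel_representative[OF l2_measurable[OF g] \<Omega>b] by metis
  note Gm = borel_measurable_lebesgue_on[OF G(1), of \<Omega>]
  have "G \<in> l2 (lebesgue_on \<Omega>)"
    by (rule l2_cong_AE[OF g Gm]) (use G(3) in \<open>eventually_elim, simp\<close>)
  then have Gl: "G \<in> l2 lborel" using l2_zero_outside(1)[OF G(1) \<Omega>b G(2)] by simp
  obtain K where K: "\<And>m. compact (K m)" "\<And>m x y. x \<in> K m \<Longrightarrow> dist x y < 1 / real (Suc m) \<Longrightarrow> y \<in> \<Omega>" "\<Omega> = (\<Union>m. K m)"
    using compact_exhaustion[OF \<Omega>] by metis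
  have "AE x in lborel. x \<in> K m \<longrightarrow> G x = 0" for m
  proof -
    define f where "f x = indicator (K m) x *\<^sub>R G x" for x
    have [measurable]: "G \<in> borel_measurable borel" "K m \<in> sets borel"
      using G(1) K(1) by (auto intro: borel_closed compact_imp_closed)
    have fb: "f \<in> borel_measurable borel" unfolding f_def by measurable
    have f: "f \<in> l2 lborel"
      by (rule l2_bounded[OF Gl, of _ 1]) (use fb in \<open>auto simp: f_def indicator_def\<close>)
    obtain R where R: "\<And>x. x \<in> K m \<Longrightarrow> norm x \<le> R"
      using K(1) compact_imp_bounded bounded_iff by metis
    then have fR: "f x = 0" if "norm x > R" for x using that by (auto simp: f_def indicator_def not_le[symmetric])
    have fi: "integrable lborel f" using f fR by (rule integrable_bounded_support)
    have zer: "l2_inner lborel (conv (moll k) f) G = 0" if k: "k > Suc m" for k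
    proof -
      have k': "1 / real (Suc k) < 1 / real (Suc m)" using k by (simp add: field_simps)
      define L where "L = {x + y | x y. x \<in> K m \<and> y \<in> cball 0 (1 / real (Suc k))}"
      have "conv (moll k) f \<in> test \<Omega>"
      proof (rule testI[OF conv_smooth[OF moll_test fi]])
        show "compact L" unfolding L_def by (intro compact_sums K compact_cball)
        show "L \<subseteq> \<Omega>" using K(2) k' by (fastforce simp: L_def dist_norm)
        show "conv (moll k) f x = 0" if "x \<notin> L" for x
        proof (rule conv_moll_eq_0)
          fix y assume y: "norm (x - y) < 1 / real (Suc k)"
          have "y \<notin> K m"
          proof
            assume "y \<in> K m"
            then have "y + (x - y) \<in> L" using y unfolding L_def by (intro CollectI exI[of _ y] exI[of _ "x - y"]) auto
            then show False using that by simp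
          qed
          then show "f y = 0" by (simp add: f_def)
        qed
      qed
      note t = this
      have "l2_inner lborel (conv (moll k) f) G = l2_inner (lebesgue_on \<Omega>) (conv (moll k) f) G"
        unfolding l2_inner_def using G test_borel[OF test_UNIV[OF t]]
        by (intro integral_lebesgue_on_zero_outside(1)[symmetric] \<Omega>b) auto
      also have "\<dots> = l2_inner (lebesgue_on \<Omega>) (conv (moll k) f) g"
        using G(3) Gm l2_measurable[OF g] l2_measurable[OF test_l2_on[OF t \<Omega>b]]
        by (intro l2_inner_cong_AE) auto
      also have "\<dots> = 0" using zero[OF t] by (simp add: l2_inner_commute)
      finally show ?thesis .
    qed
    have "(\<lambda>k. l2_inner lborel (conv (moll k) f) G) \<longlonglongrightarrow> l2_inner lborel f G"
      by (rule l2_inner_tendsto_left[OF conv_moll_l2(1)[OF f fi] f Gl conv_moll_tendsto[OF f fR]])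
    moreover have "(\<lambda>k. l2_inner lborel (conv (moll k) f) G) \<longlonglongrightarrow> 0"
      using zer by (intro tendsto_eventually) (auto simp: eventually_sequentially intro!: exI[of _ "Suc (Suc m)"])
    ultimately have "l2_inner lborel f G = 0" by (rule LIMSEQ_unique)
    moreover have "f x \<bullet> G x = f x \<bullet> f x" for x by (simp add: f_def indicator_def)
    ultimately have "l2_inner lborel f f = 0" by (simp add: l2_inner_def)
    then have "l2_norm lborel f = 0" using l2_norm_sq_inner[of lborel f] by simp
    then have "AE x in lborel. f x = 0" by (rule l2_norm_eq_0[OF f])
    then show ?thesis by eventually_elim (auto simp: f_def)
  qed
  then have "AE x in lborel. \<forall>m. x \<in> K m \<longrightarrow> G x = 0" by (intro iffD2[OF AE_all_countable] allI)
  then have "AE x in lborel. x \<in> \<Omega> \<longrightarrow> G x = 0" by eventually_elim (use K(3) in blast)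
  then have "AE x in lebesgue. x \<in> \<Omega> \<longrightarrow> G x = 0" by (rule AE_completion)
  then have "AE x in lebesgue_on \<Omega>. G x = 0" using \<Omega>l by (simp add: AE_restrict_space_iff)
  then show ?thesis using G(3) by eventually_elim simp
qed

subsection \<open>Weak derivatives\<close>

lemma L2_eq_l2: "L2 \<Omega> = l2 (lebesgue_on \<Omega>)"
  by (simp add: L2_def l2_def)

lemma ip_eq_l2_inner: "ip \<Omega> = l2_inner (lebesgue_on \<Omega>)"
  by (intro ext) (simp add: ip_def l2_inner_def)

text \<open>The definition uses scalar tests and an identity between vectors. The equivalent form
  with tests of the same type as \<open>f\<close> is an L2 pairing, in which limits can be taken
  directly; the two are compared along the vectors of \<open>Basis\<close>.\<close>

lemma has_weak_partial_iff:
  fixes f g :: "real ^ 'n \<Rightarrow> 'b::euclidean_space"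
  assumes \<Omega>: "open \<Omega>" and f: "f \<in> l2 (lebesgue_on \<Omega>)" and g: "g \<in> l2 (lebesgue_on \<Omega>)"
  shows "has_weak_partial \<Omega> j f g \<longleftrightarrow>
    (\<forall>\<psi>\<in>test \<Omega>. l2_inner (lebesgue_on \<Omega>) f (partial j \<psi>) = - l2_inner (lebesgue_on \<Omega>) g \<psi>)"
    (is "_ \<longleftrightarrow> ?R")
proof -
  let ?M = "lebesgue_on \<Omega>"
  have \<Omega>b: "\<Omega> \<in> sets borel" using \<Omega> by simp
  note tl2 = test_l2_on[OF _ \<Omega>b]
  have comp: "(LINT x|?M. \<phi> x *\<^sub>R h x) \<bullet> b = (LINT x|?M. \<phi> x * (h x \<bullet> b))"
    if "\<phi> \<in> l2 ?M" "h \<in> l2 ?M" for \<phi> and h :: "real ^ 'n \<Rightarrow> 'b" and b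
    using integral_inner_left[of b ?M "\<lambda>x. \<phi> x *\<^sub>R h x"] l2_scaleR_integrable[OF that(2,1)] by simp
  have eq: "has_weak_partial \<Omega> j f g \<longleftrightarrow> (\<forall>\<phi>\<in>test \<Omega>. \<forall>b\<in>Basis.
      (LINT x|?M. partial j \<phi> x * (f x \<bullet> b)) = - (LINT x|?M. \<phi> x * (g x \<bullet> b)))"
    unfolding has_weak_partial_def
    by (subst euclidean_eq_iff) (simp add: comp[OF tl2 g] comp[OF tl2[OF test_partial] f])
  show ?thesis
  proof
    assume "has_weak_partial \<Omega> j f g"
    then have *: "(LINT x|?M. partial j \<phi> x * (f x \<bullet> b)) = - (LINT x|?M. \<phi> x * (g x \<bullet> b))"
      if "\<phi> \<in> test \<Omega>" "b \<in> Basis" for \<phi> b using eq that by blast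
    show ?R
    proof
      fix \<psi> :: "real ^ 'n \<Rightarrow> 'b" assume \<psi>: "\<psi> \<in> test \<Omega>"
      have c: "(\<lambda>x. \<psi> x \<bullet> b) \<in> test \<Omega>" for b by (rule test_bounded_linear[OF bounded_linear_inner_left \<psi>])
      have pc: "partial j (\<lambda>x. \<psi> x \<bullet> b) x = partial j \<psi> x \<bullet> b" for b x
        by (rule partial_bounded_linear[OF bounded_linear_inner_left test_smooth[OF \<psi>]])
      have exp: "l2_inner ?M h \<phi> = (\<Sum>b\<in>Basis. (LINT x|?M. (\<phi> x \<bullet> b) * (h x \<bullet> b)))"
        if "h \<in> l2 ?M" "\<phi> \<in> l2 ?M" for h \<phi> :: "real ^ 'n \<Rightarrow> 'b"
      proof -
        have i: "integrable ?M (\<lambda>x. (\<phi> x \<bullet> b) * (h x \<bullet> b))" for b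
          using l2_inner_integrable[OF l2_bounded_linear[OF bounded_linear_inner_left that(2)]
              l2_bounded_linear[OF bounded_linear_inner_left that(1)]] by simp
        have "l2_inner ?M h \<phi> = (LINT x|?M. (\<Sum>b\<in>Basis. (\<phi> x \<bullet> b) * (h x \<bullet> b)))"
          unfolding l2_inner_def
          by (intro Bochner_Integration.integral_cong refl, subst euclidean_inner) (simp add: mult.commute)
        then show ?thesis using i by simp
      qed
      show "l2_inner ?M f (partial j \<psi>) = - l2_inner ?M g \<psi>"
        unfolding exp[OF f tl2[OF test_partial[OF \<psi>]]] exp[OF g tl2[OF \<psi>]]
        using *[OF c] by (simp add: pc sum_negf)
    qed
  next
    assume R: ?R
    show "has_weak_partial \<Omega> j f g"
      unfolding eq
    proof (intro ballI)
      fix \<phi> :: "real ^ 'n \<Rightarrow> real" and b :: 'b assume \<phi>: "\<phi> \<in> test \<Omega>" and "b \<in> Basis"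
      have t: "(\<lambda>x. \<phi> x *\<^sub>R b) \<in> test \<Omega>" by (rule test_bounded_linear[OF bounded_linear_scaleR_left \<phi>])
      have p: "partial j (\<lambda>x. \<phi> x *\<^sub>R b) x = partial j \<phi> x *\<^sub>R b" for x
        by (rule partial_bounded_linear[OF bounded_linear_scaleR_left test_smooth[OF \<phi>]])
      show "(LINT x|?M. partial j \<phi> x * (f x \<bullet> b)) = - (LINT x|?M. \<phi> x * (g x \<bullet> b))"
        using R[rule_format, OF t] by (simp add: p l2_inner_def)
    qed
  qed
qed

lemma has_weak_partial_unique:
  fixes f g g' :: "real ^ 'n \<Rightarrow> 'b::euclidean_space"
  assumes \<Omega>: "open \<Omega>" and l2: "f \<in> l2 (lebesgue_on \<Omega>)" "g \<in> l2 (lebesgue_on \<Omega>)" "g' \<in> l2 (lebesgue_on \<Omega>)"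
    and w: "has_weak_partial \<Omega> j f g" "has_weak_partial \<Omega> j f g'"
  shows "AE x in lebesgue_on \<Omega>. g x = g' x"
proof -
  have "AE x in lebesgue_on \<Omega>. g x - g' x = 0"
  proof (rule du_bois_reymond[OF \<Omega> l2_diff[OF l2(2,3)]])
    fix \<phi> :: "real ^ 'n \<Rightarrow> 'b" assume t: "\<phi> \<in> test \<Omega>"
    then show "l2_inner (lebesgue_on \<Omega>) (\<lambda>x. g x - g' x) \<phi> = 0"
      using w has_weak_partial_iff[OF \<Omega> l2(1,2)] has_weak_partial_iff[OF \<Omega> l2(1,3)]
        l2_inner_diff_left[OF l2(2,3) test_l2_on[OF t]] \<Omega> by simp
  qed
  then show ?thesis by eventually_elim simp
qed

text \<open>\<open>wpartial\<close> is a choice; exhibiting any square integrable weak derivative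
  determines the chosen one almost everywhere.\<close>

lemma wpartial_properties:
  assumes \<Omega>: "open \<Omega>" and l2: "f \<in> l2 (lebesgue_on \<Omega>)" "g \<in> l2 (lebesgue_on \<Omega>)"
    and w: "has_weak_partial \<Omega> j f g"
  shows "wpartial \<Omega> j f \<in> l2 (lebesgue_on \<Omega>)" "has_weak_partial \<Omega> j f (wpartial \<Omega> j f)"
    "AE x in lebesgue_on \<Omega>. wpartial \<Omega> j f x = g x"
proof -
  have "wpartial \<Omega> j f \<in> L2 \<Omega> \<and> has_weak_partial \<Omega> j f (wpartial \<Omega> j f)"
    unfolding wpartial_def by (rule someI[of _ g]) (use l2 w in \<open>simp add: L2_eq_l2\<close>)
  then show 1: "wpartial \<Omega> j f \<in> l2 (lebesgue_on \<Omega>)" and 2: "has_weak_partial \<Omega> j f (wpartial \<Omega> j f)"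
    by (auto simp: L2_eq_l2)
  show "AE x in lebesgue_on \<Omega>. wpartial \<Omega> j f x = g x"
    by (rule has_weak_partial_unique[OF \<Omega> l2(1) 1 l2(2) 2 w])
qed

lemma H1_wpartial:
  assumes "open \<Omega>" "f \<in> H1 \<Omega>"
  shows "f \<in> l2 (lebesgue_on \<Omega>)" "wpartial \<Omega> j f \<in> l2 (lebesgue_on \<Omega>)" "has_weak_partial \<Omega> j f (wpartial \<Omega> j f)"
proof -
  show f: "f \<in> l2 (lebesgue_on \<Omega>)" using assms(2) by (simp add: H1_def L2_eq_l2)
  obtain g where "g \<in> l2 (lebesgue_on \<Omega>)" "has_weak_partial \<Omega> j f g"
    using assms(2) by (auto simp: H1_def L2_eq_l2)
  then show "wpartial \<Omega> j f \<in> l2 (lebesgue_on \<Omega>)" "has_weak_partial \<Omega> j f (wpartial \<Omega> j f)"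
    using wpartial_properties[OF assms(1) f] by auto
qed

lemma H1I:
  assumes "f \<in> l2 (lebesgue_on \<Omega>)" "\<And>j. G j \<in> l2 (lebesgue_on \<Omega>)" "\<And>j. has_weak_partial \<Omega> j f (G j)"
  shows "f \<in> H1 \<Omega>"
  using assms by (auto simp: H1_def L2_eq_l2)

lemma integral_lebesgue_on_real_zero_outside:
  fixes h :: "real ^ 'n \<Rightarrow> real"
  assumes "open \<Omega>" "h \<in> borel_measurable borel" "\<And>x. x \<notin> \<Omega> \<Longrightarrow> h x = 0"
  shows "integral\<^sup>L (lebesgue_on \<Omega>) h = integral\<^sup>L lborel h"
  using integral_lebesgue_on_zero_outside(1)[OF assms(2) _ assms(3)] assms(1) by simp

lemma test_zero_outside: "\<phi> \<in> test \<Omega> \<Longrightarrow> x \<notin> \<Omega> \<Longrightarrow> \<phi> x = 0"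
  by (meson testE subsetD)

lemma integration_by_parts_on:
  fixes f :: "real ^ 'n \<Rightarrow> 'b::euclidean_space"
  assumes \<Omega>: "open \<Omega>" and f: "smooth f" and \<psi>: "\<psi> \<in> test \<Omega>"
  shows "l2_inner (lebesgue_on \<Omega>) f (partial j \<psi>) = - l2_inner (lebesgue_on \<Omega>) (partial j f) \<psi>"
proof -
  note [measurable] = smooth_borel[OF f] smooth_borel[OF smooth_partial[OF f], of j]
    test_borel[OF test_UNIV[OF \<psi>]] test_borel[OF test_UNIV[OF test_partial[OF \<psi>]], of j]
  have z: "\<psi> x = 0" "partial j \<psi> x = 0" if "x \<notin> \<Omega>" for x
    using test_zero_outside[OF \<psi> that] test_zero_outside[OF test_partial[OF \<psi>] that] by auto
  have "l2_inner (lebesgue_on \<Omega>) f (partial j \<psi>) = (LINT x|lborel. partial j \<psi> x \<bullet> f x)"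
    unfolding l2_inner_def by (subst integral_lebesgue_on_real_zero_outside[OF \<Omega>]) (auto simp: z inner_commute)
  also have "\<dots> = - (LINT x|lborel. \<psi> x \<bullet> partial j f x)"
    by (rule integration_by_parts[OF bounded_bilinear_inner test_UNIV[OF \<psi>] f])
  also have "(LINT x|lborel. \<psi> x \<bullet> partial j f x) = l2_inner (lebesgue_on \<Omega>) (partial j f) \<psi>"
    unfolding l2_inner_def by (subst integral_lebesgue_on_real_zero_outside[OF \<Omega>]) (auto simp: z inner_commute)
  finally show ?thesis .
qed

lemma has_weak_partial_smooth:
  assumes "open \<Omega>" "smooth f" "f \<in> l2 (lebesgue_on \<Omega>)" "partial j f \<in> l2 (lebesgue_on \<Omega>)"
  shows "has_weak_partial \<Omega> j f (partial j f)"
  unfolding has_weak_partial_iff[OF assms(1,3,4)]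
  using integration_by_parts_on[OF assms(1,2)] by (intro ballI)

lemma has_weak_partial_diff:
  fixes f g F G :: "real ^ 'n \<Rightarrow> 'b::euclidean_space"
  assumes \<Omega>: "open \<Omega>" and l2: "f \<in> l2 (lebesgue_on \<Omega>)" "g \<in> l2 (lebesgue_on \<Omega>)"
      "F \<in> l2 (lebesgue_on \<Omega>)" "G \<in> l2 (lebesgue_on \<Omega>)"
    and w: "has_weak_partial \<Omega> j f F" "has_weak_partial \<Omega> j g G"
  shows "has_weak_partial \<Omega> j (\<lambda>x. f x - g x) (\<lambda>x. F x - G x)"
  unfolding has_weak_partial_iff[OF \<Omega> l2_diff[OF l2(1,2)] l2_diff[OF l2(3,4)]]
proof
  fix \<psi> :: "real ^ 'n \<Rightarrow> 'b" assume t: "\<psi> \<in> test \<Omega>"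
  have tl: "\<psi> \<in> l2 (lebesgue_on \<Omega>)" "partial j \<psi> \<in> l2 (lebesgue_on \<Omega>)"
    using test_l2_on[OF t] test_l2_on[OF test_partial[OF t]] \<Omega> by auto
  then show "l2_inner (lebesgue_on \<Omega>) (\<lambda>x. f x - g x) (partial j \<psi>) = - l2_inner (lebesgue_on \<Omega>) (\<lambda>x. F x - G x) \<psi>"
    using w[unfolded has_weak_partial_iff[OF \<Omega> l2(1,3)] has_weak_partial_iff[OF \<Omega> l2(2,4)]] t
    by (simp add: l2_inner_diff_left l2)
qed

lemma has_weak_partial_limit:
  assumes \<Omega>: "open \<Omega>" and l2: "\<And>k. f k \<in> l2 (lebesgue_on \<Omega>)" "\<And>k. g k \<in> l2 (lebesgue_on \<Omega>)"
      "F \<in> l2 (lebesgue_on \<Omega>)" "G \<in> l2 (lebesgue_on \<Omega>)"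
    and w: "\<And>k. has_weak_partial \<Omega> j (f k) (g k)"
    and lim: "(\<lambda>k. l2_norm (lebesgue_on \<Omega>) (\<lambda>x. f k x - F x)) \<longlonglongrightarrow> 0"
      "(\<lambda>k. l2_norm (lebesgue_on \<Omega>) (\<lambda>x. g k x - G x)) \<longlonglongrightarrow> 0"
  shows "has_weak_partial \<Omega> j F G"
  unfolding has_weak_partial_iff[OF \<Omega> l2(3,4)]
proof
  fix \<psi> :: "real ^ 'a \<Rightarrow> 'b" assume t: "\<psi> \<in> test \<Omega>"
  have tl: "\<psi> \<in> l2 (lebesgue_on \<Omega>)" "partial j \<psi> \<in> l2 (lebesgue_on \<Omega>)"
    using test_l2_on[OF t] test_l2_on[OF test_partial[OF t]] \<Omega> by auto
  have "(\<lambda>k. l2_inner (lebesgue_on \<Omega>) (f k) (partial j \<psi>)) \<longlonglongrightarrow> l2_inner (lebesgue_on \<Omega>) F (partial j \<psi>)"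
    by (rule l2_inner_tendsto_left[OF l2(1,3) tl(2) lim(1)])
  moreover have "(\<lambda>k. - l2_inner (lebesgue_on \<Omega>) (g k) \<psi>) \<longlonglongrightarrow> - l2_inner (lebesgue_on \<Omega>) G \<psi>"
    by (intro tendsto_minus l2_inner_tendsto_left[OF l2(2,4) tl(1) lim(2)])
  moreover have "l2_inner (lebesgue_on \<Omega>) (f k) (partial j \<psi>) = - l2_inner (lebesgue_on \<Omega>) (g k) \<psi>" for k
    using w[of k] t unfolding has_weak_partial_iff[OF \<Omega> l2(1) l2(2)] by blast
  ultimately show "l2_inner (lebesgue_on \<Omega>) F (partial j \<psi>) = - l2_inner (lebesgue_on \<Omega>) G \<psi>"
    using LIMSEQ_unique by auto
qed

section \<open>The Sobolev norm and the closure of the test functions\<close>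

lemma H1_norm_sq:
  assumes \<Omega>: "open \<Omega>" and l2: "f \<in> l2 (lebesgue_on \<Omega>)" "\<And>j. G j \<in> l2 (lebesgue_on \<Omega>)"
    and w: "\<And>j. has_weak_partial \<Omega> j f (G j)"
  shows "(H1_norm \<Omega> f)\<^sup>2 = (l2_norm (lebesgue_on \<Omega>) f)\<^sup>2 + (\<Sum>j\<in>UNIV. (l2_norm (lebesgue_on \<Omega>) (G j))\<^sup>2)"
proof -
  have "l2_norm (lebesgue_on \<Omega>) (wpartial \<Omega> j f) = l2_norm (lebesgue_on \<Omega>) (G j)" for j
    using wpartial_properties[OF \<Omega> l2(1,2) w, of j] l2_measurable l2(2)[of j]
    by (intro l2_norm_cong_AE) auto
  then show ?thesis
    by (simp add: H1_norm_def ip_eq_l2_inner sum_nonneg flip: l2_norm_sq_inner)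
qed

lemma H1_0I:
  fixes f :: "real ^ 'n \<Rightarrow> 'b::euclidean_space"
  assumes \<Omega>: "open \<Omega>" and l2: "f \<in> l2 (lebesgue_on \<Omega>)" "\<And>j. G j \<in> l2 (lebesgue_on \<Omega>)"
    and w: "\<And>j. has_weak_partial \<Omega> j f (G j)"
    and approx: "\<And>e. e > 0 \<Longrightarrow> \<exists>\<phi>\<in>test \<Omega>. l2_norm (lebesgue_on \<Omega>) (\<lambda>x. f x - \<phi> x) < e \<and>
      (\<forall>j. l2_norm (lebesgue_on \<Omega>) (\<lambda>x. G j x - partial j \<phi> x) < e)"
  shows "f \<in> H1_0 \<Omega>"
proof -
  have "\<exists>\<phi>\<in>test \<Omega>. H1_norm \<Omega> (\<lambda>x. f x - \<phi> x) < e" if "e > 0" for e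
  proof -
    let ?n = "real (CARD('n) + 1)"
    \<comment> \<open>The squared norm has one term for the function and one for each of the
      \<open>CARD('n)\<close> derivatives.\<close>
    define d where "d = e / sqrt ?n"
    have d: "d > 0" using \<open>e > 0\<close> by (simp add: d_def)
    obtain \<phi> where \<phi>: "\<phi> \<in> test \<Omega>" "l2_norm (lebesgue_on \<Omega>) (\<lambda>x. f x - \<phi> x) < d"
      "\<And>j. l2_norm (lebesgue_on \<Omega>) (\<lambda>x. G j x - partial j \<phi> x) < d"
      using approx[OF d] by blast
    have tl: "\<phi> \<in> l2 (lebesgue_on \<Omega>)" "partial j \<phi> \<in> l2 (lebesgue_on \<Omega>)" for j
      using test_l2_on[OF \<phi>(1)] test_l2_on[OF test_partial[OF \<phi>(1)]] \<Omega> by auto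
    have "has_weak_partial \<Omega> j (\<lambda>x. f x - \<phi> x) (\<lambda>x. G j x - partial j \<phi> x)" for j
      by (rule has_weak_partial_diff[OF \<Omega> l2(1) tl(1) l2(2) tl(2) w
            has_weak_partial_smooth[OF \<Omega> test_smooth[OF \<phi>(1)] tl]])
    from H1_norm_sq[OF \<Omega> l2_diff[OF l2(1) tl(1)] l2_diff[OF l2(2) tl(2)] this]
    have "(H1_norm \<Omega> (\<lambda>x. f x - \<phi> x))\<^sup>2 = (l2_norm (lebesgue_on \<Omega>) (\<lambda>x. f x - \<phi> x))\<^sup>2
        + (\<Sum>j\<in>UNIV. (l2_norm (lebesgue_on \<Omega>) (\<lambda>x. G j x - partial j \<phi> x))\<^sup>2)" .
    also have "\<dots> < d\<^sup>2 + (\<Sum>j\<in>(UNIV::'n set). d\<^sup>2)"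
      by (intro add_less_le_mono sum_mono power_strict_mono[OF \<phi>(2)] power_mono[OF less_imp_le[OF \<phi>(3)]]) auto
    also have "\<dots> = d\<^sup>2 * ?n" by (simp add: algebra_simps)
    also have "\<dots> = e\<^sup>2" by (simp add: d_def power_divide)
    finally have "H1_norm \<Omega> (\<lambda>x. f x - \<phi> x) < e" using \<open>e > 0\<close> by (simp add: power_less_imp_less_base)
    then show ?thesis using \<phi>(1) by blast
  qed
  then show ?thesis using H1I[OF l2 w] by (simp add: H1_0_def)
qed

lemma H1_0_H1: "f \<in> H1_0 \<Omega> \<Longrightarrow> f \<in> H1 \<Omega>"
  by (simp add: H1_0_def)

lemma H1_0_sequence:
  assumes \<Omega>: "open \<Omega>" and f: "f \<in> H1_0 \<Omega>"
  shows "\<exists>\<phi>. (\<forall>k::nat. \<phi> k \<in> test \<Omega>) \<and> (\<lambda>k. l2_norm (lebesgue_on \<Omega>) (\<lambda>x. \<phi> k x - f x)) \<longlonglongrightarrow> 0 \<and>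
    (\<forall>j. (\<lambda>k. l2_norm (lebesgue_on \<Omega>) (\<lambda>x. partial j (\<phi> k) x - wpartial \<Omega> j f x)) \<longlonglongrightarrow> 0)"
proof -
  note h1 = H1_wpartial[OF \<Omega> H1_0_H1[OF f]]
  have "\<exists>\<phi>\<in>test \<Omega>. H1_norm \<Omega> (\<lambda>x. f x - \<phi> x) < 1 / real (Suc k)" for k
    using f by (simp add: H1_0_def)
  then obtain \<phi> where \<phi>: "\<And>k. \<phi> k \<in> test \<Omega>" "\<And>k. H1_norm \<Omega> (\<lambda>x. f x - \<phi> k x) < 1 / real (Suc k)"
    by metis
  have tl: "\<phi> k \<in> l2 (lebesgue_on \<Omega>)" "partial j (\<phi> k) \<in> l2 (lebesgue_on \<Omega>)" for j k
    using test_l2_on[OF \<phi>(1)] test_l2_on[OF test_partial[OF \<phi>(1)]] \<Omega> by auto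
  have "has_weak_partial \<Omega> j (\<lambda>x. f x - \<phi> k x) (\<lambda>x. wpartial \<Omega> j f x - partial j (\<phi> k) x)" for j k
    by (rule has_weak_partial_diff[OF \<Omega> h1(1) tl(1) h1(2) tl(2) h1(3)
          has_weak_partial_smooth[OF \<Omega> test_smooth[OF \<phi>(1)] tl]])
  note sq = H1_norm_sq[OF \<Omega> l2_diff[OF h1(1) tl(1)] l2_diff[OF h1(2) tl(2)] this]
  have nn: "0 \<le> H1_norm \<Omega> (\<lambda>x. f x - \<phi> k x)" for k
    unfolding H1_norm_def by (simp add: ip_eq_l2_inner sum_nonneg flip: l2_norm_sq_inner)
  have "l2_norm (lebesgue_on \<Omega>) (\<lambda>x. f x - \<phi> k x) \<le> H1_norm \<Omega> (\<lambda>x. f x - \<phi> k x)" for k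
    by (rule power2_le_imp_le[OF _ nn]) (simp add: sq sum_nonneg)
  moreover have "l2_norm (lebesgue_on \<Omega>) (\<lambda>x. wpartial \<Omega> j f x - partial j (\<phi> k) x) \<le> H1_norm \<Omega> (\<lambda>x. f x - \<phi> k x)" for j k
  proof (rule power2_le_imp_le[OF _ nn])
    have "(l2_norm (lebesgue_on \<Omega>) (\<lambda>x. wpartial \<Omega> j f x - partial j (\<phi> k) x))\<^sup>2
        \<le> (\<Sum>j\<in>UNIV. (l2_norm (lebesgue_on \<Omega>) (\<lambda>x. wpartial \<Omega> j f x - partial j (\<phi> k) x))\<^sup>2)"
      by (rule member_le_sum) auto
    then show "(l2_norm (lebesgue_on \<Omega>) (\<lambda>x. wpartial \<Omega> j f x - partial j (\<phi> k) x))\<^sup>2 \<le> (H1_norm \<Omega> (\<lambda>x. f x - \<phi> k x))\<^sup>2"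
      unfolding sq by (simp add: add_increasing)
  qed
  moreover have inv: "(\<lambda>k. 1 / real (Suc k)) \<longlonglongrightarrow> 0" by (rule LIMSEQ_Suc[OF lim_1_over_n])
  moreover have le: "H1_norm \<Omega> (\<lambda>x. f x - \<phi> k x) \<le> 1 / real (Suc k)" for k
    using \<phi>(2)[of k] by simp
  ultimately have "norm (l2_norm (lebesgue_on \<Omega>) (\<lambda>x. \<phi> k x - f x)) \<le> 1 / real (Suc k)"
    "norm (l2_norm (lebesgue_on \<Omega>) (\<lambda>x. partial j (\<phi> k) x - wpartial \<Omega> j f x)) \<le> 1 / real (Suc k)" for j k
    unfolding l2_norm_minus_commute[of _ _ f] l2_norm_minus_commute[of _ _ "wpartial \<Omega> j f"]
    by (simp_all only: real_norm_def abs_of_nonneg[OF l2_norm_nonneg]) (blast intro: order_trans)+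
  then show ?thesis
    by (intro exI[of _ \<phi>] conjI allI \<phi>(1) Lim_null_comparison[OF always_eventually inv])
qed

subsection \<open>The divergence\<close>

definition pdiv :: "(real ^ 'n \<Rightarrow> real ^ 'n) \<Rightarrow> real ^ 'n \<Rightarrow> real" where
  "pdiv \<phi> x = (\<Sum>j\<in>UNIV. partial j \<phi> x $ j)"

lemma pdiv_test: "\<phi> \<in> test \<Omega> \<Longrightarrow> pdiv \<phi> \<in> test \<Omega>"
  unfolding pdiv_def[abs_def]
  by (intro test_sum test_bounded_linear[OF bounded_linear_vec_nth] test_partial)

lemma pgrad_test: "\<phi> \<in> test \<Omega> \<Longrightarrow> (\<lambda>x. \<chi> j. partial j \<phi> x) \<in> test \<Omega>"
  by (intro test_vec_lambda test_partial)

lemma has_weak_div_iff: "has_weak_div \<Omega> v g \<longleftrightarrow>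
    (\<forall>\<phi>\<in>test \<Omega>. l2_inner (lebesgue_on \<Omega>) v (\<lambda>x. \<chi> j. partial j \<phi> x) = - l2_inner (lebesgue_on \<Omega>) g \<phi>)"
  by (simp add: has_weak_div_def ip_eq_l2_inner)

lemma has_weak_div_unique:
  assumes \<Omega>: "open \<Omega>" and l2: "g \<in> l2 (lebesgue_on \<Omega>)" "g' \<in> l2 (lebesgue_on \<Omega>)"
    and w: "has_weak_div \<Omega> v g" "has_weak_div \<Omega> v g'"
  shows "AE x in lebesgue_on \<Omega>. g x = g' x"
proof -
  have "AE x in lebesgue_on \<Omega>. g x - g' x = 0"
  proof (rule du_bois_reymond[OF \<Omega> l2_diff[OF l2]])
    fix \<phi> :: "real ^ 'a \<Rightarrow> real" assume t: "\<phi> \<in> test \<Omega>"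
    then show "l2_inner (lebesgue_on \<Omega>) (\<lambda>x. g x - g' x) \<phi> = 0"
      using w l2_inner_diff_left[OF l2 test_l2_on[OF t]] \<Omega> by (simp add: has_weak_div_iff)
  qed
  then show ?thesis by eventually_elim simp
qed

lemma wdiv_properties:
  assumes \<Omega>: "open \<Omega>" and l2: "g \<in> l2 (lebesgue_on \<Omega>)" and w: "has_weak_div \<Omega> v g"
  shows "wdiv \<Omega> v \<in> l2 (lebesgue_on \<Omega>)" "has_weak_div \<Omega> v (wdiv \<Omega> v)"
    "AE x in lebesgue_on \<Omega>. wdiv \<Omega> v x = g x"
proof -
  have "wdiv \<Omega> v \<in> L2 \<Omega> \<and> has_weak_div \<Omega> v (wdiv \<Omega> v)"
    unfolding wdiv_def by (rule someI[of _ g]) (use l2 w in \<open>simp add: L2_eq_l2\<close>)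
  then show 1: "wdiv \<Omega> v \<in> l2 (lebesgue_on \<Omega>)" and 2: "has_weak_div \<Omega> v (wdiv \<Omega> v)"
    by (auto simp: L2_eq_l2)
  show "AE x in lebesgue_on \<Omega>. wdiv \<Omega> v x = g x"
    by (rule has_weak_div_unique[OF \<Omega> 1 l2 2 w])
qed

lemma Hdiv_wdiv:
  assumes "open \<Omega>" "v \<in> Hdiv \<Omega>"
  shows "v \<in> l2 (lebesgue_on \<Omega>)" "wdiv \<Omega> v \<in> l2 (lebesgue_on \<Omega>)" "has_weak_div \<Omega> v (wdiv \<Omega> v)"
  using assms wdiv_properties[OF assms(1)] by (auto simp: Hdiv_def L2_eq_l2)

lemma H0div_Hdiv: "v \<in> H0div \<Omega> \<Longrightarrow> v \<in> Hdiv \<Omega>"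
  by (simp add: H0div_def)

lemma HdivI: "v \<in> l2 (lebesgue_on \<Omega>) \<Longrightarrow> g \<in> l2 (lebesgue_on \<Omega>) \<Longrightarrow> has_weak_div \<Omega> v g \<Longrightarrow> v \<in> Hdiv \<Omega>"
  by (auto simp: Hdiv_def L2_eq_l2)

lemma has_weak_div_partial:
  fixes v :: "real ^ 'n \<Rightarrow> real ^ 'n"
  assumes \<Omega>: "open \<Omega>" and l2: "v \<in> l2 (lebesgue_on \<Omega>)" "\<And>j. G j \<in> l2 (lebesgue_on \<Omega>)"
    and w: "\<And>j. has_weak_partial \<Omega> j v (G j)"
  shows "(\<lambda>x. \<Sum>j\<in>UNIV. G j x $ j) \<in> l2 (lebesgue_on \<Omega>)" "has_weak_div \<Omega> v (\<lambda>x. \<Sum>j\<in>UNIV. G j x $ j)"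
proof -
  let ?M = "lebesgue_on \<Omega>"
  show "(\<lambda>x. \<Sum>j\<in>UNIV. G j x $ j) \<in> l2 ?M"
    by (intro l2_sum l2_bounded_linear[OF bounded_linear_vec_nth] l2)
  show "has_weak_div \<Omega> v (\<lambda>x. \<Sum>j\<in>UNIV. G j x $ j)"
    unfolding has_weak_div_iff
  proof
    fix \<phi> :: "real ^ 'n \<Rightarrow> real" assume t: "\<phi> \<in> test \<Omega>"
    have tt: "(\<lambda>x. \<phi> x *\<^sub>R axis j 1 :: real ^ 'n) \<in> test \<Omega>" for j
      by (rule test_bounded_linear[OF bounded_linear_scaleR_left t])
    have p: "partial j (\<lambda>x. \<phi> x *\<^sub>R axis j 1 :: real ^ 'n) x = partial j \<phi> x *\<^sub>R axis j 1" for j x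
      by (rule partial_bounded_linear[OF bounded_linear_scaleR_left test_smooth[OF t]])
    have eq: "l2_inner ?M v (partial j (\<lambda>x. \<phi> x *\<^sub>R axis j 1)) = - l2_inner ?M (G j) (\<lambda>x. \<phi> x *\<^sub>R axis j 1)" for j
      using w[of j] tt unfolding has_weak_partial_iff[OF \<Omega> l2(1) l2(2)] by blast
    have i: "integrable ?M (\<lambda>x. v x \<bullet> partial j (\<lambda>x. \<phi> x *\<^sub>R axis j 1) x)"
      "integrable ?M (\<lambda>x. G j x \<bullet> (\<phi> x *\<^sub>R axis j 1))" for j
      using l2_inner_integrable[OF l2(1) test_l2_on[OF test_partial[OF tt[of j], of j]]]
        l2_inner_integrable[OF l2(2)[of j] test_l2_on[OF tt[of j]]] \<Omega> by simp_all
    have "l2_inner ?M v (\<lambda>x. \<chi> j. partial j \<phi> x) = (LINT x|?M. (\<Sum>j\<in>UNIV. v x \<bullet> partial j (\<lambda>x. \<phi> x *\<^sub>R axis j 1) x))"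
      by (simp add: l2_inner_def p inner_axis) (simp add: inner_vec_def mult.commute)
    also have "\<dots> = (\<Sum>j\<in>UNIV. l2_inner ?M v (partial j (\<lambda>x. \<phi> x *\<^sub>R axis j 1)))"
      using i by (simp add: l2_inner_def)
    also have "\<dots> = - (\<Sum>j\<in>UNIV. l2_inner ?M (G j) (\<lambda>x. \<phi> x *\<^sub>R axis j 1))"
      by (simp add: eq sum_negf)
    also have "(\<Sum>j\<in>UNIV. l2_inner ?M (G j) (\<lambda>x. \<phi> x *\<^sub>R axis j 1)) = (LINT x|?M. (\<Sum>j\<in>UNIV. G j x \<bullet> (\<phi> x *\<^sub>R axis j 1)))"
      using i by (simp add: l2_inner_def)
    also have "\<dots> = l2_inner ?M (\<lambda>x. \<Sum>j\<in>UNIV. G j x $ j) \<phi>"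
      by (simp add: l2_inner_def inner_axis sum_distrib_left mult.commute)
    finally show "l2_inner ?M v (\<lambda>x. \<chi> j. partial j \<phi> x) = - l2_inner ?M (\<lambda>x. \<Sum>j\<in>UNIV. G j x $ j) \<phi>" .
  qed
qed

lemma test_has_weak_div:
  fixes \<phi> :: "real ^ 'n \<Rightarrow> real ^ 'n"
  assumes "open \<Omega>" "\<phi> \<in> test UNIV"
  shows "has_weak_div \<Omega> \<phi> (pdiv \<phi>)"
  unfolding pdiv_def[abs_def] using assms
  by (intro has_weak_div_partial has_weak_partial_smooth test_smooth test_l2_on test_partial) auto

lemma wgrad_l2:
  assumes "open \<Omega>" "q \<in> H1 \<Omega>"
  shows "wgrad \<Omega> q \<in> l2 (lebesgue_on \<Omega>)"
proof -
  have "wgrad \<Omega> q = (\<lambda>x. \<Sum>j\<in>UNIV. wpartial \<Omega> j q x *\<^sub>R axis j 1)"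
    using basis_expansion by (intro ext) (simp add: wgrad_def vec_eq_iff axis_def if_distrib[of "\<lambda>z. _ * z"] cong: if_cong)
  then show ?thesis
    using H1_wpartial[OF assms] by (auto intro!: l2_sum l2_bounded_linear[OF bounded_linear_scaleR_left])
qed

lemma normal_trace_eq:
  assumes \<Omega>: "open \<Omega>" and g: "g \<in> l2 (lebesgue_on \<Omega>)" and w: "has_weak_div \<Omega> v g" and q: "q \<in> H1 \<Omega>"
  shows "normal_trace \<Omega> v q = l2_inner (lebesgue_on \<Omega>) v (wgrad \<Omega> q) + l2_inner (lebesgue_on \<Omega>) g q"
proof -
  have "l2_inner (lebesgue_on \<Omega>) (wdiv \<Omega> v) q = l2_inner (lebesgue_on \<Omega>) g q"
    using wdiv_properties[OF \<Omega> g w] H1_wpartial(1)[OF \<Omega> q] l2_measurable g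
    by (intro l2_inner_cong_AE) auto
  then show ?thesis by (simp add: normal_trace_def ip_eq_l2_inner)
qed

lemma test_green:
  fixes \<phi> :: "real ^ 'n \<Rightarrow> real ^ 'n"
  assumes \<Omega>: "open \<Omega>" and t: "\<phi> \<in> test \<Omega>" and q: "q \<in> H1 \<Omega>"
  shows "l2_inner (lebesgue_on \<Omega>) \<phi> (wgrad \<Omega> q) + l2_inner (lebesgue_on \<Omega>) (pdiv \<phi>) q = 0"
proof -
  let ?M = "lebesgue_on \<Omega>"
  have c: "(\<lambda>x. \<phi> x $ j) \<in> test \<Omega>" for j by (rule test_bounded_linear[OF bounded_linear_vec_nth t])
  have pc: "partial j (\<lambda>x. \<phi> x $ j) x = partial j \<phi> x $ j" for j x
    by (rule partial_bounded_linear[OF bounded_linear_vec_nth test_smooth[OF t]])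
  note h = H1_wpartial[OF \<Omega> q]
  have eq: "l2_inner ?M q (partial j (\<lambda>x. \<phi> x $ j)) = - l2_inner ?M (wpartial \<Omega> j q) (\<lambda>x. \<phi> x $ j)" for j
    using h(3)[of j] c unfolding has_weak_partial_iff[OF \<Omega> h(1,2)] by blast
  have i: "integrable ?M (\<lambda>x. q x * partial j \<phi> x $ j)" "integrable ?M (\<lambda>x. wpartial \<Omega> j q x * \<phi> x $ j)" for j
    using l2_inner_integrable[OF h(1) test_l2_on[OF test_partial[OF c]], of j j]
      l2_inner_integrable[OF h(2) test_l2_on[OF c], of j j] \<Omega> by (simp_all add: pc)
  have "l2_inner ?M \<phi> (wgrad \<Omega> q) = (\<Sum>j\<in>UNIV. l2_inner ?M (wpartial \<Omega> j q) (\<lambda>x. \<phi> x $ j))"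
    using i by (simp add: l2_inner_def inner_vec_def wgrad_def mult.commute)
  also have "\<dots> = - (\<Sum>j\<in>UNIV. l2_inner ?M q (partial j (\<lambda>x. \<phi> x $ j)))"
    by (simp add: eq sum_negf)
  also have "(\<Sum>j\<in>UNIV. l2_inner ?M q (partial j (\<lambda>x. \<phi> x $ j))) = l2_inner ?M (pdiv \<phi>) q"
    using i by (simp add: l2_inner_def pc pdiv_def sum_distrib_left mult.commute)
  finally show ?thesis by simp
qed

text \<open>With an explicit divergence \<open>g\<close> in place of the choice \<open>wdiv\<close>,
  membership is a linear condition on the pair \<open>(v, g)\<close>; closure under sums and
  multiples can then be read off.\<close>

lemma H0div_iff:
  assumes \<Omega>: "open \<Omega>" and l2: "v \<in> l2 (lebesgue_on \<Omega>)" "g \<in> l2 (lebesgue_on \<Omega>)" and w: "has_weak_div \<Omega> v g"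
  shows "v \<in> H0div \<Omega> \<longleftrightarrow>
    (\<forall>q\<in>H1 \<Omega>. l2_inner (lebesgue_on \<Omega>) v (wgrad \<Omega> q) + l2_inner (lebesgue_on \<Omega>) g q = 0)"
  using normal_trace_eq[OF \<Omega> l2(2) w] HdivI[OF l2 w] by (simp add: H0div_def)

lemma H0div_green:
  assumes "open \<Omega>" "v \<in> H0div \<Omega>" "q \<in> H1 \<Omega>"
  shows "l2_inner (lebesgue_on \<Omega>) v (wgrad \<Omega> q) + l2_inner (lebesgue_on \<Omega>) (wdiv \<Omega> v) q = 0"
  using assms by (simp add: H0div_def normal_trace_def ip_eq_l2_inner)

lemma H0div_test:
  fixes \<phi> :: "real ^ 'n \<Rightarrow> real ^ 'n"
  assumes \<Omega>: "open \<Omega>" and t: "\<phi> \<in> test \<Omega>"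
  shows "\<phi> \<in> H0div \<Omega>"
proof -
  have "\<phi> \<in> l2 (lebesgue_on \<Omega>)" "pdiv \<phi> \<in> l2 (lebesgue_on \<Omega>)"
    using test_l2_on[OF t] test_l2_on[OF pdiv_test[OF t]] \<Omega> by auto
  then show ?thesis
    using H0div_iff[OF \<Omega> _ _ test_has_weak_div[OF \<Omega> test_UNIV[OF t]]] test_green[OF \<Omega> t] by blast
qed

lemma has_weak_div_add:
  fixes v w :: "real ^ 'n \<Rightarrow> real ^ 'n"
  assumes "open \<Omega>" "v \<in> l2 (lebesgue_on \<Omega>)" "w \<in> l2 (lebesgue_on \<Omega>)"
    "g \<in> l2 (lebesgue_on \<Omega>)" "h \<in> l2 (lebesgue_on \<Omega>)" "has_weak_div \<Omega> v g" "has_weak_div \<Omega> w h"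
  shows "has_weak_div \<Omega> (\<lambda>x. v x + w x) (\<lambda>x. g x + h x)"
  unfolding has_weak_div_iff
proof
  fix \<phi> :: "real ^ 'n \<Rightarrow> real" assume t: "\<phi> \<in> test \<Omega>"
  have "\<phi> \<in> l2 (lebesgue_on \<Omega>)" "(\<lambda>x. \<chi> j. partial j \<phi> x) \<in> l2 (lebesgue_on \<Omega>)"
    using test_l2_on[OF t] test_l2_on[OF pgrad_test[OF t]] assms(1) by auto
  then show "l2_inner (lebesgue_on \<Omega>) (\<lambda>x. v x + w x) (\<lambda>x. \<chi> j. partial j \<phi> x)
      = - l2_inner (lebesgue_on \<Omega>) (\<lambda>x. g x + h x) \<phi>"
    using assms t by (simp add: has_weak_div_iff l2_inner_add_left)
qed

lemma has_weak_div_scaleR: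
  "has_weak_div \<Omega> v g \<Longrightarrow> has_weak_div \<Omega> (\<lambda>x. c *\<^sub>R v x) (\<lambda>x. c *\<^sub>R g x)"
  unfolding has_weak_div_iff l2_inner_scaleR_left by simp

lemma H0div_add:
  assumes \<Omega>: "open \<Omega>" and "v \<in> H0div \<Omega>" "w \<in> H0div \<Omega>"
  shows "(\<lambda>x. v x + w x) \<in> H0div \<Omega>"
proof -
  note v = Hdiv_wdiv[OF \<Omega> H0div_Hdiv[OF assms(2)]] and w = Hdiv_wdiv[OF \<Omega> H0div_Hdiv[OF assms(3)]]
  show ?thesis
    unfolding H0div_iff[OF \<Omega> l2_add[OF v(1) w(1)] l2_add[OF v(2) w(2)]
        has_weak_div_add[OF \<Omega> v(1) w(1) v(2) w(2) v(3) w(3)]]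
  proof
    fix q :: "real ^ 'a \<Rightarrow> real" assume q: "q \<in> H1 \<Omega>"
    show "l2_inner (lebesgue_on \<Omega>) (\<lambda>x. v x + w x) (wgrad \<Omega> q)
        + l2_inner (lebesgue_on \<Omega>) (\<lambda>x. wdiv \<Omega> v x + wdiv \<Omega> w x) q = 0"
      using H0div_green[OF \<Omega> assms(2) q] H0div_green[OF \<Omega> assms(3) q]
      by (simp add: l2_inner_add_left v w H1_wpartial(1)[OF \<Omega> q] wgrad_l2[OF \<Omega> q])
  qed
qed

lemma H0div_scaleR:
  assumes \<Omega>: "open \<Omega>" and "v \<in> H0div \<Omega>"
  shows "(\<lambda>x. c *\<^sub>R v x) \<in> H0div \<Omega>"
proof -
  note v = Hdiv_wdiv[OF \<Omega> H0div_Hdiv[OF assms(2)]]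
  show ?thesis
    unfolding H0div_iff[OF \<Omega> l2_scaleR[OF v(1)] l2_scaleR[OF v(2)] has_weak_div_scaleR[OF v(3)]]
      l2_inner_scaleR_left
    using H0div_green[OF \<Omega> assms(2)] by (simp flip: distrib_left)
qed

lemma H0div_diff:
  assumes "open \<Omega>" "v \<in> H0div \<Omega>" "w \<in> H0div \<Omega>"
  shows "(\<lambda>x. v x - w x) \<in> H0div \<Omega>"
  using H0div_add[OF assms(1,2) H0div_scaleR[OF assms(1,3), of "-1"]] by simp

lemma Hdiv_norm_eq:
  assumes \<Omega>: "open \<Omega>" and g: "g \<in> l2 (lebesgue_on \<Omega>)" and w: "has_weak_div \<Omega> v g"
  shows "Hdiv_norm \<Omega> v = sqrt ((l2_norm (lebesgue_on \<Omega>) v)\<^sup>2 + (l2_norm (lebesgue_on \<Omega>) g)\<^sup>2)"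
proof -
  have "l2_norm (lebesgue_on \<Omega>) (wdiv \<Omega> v) = l2_norm (lebesgue_on \<Omega>) g"
    using wdiv_properties[OF \<Omega> g w] l2_measurable g by (intro l2_norm_cong_AE) auto
  then show ?thesis by (simp add: Hdiv_norm_def ip_eq_l2_inner flip: l2_norm_sq_inner)
qed

subsection \<open>Density of the test fields in \<open>H0div\<close>\<close>

lemma l2_Pair:
  assumes "f \<in> l2 M" "g \<in> l2 M"
  shows "(\<lambda>x. (f x, g x)) \<in> l2 M"
proof -
  have "bounded_linear (\<lambda>y. (y, 0))" "bounded_linear (\<lambda>y. (0, y))"
    by (intro bounded_linear_Pair bounded_linear_ident bounded_linear_zero)+
  from l2_add[OF l2_bounded_linear[OF this(1) assms(1)] l2_bounded_linear[OF this(2) assms(2)]]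
  show ?thesis by simp
qed

lemma l2_inner_Pair:
  assumes "f \<in> l2 M" "g \<in> l2 M" "f' \<in> l2 M" "g' \<in> l2 M"
  shows "l2_inner M (\<lambda>x. (f x, g x)) (\<lambda>x. (f' x, g' x)) = l2_inner M f f' + l2_inner M g g'"
  using assms by (simp add: l2_inner_def inner_prod_def l2_inner_integrable)

text \<open>If \<open>r = (r\<^sub>1, r\<^sub>2)\<close> is orthogonal to all pairs \<open>(\<phi>, div \<phi>)\<close> of test fields, then \<open>r\<^sub>1 = \<nabla>r\<^sub>2\<close>
  weakly, so that the vanishing normal trace makes \<open>(v, div v)\<close> orthogonal to \<open>r\<close> as well.\<close>

lemma H0div_approx:
  fixes v :: "real ^ 'n \<Rightarrow> real ^ 'n"
  assumes \<Omega>: "open \<Omega>" and v: "v \<in> H0div \<Omega>"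
  shows "\<exists>\<phi>. (\<forall>k::nat. \<phi> k \<in> test \<Omega>) \<and> (\<lambda>k. l2_norm (lebesgue_on \<Omega>) (\<lambda>x. v x - \<phi> k x)) \<longlonglongrightarrow> 0 \<and>
    (\<lambda>k. l2_norm (lebesgue_on \<Omega>) (\<lambda>x. wdiv \<Omega> v x - pdiv (\<phi> k) x)) \<longlonglongrightarrow> 0"
proof -
  let ?M = "lebesgue_on \<Omega>"
  have \<Omega>b: "\<Omega> \<in> sets borel" using \<Omega> by simp
  note vd = Hdiv_wdiv[OF \<Omega> H0div_Hdiv[OF v]]
  define V where "V x = (v x, wdiv \<Omega> v x)" for x
  define P where "P \<phi> x = (\<phi> x, pdiv \<phi> x)" for \<phi> :: "real ^ 'n \<Rightarrow> real ^ 'n" and x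
  have V: "V \<in> l2 ?M" unfolding V_def[abs_def] by (rule l2_Pair[OF vd(1,2)])
  have tl: "\<phi> \<in> l2 ?M" "pdiv \<phi> \<in> l2 ?M" if "\<phi> \<in> test \<Omega>" for \<phi>
    using test_l2_on[OF that \<Omega>b] test_l2_on[OF pdiv_test[OF that] \<Omega>b] by auto
  have Pl: "P \<phi> \<in> l2 ?M" if "\<phi> \<in> test \<Omega>" for \<phi>
    unfolding P_def[abs_def] by (rule l2_Pair[OF tl[OF that]])
  have "\<exists>s r. (\<forall>k::nat. s k \<in> P ` test \<Omega>) \<and> r \<in> l2 ?M \<and> (\<forall>t\<in>P ` test \<Omega>. l2_inner ?M r t = 0)
    \<and> (\<lambda>k. l2_norm ?M (\<lambda>x. V x - s k x - r x)) \<longlonglongrightarrow> 0"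
  proof (rule l2_projection_residual[OF _ _ _ _ V])
    show "P ` test \<Omega> \<subseteq> l2 ?M" using Pl by blast
    show "P ` test \<Omega> \<noteq> {}" using test_zero by blast
    fix f g c assume "f \<in> P ` test \<Omega>"
    then obtain \<phi> where \<phi>: "\<phi> \<in> test \<Omega>" "f = P \<phi>" by blast
    have "P (\<lambda>x. c *\<^sub>R \<phi> x) = (\<lambda>x. c *\<^sub>R f x)"
      using partial_bounded_linear[OF bounded_linear_scaleR_right test_smooth[OF \<phi>(1)]]
      by (intro ext) (simp add: P_def \<phi> pdiv_def sum_distrib_left)
    then show "(\<lambda>x. c *\<^sub>R f x) \<in> P ` test \<Omega>" using imageI[OF test_scaleR[OF \<phi>(1), of c], of P] by simp
    assume "g \<in> P ` test \<Omega>"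
    then obtain \<psi> where \<psi>: "\<psi> \<in> test \<Omega>" "g = P \<psi>" by blast
    have "P (\<lambda>x. \<phi> x + \<psi> x) = (\<lambda>x. f x + g x)"
      using partial_add[OF test_smooth[OF \<phi>(1)] test_smooth[OF \<psi>(1)]]
      by (intro ext) (simp add: P_def \<phi> \<psi> pdiv_def sum.distrib)
    then show "(\<lambda>x. f x + g x) \<in> P ` test \<Omega>" using imageI[OF test_add[OF \<phi>(1) \<psi>(1)], of P] by simp
  qed
  then obtain s r where sr: "(\<forall>k::nat. s k \<in> P ` test \<Omega>) \<and> r \<in> l2 ?M \<and> (\<forall>t\<in>P ` test \<Omega>. l2_inner ?M r t = 0)
    \<and> (\<lambda>k. l2_norm ?M (\<lambda>x. V x - s k x - r x)) \<longlonglongrightarrow> 0"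
    by (elim exE) (rule that)
  then have s: "\<And>k::nat. s k \<in> P ` test \<Omega>" and r: "r \<in> l2 ?M"
    and orth: "\<And>t. t \<in> P ` test \<Omega> \<Longrightarrow> l2_inner ?M r t = 0"
    and lim: "(\<lambda>k. l2_norm ?M (\<lambda>x. V x - s k x - r x)) \<longlonglongrightarrow> 0"
    by (blast, blast, blast, blast)
  have "\<forall>k. \<exists>\<phi>. \<phi> \<in> test \<Omega> \<and> s k = P \<phi>" using s by blast
  then obtain \<phi> where \<phi>: "\<And>k. \<phi> k \<in> test \<Omega>" "\<And>k. s k = P (\<phi> k)" by metis
  define r1 r2 where "r1 x = fst (r x)" and "r2 x = snd (r x)" for x
  have r1: "r1 \<in> l2 ?M" and r2: "r2 \<in> l2 ?M"
    unfolding r1_def[abs_def] r2_def[abs_def]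
    by (intro l2_bounded_linear[OF bounded_linear_fst r] l2_bounded_linear[OF bounded_linear_snd r])+
  have r_eq: "r = (\<lambda>x. (r1 x, r2 x))" by (simp add: r1_def r2_def)
  have r1c: "(\<lambda>x. r1 x $ j) \<in> l2 ?M" for j by (rule l2_bounded_linear[OF bounded_linear_vec_nth r1])
  have wp: "has_weak_partial \<Omega> j r2 (\<lambda>x. r1 x $ j)" for j
    unfolding has_weak_partial_iff[OF \<Omega> r2 r1c]
  proof
    fix \<psi> :: "real ^ 'n \<Rightarrow> real" assume t: "\<psi> \<in> test \<Omega>"
    \<comment> \<open>For a field with the single component \<open>\<psi>\<close> in direction
      \<open>j\<close> the divergence is \<open>partial j \<psi>\<close>, so orthogonality to its
      pair is the definition of a weak partial derivative of \<open>r2\<close>.\<close>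
    have tt: "(\<lambda>x. \<psi> x *\<^sub>R axis j 1 :: real ^ 'n) \<in> test \<Omega>"
      by (rule test_bounded_linear[OF bounded_linear_scaleR_left t])
    have p: "partial i (\<lambda>x. \<psi> x *\<^sub>R axis j 1 :: real ^ 'n) x = partial i \<psi> x *\<^sub>R axis j 1" for i x
      by (rule partial_bounded_linear[OF bounded_linear_scaleR_left test_smooth[OF t]])
    have pd: "pdiv (\<lambda>x. \<psi> x *\<^sub>R axis j 1 :: real ^ 'n) = partial j \<psi>"
    proof
      fix x
      have "pdiv (\<lambda>x. \<psi> x *\<^sub>R axis j 1 :: real ^ 'n) x = (\<Sum>i\<in>UNIV. if i = j then partial i \<psi> x else 0)"
        unfolding pdiv_def p by (intro sum.cong) (auto simp: axis_def)
      then show "pdiv (\<lambda>x. \<psi> x *\<^sub>R axis j 1 :: real ^ 'n) x = partial j \<psi> x" by simp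
    qed
    have "0 = l2_inner ?M r (P (\<lambda>x. \<psi> x *\<^sub>R axis j 1))" using orth tt by simp
    also have "\<dots> = l2_inner ?M r1 (\<lambda>x. \<psi> x *\<^sub>R axis j 1) + l2_inner ?M r2 (partial j \<psi>)"
      unfolding r_eq P_def[abs_def] pd
      by (rule l2_inner_Pair[OF r1 r2 tl(1)[OF tt] test_l2_on[OF test_partial[OF t] \<Omega>b]])
    also have "l2_inner ?M r1 (\<lambda>x. \<psi> x *\<^sub>R axis j 1) = l2_inner ?M (\<lambda>x. r1 x $ j) \<psi>"
      by (simp add: l2_inner_def inner_axis mult.commute)
    finally show "l2_inner ?M r2 (partial j \<psi>) = - l2_inner ?M (\<lambda>x. r1 x $ j) \<psi>" by simp
  qed
  have H1: "r2 \<in> H1 \<Omega>" by (rule H1I[OF r2 r1c wp])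
  have "AE x in ?M. \<forall>j\<in>UNIV. wpartial \<Omega> j r2 x = r1 x $ j"
    by (intro AE_finite_allI) (auto intro: wpartial_properties(3)[OF \<Omega> r2 r1c wp])
  then have "AE x in ?M. wgrad \<Omega> r2 x = r1 x"
    by eventually_elim (simp add: wgrad_def vec_eq_iff)
  then have "l2_inner ?M v (wgrad \<Omega> r2) = l2_inner ?M v r1"
    using l2_measurable wgrad_l2[OF \<Omega> H1] r1 vd(1) by (intro l2_inner_cong_AE) auto
  then have "l2_inner ?M V r = 0"
    using H0div_green[OF \<Omega> v H1] l2_inner_Pair[OF vd(1,2) r1 r2] by (simp add: r_eq V_def[abs_def])
  moreover have "l2_inner ?M (s k) r = 0" for k using orth[OF s] by (simp add: l2_inner_commute)
  moreover have sl: "s k \<in> l2 ?M" for k using Pl \<phi> by simp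
  ultimately have "l2_inner ?M (\<lambda>x. V x - s k x) r = 0" for k
    by (simp add: l2_inner_diff_left V r)
  \<comment> \<open>\<open>r\<close> is the limit of \<open>V - s k\<close>, and both
    \<open>V\<close> and \<open>s k\<close> are orthogonal to \<open>r\<close>; so \<open>r\<close>
    is orthogonal to itself, and the test pairs converge to \<open>V\<close>.\<close>
  moreover have "(\<lambda>k. l2_inner ?M (\<lambda>x. V x - s k x) r) \<longlonglongrightarrow> l2_inner ?M r r"
    by (rule l2_inner_tendsto_left[OF l2_diff[OF V sl] r r lim])
  ultimately have "(\<lambda>k::nat. 0) \<longlonglongrightarrow> l2_inner ?M r r" by simp
  then have "l2_inner ?M r r = 0" by (simp add: LIMSEQ_const_iff)
  then have nr: "l2_norm ?M r = 0" using l2_norm_sq_inner[of ?M r] by simp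
  have lim': "(\<lambda>k. l2_norm ?M (\<lambda>x. V x - s k x)) \<longlonglongrightarrow> 0"
  proof (rule Lim_null_comparison[OF always_eventually lim], rule allI)
    fix k
    show "norm (l2_norm ?M (\<lambda>x. V x - s k x)) \<le> l2_norm ?M (\<lambda>x. V x - s k x - r x)"
      using l2_norm_triangle[OF l2_diff[OF l2_diff[OF V sl[of k]] r] r] nr by simp
  qed
  have dl: "(\<lambda>x. V x - s k x) \<in> l2 ?M" for k by (rule l2_diff[OF V sl])
  have "l2_norm ?M (\<lambda>x. v x - \<phi> k x) \<le> l2_norm ?M (\<lambda>x. V x - s k x)"
    "l2_norm ?M (\<lambda>x. wdiv \<Omega> v x - pdiv (\<phi> k) x) \<le> l2_norm ?M (\<lambda>x. V x - s k x)" for k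
  proof -
    show "l2_norm ?M (\<lambda>x. v x - \<phi> k x) \<le> l2_norm ?M (\<lambda>x. V x - s k x)"
      by (rule l2_norm_mono[OF dl l2_measurable[OF l2_diff[OF vd(1) tl(1)[OF \<phi>(1)]]] AE_I2])
         (simp only: V_def \<phi>(2) P_def diff_Pair norm_fst_le)
    show "l2_norm ?M (\<lambda>x. wdiv \<Omega> v x - pdiv (\<phi> k) x) \<le> l2_norm ?M (\<lambda>x. V x - s k x)"
      by (rule l2_norm_mono[OF dl l2_measurable[OF l2_diff[OF vd(2) tl(2)[OF \<phi>(1)]]] AE_I2])
         (simp only: V_def \<phi>(2) P_def diff_Pair norm_snd_le)
  qed
  then show ?thesis
    by (intro exI[of _ \<phi>] conjI \<phi>(1) Lim_null_comparison[OF always_eventually lim'] allI) auto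
qed

section \<open>Uniqueness of the extended divergence\<close>

lemma H0div_dual_tendsto:
  assumes \<Omega>: "open \<Omega>" and F: "F \<in> H0div_dual \<Omega>" and v: "v \<in> H0div \<Omega>" and t: "\<And>k. \<phi> k \<in> test \<Omega>"
    and lim: "(\<lambda>k. l2_norm (lebesgue_on \<Omega>) (\<lambda>x. v x - \<phi> k x)) \<longlonglongrightarrow> 0"
      "(\<lambda>k. l2_norm (lebesgue_on \<Omega>) (\<lambda>x. wdiv \<Omega> v x - pdiv (\<phi> k) x)) \<longlonglongrightarrow> 0"
  shows "(\<lambda>k. F (\<phi> k)) \<longlonglongrightarrow> F v"
proof -
  let ?M = "lebesgue_on \<Omega>"
  have \<Omega>b: "\<Omega> \<in> sets borel" using \<Omega> by simp
  note vd = Hdiv_wdiv[OF \<Omega> H0div_Hdiv[OF v]]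
  have tl: "\<phi> k \<in> l2 ?M" "pdiv (\<phi> k) \<in> l2 ?M" for k
    using test_l2_on[OF t \<Omega>b] test_l2_on[OF pdiv_test[OF t] \<Omega>b] by auto
  obtain C where C: "\<And>v. v \<in> H0div \<Omega> \<Longrightarrow> \<bar>F v\<bar> \<le> C * Hdiv_norm \<Omega> v"
    using F unfolding H0div_dual_def by blast
  have add: "F (\<lambda>x. v x + w x) = F v + F w" if "v \<in> H0div \<Omega>" "w \<in> H0div \<Omega>" for v w
    using F that by (auto simp: H0div_dual_def)
  have scale: "F (\<lambda>x. c *\<^sub>R v x) = c * F v" if "v \<in> H0div \<Omega>" for c v
    using F that by (auto simp: H0div_dual_def)
  have eq: "F (\<lambda>x. v x - \<phi> k x) = F v - F (\<phi> k)" for k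
  proof -
    note h = H0div_test[OF \<Omega> t[of k]]
    show ?thesis using add[OF v H0div_scaleR[OF \<Omega> h, of "-1"]] scale[OF h, of "-1"] by simp
  qed
  have "has_weak_div \<Omega> (\<lambda>x. v x - \<phi> k x) (\<lambda>x. wdiv \<Omega> v x - pdiv (\<phi> k) x)" for k
  proof -
    have "has_weak_div \<Omega> (\<lambda>x. (-1) *\<^sub>R \<phi> k x) (\<lambda>x. (-1) *\<^sub>R pdiv (\<phi> k) x)"
      by (rule has_weak_div_scaleR[OF test_has_weak_div[OF \<Omega> test_UNIV[OF t]]])
    from has_weak_div_add[OF \<Omega> vd(1) l2_scaleR[OF tl(1)] vd(2) l2_scaleR[OF tl(2)] vd(3) this]
    show ?thesis by simp
  qed
  from Hdiv_norm_eq[OF \<Omega> l2_diff[OF vd(2) tl(2)] this]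
  have "\<bar>F (\<phi> k) - F v\<bar> \<le> C * sqrt ((l2_norm ?M (\<lambda>x. v x - \<phi> k x))\<^sup>2 + (l2_norm ?M (\<lambda>x. wdiv \<Omega> v x - pdiv (\<phi> k) x))\<^sup>2)" for k
    using C[OF H0div_diff[OF \<Omega> v H0div_test[OF \<Omega> t]], of k] by (simp add: eq abs_minus_commute)
  then have le: "\<forall>\<^sub>F k in sequentially. norm (F (\<phi> k) - F v) \<le> C * sqrt ((l2_norm ?M (\<lambda>x. v x - \<phi> k x))\<^sup>2 + (l2_norm ?M (\<lambda>x. wdiv \<Omega> v x - pdiv (\<phi> k) x))\<^sup>2)"
    by (simp add: always_eventually)
  have "(\<lambda>k. C * sqrt ((l2_norm ?M (\<lambda>x. v x - \<phi> k x))\<^sup>2 + (l2_norm ?M (\<lambda>x. wdiv \<Omega> v x - pdiv (\<phi> k) x))\<^sup>2))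
      \<longlonglongrightarrow> C * sqrt (0\<^sup>2 + 0\<^sup>2)"
    by (intro tendsto_intros lim)
  then have "(\<lambda>k. C * sqrt ((l2_norm ?M (\<lambda>x. v x - \<phi> k x))\<^sup>2 + (l2_norm ?M (\<lambda>x. wdiv \<Omega> v x - pdiv (\<phi> k) x))\<^sup>2)) \<longlonglongrightarrow> 0"
    by simp
  from LIM_zero_cancel[OF Lim_null_comparison[OF le this]] show ?thesis .
qed

lemma extends_div_unique:
  assumes \<Omega>: "open \<Omega>" and "extends_div \<Omega> \<tau> F" "extends_div \<Omega> \<tau> F'" and v: "v \<in> H0div \<Omega>"
  shows "F v = F' v"
proof -
  obtain \<phi> where "(\<forall>k::nat. \<phi> k \<in> test \<Omega>) \<and> (\<lambda>k. l2_norm (lebesgue_on \<Omega>) (\<lambda>x. v x - \<phi> k x)) \<longlonglongrightarrow> 0 \<and>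
    (\<lambda>k. l2_norm (lebesgue_on \<Omega>) (\<lambda>x. wdiv \<Omega> v x - pdiv (\<phi> k) x)) \<longlonglongrightarrow> 0"
    using H0div_approx[OF \<Omega> v] by (elim exE) (rule that)
  then have \<phi>: "\<And>k. \<phi> k \<in> test \<Omega>" and lim: "(\<lambda>k. l2_norm (lebesgue_on \<Omega>) (\<lambda>x. v x - \<phi> k x)) \<longlonglongrightarrow> 0"
    "(\<lambda>k. l2_norm (lebesgue_on \<Omega>) (\<lambda>x. wdiv \<Omega> v x - pdiv (\<phi> k) x)) \<longlonglongrightarrow> 0"
    by simp_all
  have "(\<lambda>k. F (\<phi> k)) \<longlonglongrightarrow> F v" "(\<lambda>k. F' (\<phi> k)) \<longlonglongrightarrow> F' v"
    using assms(2,3) by (auto simp: extends_div_def intro: H0div_dual_tendsto[OF \<Omega> _ v \<phi> lim])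
  moreover have "F (\<phi> k) = F' (\<phi> k)" for k using assms(2,3) \<phi> by (simp add: extends_div_def)
  ultimately show ?thesis using LIMSEQ_unique by auto
qed

text \<open>This removes the choice operator: on \<open>H0div \<Omega>\<close> the value of
  \<open>div_dual\<close> can be computed with whichever extension is convenient.\<close>

lemma div_dual_eq:
  assumes "open \<Omega>" "extends_div \<Omega> \<tau> F" "v \<in> H0div \<Omega>"
  shows "div_dual \<Omega> \<tau> v = F v"
proof -
  have "extends_div \<Omega> \<tau> (div_dual \<Omega> \<tau>)"
    unfolding div_dual_def by (rule someI[of _ F]) (rule assms(2))
  then show ?thesis by (rule extends_div_unique[OF assms(1) _ assms(2,3)])
qed

subsection \<open>Fields in the closure of the test fields\<close>

lemma H1_wdiv:
  fixes v :: "real ^ 'n \<Rightarrow> real ^ 'n"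
  assumes \<Omega>: "open \<Omega>" and v: "v \<in> H1 \<Omega>"
  shows "AE x in lebesgue_on \<Omega>. wdiv \<Omega> v x = (\<Sum>j\<in>UNIV. wpartial \<Omega> j v x $ j)"
  using wdiv_properties(3)[OF \<Omega> has_weak_div_partial[OF \<Omega> H1_wpartial[OF \<Omega> v]]] .

text \<open>One and the same sequence converges together with its gradients and with its
  divergences. Thus a functional bounded only in the graph norm and a pairing with gradients can be
  followed along it simultaneously.\<close>

lemma H1_0_approx_Hdiv:
  fixes v :: "real ^ 'n \<Rightarrow> real ^ 'n"
  assumes \<Omega>: "open \<Omega>" and v: "v \<in> H1_0 \<Omega>"
  shows "\<exists>\<phi>. (\<forall>k::nat. \<phi> k \<in> test \<Omega>) \<and> (\<lambda>k. l2_norm (lebesgue_on \<Omega>) (\<lambda>x. v x - \<phi> k x)) \<longlonglongrightarrow> 0 \<and>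
    (\<forall>j. (\<lambda>k. l2_norm (lebesgue_on \<Omega>) (\<lambda>x. partial j (\<phi> k) x - wpartial \<Omega> j v x)) \<longlonglongrightarrow> 0) \<and>
    (\<lambda>k. l2_norm (lebesgue_on \<Omega>) (\<lambda>x. wdiv \<Omega> v x - pdiv (\<phi> k) x)) \<longlonglongrightarrow> 0"
proof -
  let ?M = "lebesgue_on \<Omega>"
  have \<Omega>b: "\<Omega> \<in> sets borel" using \<Omega> by simp
  note h = H1_wpartial[OF \<Omega> H1_0_H1[OF v]]
  obtain \<phi> where "(\<forall>k::nat. \<phi> k \<in> test \<Omega>) \<and> (\<lambda>k. l2_norm ?M (\<lambda>x. \<phi> k x - v x)) \<longlonglongrightarrow> 0 \<and>
    (\<forall>j. (\<lambda>k. l2_norm ?M (\<lambda>x. partial j (\<phi> k) x - wpartial \<Omega> j v x)) \<longlonglongrightarrow> 0)"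
    using H1_0_sequence[OF \<Omega> v] by (elim exE) (rule that)
  then have \<phi>: "\<And>k. \<phi> k \<in> test \<Omega>" "(\<lambda>k. l2_norm ?M (\<lambda>x. \<phi> k x - v x)) \<longlonglongrightarrow> 0"
    "\<And>j. (\<lambda>k. l2_norm ?M (\<lambda>x. partial j (\<phi> k) x - wpartial \<Omega> j v x)) \<longlonglongrightarrow> 0"
    by simp_all
  have dl: "(\<lambda>x. partial j (\<phi> k) x - wpartial \<Omega> j v x) \<in> l2 ?M" for j k
    by (intro l2_diff h(2) test_l2_on[OF test_partial[OF \<phi>(1)] \<Omega>b])
  let ?D = "\<lambda>x. \<Sum>j\<in>UNIV. wpartial \<Omega> j v x $ j"
  have Dl: "?D \<in> l2 ?M" "wdiv \<Omega> v \<in> l2 ?M"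
    using has_weak_div_partial[OF \<Omega> h] wdiv_properties(1)[OF \<Omega> has_weak_div_partial[OF \<Omega> h]] by auto
  have "norm (l2_norm ?M (\<lambda>x. wdiv \<Omega> v x - pdiv (\<phi> k) x))
      \<le> (\<Sum>j\<in>UNIV. l2_norm ?M (\<lambda>x. partial j (\<phi> k) x - wpartial \<Omega> j v x))" for k
  proof -
    have "l2_norm ?M (\<lambda>x. wdiv \<Omega> v x - pdiv (\<phi> k) x) = l2_norm ?M (\<lambda>x. ?D x - pdiv (\<phi> k) x)"
    proof (rule l2_norm_cong_AE)
      show "AE x in ?M. wdiv \<Omega> v x - pdiv (\<phi> k) x = ?D x - pdiv (\<phi> k) x"
        using H1_wdiv[OF \<Omega> H1_0_H1[OF v]] by eventually_elim simp
    qed (use l2_measurable[OF l2_diff[OF Dl(1) test_l2_on[OF pdiv_test[OF \<phi>(1)] \<Omega>b]]]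
          l2_measurable[OF l2_diff[OF Dl(2) test_l2_on[OF pdiv_test[OF \<phi>(1)] \<Omega>b]]] in auto)
    also have "\<dots> = l2_norm ?M (\<lambda>x. \<Sum>j\<in>UNIV. (partial j (\<phi> k) x - wpartial \<Omega> j v x) $ j)"
      by (subst l2_norm_minus_commute) (simp add: pdiv_def sum_subtractf)
    also have "\<dots> \<le> (\<Sum>j\<in>UNIV. l2_norm ?M (\<lambda>x. (partial j (\<phi> k) x - wpartial \<Omega> j v x) $ j))"
      by (intro l2_norm_sum_le l2_bounded_linear[OF bounded_linear_vec_nth dl]) auto
    also have "\<dots> \<le> (\<Sum>j\<in>UNIV. l2_norm ?M (\<lambda>x. partial j (\<phi> k) x - wpartial \<Omega> j v x))"
    proof (intro sum_mono l2_norm_mono[OF dl])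
      fix j
      show "(\<lambda>x. (partial j (\<phi> k) x - wpartial \<Omega> j v x) $ j) \<in> borel_measurable ?M"
        by (rule l2_measurable[OF l2_bounded_linear[OF bounded_linear_vec_nth dl]])
      show "AE x in ?M. norm ((partial j (\<phi> k) x - wpartial \<Omega> j v x) $ j) \<le> norm (partial j (\<phi> k) x - wpartial \<Omega> j v x)"
        by (intro AE_I2) (simp only: real_norm_def component_le_norm_cart)
    qed
    finally show ?thesis by simp
  qed
  then have le: "\<forall>\<^sub>F k in sequentially. norm (l2_norm ?M (\<lambda>x. wdiv \<Omega> v x - pdiv (\<phi> k) x))
      \<le> (\<Sum>j\<in>UNIV. l2_norm ?M (\<lambda>x. partial j (\<phi> k) x - wpartial \<Omega> j v x))"
    by (rule always_eventually[OF allI])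
  have "(\<lambda>k. \<Sum>j\<in>UNIV. l2_norm ?M (\<lambda>x. partial j (\<phi> k) x - wpartial \<Omega> j v x)) \<longlonglongrightarrow> (\<Sum>j\<in>(UNIV::'n set). 0)"
    by (intro tendsto_sum \<phi>(3))
  then have "(\<lambda>k. \<Sum>j\<in>UNIV. l2_norm ?M (\<lambda>x. partial j (\<phi> k) x - wpartial \<Omega> j v x)) \<longlonglongrightarrow> 0"
    by simp
  from Lim_null_comparison[OF le this]
  have "(\<lambda>k. l2_norm ?M (\<lambda>x. wdiv \<Omega> v x - pdiv (\<phi> k) x)) \<longlonglongrightarrow> 0" .
  then show ?thesis using \<phi> by (intro exI[of _ \<phi>]) (simp add: l2_norm_minus_commute[of ?M v])
qed

lemma H1_0_H0div:
  fixes v :: "real ^ 'n \<Rightarrow> real ^ 'n"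
  assumes \<Omega>: "open \<Omega>" and v: "v \<in> H1_0 \<Omega>"
  shows "v \<in> H0div \<Omega>"
proof -
  let ?M = "lebesgue_on \<Omega>"
  have \<Omega>b: "\<Omega> \<in> sets borel" using \<Omega> by simp
  note h = H1_wpartial[OF \<Omega> H1_0_H1[OF v]]
  note wd = wdiv_properties[OF \<Omega> has_weak_div_partial[OF \<Omega> h]]
  obtain \<phi> where "(\<forall>k::nat. \<phi> k \<in> test \<Omega>) \<and> (\<lambda>k. l2_norm ?M (\<lambda>x. v x - \<phi> k x)) \<longlonglongrightarrow> 0 \<and>
    (\<forall>j. (\<lambda>k. l2_norm ?M (\<lambda>x. partial j (\<phi> k) x - wpartial \<Omega> j v x)) \<longlonglongrightarrow> 0) \<and>
    (\<lambda>k. l2_norm ?M (\<lambda>x. wdiv \<Omega> v x - pdiv (\<phi> k) x)) \<longlonglongrightarrow> 0"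
    using H1_0_approx_Hdiv[OF \<Omega> v] by (elim exE) (rule that)
  then have \<phi>: "\<And>k. \<phi> k \<in> test \<Omega>" "(\<lambda>k. l2_norm ?M (\<lambda>x. v x - \<phi> k x)) \<longlonglongrightarrow> 0"
    "(\<lambda>k. l2_norm ?M (\<lambda>x. wdiv \<Omega> v x - pdiv (\<phi> k) x)) \<longlonglongrightarrow> 0"
    by simp_all
  show ?thesis
    unfolding H0div_iff[OF \<Omega> h(1) wd(1,2)]
  proof
    fix q :: "real ^ 'n \<Rightarrow> real" assume q: "q \<in> H1 \<Omega>"
    have "(\<lambda>k. l2_inner ?M (\<phi> k) (wgrad \<Omega> q) + l2_inner ?M (pdiv (\<phi> k)) q)
        \<longlonglongrightarrow> l2_inner ?M v (wgrad \<Omega> q) + l2_inner ?M (wdiv \<Omega> v) q"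
      using \<phi> by (intro tendsto_add l2_inner_tendsto_left h wd wgrad_l2[OF \<Omega> q] H1_wpartial(1)[OF \<Omega> q]
          test_l2_on[OF \<phi>(1) \<Omega>b] test_l2_on[OF pdiv_test[OF \<phi>(1)] \<Omega>b])
        (simp_all add: l2_norm_minus_commute[of ?M v] l2_norm_minus_commute[of ?M "wdiv \<Omega> v"])
    then show "l2_inner ?M v (wgrad \<Omega> q) + l2_inner ?M (wdiv \<Omega> v) q = 0"
      by (simp add: test_green[OF \<Omega> \<phi>(1) q] LIMSEQ_const_iff)
  qed
qed

section \<open>Symmetric parts and the divergence paired with fields in the closure of the test
  fields\<close>

definition symm :: "real ^ 'n ^ 'n \<Rightarrow> real ^ 'n ^ 'n" where
  "symm A = (1/2) *\<^sub>R (A + transpose A)"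

lemma bounded_linear_transpose: "bounded_linear (transpose :: real ^ 'n ^ 'n \<Rightarrow> real ^ 'n ^ 'n)"
  by (rule bounded_linearI') (simp_all add: transpose_def vec_eq_iff)

lemma bounded_linear_symm: "bounded_linear (symm :: real ^ 'n ^ 'n \<Rightarrow> _)"
  unfolding symm_def[abs_def]
  by (intro bounded_linear_const_scaleR bounded_linear_add bounded_linear_ident bounded_linear_transpose)

lemma inner_transpose: "(A :: real ^ 'n ^ 'n) \<bullet> transpose B = transpose A \<bullet> B"
  by (simp add: inner_vec_def transpose_def) (rule sum.swap)

lemma symmetric_inner_symm: "transpose A = A \<Longrightarrow> A \<bullet> symm B = A \<bullet> B"
  by (simp add: symm_def inner_add_right inner_transpose)

lemma transpose_symm [simp]: "transpose (symm A) = symm A"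
  by (simp add: symm_def transpose_def vec_eq_iff)

lemma jacobian_nth: "jacobian \<phi> (at x) $ i $ j = partial j \<phi> x $ i"
  by (simp add: jacobian_def matrix_def partial_def)

lemma jacobian_eq: "jacobian \<phi> (at x) = (\<chi> i j. partial j \<phi> x $ i)"
  by (simp add: vec_eq_iff jacobian_nth)

lemma jacobian_test: "\<phi> \<in> test \<Omega> \<Longrightarrow> (\<lambda>x. jacobian \<phi> (at x)) \<in> test \<Omega>"
  unfolding jacobian_eq
  by (intro test_vec_lambda test_bounded_linear[OF bounded_linear_vec_nth] test_partial)

lemma eps_eq_symm: "eps \<Omega> v x = symm (wgrad_vec \<Omega> v x)"
  by (simp add: eps_def symm_def)

lemma l2_matrix_columns:
  fixes G :: "'n \<Rightarrow> 'a \<Rightarrow> real ^ 'n"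
  assumes "\<And>j. G j \<in> l2 M"
  shows "(\<lambda>x. \<chi> i j. G j x $ i) \<in> l2 M"
proof -
  have "bounded_linear (\<lambda>y :: real ^ 'n. (\<chi> i k. if k = j then y $ i else 0) :: real ^ 'n ^ 'n)" for j
    by (rule bounded_linearI') (simp_all add: vec_eq_iff)
  then have "(\<lambda>x. \<Sum>j\<in>UNIV. (\<chi> i k. if k = j then G j x $ i else 0) :: real ^ 'n ^ 'n) \<in> l2 M"
    by (intro l2_sum l2_bounded_linear[OF _ assms])
  moreover have "(\<Sum>j\<in>UNIV. (\<chi> i k. if k = j then G j x $ i else 0)) = (\<chi> i j. G j x $ i)" for x
    by (simp add: vec_eq_iff)
  ultimately show ?thesis by simp
qed

lemma l2_norm_matrix_columns:
  fixes G :: "'n::finite \<Rightarrow> 'a \<Rightarrow> real ^ 'n"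
  assumes "\<And>j. G j \<in> l2 M"
  shows "(l2_norm M (\<lambda>x. \<chi> i j. G j x $ i))\<^sup>2 = (\<Sum>j\<in>UNIV. (l2_norm M (G j))\<^sup>2)"
proof -
  have "(norm (\<chi> i j. G j x $ i))\<^sup>2 = (\<Sum>j\<in>UNIV. (norm (G j x))\<^sup>2)" for x
    unfolding norm_matrix_sq power2_norm_eq_inner inner_vec_def
    by (simp add: power2_eq_square) (rule sum.swap)
  then show ?thesis using l2_integrable[OF assms] by (simp add: l2_norm_sq)
qed

lemma eps_l2:
  fixes v :: "real ^ 'n \<Rightarrow> real ^ 'n"
  assumes "open \<Omega>" "v \<in> H1 \<Omega>"
  shows "eps \<Omega> v \<in> l2 (lebesgue_on \<Omega>)"
proof -
  have "(\<lambda>x. symm (\<chi> i j. wpartial \<Omega> j v x $ i)) \<in> l2 (lebesgue_on \<Omega>)"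
    by (intro l2_bounded_linear[OF bounded_linear_symm] l2_matrix_columns H1_wpartial[OF assms])
  moreover have "eps \<Omega> v = (\<lambda>x. symm (\<chi> i j. wpartial \<Omega> j v x $ i))"
    by (intro ext) (simp add: eps_eq_symm wgrad_vec_def)
  ultimately show ?thesis by simp
qed

text \<open>The identity holds on test fields with the Jacobian and passes to the limit, on the left
  by boundedness in the graph norm, on the right by convergence of the gradients in L2. Symmetry of
  \<open>\<tau>\<close> then discards the skew part of the gradient.\<close>

lemma extends_div_H1_0:
  fixes v :: "real ^ 'n \<Rightarrow> real ^ 'n"
  assumes \<Omega>: "open \<Omega>" and F: "extends_div \<Omega> \<tau> F" and \<tau>: "\<tau> \<in> l2 (lebesgue_on \<Omega>)"
    and sym: "AE x in lebesgue_on \<Omega>. transpose (\<tau> x) = \<tau> x" and v: "v \<in> H1_0 \<Omega>"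
  shows "F v = - l2_inner (lebesgue_on \<Omega>) \<tau> (eps \<Omega> v)"
proof -
  let ?M = "lebesgue_on \<Omega>"
  have \<Omega>b: "\<Omega> \<in> sets borel" using \<Omega> by simp
  note h = H1_wpartial[OF \<Omega> H1_0_H1[OF v]]
  obtain \<phi> where "(\<forall>k::nat. \<phi> k \<in> test \<Omega>) \<and> (\<lambda>k. l2_norm ?M (\<lambda>x. v x - \<phi> k x)) \<longlonglongrightarrow> 0 \<and>
    (\<forall>j. (\<lambda>k. l2_norm ?M (\<lambda>x. partial j (\<phi> k) x - wpartial \<Omega> j v x)) \<longlonglongrightarrow> 0) \<and>
    (\<lambda>k. l2_norm ?M (\<lambda>x. wdiv \<Omega> v x - pdiv (\<phi> k) x)) \<longlonglongrightarrow> 0"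
    using H1_0_approx_Hdiv[OF \<Omega> v] by (elim exE) (rule that)
  then have \<phi>: "\<And>k. \<phi> k \<in> test \<Omega>" "(\<lambda>k. l2_norm ?M (\<lambda>x. v x - \<phi> k x)) \<longlonglongrightarrow> 0"
    "\<And>j. (\<lambda>k. l2_norm ?M (\<lambda>x. partial j (\<phi> k) x - wpartial \<Omega> j v x)) \<longlonglongrightarrow> 0"
    "(\<lambda>k. l2_norm ?M (\<lambda>x. wdiv \<Omega> v x - pdiv (\<phi> k) x)) \<longlonglongrightarrow> 0"
    by simp_all
  let ?W = "\<lambda>x. wgrad_vec \<Omega> v x" and ?J = "\<lambda>k x. jacobian (\<phi> k) (at x)"
  have Wl: "?W \<in> l2 ?M" unfolding wgrad_vec_def by (intro l2_matrix_columns h)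
  have Jl: "?J k \<in> l2 ?M" for k by (rule test_l2_on[OF jacobian_test[OF \<phi>(1)] \<Omega>b])
  have dl: "(\<lambda>x. partial j (\<phi> k) x - wpartial \<Omega> j v x) \<in> l2 ?M" for j k
    by (intro l2_diff h(2) test_l2_on[OF test_partial[OF \<phi>(1)] \<Omega>b])
  have "?J k x - ?W x = (\<chi> i j. (partial j (\<phi> k) x - wpartial \<Omega> j v x) $ i)" for k x
    by (simp add: vec_eq_iff jacobian_nth wgrad_vec_def)
  then have "(l2_norm ?M (\<lambda>x. ?J k x - ?W x))\<^sup>2 = (\<Sum>j\<in>UNIV. (l2_norm ?M (\<lambda>x. partial j (\<phi> k) x - wpartial \<Omega> j v x))\<^sup>2)" for k
    using l2_norm_matrix_columns[of "\<lambda>j x. partial j (\<phi> k) x - wpartial \<Omega> j v x" ?M, OF dl] by simp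
  moreover have "(\<lambda>k. \<Sum>j\<in>UNIV. (l2_norm ?M (\<lambda>x. partial j (\<phi> k) x - wpartial \<Omega> j v x))\<^sup>2) \<longlonglongrightarrow> (\<Sum>j\<in>(UNIV::'n set). 0\<^sup>2)"
    by (intro tendsto_sum tendsto_power \<phi>(3))
  ultimately have "(\<lambda>k. sqrt ((l2_norm ?M (\<lambda>x. ?J k x - ?W x))\<^sup>2)) \<longlonglongrightarrow> sqrt 0"
    by (intro tendsto_real_sqrt) simp
  then have lim: "(\<lambda>k. l2_norm ?M (\<lambda>x. ?J k x - ?W x)) \<longlonglongrightarrow> 0" by simp
  have "(\<lambda>k. - l2_inner ?M (?J k) \<tau>) \<longlonglongrightarrow> - l2_inner ?M ?W \<tau>"
    by (intro tendsto_minus l2_inner_tendsto_left[OF Jl Wl \<tau> lim])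
  moreover have "(\<lambda>k. F (\<phi> k)) \<longlonglongrightarrow> F v"
    using F by (intro H0div_dual_tendsto[OF \<Omega> _ H1_0_H0div[OF \<Omega> v] \<phi>(1,2,4)]) (simp add: extends_div_def)
  moreover have "F (\<phi> k) = - l2_inner ?M (?J k) \<tau>" for k
    using F \<phi>(1) by (simp add: extends_div_def ip_eq_l2_inner l2_inner_commute)
  ultimately have "F v = - l2_inner ?M \<tau> ?W"
    using LIMSEQ_unique by (auto simp: l2_inner_commute)
  also have "l2_inner ?M \<tau> ?W = l2_inner ?M \<tau> (eps \<Omega> v)"
    unfolding l2_inner_def
  proof (rule integral_cong_AE)
    show "AE x in ?M. \<tau> x \<bullet> ?W x = \<tau> x \<bullet> eps \<Omega> v x"
      using sym by eventually_elim (simp add: eps_eq_symm symmetric_inner_symm)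
  qed (use l2_measurable \<tau> Wl eps_l2[OF \<Omega> H1_0_H1[OF v]] in auto)
  finally show ?thesis .
qed

section \<open>Mean value of the divergence and divergence-free fields\<close>

lemma l2_const:
  fixes \<Omega> :: "'a::euclidean_space set"
  assumes "open \<Omega>" "bounded \<Omega>"
  shows "(\<lambda>x. c) \<in> l2 (lebesgue_on \<Omega>)"
proof -
  have [measurable]: "\<Omega> \<in> sets borel" using assms by simp
  obtain R where R: "\<And>x. x \<in> \<Omega> \<Longrightarrow> norm x \<le> R" using assms(2) bounded_iff by blast
  have "(\<lambda>x. indicator \<Omega> x *\<^sub>R c) \<in> l2 lborel"
    by (rule l2_bounded_support[where B = "norm c" and R = R]) (use R in \<open>auto simp: indicator_def not_le[symmetric]\<close>)
  then have "(\<lambda>x. indicator \<Omega> x *\<^sub>R c) \<in> l2 (lebesgue_on \<Omega>)" by (rule l2_restrict) simp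
  then show ?thesis by (rule l2_cong_AE) (auto intro!: AE_I2)
qed

text \<open>Green's formula with the constant function 1, which belongs to
  \<open>H1 \<Omega>\<close> because \<Omega> is bounded, and whose gradient is zero.\<close>

lemma H0div_mean_zero:
  fixes v :: "real ^ 'n \<Rightarrow> real ^ 'n"
  assumes \<Omega>: "open \<Omega>" "bounded \<Omega>" and v: "v \<in> H0div \<Omega>"
  shows "(LINT x|lebesgue_on \<Omega>. wdiv \<Omega> v x) = 0"
proof -
  let ?M = "lebesgue_on \<Omega>"
  note one = l2_const[OF \<Omega>, of "1::real"] and zero = l2_const[OF \<Omega>, of "0::real"]
  have wp: "has_weak_partial \<Omega> j (\<lambda>x. 1::real) (\<lambda>x. 0)" for j
    using has_weak_partial_smooth[OF \<Omega>(1) smooth_const one, of j] zero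
    by (simp add: partial_def[abs_def])
  have H1: "(\<lambda>x. 1::real) \<in> H1 \<Omega>" by (rule H1I[OF one zero wp])
  have "AE x in ?M. \<forall>j\<in>UNIV. wpartial \<Omega> j (\<lambda>x. 1::real) x = 0"
    by (intro AE_finite_allI) (auto intro: wpartial_properties(3)[OF \<Omega>(1) one zero wp])
  then have "AE x in ?M. wgrad \<Omega> (\<lambda>x. 1) x = 0"
    by eventually_elim (simp add: wgrad_def vec_eq_iff)
  then have "l2_inner ?M v (wgrad \<Omega> (\<lambda>x. 1)) = l2_inner ?M v (\<lambda>x. 0)"
    using l2_measurable wgrad_l2[OF \<Omega>(1) H1] Hdiv_wdiv(1)[OF \<Omega>(1) H0div_Hdiv[OF v]]
    by (intro l2_inner_cong_AE) auto
  then show ?thesis using H0div_green[OF \<Omega>(1) v H1] by (simp add: l2_inner_def)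
qed

text \<open>The divergence has mean zero by the vanishing normal trace, so it is itself an
  admissible \<open>q\<close>; tested against itself it has norm zero.\<close>

lemma H0div_div_free:
  fixes v :: "real ^ 'n \<Rightarrow> real ^ 'n"
  assumes \<Omega>: "open \<Omega>" "bounded \<Omega>" and v: "v \<in> H0div \<Omega>"
    and orth: "\<And>q. q \<in> L2_0 \<Omega> \<Longrightarrow> ip \<Omega> (wdiv \<Omega> v) q = 0"
  shows "AE x in lebesgue_on \<Omega>. wdiv \<Omega> v x = 0"
proof -
  note w = Hdiv_wdiv(2)[OF \<Omega>(1) H0div_Hdiv[OF v]]
  have "wdiv \<Omega> v \<in> L2_0 \<Omega>" using w H0div_mean_zero[OF \<Omega> v] by (simp add: L2_0_def L2_eq_l2)
  then have "l2_norm (lebesgue_on \<Omega>) (wdiv \<Omega> v) = 0"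
    using orth l2_norm_sq_inner[of "lebesgue_on \<Omega>" "wdiv \<Omega> v"] by (simp add: ip_eq_l2_inner)
  then show ?thesis by (rule l2_norm_eq_0[OF w])
qed

subsection \<open>Boundary layers of polytopal domains\<close>

text \<open>The complement of one polyhedron is a finite union of open half-spaces. Intersecting
  with the pieces found so far and distributing over the unions keeps every piece open and convex;
  overlaps do no harm.\<close>

lemma complement_polyhedra_convex_cover:
  fixes \<P> :: "'a::euclidean_space set set"
  assumes "finite \<P>" "\<forall>P\<in>\<P>. polyhedron P"
  shows "\<exists>\<R>. finite \<R> \<and> (\<forall>R\<in>\<R>. open R \<and> convex R) \<and> - \<Union>\<P> = \<Union>\<R>"
  using assms
proof (induction \<P> rule: finite_induct)
  case empty
  show ?case by (intro exI[of _ "{UNIV}"]) auto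
next
  case (insert P \<P>)
  then obtain \<R> where \<R>: "finite \<R>" "\<And>R. R \<in> \<R> \<Longrightarrow> open R \<and> convex R" "- \<Union>\<P> = \<Union>\<R>" by auto
  obtain F where F: "finite F" "P = \<Inter>F" "\<And>h. h \<in> F \<Longrightarrow> \<exists>a b. a \<noteq> 0 \<and> h = {x. a \<bullet> x \<le> b}"
    using insert.prems unfolding polyhedron_def by auto
  have co: "open (- h) \<and> convex (- h)" if h: "h \<in> F" for h
  proof -
    obtain a b where "h = {x. a \<bullet> x \<le> b}" using F(3)[OF h] by blast
    then have "- h = {x. a \<bullet> x > b}" by auto
    then show ?thesis by (simp add: open_halfspace_gt convex_halfspace_gt)
  qed
  let ?S = "(\<lambda>(h, R). - h \<inter> R) ` (F \<times> \<R>)"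
  have "- \<Union>(insert P \<P>) = - P \<inter> \<Union>\<R>" using \<R>(3) by auto
  also have "\<dots> = \<Union>?S" unfolding F(2) by auto
  finally have "- \<Union>(insert P \<P>) = \<Union>?S" .
  moreover have "finite ?S" using F(1) \<R>(1) by auto
  moreover have "\<forall>R\<in>?S. open R \<and> convex R" using co \<R>(2) by (auto intro: open_Int convex_Int)
  ultimately show ?case by blast
qed

text \<open>A bounded convex open set contains the cone with any of its points \<open>y\<close> as apex over a fixed ball
  \<open>B(z, \<rho>)\<close>; the directions \<open>z - y\<close> may be replaced by those of a finite net.\<close>

lemma convex_open_finite_directions:
  fixes R :: "'a::euclidean_space set"
  assumes R: "open R" "convex R" "bounded R"
  shows "\<exists>E d0. finite E \<and> d0 > 0 \<and> (\<forall>d y x. 0 < d \<and> d \<le> d0 \<and> y \<in> R \<and> norm (x - y) \<le> d \<longrightarrow> (\<exists>e\<in>E. x + d *\<^sub>R e \<in> R))"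
proof (cases "R = {}")
  case True
  then show ?thesis by (intro exI[of _ "{}"] exI[of _ 1]) auto
next
  case False
  then obtain z where "z \<in> R" by blast
  then obtain \<rho> where \<rho>: "\<rho> > 0" "ball z \<rho> \<subseteq> R" using R(1) open_contains_ball by blast
  obtain B where B: "\<And>x. x \<in> R \<Longrightarrow> norm x \<le> B" using R(3) bounded_iff by blast
  have "\<forall>e>0. \<exists>k. finite k \<and> cball (0::'a) (2 * B) \<subseteq> (\<Union>x\<in>k. ball x e)"
    using compact_cball[of "0::'a" "2 * B"] unfolding compact_eq_totally_bounded by (rule conjunct2)
  from this[rule_format, of "\<rho>/2"] \<rho>(1)
  obtain K where K: "finite K" "cball (0::'a) (2 * B) \<subseteq> (\<Union>e\<in>K. ball e (\<rho>/2))" by auto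
  let ?E = "(\<lambda>e. (4/\<rho>) *\<^sub>R e) ` K"
  have "\<exists>e\<in>?E. x + d *\<^sub>R e \<in> R" if d: "0 < d" "d \<le> \<rho>/4" and y: "y \<in> R" and x: "norm (x - y) \<le> d" for d x y
  proof -
    have "norm (z - y) \<le> 2 * B" using B[OF y] B[OF \<open>z \<in> R\<close>] norm_triangle_ineq4[of z y] by linarith
    then have "z - y \<in> (\<Union>e\<in>K. ball e (\<rho>/2))"
      by (intro subsetD[OF K(2)]) simp
    then obtain e where e: "e \<in> K" "norm (z - y - e) < \<rho>/2"
      by (auto simp: dist_norm norm_minus_commute)
    \<comment> \<open>The parameter on the segment from \<open>y\<close> into the ball around
      \<open>z\<close>. With this value the displacement \<open>x - y\<close>, divided by
      \<open>t\<close>, has norm at most \<open>\<rho>/4\<close>; together with the net's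
      \<open>\<rho>/2\<close> it stays below \<open>\<rho>\<close>. The restriction
      \<open>d \<le> \<rho>/4\<close> is what gives \<open>t \<le> 1\<close>.\<close>
    define t where "t = 4 * d / \<rho>"
    have t: "0 < t" "t \<le> 1" "t * \<rho> = 4 * d" using d \<rho>(1) by (auto simp: t_def field_simps)
    \<comment> \<open>The solution of
      \<open>(1 - t) *\<^sub>R y + t *\<^sub>R w = x + t *\<^sub>R e\<close>: the translated point
      is exhibited as a convex combination of \<open>y\<close> and a point near
      \<open>z\<close>.\<close>
    define w where "w = z + (1/t) *\<^sub>R (x - y) + (e - (z - y))"
    have "norm ((1/t) *\<^sub>R (x - y)) = norm (x - y) / t" using t(1) by (simp del: scaleR_diff_right)
    also have "\<dots> \<le> d / t" using x t(1) by (intro divide_right_mono) auto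
    also have "\<dots> = \<rho>/4" using d(1) \<rho>(1) by (simp add: t_def)
    finally have "norm ((1/t) *\<^sub>R (x - y)) \<le> \<rho>/4" .
    moreover have "norm (e - (z - y)) < \<rho>/2" using e(2) by (simp only: norm_minus_commute[of e "z - y"])
    ultimately have "norm ((1/t) *\<^sub>R (x - y) + (e - (z - y))) < \<rho>"
      using norm_triangle_ineq[of "(1/t) *\<^sub>R (x - y)" "e - (z - y)"] \<rho>(1) by linarith
    moreover have "w - z = (1/t) *\<^sub>R (x - y) + (e - (z - y))" unfolding w_def by simp
    ultimately have "norm (w - z) < \<rho>" by (simp only:)
    then have "w \<in> R" using \<rho>(2) by (auto simp: dist_norm norm_minus_commute)
    then have "(1 - t) *\<^sub>R y + t *\<^sub>R w \<in> R" using R(2) y t by (intro convexD) auto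
    also have "(1 - t) *\<^sub>R y + t *\<^sub>R w = x + t *\<^sub>R e"
      using t(1) by (simp add: w_def algebra_simps)
    also have "t *\<^sub>R e = d *\<^sub>R ((4/\<rho>) *\<^sub>R e)" by (simp add: t_def)
    finally show ?thesis using e(1) by blast
  qed
  then show ?thesis using K(1) \<rho>(1) by (intro exI[of _ ?E] exI[of _ "\<rho>/4"]) auto
qed

lemma polytopal_domain_open: "polytopal_domain \<Omega> \<Longrightarrow> open \<Omega>"
  by (auto simp: polytopal_domain_def)

text \<open>Since \<Omega> is the interior of the union of polytopes, its complement is the closure
  of the union of the open convex pieces. A point near the complement is therefore near an interior
  point of some piece, and the cone contained in that piece supplies the direction.\<close>

lemma polytopal_domain_exit_directions:
  fixes \<Omega> :: "(real ^ 'n) set"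
  assumes "polytopal_domain \<Omega>" "bounded \<Omega>"
  shows "\<exists>E d0. finite E \<and> d0 > 0 \<and>
    (\<forall>d x y. 0 < d \<and> d \<le> d0 \<and> x \<in> \<Omega> \<and> y \<notin> \<Omega> \<and> dist x y < d \<longrightarrow> (\<exists>e\<in>E. x + d *\<^sub>R e \<notin> \<Omega>))"
proof -
  obtain \<P> where \<P>: "finite \<P>" "\<forall>P\<in>\<P>. polytope P" "\<Omega> = interior (\<Union>\<P>)"
    using assms(1) by (auto simp: polytopal_domain_def)
  obtain \<R> where \<R>: "finite \<R>" "\<And>R. R \<in> \<R> \<Longrightarrow> open R \<and> convex R" "- \<Union>\<P> = \<Union>\<R>"
    using complement_polyhedra_convex_cover[OF \<P>(1)] \<P>(2) polytope_imp_polyhedron by metis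
  have \<Omega>N: "- \<Omega> = closure (\<Union>\<R>)" using \<P>(3) \<R>(3) by (metis closure_complement)
  obtain B where B: "\<And>x. x \<in> \<Omega> \<Longrightarrow> norm x \<le> B" using assms(2) bounded_iff by blast
  let ?T = "\<lambda>R. R \<inter> ball 0 (B + 1)"
  have "\<forall>R\<in>\<R>. \<exists>E d0. finite E \<and> d0 > 0 \<and> (\<forall>d y x. 0 < d \<and> d \<le> d0 \<and> y \<in> ?T R \<and> norm (x - y) \<le> d \<longrightarrow> (\<exists>e\<in>E. x + d *\<^sub>R e \<in> ?T R))"
    using \<R>(2) by (intro ballI convex_open_finite_directions) (auto intro: open_Int convex_Int bounded_Int)
  then obtain E d0 where Ed: "\<And>R. R \<in> \<R> \<Longrightarrow> finite (E R)" "\<And>R. R \<in> \<R> \<Longrightarrow> d0 R > (0::real)"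
    "\<And>R d y x. R \<in> \<R> \<Longrightarrow> 0 < d \<Longrightarrow> d \<le> d0 R \<Longrightarrow> y \<in> ?T R \<Longrightarrow> norm (x - y) \<le> d \<Longrightarrow> \<exists>e\<in>E R. x + d *\<^sub>R e \<in> ?T R"
    by metis
  \<comment> \<open>The entry 1 makes the set nonempty and also keeps points within distance
    \<open>d1\<close> of \<Omega> inside the ball of radius \<open>B + 1\<close> that bounds the
    pieces.\<close>
  define d1 where "d1 = Min (insert 1 (d0 ` \<R>))"
  have d1: "d1 > 0" "d1 \<le> 1" "\<And>R. R \<in> \<R> \<Longrightarrow> d1 \<le> d0 R"
    using \<R>(1) Ed(2) by (auto simp: d1_def)
  have "\<exists>e\<in>\<Union>(E ` \<R>). x + d *\<^sub>R e \<notin> \<Omega>" if d: "0 < d" "d \<le> d1" and x: "x \<in> \<Omega>" and y: "y \<notin> \<Omega>" "dist x y < d" for d x y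
  proof -
    have "y \<in> closure (\<Union>\<R>)" using y(1) \<Omega>N by blast
    \<comment> \<open>\<open>y\<close> may lie on the boundary and in no piece; the strict
      inequality \<open>dist x y < d\<close> leaves room to replace it by a point of a
      piece.\<close>
    then have "\<exists>w\<in>\<Union>\<R>. dist w y < d - dist x y"
      unfolding closure_approachable using y(2) by (elim allE[of _ "d - dist x y"]) simp
    then obtain w where w: "w \<in> \<Union>\<R>" "dist w y < d - dist x y" by blast
    have xw: "norm (x - w) < d" using w(2) dist_triangle[of x w y] by (simp add: dist_norm norm_minus_commute)
    obtain R where R: "R \<in> \<R>" "w \<in> R" using w(1) by blast
    have "norm w < B + 1" using B[OF x] xw d d1(2) norm_triangle_ineq2[of w x] by (simp add: norm_minus_commute)
    then have "w \<in> ?T R" using R by simp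
    then obtain e where "e \<in> E R" "x + d *\<^sub>R e \<in> ?T R"
      using Ed(3)[OF R(1) d(1) _ _ less_imp_le[OF xw]] d(2) d1(3)[OF R(1)] by force
    moreover have "\<Union>\<R> \<subseteq> - \<Omega>" unfolding \<Omega>N by (rule closure_subset)
    ultimately show ?thesis using R(1) by blast
  qed
  then show ?thesis using \<R>(1) Ed(1) d1(1) by (intro exI[of _ "\<Union>(E ` \<R>)"] exI[of _ d1]) blast
qed

section \<open>The L2 norm on the boundary layer\<close>

text \<open>Differentiability of translation in L2. A test function \<open>\<phi> k\<close> whose
  derivative is within \<open>\<epsilon>/3\<close> of \<open>G\<close> is fixed before
  \<open>s\<close>: its increments differ from those of \<open>U\<close> by at most
  \<open>s * (\<epsilon>/3)\<close> for every \<open>s\<close>, and its own Taylor remainder is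
  quadratic in \<open>s\<close>.\<close>

lemma l2_shift_expansion:
  fixes U :: "real ^ 'n \<Rightarrow> 'b::euclidean_space"
  assumes U: "U \<in> l2 lborel" and G: "G \<in> l2 lborel" and t: "\<And>k. \<phi> k \<in> test UNIV"
    and lim: "(\<lambda>k. l2_norm lborel (\<lambda>x. \<phi> k x - U x)) \<longlonglongrightarrow> 0"
      "(\<lambda>k. l2_norm lborel (\<lambda>x. frechet_derivative (\<phi> k) (at x) e - G x)) \<longlonglongrightarrow> 0"
    and "\<epsilon> > 0"
  shows "\<exists>t0>0. \<forall>s. 0 < s \<and> s \<le> t0 \<longrightarrow> l2_norm lborel (\<lambda>x. U (x + s *\<^sub>R e) - U x - s *\<^sub>R G x) \<le> \<epsilon> * s"
proof -
  let ?N = "l2_norm lborel"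
  let ?D = "\<lambda>k x. frechet_derivative (\<phi> k) (at x) e"
  have \<phi>l: "\<phi> k \<in> l2 lborel" "?D k \<in> l2 lborel" for k by (intro test_l2 test_deriv t)+
  note tr = l2_translate(1)
  obtain k where k: "?N (\<lambda>x. ?D k x - G x) < \<epsilon>/3"
    using order_tendstoD(2)[OF lim(2), of "\<epsilon>/3"] \<open>\<epsilon> > 0\<close> eventually_happens'[OF sequentially_bot] by fastforce
  \<comment> \<open>The bound on translations is available for test functions only, so
    \<open>U\<close> is compared with \<open>\<phi> k\<close> through a further
    \<open>\<phi> l\<close>. The increment of \<open>\<phi> l - \<phi> k\<close> is at most
    \<open>s\<close> times the norm of its derivative, and \<open>l\<close> tends to infinity with
    \<open>s\<close> fixed.\<close>
  have step: "?N (\<lambda>x. U (x + s *\<^sub>R e) - U x - (\<phi> k (x + s *\<^sub>R e) - \<phi> k x)) \<le> s * (\<epsilon>/3)" if "s > 0" for s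
  proof -
    have split: "?N (\<lambda>x. U (x + s *\<^sub>R e) - U x - (\<phi> k (x + s *\<^sub>R e) - \<phi> k x))
      \<le> ?N (\<lambda>x. U (x + s *\<^sub>R e) - \<phi> l (x + s *\<^sub>R e)) + ?N (\<lambda>x. \<phi> l x - U x)
        + s * (?N (\<lambda>x. ?D l x - G x) + ?N (\<lambda>x. G x - ?D k x))" for l
    proof -
      let ?\<psi> = "\<lambda>x. \<phi> l x - \<phi> k x"
      have \<psi>: "?\<psi> \<in> test UNIV" by (intro test_diff t)
      have "(?\<psi> has_derivative (\<lambda>h. frechet_derivative (\<phi> l) (at x) h - frechet_derivative (\<phi> k) (at x) h)) (at x)" for x
        by (intro has_derivative_diff smooth_has_derivative test_smooth[OF t])
      then have D\<psi>: "frechet_derivative ?\<psi> (at x) = (\<lambda>h. frechet_derivative (\<phi> l) (at x) h - frechet_derivative (\<phi> k) (at x) h)" for x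
        using frechet_derivative_at by metis
      have sc: "frechet_derivative ?\<psi> (at x) (s *\<^sub>R e) = s *\<^sub>R (?D l x - ?D k x)" for x
        using linear_scale[OF linear_frechet_derivative[OF smooth_differentiable[OF test_smooth[OF \<psi>]]], of x s e]
        by (simp add: D\<psi>)
      have "?N (\<lambda>x. ?\<psi> (x + s *\<^sub>R e) - ?\<psi> x) \<le> s * ?N (\<lambda>x. ?D l x - ?D k x)"
        using l2_translation_bound[OF \<psi>, of "s *\<^sub>R e"] \<open>s > 0\<close> unfolding sc l2_norm_scaleR by simp
      also have "\<dots> \<le> s * (?N (\<lambda>x. ?D l x - G x) + ?N (\<lambda>x. G x - ?D k x))"
        using \<open>s > 0\<close> by (intro mult_left_mono l2_norm_triangle_diff \<phi>l G) auto
      finally have 1: "?N (\<lambda>x. ?\<psi> (x + s *\<^sub>R e) - ?\<psi> x) \<le> s * (?N (\<lambda>x. ?D l x - G x) + ?N (\<lambda>x. G x - ?D k x))" .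
      have a: "(\<lambda>x. U (x + s *\<^sub>R e) - \<phi> l (x + s *\<^sub>R e)) \<in> l2 lborel" "(\<lambda>x. \<phi> l x - U x) \<in> l2 lborel"
        "(\<lambda>x. ?\<psi> (x + s *\<^sub>R e) - ?\<psi> x) \<in> l2 lborel"
        by (intro l2_diff tr U \<phi>l test_l2[OF \<psi>])+
      have "?N (\<lambda>x. U (x + s *\<^sub>R e) - U x - (\<phi> k (x + s *\<^sub>R e) - \<phi> k x))
          = ?N (\<lambda>x. (U (x + s *\<^sub>R e) - \<phi> l (x + s *\<^sub>R e)) + (\<phi> l x - U x) + (?\<psi> (x + s *\<^sub>R e) - ?\<psi> x))"
        by (simp add: algebra_simps)
      also have "\<dots> \<le> ?N (\<lambda>x. (U (x + s *\<^sub>R e) - \<phi> l (x + s *\<^sub>R e)) + (\<phi> l x - U x)) + ?N (\<lambda>x. ?\<psi> (x + s *\<^sub>R e) - ?\<psi> x)"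
        by (intro l2_norm_triangle l2_add a)
      also have "\<dots> \<le> ?N (\<lambda>x. U (x + s *\<^sub>R e) - \<phi> l (x + s *\<^sub>R e)) + ?N (\<lambda>x. \<phi> l x - U x) + ?N (\<lambda>x. ?\<psi> (x + s *\<^sub>R e) - ?\<psi> x)"
        by (intro add_right_mono l2_norm_triangle a)
      finally show ?thesis using 1 by linarith
    qed
    have shifted: "?N (\<lambda>x. U (x + s *\<^sub>R e) - \<phi> l (x + s *\<^sub>R e)) = ?N (\<lambda>x. \<phi> l x - U x)" for l
      using l2_translate(2)[OF l2_diff[OF U \<phi>l(1)[of l]], of "s *\<^sub>R e"] by (simp add: l2_norm_minus_commute[of _ U])
    have "?N (\<lambda>x. U (x + s *\<^sub>R e) - U x - (\<phi> k (x + s *\<^sub>R e) - \<phi> k x))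
      \<le> ?N (\<lambda>x. \<phi> l x - U x) + ?N (\<lambda>x. \<phi> l x - U x)
        + s * (?N (\<lambda>x. ?D l x - G x) + ?N (\<lambda>x. G x - ?D k x))" for l
      using split[of l] unfolding shifted .
    moreover have "(\<lambda>l. ?N (\<lambda>x. \<phi> l x - U x) + ?N (\<lambda>x. \<phi> l x - U x)
        + s * (?N (\<lambda>x. ?D l x - G x) + ?N (\<lambda>x. G x - ?D k x))) \<longlonglongrightarrow> 0 + 0 + s * (0 + ?N (\<lambda>x. G x - ?D k x))"
      by (intro tendsto_intros lim)
    ultimately have "?N (\<lambda>x. U (x + s *\<^sub>R e) - U x - (\<phi> k (x + s *\<^sub>R e) - \<phi> k x)) \<le> 0 + 0 + s * (0 + ?N (\<lambda>x. G x - ?D k x))"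
      by (intro LIMSEQ_le_const) auto
    also have "\<dots> \<le> s * (\<epsilon>/3)"
      using k \<open>s > 0\<close> by (simp add: l2_norm_minus_commute[of _ G])
    finally show ?thesis .
  qed
  obtain C where C: "C \<ge> 0" "\<And>t. \<bar>t\<bar> \<le> 1 \<Longrightarrow> ?N (\<lambda>x. \<phi> k (x + t *\<^sub>R e) - \<phi> k x - t *\<^sub>R ?D k x) \<le> C * t\<^sup>2"
    using l2_difference_quotient[OF t[of k], of e] by auto
  \<comment> \<open>The bound 1 is the range in which the quadratic remainder holds; the other entry
    makes \<open>C * s\<close> at most \<open>\<epsilon>/3\<close>, with \<open>C + 1\<close>
    guarding against division by zero.\<close>
  define t0 where "t0 = min 1 (\<epsilon> / (3 * (C + 1)))"
  have t0: "t0 > 0" using C(1) \<open>\<epsilon> > 0\<close> by (auto simp: t0_def)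
  have "?N (\<lambda>x. U (x + s *\<^sub>R e) - U x - s *\<^sub>R G x) \<le> \<epsilon> * s" if s: "0 < s" "s \<le> t0" for s
  proof -
    have "C * s \<le> (C + 1) * (\<epsilon> / (3 * (C + 1)))"
      using s C(1) by (intro mult_mono) (auto simp: t0_def)
    also have "\<dots> = \<epsilon>/3" using C(1) by (simp add: field_simps)
    finally have "C * s * s \<le> (\<epsilon>/3) * s" using s(1) by (intro mult_right_mono) auto
    then have "C * s\<^sup>2 \<le> s * (\<epsilon>/3)" by (simp add: power2_eq_square mult_ac)
    moreover have "?N (\<lambda>x. \<phi> k (x + s *\<^sub>R e) - \<phi> k x - s *\<^sub>R ?D k x) \<le> C * s\<^sup>2"
      using C(2)[of s] s by (simp add: t0_def)
    ultimately have 2: "?N (\<lambda>x. \<phi> k (x + s *\<^sub>R e) - \<phi> k x - s *\<^sub>R ?D k x) \<le> s * (\<epsilon>/3)" by simp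
    have 3: "?N (\<lambda>x. s *\<^sub>R (?D k x - G x)) \<le> s * (\<epsilon>/3)"
      unfolding l2_norm_scaleR using k s by simp
    have a: "(\<lambda>x. U (x + s *\<^sub>R e) - U x - (\<phi> k (x + s *\<^sub>R e) - \<phi> k x)) \<in> l2 lborel"
      "(\<lambda>x. \<phi> k (x + s *\<^sub>R e) - \<phi> k x - s *\<^sub>R ?D k x) \<in> l2 lborel" "(\<lambda>x. s *\<^sub>R (?D k x - G x)) \<in> l2 lborel"
      by (intro l2_diff l2_scaleR tr U \<phi>l G)+
    have "?N (\<lambda>x. U (x + s *\<^sub>R e) - U x - s *\<^sub>R G x)
        = ?N (\<lambda>x. (U (x + s *\<^sub>R e) - U x - (\<phi> k (x + s *\<^sub>R e) - \<phi> k x))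
            + (\<phi> k (x + s *\<^sub>R e) - \<phi> k x - s *\<^sub>R ?D k x) + s *\<^sub>R (?D k x - G x))"
      by (simp add: algebra_simps)
    also have "\<dots> \<le> ?N (\<lambda>x. (U (x + s *\<^sub>R e) - U x - (\<phi> k (x + s *\<^sub>R e) - \<phi> k x))
            + (\<phi> k (x + s *\<^sub>R e) - \<phi> k x - s *\<^sub>R ?D k x)) + ?N (\<lambda>x. s *\<^sub>R (?D k x - G x))"
      by (intro l2_norm_triangle l2_add a)
    also have "\<dots> \<le> ?N (\<lambda>x. U (x + s *\<^sub>R e) - U x - (\<phi> k (x + s *\<^sub>R e) - \<phi> k x))
            + ?N (\<lambda>x. \<phi> k (x + s *\<^sub>R e) - \<phi> k x - s *\<^sub>R ?D k x) + ?N (\<lambda>x. s *\<^sub>R (?D k x - G x))"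
      by (intro add_right_mono l2_norm_triangle a)
    also have "\<dots> \<le> s * (\<epsilon>/3) + s * (\<epsilon>/3) + s * (\<epsilon>/3)"
      using step[OF s(1)] 2 3 by linarith
    finally show ?thesis by simp
  qed
  then show ?thesis using t0 by blast
qed

text \<open>The set of points of \<Omega> at distance less than \<open>d\<close> from the
  complement; as an intersection with a union of balls it is visibly open, hence Borel.\<close>

definition layer :: "'a::metric_space set \<Rightarrow> real \<Rightarrow> 'a set" where
  "layer \<Omega> d = \<Omega> \<inter> (\<Union>y\<in>-\<Omega>. ball y d)"

lemma layer_open: "open \<Omega> \<Longrightarrow> open (layer \<Omega> d)"
  by (auto simp: layer_def)

text \<open>Every point of the open set has a positive distance to the complement and leaves the
  layers eventually, so dominated convergence applies.\<close>

lemma l2_norm_layer_tendsto: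
  fixes G :: "'a::euclidean_space \<Rightarrow> 'b::euclidean_space"
  assumes \<Omega>: "open \<Omega>" and G: "G \<in> l2 lborel" and d: "d \<longlonglongrightarrow> 0"
  shows "(\<lambda>m. l2_norm lborel (\<lambda>x. indicator (layer \<Omega> (d m)) x *\<^sub>R G x)) \<longlonglongrightarrow> 0"
proof -
  have [measurable]: "G \<in> borel_measurable borel" "layer \<Omega> (d m) \<in> sets borel" for m
    using l2_measurable[OF G] layer_open[OF \<Omega>] by auto
  have "(\<lambda>m. l2_norm lborel (\<lambda>x. indicator (layer \<Omega> (d m)) x *\<^sub>R G x - 0)) \<longlonglongrightarrow> 0"
  proof (rule l2_dominated_convergence)
    show "(\<lambda>x. norm (G x)) \<in> l2 lborel" using G by (simp add: l2_def)
    show "AE x in lborel. (\<lambda>m. indicator (layer \<Omega> (d m)) x *\<^sub>R G x) \<longlonglongrightarrow> 0"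
    proof (intro AE_I2 tendsto_eventually)
      fix x
      show "\<forall>\<^sub>F m in sequentially. indicator (layer \<Omega> (d m)) x *\<^sub>R G x = 0"
      proof (cases "x \<in> \<Omega>")
        case True
        then obtain r where r: "r > 0" "ball x r \<subseteq> \<Omega>" using \<Omega> open_contains_ball by blast
        have "\<forall>\<^sub>F m in sequentially. d m < r" using order_tendstoD(2)[OF d r(1)] .
        then show ?thesis
        proof eventually_elim
          case (elim m)
          then have "x \<notin> layer \<Omega> (d m)" using r(2) by (force simp: layer_def dist_commute)
          then show ?case by simp
        qed
      qed (simp add: layer_def)
    qed
  qed (auto simp: indicator_def)
  then show ?thesis by simp
qed

lemma finite_uniform_bound:
  fixes r :: "'a \<Rightarrow> real"
  assumes "finite E" "\<And>e. e \<in> E \<Longrightarrow> r e > 0"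
  shows "\<exists>d>0. \<forall>e\<in>E. d \<le> r e"
  using assms by (intro exI[of _ "Min (insert 1 (r ` E))"]) auto

text \<open>At the end of an exit direction \<open>U\<close> vanishes, so on the layer the size of
  \<open>U\<close> is that of an increment over \<open>d *\<^sub>R e\<close>. The increment is
  \<open>d\<close> times a directional derivative plus a remainder of order o(d), and the derivative
  is itself small on a thin layer.\<close>

lemma layer_estimate:
  fixes U :: "real ^ 'n \<Rightarrow> 'b::euclidean_space"
  assumes \<Omega>: "polytopal_domain \<Omega>" "bounded \<Omega>"
    and U: "U \<in> l2 lborel" "\<And>x. x \<notin> \<Omega> \<Longrightarrow> U x = 0" and G: "\<And>j. G j \<in> l2 lborel"
    and t: "\<And>k. \<phi> k \<in> test UNIV"
    and lim: "(\<lambda>k. l2_norm lborel (\<lambda>x. \<phi> k x - U x)) \<longlonglongrightarrow> 0"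
      "\<And>j. (\<lambda>k. l2_norm lborel (\<lambda>x. partial j (\<phi> k) x - G j x)) \<longlonglongrightarrow> 0"
    and "\<epsilon> > 0"
  shows "\<exists>d1>0. \<forall>d. 0 < d \<and> d \<le> d1 \<longrightarrow> l2_norm lborel (\<lambda>x. indicator (layer \<Omega> d) x *\<^sub>R U x) \<le> \<epsilon> * d"
proof -
  let ?N = "l2_norm lborel"
  have op: "open \<Omega>" by (rule polytopal_domain_open[OF \<Omega>(1)])
  obtain E d0 where E: "finite E" "d0 > 0"
    "\<And>d x y. 0 < d \<Longrightarrow> d \<le> d0 \<Longrightarrow> x \<in> \<Omega> \<Longrightarrow> y \<notin> \<Omega> \<Longrightarrow> dist x y < d \<Longrightarrow> \<exists>e\<in>E. x + d *\<^sub>R e \<notin> \<Omega>"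
    using polytopal_domain_exit_directions[OF \<Omega>] by metis
  \<comment> \<open>The limit of the directional derivatives of \<open>\<phi> k\<close>, assembled
    from the limits of the partial derivatives.\<close>
  define Ge where "Ge e x = (\<Sum>j\<in>UNIV. (e $ j) *\<^sub>R G j x)" for e :: "real ^ 'n" and x
  have Ge: "Ge e \<in> l2 lborel" for e unfolding Ge_def[abs_def] by (intro l2_sum l2_scaleR G)
  have lime: "(\<lambda>k. ?N (\<lambda>x. frechet_derivative (\<phi> k) (at x) e - Ge e x)) \<longlonglongrightarrow> 0" for e
  proof (rule Lim_null_comparison[OF always_eventually], rule allI)
    fix k
    have "?N (\<lambda>x. frechet_derivative (\<phi> k) (at x) e - Ge e x) = ?N (\<lambda>x. \<Sum>j\<in>UNIV. (e $ j) *\<^sub>R (partial j (\<phi> k) x - G j x))"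
      using frechet_derivative_eq_sum_partial[OF smooth_differentiable[OF test_smooth[OF t]]]
      by (simp add: Ge_def scaleR_diff_right sum_subtractf)
    also have "\<dots> \<le> (\<Sum>j\<in>UNIV. ?N (\<lambda>x. (e $ j) *\<^sub>R (partial j (\<phi> k) x - G j x)))"
      by (intro l2_norm_sum_le l2_scaleR l2_diff test_l2 test_partial t G) auto
    also have "\<dots> = (\<Sum>j\<in>UNIV. \<bar>e $ j\<bar> * ?N (\<lambda>x. partial j (\<phi> k) x - G j x))"
      unfolding l2_norm_scaleR ..
    finally show "norm (?N (\<lambda>x. frechet_derivative (\<phi> k) (at x) e - Ge e x))
      \<le> (\<Sum>j\<in>UNIV. \<bar>e $ j\<bar> * ?N (\<lambda>x. partial j (\<phi> k) x - G j x))" by simp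
  next
    have "(\<lambda>k. \<Sum>j\<in>UNIV. \<bar>e $ j\<bar> * ?N (\<lambda>x. partial j (\<phi> k) x - G j x)) \<longlonglongrightarrow> (\<Sum>j\<in>(UNIV::'n set). \<bar>e $ j\<bar> * 0)"
      by (intro tendsto_sum tendsto_mult tendsto_const lim)
    then show "(\<lambda>k. \<Sum>j\<in>UNIV. \<bar>e $ j\<bar> * ?N (\<lambda>x. partial j (\<phi> k) x - G j x)) \<longlonglongrightarrow> 0" by simp
  qed
  \<comment> \<open>Each direction in \<open>E\<close> contributes twice, by the remainder and by
    the linear term; adding one covers an empty \<open>E\<close>.\<close>
  define \<epsilon>' where "\<epsilon>' = \<epsilon> / (2 * (real (card E) + 1))"
  have \<epsilon>': "\<epsilon>' > 0" using \<open>\<epsilon> > 0\<close> by (simp add: \<epsilon>'_def)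
  have "\<forall>e. \<exists>r>0. \<forall>s. 0 < s \<and> s \<le> r \<longrightarrow> ?N (\<lambda>x. U (x + s *\<^sub>R e) - U x - s *\<^sub>R Ge e x) \<le> \<epsilon>' * s"
    by (intro allI l2_shift_expansion[OF U(1) Ge t lim(1) lime \<epsilon>'])
  from choice[OF this]
  obtain r where "\<forall>e. r e > 0 \<and> (\<forall>s. 0 < s \<and> s \<le> r e \<longrightarrow> ?N (\<lambda>x. U (x + s *\<^sub>R e) - U x - s *\<^sub>R Ge e x) \<le> \<epsilon>' * s)"
    by (elim exE) (rule that)
  then have r: "\<And>e. r e > 0" "\<And>e s. 0 < s \<Longrightarrow> s \<le> r e \<Longrightarrow> ?N (\<lambda>x. U (x + s *\<^sub>R e) - U x - s *\<^sub>R Ge e x) \<le> \<epsilon>' * s"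
    by simp_all
  have lb: "layer \<Omega> d \<in> sets borel" for d using layer_open[OF op] by auto
  have cut: "(\<lambda>x. indicator (layer \<Omega> d) x *\<^sub>R f x) \<in> l2 lborel \<and> ?N (\<lambda>x. indicator (layer \<Omega> d) x *\<^sub>R f x) \<le> ?N f"
    if f: "f \<in> l2 lborel" for d and f :: "real ^ 'n \<Rightarrow> 'b"
  proof -
    note [measurable] = lb[of d]
    have [measurable]: "f \<in> borel_measurable borel" using l2_measurable[OF f] by simp
    have m: "(\<lambda>x. indicator (layer \<Omega> d) x *\<^sub>R f x) \<in> borel_measurable lborel" by measurable
    show ?thesis
      using l2_bounded[OF f m, of 1] l2_norm_mono[OF f m] by (simp add: indicator_def)
  qed
  have "\<exists>s>0. \<forall>d\<le>s. ?N (\<lambda>x. indicator (layer \<Omega> d) x *\<^sub>R Ge e x) \<le> \<epsilon>'" for e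
  proof -
    have "(\<lambda>m. ?N (\<lambda>x. indicator (layer \<Omega> (1 / real (Suc m))) x *\<^sub>R Ge e x)) \<longlonglongrightarrow> 0"
      by (rule l2_norm_layer_tendsto[OF op Ge LIMSEQ_Suc[OF lim_1_over_n]])
    then obtain m where m: "?N (\<lambda>x. indicator (layer \<Omega> (1 / real (Suc m))) x *\<^sub>R Ge e x) < \<epsilon>'"
      using order_tendstoD(2)[OF _ \<epsilon>'] eventually_happens'[OF sequentially_bot] by blast
    have "?N (\<lambda>x. indicator (layer \<Omega> d) x *\<^sub>R Ge e x) \<le> \<epsilon>'" if d: "d \<le> 1 / real (Suc m)" for d
    proof -
      have "layer \<Omega> d \<subseteq> layer \<Omega> (1 / real (Suc m))" using d by (force simp: layer_def)
      then have "?N (\<lambda>x. indicator (layer \<Omega> d) x *\<^sub>R Ge e x) \<le> ?N (\<lambda>x. indicator (layer \<Omega> (1 / real (Suc m))) x *\<^sub>R Ge e x)"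
        using cut[OF Ge] by (intro l2_norm_mono l2_measurable[of _ lborel]) (auto simp: indicator_def)
      then show ?thesis using m by simp
    qed
    then show ?thesis by (intro exI[of _ "1 / real (Suc m)"]) auto
  qed
  then obtain s where s: "\<And>e. s e > 0" "\<And>e d. d \<le> s e \<Longrightarrow> ?N (\<lambda>x. indicator (layer \<Omega> d) x *\<^sub>R Ge e x) \<le> \<epsilon>'"
    by metis
  obtain d2 where d2: "d2 > 0" "\<And>e. e \<in> E \<Longrightarrow> d2 \<le> min (r e) (s e)"
    using finite_uniform_bound[OF E(1), of "\<lambda>e. min (r e) (s e)"] r(1) s(1) by (metis min_less_iff_conj)
  have "?N (\<lambda>x. indicator (layer \<Omega> d) x *\<^sub>R U x) \<le> \<epsilon> * d" if d: "0 < d" "d \<le> min d0 d2" for d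
  proof -
    let ?I = "\<lambda>x. indicator (layer \<Omega> d) x :: real"
    let ?h = "\<lambda>e x. ?I x *\<^sub>R (U (x + d *\<^sub>R e) - U x)"
    have hl: "?h e \<in> l2 lborel" for e by (intro conjunct1[OF cut] l2_diff l2_translate U)
    have nh: "(\<lambda>x. norm (?h e x)) \<in> l2 lborel" for e by (rule l2_norm_fun[OF hl])
    have sl: "(\<lambda>x. \<Sum>e\<in>E. norm (?h e x)) \<in> l2 lborel" by (intro l2_sum nh)
    \<comment> \<open>The exit direction depends on the point. Bounding by the sum over all
      directions avoids selecting it measurably.\<close>
    have "?N (\<lambda>x. ?I x *\<^sub>R U x) \<le> ?N (\<lambda>x. \<Sum>e\<in>E. norm (?h e x))"
    proof (rule l2_norm_mono[OF sl l2_measurable[OF conjunct1[OF cut[OF U(1)]]] AE_I2])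
      fix x
      show "norm (?I x *\<^sub>R U x) \<le> norm (\<Sum>e\<in>E. norm (?h e x))"
      proof (cases "x \<in> layer \<Omega> d")
        case True
        then obtain y where "x \<in> \<Omega>" "y \<notin> \<Omega>" "dist x y < d" by (auto simp: layer_def dist_commute)
        then obtain e where e: "e \<in> E" "x + d *\<^sub>R e \<notin> \<Omega>" using E(3)[of d x y] d by auto
        have "norm (?I x *\<^sub>R U x) = norm (?h e x)" using U(2)[OF e(2)] True by simp
        also have "\<dots> \<le> (\<Sum>e\<in>E. norm (?h e x))" using E(1) e(1) by (intro member_le_sum) auto
        finally show ?thesis by simp
      qed simp
    qed
    also have "\<dots> \<le> (\<Sum>e\<in>E. ?N (\<lambda>x. norm (?h e x)))" by (intro l2_norm_sum_le E(1) nh)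
    also have "\<dots> \<le> (\<Sum>e\<in>E. 2 * (\<epsilon>' * d))"
    proof (rule sum_mono)
      fix e assume e: "e \<in> E"
      let ?S = "\<lambda>x. U (x + d *\<^sub>R e) - U x - d *\<^sub>R Ge e x"
      have S: "?S \<in> l2 lborel" by (intro l2_diff l2_scaleR l2_translate U Ge)
      have "?N (\<lambda>x. norm (?h e x)) = ?N (\<lambda>x. ?I x *\<^sub>R ?S x + d *\<^sub>R (?I x *\<^sub>R Ge e x))"
        by (simp add: l2_norm_def scaleR_diff_right mult.commute)
      also have "\<dots> \<le> ?N (\<lambda>x. ?I x *\<^sub>R ?S x) + ?N (\<lambda>x. d *\<^sub>R (?I x *\<^sub>R Ge e x))"
        by (intro l2_norm_triangle l2_scaleR conjunct1[OF cut] S Ge)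
      also have "?N (\<lambda>x. ?I x *\<^sub>R ?S x) \<le> \<epsilon>' * d"
        using cut[OF S, of d] r(2)[of d e] d d2(2)[OF e] by simp
      also have "?N (\<lambda>x. d *\<^sub>R (?I x *\<^sub>R Ge e x)) \<le> \<epsilon>' * d"
        unfolding l2_norm_scaleR using s(2)[of d e] d d2(2)[OF e] by (simp add: mult.commute[of d] mult_right_mono)
      finally show "?N (\<lambda>x. norm (?h e x)) \<le> 2 * (\<epsilon>' * d)" by simp
    qed
    also have "\<dots> = 2 * real (card E) * \<epsilon>' * d" by simp
    also have "\<dots> \<le> 2 * (real (card E) + 1) * \<epsilon>' * d"
      using d \<epsilon>' by (intro mult_right_mono) auto
    also have "\<dots> = \<epsilon> * d"
    proof -
      have "real (card E) + 1 > 0" by (rule add_nonneg_pos) auto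
      then have "2 * (real (card E) + 1) * \<epsilon>' = \<epsilon>" unfolding \<epsilon>'_def by (simp only: nonzero_mult_div_cancel_left times_divide_eq_right) simp
      then show ?thesis by simp
    qed
    finally show ?thesis .
  qed
  then show ?thesis using E(2) d2(1) by (intro exI[of _ "min d0 d2"]) auto
qed

section \<open>Cutoff functions and approximation by test functions\<close>

text \<open>With \<open>\<delta> = 1 / Suc m\<close>, the indicator of the points at distance at
  least \<open>2 * \<delta>\<close> from the complement is mollified with radius
  \<open>\<delta>\<close>. The result is supported at distance at least \<open>\<delta>\<close>,
  equals 1 at distance \<open>3 * \<delta>\<close> and more, and is locally constant at distance
  \<open>4 * \<delta>\<close> and more; this is the 4 in the width of the layer.\<close>

lemma cutoff_exists:
  fixes \<Omega> :: "(real ^ 'n) set"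
  assumes \<Omega>: "open \<Omega>" "bounded \<Omega>"
  shows "\<exists>C\<ge>0. \<forall>m. \<exists>q\<in>test \<Omega>. (\<forall>x. 0 \<le> q x \<and> q x \<le> 1) \<and> (\<forall>j x. \<bar>partial j q x\<bar> \<le> C * real (Suc m)) \<and>
    (\<forall>x\<in>\<Omega>. x \<notin> layer \<Omega> (4 / real (Suc m)) \<longrightarrow> q x = (1::real) \<and> (\<forall>j. partial j q x = 0))"
proof -
  obtain C where C: "C \<ge> 0" "\<And>k j. (LINT x|lborel. \<bar>partial j (moll k) (x :: real ^ 'n)\<bar>) \<le> C * real (Suc k)"
    using moll_partial_bound by metis
  obtain B where B: "\<And>x. x \<in> \<Omega> \<Longrightarrow> norm x \<le> B" using \<Omega>(2) bounded_iff by blast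
  have "\<exists>q\<in>test \<Omega>. (\<forall>x. 0 \<le> q x \<and> q x \<le> 1) \<and> (\<forall>j x. \<bar>partial j q x\<bar> \<le> C * real (Suc m)) \<and>
    (\<forall>x\<in>\<Omega>. x \<notin> layer \<Omega> (4 / real (Suc m)) \<longrightarrow> q x = (1::real) \<and> (\<forall>j. partial j q x = 0))" for m
  proof -
    define \<delta> where "\<delta> = 1 / real (Suc m)"
    have \<delta>: "\<delta> > 0" by (simp add: \<delta>_def)
    define A where "A r = {x. \<forall>y\<in>-\<Omega>. r \<le> dist x y}" for r
    have A: "closed (A r)" for r
    proof -
      have "A r = (\<Inter>y\<in>-\<Omega>. {x. r \<le> dist x y})" unfolding A_def by blast
      then show ?thesis by (auto intro!: closed_INT closed_Collect_le continuous_intros)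
    qed
    have A\<Omega>: "A r \<subseteq> \<Omega>" if "r > 0" for r using that by (force simp: A_def)
    have Anear: "y \<in> A (r - s)" if "x \<in> A r" "norm (x - y) \<le> s" for x y r s
      unfolding A_def
    proof (intro CollectI ballI)
      fix w assume "w \<in> - \<Omega>"
      then have "r \<le> dist x w" using that(1) by (simp add: A_def)
      then show "r - s \<le> dist y w" using that(2) dist_triangle[of x w y] by (simp add: dist_norm)
    qed
    define f where "f x = (indicator (A (2 * \<delta>)) x :: real)" for x
    have [measurable]: "A r \<in> sets borel" for r using A by (rule borel_closed)
    have fb: "f \<in> borel_measurable borel" unfolding f_def by measurable
    have f01: "0 \<le> f x" "f x \<le> 1" for x by (auto simp: f_def indicator_def)
    have fR: "f x = 0" if "norm x > B" for x
      using that B A\<Omega>[of "2 * \<delta>"] \<delta> by (auto simp: f_def indicator_def not_le[symmetric])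
    have f: "f \<in> l2 lborel" by (rule l2_bounded_support[OF fb, of 1 B]) (use f01 fR in auto)
    have fi: "integrable lborel f" using f fR by (rule integrable_bounded_support)
    let ?q = "conv (moll m) f"
    have mi: "integrable lborel (\<lambda>y. moll m (x - y))" for x :: "real ^ 'n"
      by (rule test_integrable[OF test_reflect[OF moll_test]])
    note ci = conv_integrable[OF moll_test fi, of m]
    have test: "?q \<in> test \<Omega>"
    proof (rule testI[OF conv_smooth[OF moll_test fi]])
      have "bounded (A \<delta>)" using A\<Omega>[OF \<delta>] \<Omega>(2) bounded_subset by blast
      then show "compact (A \<delta>)" using A by (simp add: compact_eq_bounded_closed)
      show "A \<delta> \<subseteq> \<Omega>" by (rule A\<Omega>[OF \<delta>])
      show "?q x = 0" if x: "x \<notin> A \<delta>" for x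
      proof (rule conv_moll_eq_0)
        fix y assume "norm (x - y) < 1 / real (Suc m)"
        then have "norm (y - x) \<le> \<delta>" by (simp add: \<delta>_def norm_minus_commute)
        then have "y \<notin> A (2 * \<delta>)" using Anear[of y "2 * \<delta>" x \<delta>] x by auto
        then show "f y = 0" by (simp add: f_def)
      qed
    qed
    have q0: "0 \<le> ?q x" for x unfolding conv_def using f01 by (intro integral_nonneg_AE) simp
    have q1: "?q x \<le> 1" for x
    proof -
      have "?q x \<le> (LINT y|lborel. moll m (x - y))"
        unfolding conv_def using f01 by (intro integral_mono ci mi) (simp add: mult_left_le)
      then show ?thesis by (simp add: integral_moll_reflect)
    qed
    have qone: "?q x = 1" if x: "x \<in> A (3 * \<delta>)" for x
    proof -
      have "moll m (x - y) *\<^sub>R f y = moll m (x - y)" for y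
      proof (cases "norm (x - y) < \<delta>")
        case True
        then have "y \<in> A (2 * \<delta>)" using Anear[OF x, of y \<delta>] by simp
        then show ?thesis by (simp add: f_def)
      next
        case False
        then show ?thesis using moll_eq_0[of m "x - y"] by (simp add: \<delta>_def)
      qed
      then have "?q x = (LINT y|lborel. moll m (x - y))" by (simp only: conv_def)
      then show ?thesis by (simp only: integral_moll_reflect)
    qed
    have qp0: "partial j ?q x = 0" if x: "x \<in> A (4 * \<delta>)" for x j
    proof -
      have "(?q has_derivative (\<lambda>h. 0)) (at x)"
      proof (rule has_derivative_transform_within_open[of "\<lambda>x. 1" _ _ _ "ball x \<delta>"])
        show "1 = ?q y" if "y \<in> ball x \<delta>" for y
        proof -
          have "norm (x - y) \<le> \<delta>" using that by (simp add: dist_norm)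
          then have "y \<in> A (3 * \<delta>)" using Anear[OF x, of y \<delta>] by simp
          then show ?thesis by (simp add: qone)
        qed
      qed (use \<delta> in auto)
      then show ?thesis by (rule partial_eqI)
    qed
    have qp: "\<bar>partial j ?q x\<bar> \<le> C * real (Suc m)" for j x
    proof -
      note pm = test_partial[OF moll_test[of m], of j]
      have "\<bar>partial j ?q x\<bar> = \<bar>LINT y|lborel. partial j (moll m) (x - y) * f y\<bar>"
        by (simp add: partial_conv[OF moll_test fi] conv_def)
      also have "\<dots> \<le> (LINT y|lborel. \<bar>partial j (moll m) (x - y) * f y\<bar>)"
        using integral_norm_bound[of lborel "\<lambda>y. partial j (moll m) (x - y) * f y"] by simp
      also have "\<dots> \<le> (LINT y|lborel. \<bar>partial j (moll m) (x - y)\<bar>)"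
      proof (rule integral_mono)
        show "integrable lborel (\<lambda>y. \<bar>partial j (moll m) (x - y) * f y\<bar>)"
          using conv_integrable[OF pm fi, of x] by simp
        show "integrable lborel (\<lambda>y. \<bar>partial j (moll m) (x - y)\<bar>)"
          using test_integrable[OF test_reflect[OF pm], of x] by simp
        show "\<bar>partial j (moll m) (x - y) * f y\<bar> \<le> \<bar>partial j (moll m) (x - y)\<bar>" for y
          using f01 by (simp add: abs_mult mult_left_le)
      qed
      also have "\<dots> = (LINT y|lborel. \<bar>partial j (moll m) y\<bar>)"
        using integral_lborel_reflect[OF borel_measurable_abs[OF test_borel[OF pm]], of x] by simp
      finally show ?thesis using C(2)[of j m] by simp
    qed
    have "x \<in> A (4 * \<delta>)" if "x \<in> \<Omega>" "x \<notin> layer \<Omega> (4 / real (Suc m))" for x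
      using that by (auto simp: A_def layer_def \<delta>_def dist_commute not_less)
    moreover have "A (4 * \<delta>) \<subseteq> A (3 * \<delta>)" using \<delta> by (force simp: A_def)
    ultimately have "?q x = 1 \<and> (\<forall>j. partial j ?q x = 0)" if "x \<in> \<Omega>" "x \<notin> layer \<Omega> (4 / real (Suc m))" for x
      using that qone qp0 by blast
    then show ?thesis using test q0 q1 qp by (intro bexI[of _ ?q]) auto
  qed
  then show ?thesis using C(1) by blast
qed

text \<open>The bound on \<open>h\<close> is assumed on \<Omega> only: for \<open>h = 1 - q\<close>
  it fails outside, where the cutoff vanishes while the layer is contained in \<Omega>.\<close>

lemma l2_norm_mult_le:
  fixes F :: "'a::euclidean_space \<Rightarrow> 'b::euclidean_space"
  assumes \<Omega>: "\<Omega> \<in> sets borel" and L: "L \<in> sets borel" and h: "h \<in> borel_measurable borel" and F: "F \<in> l2 lborel"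
    and le: "\<And>x. x \<in> \<Omega> \<Longrightarrow> \<bar>h x\<bar> \<le> c * indicator L x" and c: "c \<ge> 0"
  shows "(\<lambda>x. h x *\<^sub>R F x) \<in> l2 (lebesgue_on \<Omega>)"
    "l2_norm (lebesgue_on \<Omega>) (\<lambda>x. h x *\<^sub>R F x) \<le> c * l2_norm lborel (\<lambda>x. indicator L x *\<^sub>R F x)"
proof -
  note [measurable] = L h
  have [measurable]: "F \<in> borel_measurable borel" using l2_measurable[OF F] by simp
  let ?I = "\<lambda>x. indicator L x *\<^sub>R F x"
  have I: "?I \<in> l2 lborel"
    by (rule l2_bounded[OF F, of _ 1]) (auto simp: indicator_def)
  have hF: "(\<lambda>x. h x *\<^sub>R F x) \<in> borel_measurable (lebesgue_on \<Omega>)"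
    by (rule borel_measurable_lebesgue_on) measurable
  have pw: "AE x in lebesgue_on \<Omega>. norm (h x *\<^sub>R F x) \<le> c * norm (?I x)"
  proof (rule AE_I2)
    fix x assume "x \<in> space (lebesgue_on \<Omega>)"
    then have "\<bar>h x\<bar> * norm (F x) \<le> c * indicator L x * norm (F x)"
      using le by (intro mult_right_mono) auto
    then show "norm (h x *\<^sub>R F x) \<le> c * norm (?I x)" by (simp add: mult.assoc)
  qed
  note I\<Omega> = l2_restrict[OF I \<Omega>]
  show "(\<lambda>x. h x *\<^sub>R F x) \<in> l2 (lebesgue_on \<Omega>)" by (rule l2_bounded[OF I\<Omega>(1) hF pw])
  have "l2_norm (lebesgue_on \<Omega>) (\<lambda>x. h x *\<^sub>R F x) \<le> c * l2_norm (lebesgue_on \<Omega>) ?I"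
    by (rule l2_norm_le_C[OF I\<Omega>(1) hF pw c])
  also have "\<dots> \<le> c * l2_norm lborel ?I" by (intro mult_left_mono I\<Omega>(2) c)
  finally show "l2_norm (lebesgue_on \<Omega>) (\<lambda>x. h x *\<^sub>R F x) \<le> c * l2_norm lborel ?I" .
qed

lemma l2_norm_indicator_le:
  assumes "F \<in> l2 lborel" "L \<in> sets borel"
  shows "l2_norm lborel (\<lambda>x. indicator L x *\<^sub>R F x) \<le> l2_norm lborel F"
proof -
  note [measurable] = assms(2)
  have [measurable]: "F \<in> borel_measurable borel" using l2_measurable[OF assms(1)] by simp
  show ?thesis by (rule l2_norm_mono[OF assms(1)]) (auto simp: indicator_def)
qed

text \<open>The cutoff at distance \<open>1/m\<close> costs a gradient of order \<open>m\<close>, which the estimate of \<open>U\<close> on the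
  boundary layer compensates.\<close>

lemma H1_0_cutoff_approx:
  fixes U :: "real ^ 'n \<Rightarrow> 'b::euclidean_space"
  assumes \<Omega>: "polytopal_domain \<Omega>" "bounded \<Omega>"
    and U: "U \<in> l2 lborel" "\<And>x. x \<notin> \<Omega> \<Longrightarrow> U x = 0" and G: "\<And>j. G j \<in> l2 lborel"
    and t: "\<And>k. \<phi> k \<in> test UNIV"
    and lim: "(\<lambda>k. l2_norm lborel (\<lambda>x. \<phi> k x - U x)) \<longlonglongrightarrow> 0"
      "\<And>j. (\<lambda>k. l2_norm lborel (\<lambda>x. partial j (\<phi> k) x - G j x)) \<longlonglongrightarrow> 0"
    and e: "e > 0"
  shows "\<exists>\<psi>\<in>test \<Omega>. l2_norm (lebesgue_on \<Omega>) (\<lambda>x. U x - \<psi> x) < e \<and>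
    (\<forall>j. l2_norm (lebesgue_on \<Omega>) (\<lambda>x. G j x - partial j \<psi> x) < e)"
proof -
  let ?M = "lebesgue_on \<Omega>"
  have op: "open \<Omega>" by (rule polytopal_domain_open[OF \<Omega>(1)])
  have \<Omega>b: "\<Omega> \<in> sets borel" using op by simp
  obtain C where C: "C \<ge> 0"
    "\<forall>m. \<exists>q\<in>test \<Omega>. (\<forall>x. 0 \<le> q x \<and> q x \<le> 1) \<and> (\<forall>j x. \<bar>partial j q x\<bar> \<le> C * real (Suc m)) \<and>
    (\<forall>x\<in>\<Omega>. x \<notin> layer \<Omega> (4 / real (Suc m)) \<longrightarrow> q x = (1::real) \<and> (\<forall>j. partial j q x = 0))"
    using cutoff_exists[OF op \<Omega>(2)] by auto
  define d where "d m = 4 / real (Suc m)" for m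
  define L where "L m = layer \<Omega> (d m)" for m
  have d: "d \<longlonglongrightarrow> 0" "d m > 0" for m
    unfolding d_def by (rule LIMSEQ_Suc[OF lim_const_over_n]) simp
  have Lb: "L m \<in> sets borel" for m unfolding L_def using layer_open[OF op] by auto
  have ev1: "\<forall>\<^sub>F m in sequentially. l2_norm lborel (\<lambda>x. indicator (L m) x *\<^sub>R U x) < e/4"
    unfolding L_def using e by (intro order_tendstoD(2)[OF l2_norm_layer_tendsto[OF op U(1) d(1)]]) auto
  have "\<forall>\<^sub>F m in sequentially. l2_norm lborel (\<lambda>x. indicator (L m) x *\<^sub>R G j x) < e/4" for j
    unfolding L_def using e by (intro order_tendstoD(2)[OF l2_norm_layer_tendsto[OF op G d(1)]]) auto
  then have ev2: "\<forall>\<^sub>F m in sequentially. \<forall>j. l2_norm lborel (\<lambda>x. indicator (L m) x *\<^sub>R G j x) < e/4"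
    by (rule eventually_all_finite)
  have ev3: "\<forall>\<^sub>F m in sequentially. C * real (Suc m) * l2_norm lborel (\<lambda>x. indicator (L m) x *\<^sub>R U x) < e/4"
  proof -
    define D where "D = C + 1"
    \<comment> \<open>The factor \<open>Suc m\<close> of the cutoff's gradient cancels against
      \<open>d m = 4 / Suc m\<close>. What remains is \<open>4 * (\<epsilon> * C)\<close>, at most
      \<open>e/8\<close>.\<close>
    define \<epsilon> where "\<epsilon> = e / 32 / D"
    have D: "D > 0" "C \<le> D" using C(1) by (simp_all add: D_def)
    then have \<epsilon>: "\<epsilon> > 0" "\<epsilon> * D = e / 32" using e by (auto simp: \<epsilon>_def)
    obtain d1 where d1: "d1 > 0" "\<And>d. 0 < d \<Longrightarrow> d \<le> d1 \<Longrightarrow> l2_norm lborel (\<lambda>x. indicator (layer \<Omega> d) x *\<^sub>R U x) \<le> \<epsilon> * d"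
      using layer_estimate[OF \<Omega> U G t lim \<epsilon>(1)] by auto
    have "\<forall>\<^sub>F m in sequentially. d m < d1" by (rule order_tendstoD(2)[OF d(1) d1(1)])
    then show ?thesis
    proof eventually_elim
      case (elim m)
      have "C * real (Suc m) * l2_norm lborel (\<lambda>x. indicator (L m) x *\<^sub>R U x) \<le> C * real (Suc m) * (\<epsilon> * d m)"
        unfolding L_def using elim C(1) by (intro mult_left_mono d1(2) d(2)) auto
      also have "\<dots> = 4 * (\<epsilon> * C)" by (simp add: d_def del: of_nat_Suc)
      also have "\<dots> \<le> 4 * (\<epsilon> * D)" using \<epsilon>(1) D by simp
      also have "\<dots> < e/4" using \<epsilon>(2) e by simp
      finally show ?case .
    qed
  qed
  from eventually_conj[OF ev1 eventually_conj[OF ev2 ev3]]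
  obtain m where m: "l2_norm lborel (\<lambda>x. indicator (L m) x *\<^sub>R U x) < e/4"
    "\<And>j. l2_norm lborel (\<lambda>x. indicator (L m) x *\<^sub>R G j x) < e/4"
    "C * real (Suc m) * l2_norm lborel (\<lambda>x. indicator (L m) x *\<^sub>R U x) < e/4"
    using eventually_happens'[OF sequentially_bot] by blast
  obtain q where q: "q \<in> test \<Omega>" "\<And>x. 0 \<le> q x" "\<And>x. q x \<le> 1" "\<And>j x. \<bar>partial j q x\<bar> \<le> C * real (Suc m)"
    "\<And>x. x \<in> \<Omega> \<Longrightarrow> x \<notin> L m \<Longrightarrow> q x = (1::real)" "\<And>x j. x \<in> \<Omega> \<Longrightarrow> x \<notin> L m \<Longrightarrow> partial j q x = 0"
    using C(2)[rule_format, of m] unfolding L_def d_def by blast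
  define c where "c = C * real (Suc m)"
  have c: "c \<ge> 0" using C(1) by (simp add: c_def)
  \<comment> \<open>Chosen after \<open>m\<close>: the cutoff and its gradient bound
    \<open>c\<close> are already fixed, and \<open>\<phi> k\<close> must be so close to
    \<open>U\<close> that even \<open>c\<close> times the error is small.\<close>
  define \<epsilon> where "\<epsilon> = min (e/4) (e / (4 * (c + 1)))"
  have \<epsilon>: "\<epsilon> > 0" using e c by (simp add: \<epsilon>_def)
  moreover have "\<epsilon> \<le> e/4" unfolding \<epsilon>_def by (rule min.cobounded1)
  ultimately have \<epsilon>: "\<epsilon> > 0" "\<epsilon> \<le> e/4" .
  have c\<epsilon>: "c * \<epsilon> \<le> e/4"
  proof -
    have "c * \<epsilon> \<le> (c + 1) * (e / (4 * (c + 1)))" using c \<epsilon>(1) by (intro mult_mono) (auto simp: \<epsilon>_def)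
    also have "\<dots> = e/4" using c by (simp add: field_simps)
    finally show ?thesis .
  qed
  have "\<forall>\<^sub>F k in sequentially. \<forall>j. l2_norm lborel (\<lambda>x. partial j (\<phi> k) x - G j x) < \<epsilon>"
    by (intro eventually_all_finite order_tendstoD(2)[OF lim(2) \<epsilon>(1)])
  from eventually_conj[OF order_tendstoD(2)[OF lim(1) \<epsilon>(1)] this]
  obtain k where k: "l2_norm lborel (\<lambda>x. \<phi> k x - U x) < \<epsilon>" "\<And>j. l2_norm lborel (\<lambda>x. partial j (\<phi> k) x - G j x) < \<epsilon>"
    using eventually_happens'[OF sequentially_bot] by blast
  let ?f = "\<phi> k"
  have fl: "?f \<in> l2 lborel" "partial j ?f \<in> l2 lborel" for j by (intro test_l2 test_partial t)+
  have k': "l2_norm lborel (\<lambda>x. U x - ?f x) < \<epsilon>" "\<And>j. l2_norm lborel (\<lambda>x. G j x - partial j ?f x) < \<epsilon>"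
    using k by (simp_all add: l2_norm_minus_commute[of _ U] l2_norm_minus_commute[of _ "G _"])
  have qb: "q \<in> borel_measurable borel" "partial j q \<in> borel_measurable borel" for j
    using test_borel[OF test_UNIV[OF q(1)]] test_borel[OF test_UNIV[OF test_partial[OF q(1)]]] by auto
  have q1b: "(\<lambda>x. 1 - q x) \<in> borel_measurable borel" using qb by simp
  have le1: "\<bar>1 - q x\<bar> \<le> 1 * indicator (L m) x" if "x \<in> \<Omega>" for x
    using q(2,3)[of x] q(5)[OF that] by (auto simp: indicator_def)
  have le2: "\<bar>q x\<bar> \<le> 1 * indicator \<Omega> x" if "x \<in> \<Omega>" for x using q(2,3)[of x] that by simp
  have le3: "\<bar>partial j q x\<bar> \<le> c * indicator (L m) x" if "x \<in> \<Omega>" for x j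
    using q(4)[of j x] q(6)[OF that] by (auto simp: indicator_def c_def)
  have le4: "\<bar>partial j q x\<bar> \<le> c * indicator \<Omega> x" if "x \<in> \<Omega>" for x j
    using q(4)[of j x] that by (simp add: c_def)
  let ?\<psi> = "\<lambda>x. q x *\<^sub>R ?f x"
  have \<psi>: "?\<psi> \<in> test \<Omega>" by (rule test_bilinear_left[OF bounded_bilinear_scaleR q(1) test_smooth[OF t]])
  have p\<psi>: "partial j ?\<psi> x = q x *\<^sub>R partial j ?f x + partial j q x *\<^sub>R ?f x" for j x
    by (rule partial_bilinear[OF bounded_bilinear_scaleR test_smooth[OF q(1)] test_smooth[OF t]])
  have A: "l2_norm ?M (\<lambda>x. (1 - q x) *\<^sub>R F x) < e/4" "(\<lambda>x. (1 - q x) *\<^sub>R F x) \<in> l2 ?M"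
    if "F \<in> l2 lborel" "l2_norm lborel (\<lambda>x. indicator (L m) x *\<^sub>R F x) < e/4" for F :: "real ^ 'n \<Rightarrow> 'b"
    using l2_norm_mult_le[OF \<Omega>b Lb q1b that(1) le1] that(2) by auto
  have B: "l2_norm ?M (\<lambda>x. q x *\<^sub>R F x) < \<epsilon>" "(\<lambda>x. q x *\<^sub>R F x) \<in> l2 ?M"
    if "F \<in> l2 lborel" "l2_norm lborel F < \<epsilon>" for F :: "real ^ 'n \<Rightarrow> 'b"
    using l2_norm_mult_le[OF \<Omega>b \<Omega>b qb(1) that(1) le2] l2_norm_indicator_le[OF that(1) \<Omega>b] that(2) by auto
  note dU = l2_diff[OF U(1) fl(1)] and dG = l2_diff[OF G fl(2)]
  \<comment> \<open>The error splits into the part of \<open>U\<close> lost by the cutoff and the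
    approximation error weighted by \<open>q \<le> 1\<close>.\<close>
  have "l2_norm ?M (\<lambda>x. U x - ?\<psi> x) = l2_norm ?M (\<lambda>x. (1 - q x) *\<^sub>R U x + q x *\<^sub>R (U x - ?f x))"
    by (simp add: algebra_simps)
  also have "\<dots> \<le> l2_norm ?M (\<lambda>x. (1 - q x) *\<^sub>R U x) + l2_norm ?M (\<lambda>x. q x *\<^sub>R (U x - ?f x))"
    by (intro l2_norm_triangle A B U m dU k')
  also have "\<dots> < e/4 + \<epsilon>" by (intro add_strict_mono A B U m dU k')
  finally have 1: "l2_norm ?M (\<lambda>x. U x - ?\<psi> x) < e" using \<epsilon>(2) e by simp
  have 2: "l2_norm ?M (\<lambda>x. G j x - partial j ?\<psi> x) < e" for j
  proof -
    have D: "(\<lambda>x. partial j q x *\<^sub>R U x) \<in> l2 ?M" "l2_norm ?M (\<lambda>x. partial j q x *\<^sub>R U x) < e/4"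
      using l2_norm_mult_le[OF \<Omega>b Lb qb(2) U(1) le3 c, of j] m(3) by (auto simp: c_def)
    have "l2_norm ?M (\<lambda>x. partial j q x *\<^sub>R (U x - ?f x)) \<le> c * l2_norm lborel (\<lambda>x. indicator \<Omega> x *\<^sub>R (U x - ?f x))"
      by (rule l2_norm_mult_le(2)[OF \<Omega>b \<Omega>b qb(2) dU le4 c])
    also have "\<dots> \<le> c * \<epsilon>"
      using l2_norm_indicator_le[OF dU \<Omega>b] k'(1) c by (intro mult_left_mono) auto
    finally have E: "l2_norm ?M (\<lambda>x. partial j q x *\<^sub>R (U x - ?f x)) \<le> e/4" using c\<epsilon> by linarith
    have El: "(\<lambda>x. partial j q x *\<^sub>R (U x - ?f x)) \<in> l2 ?M"
      by (rule l2_norm_mult_le(1)[OF \<Omega>b \<Omega>b qb(2) dU le4 c])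
    \<comment> \<open>Besides the two terms as before, the product rule produces
      \<open>partial j q\<close> times \<open>?f\<close>. It is compared with
      \<open>partial j q\<close> times \<open>U\<close>, the critical term, which the estimate on
      the layer controls.\<close>
    have "l2_norm ?M (\<lambda>x. G j x - partial j ?\<psi> x)
      = l2_norm ?M (\<lambda>x. ((1 - q x) *\<^sub>R G j x + q x *\<^sub>R (G j x - partial j ?f x))
          + (partial j q x *\<^sub>R (U x - ?f x) - partial j q x *\<^sub>R U x))"
      by (simp add: p\<psi> algebra_simps)
    also have "\<dots> \<le> l2_norm ?M (\<lambda>x. (1 - q x) *\<^sub>R G j x + q x *\<^sub>R (G j x - partial j ?f x))
          + l2_norm ?M (\<lambda>x. partial j q x *\<^sub>R (U x - ?f x) - partial j q x *\<^sub>R U x)"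
      by (intro l2_norm_triangle l2_add l2_diff A B G m dG k' D El)
    also have "l2_norm ?M (\<lambda>x. (1 - q x) *\<^sub>R G j x + q x *\<^sub>R (G j x - partial j ?f x))
        \<le> l2_norm ?M (\<lambda>x. (1 - q x) *\<^sub>R G j x) + l2_norm ?M (\<lambda>x. q x *\<^sub>R (G j x - partial j ?f x))"
      by (intro l2_norm_triangle A B G m dG k')
    also have "l2_norm ?M (\<lambda>x. partial j q x *\<^sub>R (U x - ?f x) - partial j q x *\<^sub>R U x)
        \<le> l2_norm ?M (\<lambda>x. partial j q x *\<^sub>R (U x - ?f x)) + l2_norm ?M (\<lambda>x. partial j q x *\<^sub>R U x)"
      using l2_norm_triangle[OF El l2_minus[OF D(1)]] by (simp add: l2_norm_minus)
    finally show ?thesis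
      using A(1)[OF G m(2)[of j]] B(1)[OF dG k'(2)[of j]] D(2) E \<epsilon>(2) by linarith
  qed
  show ?thesis using 1 2 by (intro bexI[OF _ \<psi>] conjI allI)
qed

section \<open>Convergence of gradients from convergence of symmetric gradients\<close>

lemma partial_diff:
  assumes "smooth f" "smooth g"
  shows "partial j (\<lambda>x. f x - g x) x = partial j f x - partial j g x"
  by (subst partial_eqI[OF has_derivative_diff[OF smooth_has_derivative smooth_has_derivative]])
     (use assms in \<open>auto simp: partial_def\<close>)

text \<open>Korn's inequality for the differences \<open>\<phi> k - \<phi> l\<close> turns
  convergence of the symmetric gradients into the Cauchy property of every partial derivative;
  completeness supplies the limits.\<close>

lemma korn_convergence:
  fixes \<phi> :: "nat \<Rightarrow> real ^ 'n \<Rightarrow> real ^ 'n"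
  assumes t: "\<And>k. \<phi> k \<in> test UNIV" and S: "S \<in> l2 lborel"
    and lim: "(\<lambda>k. l2_norm lborel (\<lambda>x. sgrad (\<phi> k) x - S x)) \<longlonglongrightarrow> 0"
  shows "\<exists>G. G \<in> l2 lborel \<and> (\<lambda>k. l2_norm lborel (\<lambda>x. partial j (\<phi> k) x - G x)) \<longlonglongrightarrow> 0"
proof -
  let ?N = "l2_norm lborel"
  have sl: "sgrad (\<phi> k) \<in> l2 lborel" for k by (intro test_l2 sgrad_test t)
  have key: "?N (\<lambda>x. partial j (\<phi> k) x - partial j (\<phi> l) x) \<le> sqrt 2 * (?N (\<lambda>x. sgrad (\<phi> k) x - S x) + ?N (\<lambda>x. sgrad (\<phi> l) x - S x))" for k l
  proof -
    let ?\<psi> = "\<lambda>x. \<phi> k x - \<phi> l x"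
    have p: "partial i ?\<psi> x = partial i (\<phi> k) x - partial i (\<phi> l) x" for i x
      by (rule partial_diff[OF test_smooth[OF t] test_smooth[OF t]])
    have sg: "sgrad ?\<psi> x = sgrad (\<phi> k) x - sgrad (\<phi> l) x" for x
      unfolding sgrad_def p by (simp add: vec_eq_iff diff_divide_distrib add_divide_distrib)
    have "(?N (partial j ?\<psi>))\<^sup>2 \<le> (\<Sum>j\<in>UNIV. (?N (partial j ?\<psi>))\<^sup>2)"
      by (rule member_le_sum) auto
    also have "\<dots> \<le> 2 * (?N (sgrad ?\<psi>))\<^sup>2" by (rule korn[OF test_diff[OF t t]])
    also have "\<dots> = (sqrt 2 * ?N (sgrad ?\<psi>))\<^sup>2" by (simp add: power_mult_distrib)
    finally have "?N (partial j ?\<psi>) \<le> sqrt 2 * ?N (sgrad ?\<psi>)" by (rule power2_le_imp_le) simp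
    also have "?N (sgrad ?\<psi>) \<le> ?N (\<lambda>x. sgrad (\<phi> k) x - S x) + ?N (\<lambda>x. sgrad (\<phi> l) x - S x)"
      using l2_norm_triangle_diff[OF sl S sl, of k l] by (simp add: sg[abs_def] l2_norm_minus_commute[of _ S])
    finally show ?thesis by (simp add: p[abs_def])
  qed
  have "\<exists>f \<in> l2 lborel. (\<lambda>k. ?N (\<lambda>x. partial j (\<phi> k) x - f x)) \<longlonglongrightarrow> 0"
  proof (rule l2_complete)
    show "partial j (\<phi> k) \<in> l2 lborel" for k by (intro test_l2 test_partial t)
    fix e :: real assume e: "e > 0"
    have "e / (2 * sqrt 2) > 0" using e by simp
    from order_tendstoD(2)[OF lim this]
    obtain N where N: "\<And>k. k \<ge> N \<Longrightarrow> ?N (\<lambda>x. sgrad (\<phi> k) x - S x) < e / (2 * sqrt 2)"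
      by (auto simp: eventually_sequentially)
    have "?N (\<lambda>x. partial j (\<phi> k) x - partial j (\<phi> l) x) < e" if "k \<ge> N" "l \<ge> N" for k l
    proof -
      have "sqrt 2 * (?N (\<lambda>x. sgrad (\<phi> k) x - S x) + ?N (\<lambda>x. sgrad (\<phi> l) x - S x)) < sqrt 2 * (e / (2 * sqrt 2) + e / (2 * sqrt 2))"
        by (intro mult_strict_left_mono add_strict_mono N that) simp
      also have "\<dots> = e" by (simp add: field_simps)
      finally show ?thesis using key[of k l] by linarith
    qed
    then show "\<exists>N. \<forall>m\<ge>N. \<forall>n\<ge>N. ?N (\<lambda>x. partial j (\<phi> m) x - partial j (\<phi> n) x) < e" by blast
  qed
  then show ?thesis by blast
qed

subsection \<open>Symmetric matrix fields and the row-wise divergence\<close>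

definition rowdiv :: "(real ^ 'n \<Rightarrow> real ^ 'n ^ 'n) \<Rightarrow> real ^ 'n \<Rightarrow> real ^ 'n" where
  "rowdiv \<tau> x = (\<chi> i. \<Sum>j\<in>UNIV. partial j \<tau> x $ i $ j)"

lemma bounded_linear_entry: "bounded_linear (\<lambda>A :: real ^ 'n ^ 'm. A $ i $ j)"
  by (rule bounded_linear_compose[OF bounded_linear_vec_nth bounded_linear_vec_nth])

lemma rowdiv_test: "\<tau> \<in> test \<Omega> \<Longrightarrow> rowdiv \<tau> \<in> test \<Omega>"
  unfolding rowdiv_def[abs_def]
  by (intro test_vec_lambda test_sum test_bounded_linear[OF bounded_linear_entry] test_partial)

lemma integration_by_parts_matrix:
  fixes \<tau> :: "real ^ 'n \<Rightarrow> real ^ 'n ^ 'n"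
  assumes \<Omega>: "open \<Omega>" and \<tau>: "\<tau> \<in> test UNIV" and \<phi>: "\<phi> \<in> test \<Omega>"
  shows "l2_inner (lebesgue_on \<Omega>) (rowdiv \<tau>) \<phi> = - l2_inner (lebesgue_on \<Omega>) \<tau> (\<lambda>x. jacobian \<phi> (at x))"
proof -
  let ?M = "lebesgue_on \<Omega>"
  have \<Omega>b: "\<Omega> \<in> sets borel" using \<Omega> by simp
  \<comment> \<open>Columns rather than rows: column \<open>j\<close> is the vector field paired
    with \<open>partial j \<phi>\<close>, so integration by parts in direction \<open>j\<close>
    applies to it as a whole.\<close>
  let ?c = "\<lambda>j x. \<chi> i. \<tau> x $ i $ j"
  have c: "?c j \<in> test UNIV" for j by (intro test_vec_lambda test_bounded_linear[OF bounded_linear_entry \<tau>])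
  have bl: "bounded_linear (\<lambda>A :: real ^ 'n ^ 'n. \<chi> i. A $ i $ j)" for j
    by (rule bounded_linearI') (simp_all add: vec_eq_iff)
  have pc: "partial k (?c j) x = (\<chi> i. partial k \<tau> x $ i $ j)" for k j x
    by (rule partial_bounded_linear[OF bl test_smooth[OF \<tau>]])
  have i: "integrable ?M (\<lambda>x. ?c j x \<bullet> partial j \<phi> x)" "integrable ?M (\<lambda>x. partial j (?c j) x \<bullet> \<phi> x)" for j
    by (rule l2_inner_integrable[OF test_l2_on[OF c \<Omega>b] test_l2_on[OF test_partial[OF \<phi>] \<Omega>b]],
        rule l2_inner_integrable[OF test_l2_on[OF test_partial[OF c] \<Omega>b] test_l2_on[OF \<phi> \<Omega>b]])
  have "l2_inner ?M \<tau> (\<lambda>x. jacobian \<phi> (at x)) = (LINT x|?M. (\<Sum>j\<in>UNIV. ?c j x \<bullet> partial j \<phi> x))"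
    unfolding l2_inner_def
    by (intro Bochner_Integration.integral_cong refl) (simp add: inner_vec_def jacobian_nth, rule sum.swap)
  also have "\<dots> = (\<Sum>j\<in>UNIV. l2_inner ?M (?c j) (partial j \<phi>))" using i by (simp add: l2_inner_def)
  also have "\<dots> = - (\<Sum>j\<in>UNIV. l2_inner ?M (partial j (?c j)) \<phi>)"
    by (simp add: integration_by_parts_on[OF \<Omega> test_smooth[OF c] \<phi>] sum_negf)
  also have "(\<Sum>j\<in>UNIV. l2_inner ?M (partial j (?c j)) \<phi>) = (LINT x|?M. (\<Sum>j\<in>UNIV. partial j (?c j) x \<bullet> \<phi> x))"
    using i by (simp add: l2_inner_def)
  also have "\<dots> = l2_inner ?M (rowdiv \<tau>) \<phi>"
    unfolding l2_inner_def
    by (intro Bochner_Integration.integral_cong refl)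
       (simp add: pc inner_vec_def rowdiv_def sum_distrib_right, rule sum.swap)
  finally show ?thesis by simp
qed

text \<open>The compact support lies in the fields \<open>\<phi>\<close> on which the distributional
  divergence is defined, so \<open>\<tau>\<close> may be nonzero on the boundary. The pairing with
  the classical divergence is bounded by the L2 norm alone and hence extends to
  \<open>H0div \<Omega>\<close>.\<close>

lemma extends_div_test:
  fixes \<tau> :: "real ^ 'n \<Rightarrow> real ^ 'n ^ 'n"
  assumes \<Omega>: "open \<Omega>" and \<tau>: "\<tau> \<in> test UNIV"
  shows "extends_div \<Omega> \<tau> (l2_inner (lebesgue_on \<Omega>) (rowdiv \<tau>))"
proof -
  let ?M = "lebesgue_on \<Omega>"
  have rl: "rowdiv \<tau> \<in> l2 ?M" by (rule test_l2_on[OF rowdiv_test[OF \<tau>]]) (use \<Omega> in simp)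
  have "\<bar>l2_inner ?M (rowdiv \<tau>) v\<bar> \<le> l2_norm ?M (rowdiv \<tau>) * Hdiv_norm \<Omega> v" if v: "v \<in> H0div \<Omega>" for v
  proof -
    note vd = Hdiv_wdiv[OF \<Omega> H0div_Hdiv[OF v]]
    have "l2_norm ?M v \<le> Hdiv_norm \<Omega> v"
      unfolding Hdiv_norm_eq[OF \<Omega> vd(2,3)] by (rule real_le_rsqrt) simp
    then show ?thesis using l2_Cauchy_Schwarz[OF rl vd(1)]
      by (meson l2_norm_nonneg mult_left_mono order_trans)
  qed
  then have "l2_inner ?M (rowdiv \<tau>) \<in> H0div_dual \<Omega>"
    using Hdiv_wdiv(1)[OF \<Omega> H0div_Hdiv]
    by (auto simp: H0div_dual_def l2_inner_add_right rl l2_inner_scaleR_right)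
  then show ?thesis
    using integration_by_parts_matrix[OF \<Omega> \<tau>] by (simp add: extends_div_def ip_eq_l2_inner)
qed

subsection \<open>Weak symmetric gradients up to the boundary\<close>

text \<open>For the passage from (P) to (M): there \<open>\<sigma>\<close> is prescribed only almost
  everywhere, and completeness of Lebesgue measure supplies its measurability.\<close>

lemma borel_measurable_lebesgue_on_AE:
  fixes f g :: "'a::euclidean_space \<Rightarrow> 'b::euclidean_space"
  assumes f: "f \<in> borel_measurable (lebesgue_on \<Omega>)" and \<Omega>: "\<Omega> \<in> sets lebesgue"
    and ae: "AE x in lebesgue_on \<Omega>. f x = g x"
  shows "g \<in> borel_measurable (lebesgue_on \<Omega>)"
proof -
  have "(\<lambda>x. if x \<in> \<Omega> then f x else 0) \<in> borel_measurable lebesgue"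
    by (rule iffD2[OF borel_measurable_if[OF \<Omega>] f])
  moreover have "AE x in lebesgue. (if x \<in> \<Omega> then f x else 0) = (if x \<in> \<Omega> then g x else 0)"
    using ae \<Omega> by (auto simp: AE_restrict_space_iff)
  ultimately have "(\<lambda>x. if x \<in> \<Omega> then g x else 0) \<in> borel_measurable lebesgue"
    by (rule borel_measurable_AE)
  then show ?thesis by (rule iffD1[OF borel_measurable_if[OF \<Omega>]])
qed

lemma l2_borel_representative:
  fixes f :: "'a::euclidean_space \<Rightarrow> 'b::euclidean_space"
  assumes "open \<Omega>" "f \<in> l2 (lebesgue_on \<Omega>)"
  shows "\<exists>F. F \<in> l2 lborel \<and> (\<forall>x. x \<notin> \<Omega> \<longrightarrow> F x = 0) \<and> (AE x in lebesgue_on \<Omega>. F x = f x)"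
proof -
  have \<Omega>b: "\<Omega> \<in> sets borel" using assms(1) by simp
  obtain F where F: "F \<in> borel_measurable borel" "\<And>x. x \<notin> \<Omega> \<Longrightarrow> F x = 0" "AE x in lebesgue_on \<Omega>. F x = f x"
    using borel_representative[OF l2_measurable[OF assms(2)] \<Omega>b] by metis
  have "F \<in> l2 (lebesgue_on \<Omega>)"
    by (rule l2_cong_AE[OF assms(2) borel_measurable_lebesgue_on[OF F(1)]]) (use F(3) in \<open>eventually_elim, simp\<close>)
  then show ?thesis using l2_zero_outside(1)[OF F(1) \<Omega>b F(2)] F by blast
qed

text \<open>Testing with \<open>\<tau>\<close> up to the boundary makes the zero extension of \<open>u\<close> have the weak symmetric
  gradient \<open>S\<close> (extended by zero) on the whole space; testing with mollifiers gives the smooth version.\<close>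

lemma symmetric_gradient_H1_0:
  fixes u :: "real ^ 'n \<Rightarrow> real ^ 'n" and S :: "real ^ 'n \<Rightarrow> real ^ 'n ^ 'n"
  assumes \<Omega>: "polytopal_domain \<Omega>" "bounded \<Omega>"
    and u: "u \<in> l2 (lebesgue_on \<Omega>)" and S: "S \<in> l2 (lebesgue_on \<Omega>)"
    and sym: "AE x in lebesgue_on \<Omega>. transpose (S x) = S x"
    and weak: "\<And>\<tau>. \<tau> \<in> test UNIV \<Longrightarrow> (\<And>x. transpose (\<tau> x) = \<tau> x) \<Longrightarrow>
       l2_inner (lebesgue_on \<Omega>) S \<tau> = - l2_inner (lebesgue_on \<Omega>) u (rowdiv \<tau>)"
  shows "u \<in> H1_0 \<Omega>" "AE x in lebesgue_on \<Omega>. eps \<Omega> u x = S x"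
proof -
  let ?M = "lebesgue_on \<Omega>"
  have op: "open \<Omega>" by (rule polytopal_domain_open[OF \<Omega>(1)])
  have \<Omega>b: "\<Omega> \<in> sets borel" using op by simp
  obtain B where B: "\<And>x. x \<in> \<Omega> \<Longrightarrow> norm x \<le> B" using \<Omega>(2) bounded_iff by blast
  obtain U where U: "U \<in> l2 lborel" "\<And>x. x \<notin> \<Omega> \<Longrightarrow> U x = 0" "AE x in ?M. U x = u x"
    using l2_borel_representative[OF op u] by blast
  obtain T where T: "T \<in> l2 lborel" "\<And>x. x \<notin> \<Omega> \<Longrightarrow> T x = 0" "AE x in ?M. T x = S x"
    using l2_borel_representative[OF op S] by blast
  have UB: "U x = 0" if "norm x > B" for x using U(2) B that by force
  have TB: "T x = 0" if "norm x > B" for x using T(2) B that by force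
  have Ui: "integrable lborel U" using U(1) UB by (rule integrable_bounded_support)
  have Ti: "integrable lborel T" using T(1) TB by (rule integrable_bounded_support)
  define \<phi> where "\<phi> k = conv (moll k) U" for k
  have \<phi>: "\<phi> k \<in> test UNIV" for k unfolding \<phi>_def by (rule conv_moll_test[OF Ui UB])
  have limU: "(\<lambda>k. l2_norm lborel (\<lambda>x. \<phi> k x - U x)) \<longlonglongrightarrow> 0"
    unfolding \<phi>_def by (rule conv_moll_tendsto[OF U(1) UB])
  have inner_lborel: "l2_inner ?M F t = l2_inner lborel F' t"
    if "F \<in> l2 ?M" "F' \<in> l2 lborel" "\<And>x. x \<notin> \<Omega> \<Longrightarrow> F' x = 0" "AE x in ?M. F' x = F x" "t \<in> test UNIV"
    for F F' t :: "real ^ 'n \<Rightarrow> 'c::euclidean_space"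
  proof -
    have m: "F' \<in> borel_measurable borel" using l2_measurable[OF that(2)] by simp
    have "l2_inner ?M F t = l2_inner ?M F' t"
      using that(4) l2_measurable[OF that(1)] borel_measurable_lebesgue_on[OF m] borel_measurable_lebesgue_on[OF test_borel[OF that(5)]]
      by (intro l2_inner_cong_AE) auto
    also have "\<dots> = l2_inner lborel F' t"
      unfolding l2_inner_def using m test_borel[OF that(5)] that(3)
      by (intro integral_lebesgue_on_zero_outside(1)[OF _ \<Omega>b]) auto
    finally show ?thesis .
  qed
  have symT: "AE x in lborel. transpose (T x) = T x"
  proof -
    have "AE x in ?M. transpose (T x) = T x" using sym T(3) by eventually_elim simp
    then have "AE x in lebesgue. x \<in> \<Omega> \<longrightarrow> transpose (T x) = T x"
      using \<Omega>b by (simp add: AE_restrict_space_iff sets_completionI_sets)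
    then have "AE x in lborel. x \<in> \<Omega> \<longrightarrow> transpose (T x) = T x" by (simp add: AE_completion_iff)
    then show ?thesis
    proof eventually_elim
      case (elim x)
      then show ?case using T(2)[of x] by (cases "x \<in> \<Omega>") (auto simp: transpose_def vec_eq_iff)
    qed
  qed
  \<comment> \<open>Mollification commutes with the weak symmetric gradient of the zero extension.
    Each entry at \<open>x\<close> is \<open>weak\<close> tested with the reflected kernel times a
    symmetrised unit matrix; for \<open>x\<close> near the boundary this test field is not supported
    in \<Omega>.\<close>
  have sg: "sgrad (\<phi> k) x = conv (moll k) T x" for k x
  proof -
    have "sgrad (\<phi> k) x $ i $ j = conv (moll k) T x $ i $ j" for i j
    proof -
      define m where "m y = moll k (x - y)" for y
      have m: "m \<in> test UNIV" unfolding m_def[abs_def] by (rule test_reflect[OF moll_test])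
      \<comment> \<open>The sign produced by the reflection absorbs the minus sign in
        \<open>weak\<close>.\<close>
      have pm: "partial l m y = - partial l (moll k) (x - y)" for l y
        unfolding m_def[abs_def] using partial_affine[OF test_smooth[OF moll_test], of l k x "-1" y] by simp
      \<comment> \<open>Symmetric, as \<open>weak\<close> demands, and paired with a symmetric
        matrix it still extracts the single entry \<open>(i, j)\<close>.\<close>
      define A where "A = symm (axis i (axis j (1::real)) :: real ^ 'n ^ 'n)"
      have tA: "transpose A = A" by (simp add: A_def)
      have Ab: "A $ a $ b = ((if a = i \<and> b = j then 1 else 0) + (if a = j \<and> b = i then 1 else 0)) / 2" for a b
      proof -
        have ax: "(axis i (axis j (1::real)) :: real ^ 'n ^ 'n) $ a $ b = (if a = i \<and> b = j then 1 else 0)" for a b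
          by (cases "a = i"; cases "b = j") (simp_all add: axis_def)
        have "A $ a $ b = (axis i (axis j (1::real)) $ a $ b + axis i (axis j (1::real)) $ b $ a) / 2"
          by (simp add: A_def symm_def transpose_def del: axis_nth)
        then show ?thesis unfolding ax by (simp only: conj_commute)
      qed
      let ?\<tau> = "\<lambda>y. m y *\<^sub>R A"
      have \<tau>: "?\<tau> \<in> test UNIV" by (rule test_bounded_linear[OF bounded_linear_scaleR_left m])
      have p\<tau>: "partial l ?\<tau> y = partial l m y *\<^sub>R A" for l y
        by (rule partial_bounded_linear[OF bounded_linear_scaleR_left test_smooth[OF m]])
      have rd: "rowdiv ?\<tau> y = (\<chi> a. ((if a = i then partial j m y else 0) + (if a = j then partial i m y else 0)) / 2)" for y
      proof -
        have "(\<Sum>b\<in>UNIV. partial b m y * A $ a $ b)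
            = (\<Sum>b\<in>UNIV. (if b = j then (if a = i then partial b m y / 2 else 0) else 0) + (if b = i then (if a = j then partial b m y / 2 else 0) else 0))" for a
          by (intro sum.cong refl) (auto simp: Ab)
        then have "(\<Sum>b\<in>UNIV. partial b m y * A $ a $ b)
            = ((if a = i then partial j m y else 0) + (if a = j then partial i m y else 0)) / 2" for a
          by (simp add: sum.distrib)
        then show ?thesis by (simp add: rowdiv_def p\<tau> vec_eq_iff)
      qed
      have inner_rd: "U y \<bullet> rowdiv ?\<tau> y = (U y $ i * partial j m y + U y $ j * partial i m y) / 2" for y
      proof -
        have "U y \<bullet> rowdiv ?\<tau> y = (\<Sum>a\<in>UNIV. (if a = i then U y $ a * partial j m y / 2 else 0) + (if a = j then U y $ a * partial i m y / 2 else 0))"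
          unfolding rd inner_vec_def by (intro sum.cong refl) (auto simp: algebra_simps add_divide_distrib)
        then show ?thesis by (simp add: sum.distrib add_divide_distrib)
      qed
      have innerA: "C \<bullet> A = C $ i $ j" if "transpose C = C" for C :: "real ^ 'n ^ 'n"
        unfolding A_def symmetric_inner_symm[OF that] by (simp add: inner_axis)
      have "conv (moll k) T x $ i $ j = (LINT y|lborel. (moll k (x - y) *\<^sub>R T y) $ i $ j)"
        unfolding conv_def using integral_bounded_linear[OF bounded_linear_entry conv_integrable[OF moll_test Ti]] by simp
      also have "\<dots> = l2_inner lborel T ?\<tau>"
        unfolding l2_inner_def
      proof (rule integral_cong_AE)
        show "AE y in lborel. (moll k (x - y) *\<^sub>R T y) $ i $ j = T y \<bullet> (m y *\<^sub>R A)"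
          using symT by eventually_elim (simp add: innerA m_def)
        show "(\<lambda>y. (moll k (x - y) *\<^sub>R T y) $ i $ j) \<in> borel_measurable lborel"
          using borel_measurable_continuous_on[OF linear_continuous_on[OF bounded_linear_entry]
              borel_measurable_integrable[OF conv_integrable[OF moll_test Ti]]] .
        show "(\<lambda>y. T y \<bullet> (m y *\<^sub>R A)) \<in> borel_measurable lborel"
          using borel_measurable_integrable[OF l2_inner_integrable[OF T(1) test_l2[OF \<tau>]]] .
      qed
      also have "\<dots> = l2_inner ?M S ?\<tau>" using inner_lborel[OF S T \<tau>] by simp
      also have "\<dots> = - l2_inner ?M u (rowdiv ?\<tau>)"
        by (rule weak[OF \<tau>]) (simp add: transpose_scalar tA)
      also have "\<dots> = - l2_inner lborel U (rowdiv ?\<tau>)" using inner_lborel[OF u U rowdiv_test[OF \<tau>]] by simp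
      also have "\<dots> = - (LINT y|lborel. (U y $ i * partial j m y + U y $ j * partial i m y) / 2)"
        by (simp add: l2_inner_def inner_rd)
      also have "\<dots> = (partial j (\<phi> k) x $ i + partial i (\<phi> k) x $ j) / 2"
      proof -
        have ci: "integrable lborel (\<lambda>y. partial l (moll k) (x - y) * U y $ a)" for l a
          using integrable_bounded_linear[OF bounded_linear_vec_nth[of a] conv_integrable[OF test_partial[OF moll_test, of l] Ui]] by simp
        have pc: "partial l (\<phi> k) x $ a = (LINT y|lborel. partial l (moll k) (x - y) * U y $ a)" for l a
          unfolding \<phi>_def partial_conv[OF moll_test Ui] conv_def
          using integral_bounded_linear[OF bounded_linear_vec_nth[of a] conv_integrable[OF test_partial[OF moll_test, of l] Ui]] by simp
        have "- (LINT y|lborel. (U y $ i * partial j m y + U y $ j * partial i m y) / 2)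
            = (LINT y|lborel. (partial j (moll k) (x - y) * U y $ i + partial i (moll k) (x - y) * U y $ j) / 2)"
          by (simp add: pm mult.commute flip: integral_minus) (simp add: field_simps)
        then show ?thesis using ci by (simp add: pc)
      qed
      finally show ?thesis by (simp add: sgrad_def)
    qed
    then show ?thesis by (simp add: vec_eq_iff)
  qed
  have limT: "(\<lambda>k. l2_norm lborel (\<lambda>x. sgrad (\<phi> k) x - T x)) \<longlonglongrightarrow> 0"
    unfolding sg by (rule conv_moll_tendsto[OF T(1) TB])
  have "\<forall>j. \<exists>G. G \<in> l2 lborel \<and> (\<lambda>k. l2_norm lborel (\<lambda>x. partial j (\<phi> k) x - G x)) \<longlonglongrightarrow> 0"
    using korn_convergence[OF \<phi> T(1) limT] by blast
  from choice[OF this] obtain G where "\<forall>j. G j \<in> l2 lborel \<and> (\<lambda>k. l2_norm lborel (\<lambda>x. partial j (\<phi> k) x - G j x)) \<longlonglongrightarrow> 0"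
    by (elim exE) (rule that)
  then have G: "\<And>j. G j \<in> l2 lborel" and limG: "\<And>j. (\<lambda>k. l2_norm lborel (\<lambda>x. partial j (\<phi> k) x - G j x)) \<longlonglongrightarrow> 0"
    by simp_all
  note UM = l2_restrict(1)[OF U(1) \<Omega>b] and GM = l2_restrict(1)[OF G \<Omega>b]
  note tl = test_l2_on[OF \<phi> \<Omega>b] test_l2_on[OF test_partial[OF \<phi>] \<Omega>b]
  have to_M: "(\<lambda>k. l2_norm ?M (f k)) \<longlonglongrightarrow> 0"
    if "\<And>k. f k \<in> l2 lborel" "(\<lambda>k. l2_norm lborel (f k)) \<longlonglongrightarrow> 0" for f :: "nat \<Rightarrow> real ^ 'n \<Rightarrow> 'c::euclidean_space"
    by (rule Lim_null_comparison[OF always_eventually that(2)]) (use l2_restrict(2)[OF that(1) \<Omega>b] in simp)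
  have limUM: "(\<lambda>k. l2_norm ?M (\<lambda>x. \<phi> k x - U x)) \<longlonglongrightarrow> 0"
    by (rule to_M[OF l2_diff[OF test_l2[OF \<phi>] U(1)] limU])
  have limGM: "(\<lambda>k. l2_norm ?M (\<lambda>x. partial j (\<phi> k) x - G j x)) \<longlonglongrightarrow> 0" for j
    by (rule to_M[OF l2_diff[OF test_l2[OF test_partial[OF \<phi>]] G] limG])
  have wU: "has_weak_partial \<Omega> j U (G j)" for j
    by (rule has_weak_partial_limit[OF op tl UM GM has_weak_partial_smooth[OF op test_smooth[OF \<phi>] tl] limUM limGM])
  \<comment> \<open>\<open>u\<close> and \<open>U\<close> agree almost everywhere on \<Omega> but
    may differ outside; weak derivatives see only these pairings.\<close>
  have eq_inner: "l2_inner ?M u \<psi> = l2_inner ?M U \<psi>" if "\<psi> \<in> l2 ?M" for \<psi>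
    using U(3) l2_measurable u UM that by (intro l2_inner_cong_AE) auto
  have wu: "has_weak_partial \<Omega> j u (G j)" for j
    unfolding has_weak_partial_iff[OF op u GM]
  proof
    fix \<psi> :: "real ^ 'n \<Rightarrow> real ^ 'n" assume t: "\<psi> \<in> test \<Omega>"
    have "l2_inner ?M u (partial j \<psi>) = l2_inner ?M U (partial j \<psi>)"
      by (rule eq_inner[OF test_l2_on[OF test_partial[OF t] \<Omega>b]])
    then show "l2_inner ?M u (partial j \<psi>) = - l2_inner ?M (G j) \<psi>"
      using wU[of j] t unfolding has_weak_partial_iff[OF op UM GM] by simp
  qed
  show H10: "u \<in> H1_0 \<Omega>"
  proof (rule H1_0I[OF op u GM wu])
    fix e :: real assume "e > 0"
    from H1_0_cutoff_approx[OF \<Omega> U(1,2) G \<phi> limU limG this]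
    obtain \<psi> where \<psi>: "\<psi> \<in> test \<Omega>" "l2_norm ?M (\<lambda>x. U x - \<psi> x) < e" "\<And>j. l2_norm ?M (\<lambda>x. G j x - partial j \<psi> x) < e"
      by blast
    have "l2_norm ?M (\<lambda>x. u x - \<psi> x) = l2_norm ?M (\<lambda>x. U x - \<psi> x)"
    proof (rule l2_norm_cong_AE)
      show "AE x in ?M. u x - \<psi> x = U x - \<psi> x" using U(3) by eventually_elim simp
    qed (use l2_measurable[OF l2_diff[OF u test_l2_on[OF \<psi>(1) \<Omega>b]]] l2_measurable[OF l2_diff[OF UM test_l2_on[OF \<psi>(1) \<Omega>b]]] in auto)
    then show "\<exists>\<psi>\<in>test \<Omega>. l2_norm ?M (\<lambda>x. u x - \<psi> x) < e \<and> (\<forall>j. l2_norm ?M (\<lambda>x. G j x - partial j \<psi> x) < e)"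
      using \<psi>(2,3) by (intro bexI[OF _ \<psi>(1)] conjI allI) (simp_all only:)
  qed
  let ?W = "\<lambda>x. symm (\<chi> i j. G j x $ i)"
  have "AE x in ?M. \<forall>j\<in>UNIV. wpartial \<Omega> j u x = G j x"
    by (intro AE_finite_allI) (auto intro: wpartial_properties(3)[OF op u GM wu])
  then have epsW: "AE x in ?M. eps \<Omega> u x = ?W x"
    by eventually_elim (simp add: eps_eq_symm wgrad_vec_def)
  have colsl: "(\<lambda>x. \<chi> i j. G j x $ i) \<in> l2 lborel" by (rule l2_matrix_columns[OF G])
  have Wl: "?W \<in> l2 lborel" by (rule l2_bounded_linear[OF bounded_linear_symm colsl])
  \<comment> \<open>The sequence \<open>sgrad (\<phi> k)\<close> has two descriptions of its limit,
    the symmetric part of the limit gradient and the zero extension \<open>T\<close> of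
    \<open>S\<close>. Uniqueness of limits identifies \<open>eps \<Omega> u\<close> with
    \<open>S\<close>.\<close>
  have limW: "(\<lambda>k. l2_norm lborel (\<lambda>x. sgrad (\<phi> k) x - ?W x)) \<longlonglongrightarrow> 0"
  proof -
    obtain K where K: "K \<ge> 0" "\<And>A :: real ^ 'n ^ 'n. norm (symm A) \<le> norm A * K"
      using bounded_linear.nonneg_bounded[OF bounded_linear_symm] by blast
    let ?d = "\<lambda>k x. \<chi> i j. (partial j (\<phi> k) x - G j x) $ i"
    have dl: "(\<lambda>x. partial j (\<phi> k) x - G j x) \<in> l2 lborel" for j k
      by (intro l2_diff test_l2 test_partial \<phi> G)
    have "sgrad (\<phi> k) x - ?W x = symm (?d k x)" for k x
      by (simp add: sgrad_def symm_def transpose_def vec_eq_iff field_simps)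
    moreover have cl: "?d k \<in> l2 lborel" for k by (rule l2_matrix_columns[OF dl])
    have "l2_norm lborel (\<lambda>x. symm (?d k x)) \<le> K * l2_norm lborel (?d k)" for k
      by (rule l2_norm_le_C[OF cl l2_measurable[OF l2_bounded_linear[OF bounded_linear_symm cl]] _ K(1)])
         (use K(2) in \<open>simp add: mult.commute\<close>)
    ultimately have "l2_norm lborel (\<lambda>x. sgrad (\<phi> k) x - ?W x) \<le> K * l2_norm lborel (?d k)" for k
      by simp
    moreover have "(l2_norm lborel (?d k))\<^sup>2 = (\<Sum>j\<in>UNIV. (l2_norm lborel (\<lambda>x. partial j (\<phi> k) x - G j x))\<^sup>2)" for k
      by (rule l2_norm_matrix_columns[OF dl])
    then have "l2_norm lborel (?d k) = sqrt (\<Sum>j\<in>UNIV. (l2_norm lborel (\<lambda>x. partial j (\<phi> k) x - G j x))\<^sup>2)" for k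
      by (intro real_sqrt_unique[symmetric]) simp_all
    moreover have "(\<lambda>k. K * sqrt (\<Sum>j\<in>UNIV. (l2_norm lborel (\<lambda>x. partial j (\<phi> k) x - G j x))\<^sup>2)) \<longlonglongrightarrow> K * sqrt (\<Sum>j\<in>(UNIV::'n set). 0\<^sup>2)"
      by (intro tendsto_mult tendsto_const tendsto_real_sqrt tendsto_sum tendsto_power limG)
    ultimately show ?thesis
      by (intro Lim_null_comparison[of "\<lambda>k. l2_norm lborel (\<lambda>x. sgrad (\<phi> k) x - ?W x)"
            "\<lambda>k. K * sqrt (\<Sum>j\<in>UNIV. (l2_norm lborel (\<lambda>x. partial j (\<phi> k) x - G j x))\<^sup>2)"]
          always_eventually) simp_all
  qed
  have "AE x in lborel. ?W x = T x"
    by (rule l2_unique_limit[OF test_l2[OF sgrad_test[OF \<phi>]] Wl T(1) limW limT])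
  then have "AE x in lebesgue. ?W x = T x" by (rule AE_completion)
  then have "AE x in ?M. ?W x = T x"
    using \<Omega>b by (subst AE_restrict_space_iff) (auto simp: sets_completionI_sets)
  then show "AE x in ?M. eps \<Omega> u x = S x" using epsW T(3) by eventually_elim simp
qed

subsection \<open>Equivalence of the two problems\<close>

lemma test_H1_0:
  assumes \<Omega>: "open \<Omega>" and t: "\<phi> \<in> test \<Omega>"
  shows "\<phi> \<in> H1_0 \<Omega>"
proof -
  have \<Omega>b: "\<Omega> \<in> sets borel" using \<Omega> by simp
  note tl = test_l2_on[OF t \<Omega>b] test_l2_on[OF test_partial[OF t] \<Omega>b]
  show ?thesis
  proof (rule H1_0I[OF \<Omega> tl has_weak_partial_smooth[OF \<Omega> test_smooth[OF t] tl]])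
    fix e :: real assume "e > 0"
    then show "\<exists>\<psi>\<in>test \<Omega>. l2_norm (lebesgue_on \<Omega>) (\<lambda>x. \<phi> x - \<psi> x) < e \<and>
        (\<forall>j. l2_norm (lebesgue_on \<Omega>) (\<lambda>x. partial j \<phi> x - partial j \<psi> x) < e)"
      by (intro bexI[OF _ t]) (simp add: l2_norm_def)
  qed
qed

lemma wpartial_test:
  assumes \<Omega>: "open \<Omega>" and t: "\<phi> \<in> test UNIV"
  shows "AE x in lebesgue_on \<Omega>. \<forall>j. wpartial \<Omega> j \<phi> x = partial j \<phi> x" "\<phi> \<in> H1 \<Omega>"
proof -
  have \<Omega>b: "\<Omega> \<in> sets borel" using \<Omega> by simp
  note tl = test_l2_on[OF t \<Omega>b] test_l2_on[OF test_partial[OF t] \<Omega>b]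
  note w = has_weak_partial_smooth[OF \<Omega> test_smooth[OF t] tl]
  have "AE x in lebesgue_on \<Omega>. \<forall>j\<in>UNIV. wpartial \<Omega> j \<phi> x = partial j \<phi> x"
    by (intro AE_finite_allI) (auto intro: wpartial_properties(3)[OF \<Omega> tl w])
  then show "AE x in lebesgue_on \<Omega>. \<forall>j. wpartial \<Omega> j \<phi> x = partial j \<phi> x" by simp
  show "\<phi> \<in> H1 \<Omega>" by (rule H1I[OF tl w])
qed

section \<open>Deviatoric parts\<close>

lemma bounded_linear_trace: "bounded_linear (trace :: real ^ 'n ^ 'n \<Rightarrow> real)"
  by (rule bounded_linearI') (simp_all add: trace_def sum.distrib sum_distrib_left)

definition dev :: "real ^ 'n ^ 'n \<Rightarrow> real ^ 'n ^ 'n" where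
  "dev A = A - (trace A / real CARD('n)) *\<^sub>R mat 1"

lemma bounded_linear_dev: "bounded_linear (dev :: real ^ 'n ^ 'n \<Rightarrow> _)"
proof -
  have "bounded_linear (\<lambda>A :: real ^ 'n ^ 'n. A - ((1 / real CARD('n)) * trace A) *\<^sub>R mat 1)"
    by (intro bounded_linear_sub bounded_linear_ident bounded_linear_scaleR_const bounded_linear_const_mult bounded_linear_trace)
  then show ?thesis by (simp add: dev_def[abs_def])
qed

lemma trace_dev: "trace (dev A) = 0"
  by (simp add: dev_def trace_def mat_def sum_subtractf)

lemma transpose_dev: "transpose A = A \<Longrightarrow> transpose (dev A) = dev A"
  by (simp add: dev_def transpose_def mat_def vec_eq_iff)

lemma inner_dev:
  fixes A B :: "real ^ 'n ^ 'n"
  assumes "trace A = 0"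
  shows "A \<bullet> dev B = A \<bullet> B"
proof -
  have "A \<bullet> mat 1 = (\<Sum>i\<in>UNIV. \<Sum>j\<in>UNIV. if j = i then A $ i $ j else 0)"
    unfolding inner_vec_def by (intro sum.cong refl) (simp add: mat_def)
  then have "A \<bullet> mat 1 = trace A" by (simp add: trace_def)
  then show ?thesis using assms by (simp add: dev_def inner_diff_right)
qed

text \<open>The row-wise divergence of a scalar function times the identity is the gradient of that
  function, here of the trace divided by the dimension.\<close>

lemma rowdiv_dev:
  fixes \<tau> :: "real ^ 'n \<Rightarrow> real ^ 'n ^ 'n"
  assumes "smooth \<tau>"
  shows "rowdiv (\<lambda>x. dev (\<tau> x)) x = rowdiv \<tau> x - (1 / real CARD('n)) *\<^sub>R (\<chi> j. partial j (\<lambda>x. trace (\<tau> x)) x)"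
proof -
  have "rowdiv (\<lambda>x. dev (\<tau> x)) x $ i
      = (\<Sum>j\<in>UNIV. partial j \<tau> x $ i $ j - (if i = j then trace (partial j \<tau> x) / real CARD('n) else 0))" for i
    unfolding rowdiv_def partial_bounded_linear[OF bounded_linear_dev assms]
    by (simp, intro sum.cong refl) (simp add: dev_def mat_def)
  then show ?thesis
    unfolding partial_bounded_linear[OF bounded_linear_trace assms]
    by (simp add: vec_eq_iff sum_subtractf rowdiv_def)
qed

lemma Hcurldiv_ST_props:
  assumes "\<tau> \<in> Hcurldiv_ST \<Omega>"
  shows "\<tau> \<in> l2 (lebesgue_on \<Omega>)" "AE x in lebesgue_on \<Omega>. transpose (\<tau> x) = \<tau> x"
    "AE x in lebesgue_on \<Omega>. trace (\<tau> x) = 0" "\<exists>F. extends_div \<Omega> \<tau> F"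
  using assms by (auto simp: Hcurldiv_ST_def L2_eq_l2)

lemma Hcurldiv_ST_dev_test:
  fixes \<tau> :: "real ^ 'n \<Rightarrow> real ^ 'n ^ 'n"
  assumes \<Omega>: "open \<Omega>" and \<tau>: "\<tau> \<in> test UNIV" and sym: "\<And>x. transpose (\<tau> x) = \<tau> x"
  shows "(\<lambda>x. dev (\<tau> x)) \<in> Hcurldiv_ST \<Omega>"
proof -
  note t = test_bounded_linear[OF bounded_linear_dev \<tau>]
  have "(\<lambda>x. dev (\<tau> x)) \<in> l2 (lebesgue_on \<Omega>)" by (rule test_l2_on[OF t]) (use \<Omega> in simp)
  then show ?thesis
    using extends_div_test[OF \<Omega> t] by (auto simp: Hcurldiv_ST_def L2_eq_l2 trace_dev transpose_dev[OF sym])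
qed

text \<open>In Green's formula the boundary condition sits in \<open>u\<close>, so \<open>w\<close>
  is free on the boundary.\<close>

lemma H0div_inner_gradient:
  fixes u :: "real ^ 'n \<Rightarrow> real ^ 'n"
  assumes \<Omega>: "open \<Omega>" and u: "u \<in> H0div \<Omega>" and div: "AE x in lebesgue_on \<Omega>. wdiv \<Omega> u x = 0"
    and t: "w \<in> test UNIV"
  shows "l2_inner (lebesgue_on \<Omega>) u (\<lambda>x. \<chi> j. partial j w x) = 0"
proof -
  let ?M = "lebesgue_on \<Omega>"
  have \<Omega>b: "\<Omega> \<in> sets borel" using \<Omega> by simp
  note ud = Hdiv_wdiv[OF \<Omega> H0div_Hdiv[OF u]]
  note wt = wpartial_test[OF \<Omega> t]
  have "l2_inner ?M u (\<lambda>x. \<chi> j. partial j w x) = l2_inner ?M u (wgrad \<Omega> w)"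
  proof (rule l2_inner_cong_AE)
    show "AE x in ?M. (\<chi> j. partial j w x) = wgrad \<Omega> w x"
      using wt(1) by eventually_elim (simp add: wgrad_def)
  qed (use l2_measurable ud wgrad_l2[OF \<Omega> wt(2)] test_l2_on[OF pgrad_test[OF t] \<Omega>b] in auto)
  also have "\<dots> = - l2_inner ?M (wdiv \<Omega> u) w" using H0div_green[OF \<Omega> u wt(2)] by simp
  also have "l2_inner ?M (wdiv \<Omega> u) w = l2_inner ?M (\<lambda>x. 0) w"
    using div l2_measurable ud test_l2_on[OF t \<Omega>b] by (intro l2_inner_cong_AE) auto
  finally show ?thesis by (simp add: l2_inner_def)
qed

lemma l2_norm_le_Hdiv_norm:
  assumes \<Omega>: "open \<Omega>" and v: "v \<in> H0div \<Omega>"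
  shows "l2_norm (lebesgue_on \<Omega>) v \<le> Hdiv_norm \<Omega> v" "l2_norm (lebesgue_on \<Omega>) (wdiv \<Omega> v) \<le> Hdiv_norm \<Omega> v"
  unfolding Hdiv_norm_eq[OF \<Omega> Hdiv_wdiv(2,3)[OF \<Omega> H0div_Hdiv[OF v]]]
  by (rule real_le_rsqrt; simp)+

section \<open>From the mixed to the primal problem\<close>

text \<open>Incompressibility has to precede the identification of the stress, since it is what
  frees the test tensors from the trace constraint. The momentum equation enters only at the end,
  restricted to fields in \<open>H1_0 \<Omega>\<close>.\<close>

lemma mixed_imp_primal:
  fixes \<Omega> :: "(real ^ 'n) set"
  assumes \<Omega>: "polytopal_domain \<Omega>" "bounded \<Omega>" and \<nu>: "0 < \<nu>" and mixed: "mixed_problem \<Omega> \<nu> f \<sigma> u p"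
  shows "u \<in> H1_0 \<Omega>" "AE x in lebesgue_on \<Omega>. \<sigma> x = \<nu> *\<^sub>R eps \<Omega> u x" "primal_problem \<Omega> \<nu> f u p"
proof -
  let ?M = "lebesgue_on \<Omega>"
  have op: "open \<Omega>" by (rule polytopal_domain_open[OF \<Omega>(1)])
  have \<Omega>b: "\<Omega> \<in> sets borel" using op by simp
  have \<sigma>: "\<sigma> \<in> Hcurldiv_ST \<Omega>" and u: "u \<in> H0div \<Omega>" and p: "p \<in> L2_0 \<Omega>"
    and eq1: "\<And>\<tau> q. \<tau> \<in> Hcurldiv_ST \<Omega> \<Longrightarrow> q \<in> L2_0 \<Omega> \<Longrightarrow>
        inverse \<nu> * ip \<Omega> \<sigma> \<tau> + div_dual \<Omega> \<tau> u - ip \<Omega> q (wdiv \<Omega> u) = 0"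
    and eq2: "\<And>v. v \<in> H0div \<Omega> \<Longrightarrow> div_dual \<Omega> \<sigma> v - ip \<Omega> p (wdiv \<Omega> v) - ip \<Omega> u v = - f v"
    using mixed by (auto simp: mixed_problem_def)
  note \<sigma>p = Hcurldiv_ST_props[OF \<sigma>]
  note ud = Hdiv_wdiv[OF op H0div_Hdiv[OF u]]
  have z: "(\<lambda>x. 0) \<in> L2_0 \<Omega>" by (simp add: L2_0_def L2_eq_l2)
  \<comment> \<open>For the deviator of a smooth tensor the chosen functional is an ordinary
    integral against the classical divergence.\<close>
  have dd: "div_dual \<Omega> (\<lambda>x. dev (\<tau> x)) u = l2_inner ?M (rowdiv (\<lambda>x. dev (\<tau> x))) u" if "\<tau> \<in> test UNIV" for \<tau>
    by (rule div_dual_eq[OF op extends_div_test[OF op test_bounded_linear[OF bounded_linear_dev that]] u])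
  \<comment> \<open>The zero tensor isolates \<open>q\<close>. It is written as \<open>dev 0\<close>
    so that \<open>dd\<close> evaluates its \<open>div_dual\<close>, whose vanishing is not
    immediate for a chosen functional.\<close>
  have orth: "ip \<Omega> (wdiv \<Omega> u) q = 0" if q: "q \<in> L2_0 \<Omega>" for q
  proof -
    let ?z = "\<lambda>x :: real ^ 'n. dev (0 :: real ^ 'n ^ 'n)"
    have z0: "?z = (\<lambda>x. 0)" by (simp add: dev_def trace_def)
    have "?z \<in> Hcurldiv_ST \<Omega>"
      by (rule Hcurldiv_ST_dev_test[OF op test_zero]) (simp add: transpose_def vec_eq_iff)
    from eq1[OF this q] have "inverse \<nu> * ip \<Omega> \<sigma> ?z + l2_inner ?M (rowdiv ?z) u - ip \<Omega> q (wdiv \<Omega> u) = 0"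
      unfolding dd[OF test_zero] .
    moreover have "ip \<Omega> \<sigma> ?z = 0" by (simp add: z0 ip_def)
    moreover have "rowdiv ?z = (\<lambda>x. 0)" unfolding z0 by (simp add: rowdiv_def[abs_def] vec_eq_iff fun_eq_iff)
    ultimately show ?thesis by (simp add: ip_eq_l2_inner l2_inner_def mult.commute)
  qed
  have div0: "AE x in ?M. wdiv \<Omega> u x = 0" by (rule H0div_div_free[OF op \<Omega>(2) u orth])
  let ?S = "\<lambda>x. inverse \<nu> *\<^sub>R \<sigma> x"
  have Sl: "?S \<in> l2 ?M" by (rule l2_scaleR[OF \<sigma>p(1)])
  have Ssym: "AE x in ?M. transpose (?S x) = ?S x"
    using \<sigma>p(2) by eventually_elim (simp add: transpose_scalar)
  have weak: "l2_inner ?M ?S \<tau> = - l2_inner ?M u (rowdiv \<tau>)"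
    if \<tau>: "\<tau> \<in> test UNIV" and sym: "\<And>x. transpose (\<tau> x) = \<tau> x" for \<tau>
  proof -
    note dt = test_bounded_linear[OF bounded_linear_dev \<tau>]
    have "l2_inner ?M \<sigma> \<tau> = l2_inner ?M \<sigma> (\<lambda>x. dev (\<tau> x))"
      unfolding l2_inner_def
    proof (rule integral_cong_AE)
      show "AE x in ?M. \<sigma> x \<bullet> \<tau> x = \<sigma> x \<bullet> dev (\<tau> x)"
        using \<sigma>p(3) by eventually_elim (simp add: inner_dev)
    qed (use borel_measurable_integrable[OF l2_inner_integrable[OF \<sigma>p(1) test_l2_on[OF \<tau> \<Omega>b]]]
           borel_measurable_integrable[OF l2_inner_integrable[OF \<sigma>p(1) test_l2_on[OF dt \<Omega>b]]] in auto)
    moreover have "inverse \<nu> * l2_inner ?M \<sigma> (\<lambda>x. dev (\<tau> x)) = - l2_inner ?M u (rowdiv (\<lambda>x. dev (\<tau> x)))"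
      using eq1[OF Hcurldiv_ST_dev_test[OF op \<tau> sym] z] dd[OF \<tau>]
      by (simp add: ip_eq_l2_inner l2_inner_commute[of _ u]) (simp add: l2_inner_def)
    moreover have "l2_inner ?M u (rowdiv (\<lambda>x. dev (\<tau> x))) = l2_inner ?M u (rowdiv \<tau>)"
    proof -
      note tt = test_bounded_linear[OF bounded_linear_trace \<tau>]
      have "l2_inner ?M u (rowdiv (\<lambda>x. dev (\<tau> x)))
          = l2_inner ?M u (rowdiv \<tau>) - l2_inner ?M u (\<lambda>x. (1 / real CARD('n)) *\<^sub>R (\<chi> j. partial j (\<lambda>x. trace (\<tau> x)) x))"
        unfolding rowdiv_dev[OF test_smooth[OF \<tau>], abs_def]
        by (intro l2_inner_diff_right ud l2_scaleR test_l2_on[OF rowdiv_test[OF \<tau>] \<Omega>b] test_l2_on[OF pgrad_test[OF tt] \<Omega>b])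
      then show ?thesis unfolding l2_inner_scaleR_right H0div_inner_gradient[OF op u div0 tt] by simp
    qed
    ultimately show ?thesis unfolding l2_inner_scaleR_left by simp
  qed
  have eps_u: "AE x in ?M. eps \<Omega> u x = ?S x"
    by (rule symmetric_gradient_H1_0(2)[OF \<Omega> ud(1) Sl Ssym]) (rule weak)
  show u0: "u \<in> H1_0 \<Omega>"
    by (rule symmetric_gradient_H1_0(1)[OF \<Omega> ud(1) Sl Ssym]) (rule weak)
  show \<sigma>e: "AE x in ?M. \<sigma> x = \<nu> *\<^sub>R eps \<Omega> u x"
    using eps_u by eventually_elim (use \<nu> in simp)
  have el: "eps \<Omega> v \<in> l2 ?M" if "v \<in> H1_0 \<Omega>" for v by (rule eps_l2[OF op H1_0_H1[OF that]])
  have "\<nu> * ip \<Omega> (eps \<Omega> u) (eps \<Omega> v) + ip \<Omega> u v + ip \<Omega> p (wdiv \<Omega> v) = f v" if v: "v \<in> H1_0 \<Omega>" for v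
  proof -
    obtain F where F: "extends_div \<Omega> \<sigma> F" using \<sigma>p(4) by blast
    note v0 = H1_0_H0div[OF op v]
    have "div_dual \<Omega> \<sigma> v = F v" by (rule div_dual_eq[OF op F v0])
    also have "\<dots> = - l2_inner ?M \<sigma> (eps \<Omega> v)" by (rule extends_div_H1_0[OF op F \<sigma>p(1,2) v])
    also have "l2_inner ?M \<sigma> (eps \<Omega> v) = l2_inner ?M (\<lambda>x. \<nu> *\<^sub>R eps \<Omega> u x) (eps \<Omega> v)"
      using \<sigma>e l2_measurable[OF \<sigma>p(1)] l2_measurable[OF l2_scaleR[OF el[OF u0]]] l2_measurable[OF el[OF v]]
      by (intro l2_inner_cong_AE) auto
    also have "\<dots> = \<nu> * ip \<Omega> (eps \<Omega> u) (eps \<Omega> v)"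
      unfolding l2_inner_scaleR_left ip_eq_l2_inner ..
    finally show ?thesis using eq2[OF v0] by simp
  qed
  then show "primal_problem \<Omega> \<nu> f u p" using u0 p orth by (simp add: primal_problem_def)
qed

section \<open>From the primal to the mixed problem\<close>

lemma trace_eps: "trace (eps \<Omega> u x) = (\<Sum>j\<in>UNIV. wpartial \<Omega> j u x $ j)"
  by (simp add: eps_def trace_def wgrad_vec_def transpose_def)

text \<open>Test fields mediate in both equations. On them (P) computes the distributional
  divergence of \<open>\<sigma>\<close>, and uniqueness of the bounded extension carries the second
  equation to all of \<open>H0div \<Omega>\<close>; in the first, \<open>u\<close> is a limit of
  test fields, which evaluates \<open>div_dual \<Omega> \<tau> u\<close> for every admissible
  \<open>\<tau>\<close>.\<close>

lemma primal_imp_mixed: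
  fixes \<Omega> :: "(real ^ 'n) set"
  assumes \<Omega>: "open \<Omega>" "bounded \<Omega>" and \<nu>: "0 < \<nu>" and f: "f \<in> H0div_dual \<Omega>"
    and primal: "primal_problem \<Omega> \<nu> f u p" and \<sigma>: "AE x in lebesgue_on \<Omega>. \<sigma> x = \<nu> *\<^sub>R eps \<Omega> u x"
  shows "mixed_problem \<Omega> \<nu> f \<sigma> u p"
proof -
  let ?M = "lebesgue_on \<Omega>"
  have \<Omega>b: "\<Omega> \<in> sets borel" using \<Omega>(1) by simp
  have u: "u \<in> H1_0 \<Omega>" and p: "p \<in> L2_0 \<Omega>"
    and eq: "\<And>v. v \<in> H1_0 \<Omega> \<Longrightarrow> \<nu> * ip \<Omega> (eps \<Omega> u) (eps \<Omega> v) + ip \<Omega> u v + ip \<Omega> p (wdiv \<Omega> v) = f v"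
    and orth: "\<And>q. q \<in> L2_0 \<Omega> \<Longrightarrow> ip \<Omega> (wdiv \<Omega> u) q = 0"
    using primal by (auto simp: primal_problem_def)
  have pl: "p \<in> l2 ?M" using p by (simp add: L2_0_def L2_eq_l2)
  note u0 = H1_0_H0div[OF \<Omega>(1) u]
  note ud = Hdiv_wdiv[OF \<Omega>(1) H0div_Hdiv[OF u0]]
  have div0: "AE x in ?M. wdiv \<Omega> u x = 0" by (rule H0div_div_free[OF \<Omega> u0 orth])
  have el: "eps \<Omega> v \<in> l2 ?M" if "v \<in> H1_0 \<Omega>" for v by (rule eps_l2[OF \<Omega>(1) H1_0_H1[OF that]])
  have \<nu>l: "(\<lambda>x. \<nu> *\<^sub>R eps \<Omega> u x) \<in> l2 ?M" by (rule l2_scaleR[OF el[OF u]])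
  have \<sigma>': "AE x in ?M. \<nu> *\<^sub>R eps \<Omega> u x = \<sigma> x" using \<sigma> by eventually_elim simp
  have \<sigma>m: "\<sigma> \<in> borel_measurable ?M"
    by (rule borel_measurable_lebesgue_on_AE[OF l2_measurable[OF \<nu>l] _ \<sigma>']) (use \<Omega>b in \<open>simp add: sets_completionI_sets\<close>)
  have \<sigma>l: "\<sigma> \<in> l2 ?M" by (rule l2_cong_AE[OF \<nu>l \<sigma>m \<sigma>'])
  have \<sigma>inner: "l2_inner ?M \<sigma> g = \<nu> * l2_inner ?M (eps \<Omega> u) g" if "g \<in> l2 ?M" for g
  proof -
    have "l2_inner ?M \<sigma> g = l2_inner ?M (\<lambda>x. \<nu> *\<^sub>R eps \<Omega> u x) g"
      using \<sigma> \<sigma>m l2_measurable[OF \<nu>l] l2_measurable[OF that] by (intro l2_inner_cong_AE) auto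
    then show ?thesis unfolding l2_inner_scaleR_left .
  qed
  \<comment> \<open>The trace of \<open>eps \<Omega> u\<close> is the divergence of \<open>u\<close>
    almost everywhere, so the traceless constraint on \<open>\<sigma>\<close> is
    incompressibility.\<close>
  have ST: "AE x in ?M. transpose (\<sigma> x) = \<sigma> x \<and> trace (\<sigma> x) = 0"
    using \<sigma> H1_wdiv[OF \<Omega>(1) H1_0_H1[OF u]] div0
  proof eventually_elim
    case (elim x)
    have "trace (\<sigma> x) = \<nu> * trace (eps \<Omega> u x)" unfolding elim(1) by (simp add: trace_def sum_distrib_left)
    also have "\<dots> = 0" using elim(2,3) by (simp add: trace_eps)
    finally have "trace (\<sigma> x) = 0" .
    moreover have "transpose (\<sigma> x) = \<sigma> x" unfolding elim(1) eps_eq_symm by (simp add: transpose_scalar)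
    ultimately show ?case by simp
  qed
  define F where "F v = ip \<Omega> p (wdiv \<Omega> v) + ip \<Omega> u v - f v" for v
  have fadd: "f (\<lambda>x. v x + w x) = f v + f w" if "v \<in> H0div \<Omega>" "w \<in> H0div \<Omega>" for v w
    using f that by (auto simp: H0div_dual_def)
  have fscale: "f (\<lambda>x. c *\<^sub>R v x) = c * f v" if "v \<in> H0div \<Omega>" for c v
    using f that by (auto simp: H0div_dual_def)
  obtain C where C: "\<And>v. v \<in> H0div \<Omega> \<Longrightarrow> \<bar>f v\<bar> \<le> C * Hdiv_norm \<Omega> v"
    using f unfolding H0div_dual_def by blast
  \<comment> \<open>As a choice, \<open>wdiv\<close> is additive and homogeneous only almost
    everywhere; paired with \<open>p\<close> it may be replaced by any explicit divergence, which
    gives linearity of \<open>F\<close>.\<close>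
  have pdiv_eq: "ip \<Omega> p (wdiv \<Omega> v) = l2_inner ?M p g" if "g \<in> l2 ?M" "has_weak_div \<Omega> v g" for v g
    unfolding ip_eq_l2_inner
    using wdiv_properties[OF \<Omega>(1) that] l2_measurable[OF pl] l2_measurable[OF that(1)] l2_measurable
    by (intro l2_inner_cong_AE) auto
  have Fdual: "F \<in> H0div_dual \<Omega>"
    unfolding H0div_dual_def
  proof (intro CollectI conjI ballI allI exI)
    fix v w assume v: "v \<in> H0div \<Omega>" and w: "w \<in> H0div \<Omega>"
    note vd = Hdiv_wdiv[OF \<Omega>(1) H0div_Hdiv[OF v]] and wd = Hdiv_wdiv[OF \<Omega>(1) H0div_Hdiv[OF w]]
    show "F (\<lambda>x. v x + w x) = F v + F w"
      unfolding F_def fadd[OF v w]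
        pdiv_eq[OF l2_add[OF vd(2) wd(2)] has_weak_div_add[OF \<Omega>(1) vd(1) wd(1) vd(2) wd(2) vd(3) wd(3)]]
      by (simp add: ip_eq_l2_inner l2_inner_add_right pl vd wd ud)
  next
    fix c v assume v: "v \<in> H0div \<Omega>"
    note vd = Hdiv_wdiv[OF \<Omega>(1) H0div_Hdiv[OF v]]
    show "F (\<lambda>x. c *\<^sub>R v x) = c * F v"
      unfolding F_def fscale[OF v] pdiv_eq[OF l2_scaleR[OF vd(2)] has_weak_div_scaleR[OF vd(3)]]
      unfolding ip_eq_l2_inner l2_inner_scaleR_right
      by (simp add: algebra_simps)
  next
    fix v assume v: "v \<in> H0div \<Omega>"
    note vd = Hdiv_wdiv[OF \<Omega>(1) H0div_Hdiv[OF v]]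
    note b = l2_norm_le_Hdiv_norm[OF \<Omega>(1) v]
    have "\<bar>ip \<Omega> p (wdiv \<Omega> v)\<bar> \<le> l2_norm ?M p * Hdiv_norm \<Omega> v"
      unfolding ip_eq_l2_inner
      by (rule order_trans[OF l2_Cauchy_Schwarz[OF pl vd(2)]]) (intro mult_left_mono b l2_norm_nonneg)
    moreover have "\<bar>ip \<Omega> u v\<bar> \<le> l2_norm ?M u * Hdiv_norm \<Omega> v"
      unfolding ip_eq_l2_inner
      by (rule order_trans[OF l2_Cauchy_Schwarz[OF ud(1) vd(1)]]) (intro mult_left_mono b l2_norm_nonneg)
    ultimately show "\<bar>F v\<bar> \<le> (l2_norm ?M p + l2_norm ?M u + C) * Hdiv_norm \<Omega> v"
      using C[OF v] unfolding F_def distrib_right by linarith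
  qed
  have Fext: "extends_div \<Omega> \<sigma> F"
    unfolding extends_div_def
  proof (intro conjI ballI Fdual)
    fix \<phi> :: "real ^ 'n \<Rightarrow> real ^ 'n" assume t: "\<phi> \<in> test \<Omega>"
    note t0 = test_H1_0[OF \<Omega>(1) t]
    have jl: "(\<lambda>x. jacobian \<phi> (at x)) \<in> l2 ?M" by (rule test_l2_on[OF jacobian_test[OF t] \<Omega>b])
    have "F \<phi> = - (\<nu> * ip \<Omega> (eps \<Omega> u) (eps \<Omega> \<phi>))" using eq[OF t0] by (simp add: F_def)
    also have "\<dots> = - l2_inner ?M \<sigma> (eps \<Omega> \<phi>)" by (simp add: \<sigma>inner[OF el[OF t0]] ip_eq_l2_inner)
    also have "l2_inner ?M \<sigma> (eps \<Omega> \<phi>) = l2_inner ?M \<sigma> (\<lambda>x. jacobian \<phi> (at x))"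
      unfolding l2_inner_def
    proof (rule integral_cong_AE)
      show "AE x in ?M. \<sigma> x \<bullet> eps \<Omega> \<phi> x = \<sigma> x \<bullet> jacobian \<phi> (at x)"
        using ST wpartial_test(1)[OF \<Omega>(1) test_UNIV[OF t]]
      proof eventually_elim
        case (elim x)
        have "wgrad_vec \<Omega> \<phi> x = jacobian \<phi> (at x)" using elim(2) by (simp add: wgrad_vec_def jacobian_eq)
        then show ?case using elim(1) by (simp add: eps_eq_symm symmetric_inner_symm)
      qed
    qed (use borel_measurable_integrable[OF l2_inner_integrable[OF \<sigma>l el[OF t0]]]
           borel_measurable_integrable[OF l2_inner_integrable[OF \<sigma>l jl]] in auto)
    finally show "F \<phi> = - ip \<Omega> \<sigma> (\<lambda>x. jacobian \<phi> (at x))" by (simp add: ip_eq_l2_inner)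
  qed
  have \<sigma>H: "\<sigma> \<in> Hcurldiv_ST \<Omega>" using \<sigma>l ST Fext by (auto simp: Hcurldiv_ST_def L2_eq_l2)
  have "inverse \<nu> * ip \<Omega> \<sigma> \<tau> + div_dual \<Omega> \<tau> u - ip \<Omega> q (wdiv \<Omega> u) = 0"
    if \<tau>: "\<tau> \<in> Hcurldiv_ST \<Omega>" and q: "q \<in> L2_0 \<Omega>" for \<tau> q
  proof -
    note \<tau>p = Hcurldiv_ST_props[OF \<tau>]
    obtain F' where F': "extends_div \<Omega> \<tau> F'" using \<tau>p(4) by blast
    have "div_dual \<Omega> \<tau> u = F' u" by (rule div_dual_eq[OF \<Omega>(1) F' u0])
    also have "\<dots> = - l2_inner ?M \<tau> (eps \<Omega> u)" by (rule extends_div_H1_0[OF \<Omega>(1) F' \<tau>p(1,2) u])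
    finally have "div_dual \<Omega> \<tau> u = - l2_inner ?M (eps \<Omega> u) \<tau>" by (simp add: l2_inner_commute)
    moreover have "inverse \<nu> * ip \<Omega> \<sigma> \<tau> = l2_inner ?M (eps \<Omega> u) \<tau>"
      using \<nu> by (simp add: ip_eq_l2_inner \<sigma>inner[OF \<tau>p(1)])
    moreover have "ip \<Omega> q (wdiv \<Omega> u) = 0" using orth[OF q] by (simp add: ip_eq_l2_inner l2_inner_commute)
    ultimately show ?thesis by simp
  qed
  moreover have "div_dual \<Omega> \<sigma> v - ip \<Omega> p (wdiv \<Omega> v) - ip \<Omega> u v = - f v" if "v \<in> H0div \<Omega>" for v
    using div_dual_eq[OF \<Omega>(1) Fext that] by (simp add: F_def)
  ultimately show ?thesis using \<sigma>H u0 p by (simp add: mixed_problem_def)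
qed

theorem theorem3p4:
  fixes \<Omega> :: "(real ^ 'n) set"
    and \<nu> :: real
    and f :: "(real ^ 'n \<Rightarrow> real ^ 'n) \<Rightarrow> real"
  assumes "CARD('n) \<ge> 2"
    and "polytopal_domain \<Omega>" and "bounded \<Omega>" and "connected \<Omega>"
    and "0 < \<nu>" and "\<nu> \<le> 1"
    and "f \<in> H0div_dual \<Omega>"
  shows "(\<forall>\<sigma> u p. mixed_problem \<Omega> \<nu> f \<sigma> u p \<longrightarrow>
            u \<in> H1_0 \<Omega> \<and>
            (AE x in lebesgue_on \<Omega>. \<sigma> x = \<nu> *\<^sub>R eps \<Omega> u x) \<and>
            primal_problem \<Omega> \<nu> f u p) \<and>
         (\<forall>\<sigma> u p. primal_problem \<Omega> \<nu> f u p \<and>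
            (AE x in lebesgue_on \<Omega>. \<sigma> x = \<nu> *\<^sub>R eps \<Omega> u x) \<longrightarrow>
            mixed_problem \<Omega> \<nu> f \<sigma> u p)"
  using mixed_imp_primal[OF assms(2,3,5)]
    primal_imp_mixed[OF polytopal_domain_open[OF assms(2)] assms(3,5,7)]
  by (intro conjI allI impI) auto

end
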